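(* Let $A$ be a bounded linear operator on a Hilbert space $H$, $A=A_R+iA_I$ with $A_R,A_I$ self-adjoint, and let $A_I=KJK^{*}$, where $K:\mathbb{C}^m\to H$ is a bounded linear operator and $J$ is an $m\times m$ matrix with $J=J^{*}$, $J^2=I_m$. Let $$W(z)=I_m-2iK^{*}(A-zI)^{-1}KJ$$ be the characteristic operator function of $A$. Suppose that $W(z)$ satisfies the following conditions for some $-\infty<a<b<\infty$. 1) $W(z)$ is analytic in the domain $z\notin[a,b]$ and $$W(z)=I_m+\frac{1}{2\pi i}\int_a^b\frac{F(x)}{x-z}\,dx,$$ where $F(x)$ is a bounded $m\times m$ matrix function on $[a,b]$. 2) $W^{*}(z)JW(\bar z)=J$, and $i\,\dfrac{W^{*}(z)JW(z)-J}{z-\bar z}\ge 0$ for $z\ne\bar z$. 3) The matrix functions $F_1(x)$ and $F_2(x)$ associated with $W$ (defined in the context) are bounded on $[a,b]$. Then the simple part of $A$ is linearly similar to a self-adjoint operator with absolutely continuous spectrum.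
   Context: Simple part: the simple part of $A$ is the operator induced by $A$ on the subspace $H_1=\overline{\sum_{k=0}^{\infty}A^kD_A}$, where $D_A=\overline{(A-A^{*})H}$. Definition of $F_1,F_2$: condition 1) guarantees the almost everywhere existence of the limits $W_\pm(x)=\lim_{y\to\pm0}W(x+iy)$. By Potapov's $J$-polar decomposition, $W_+(x)=U(x)R(x)$, $W_-(x)=U(x)R^{-1}(x)$, where the $m\times m$ matrix functions $U,R$ satisfy $U^{*}(x)JU(x)=J$, $JR(x)=R^{*}(x)J$, and the spectrum of $R(x)$ is positive; $R(x)$ is called the $J$-module of $W_+(x)$. Then $D(x)=J[R(x)-R^{-1}(x)]\ge0$ for $x\in[a,b]$ and $D(x)=0$ for $x\notin[a,b]$. With $k=\sup_{a\le x\le b}\operatorname{rank}D(x)\le m$, $F_1(x)$ is a $k\times m$ matrix function with $F_1^{*}(x)F_1(x)=D(x)$, and $F_2(x)=F_1(x)JU^{*}(x)$. (These satisfy $W_+(x)-W_-(x)=F_2^{*}(x)F_1(x)=F(x)$.) Here $W^{*}(z)$ denotes $(W(z))^{*}$, and two operators are linearly similar if they are conjugate by a bounded operator with bounded inverse. *)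

theory Defs
  imports "HOL-Analysis.Analysis"
begin

section \<open>Complex Hilbert spaces\<close>

text \<open>The scalar product is antilinear in the first argument.\<close>

class complex_inner = real_normed_vector +
  fixes scaleC :: "complex \<Rightarrow> 'a \<Rightarrow> 'a"  (infixr \<open>*\<^sub>C\<close> 75)
    and cinner :: "'a \<Rightarrow> 'a \<Rightarrow> complex"
  assumes scaleC_add_right: "c *\<^sub>C (x + y) = c *\<^sub>C x + c *\<^sub>C y"
    and scaleC_add_left: "(c + d) *\<^sub>C x = c *\<^sub>C x + d *\<^sub>C x"
    and scaleC_scaleC: "c *\<^sub>C (d *\<^sub>C x) = (c * d) *\<^sub>C x"
    and scaleC_of_real: "complex_of_real r *\<^sub>C x = r *\<^sub>R x"
    and cinner_commute: "cinner x y = cnj (cinner y x)"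
    and cinner_add_right: "cinner x (y + z) = cinner x y + cinner x z"
    and cinner_scaleC_right: "cinner x (c *\<^sub>C y) = c * cinner x y"
    and cinner_ge_zero: "0 \<le> Re (cinner x x)"
    and norm_eq_sqrt_cinner: "norm x = sqrt (Re (cinner x x))"

class complex_hilbert = complex_inner + complete_space

instantiation complex :: complex_hilbert
begin
definition scaleC_complex :: "complex \<Rightarrow> complex \<Rightarrow> complex"
  where "scaleC_complex c z = c * z"
definition cinner_complex :: "complex \<Rightarrow> complex \<Rightarrow> complex"
  where "cinner_complex z w = cnj z * w"
instance
  by standard
    (simp_all add: scaleC_complex_def cinner_complex_def algebra_simps scaleR_conv_of_real
      cmod_def power2_eq_square)
end

instantiation vec :: (complex_inner, finite) complex_inner
begin
definition scaleC_vec :: "complex \<Rightarrow> 'a ^ 'b \<Rightarrow> 'a ^ 'b"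
  where "scaleC_vec c x = (\<chi> i. c *\<^sub>C (x $ i))"
definition cinner_vec :: "'a ^ 'b \<Rightarrow> 'a ^ 'b \<Rightarrow> complex"
  where "cinner_vec x y = (\<Sum>i\<in>UNIV. cinner (x $ i) (y $ i))"
instance
proof
  fix x y z :: "'a ^ 'b" and c d :: complex and r :: real
  show "c *\<^sub>C (x + y) = c *\<^sub>C x + c *\<^sub>C y" "(c + d) *\<^sub>C x = c *\<^sub>C x + d *\<^sub>C x"
    "c *\<^sub>C d *\<^sub>C x = (c * d) *\<^sub>C x" "complex_of_real r *\<^sub>C x = r *\<^sub>R x"
    by (simp_all add: scaleC_vec_def vec_eq_iff scaleC_add_right scaleC_add_left
        scaleC_scaleC scaleC_of_real)
  show "cinner x y = cnj (cinner y x)"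
    unfolding cinner_vec_def by (subst cinner_commute) simp
  show "cinner x (y + z) = cinner x y + cinner x z" "cinner x (c *\<^sub>C y) = c * cinner x y"
    by (simp_all add: cinner_vec_def scaleC_vec_def cinner_add_right cinner_scaleC_right
        sum.distrib sum_distrib_left)
  show "0 \<le> Re (cinner x x)"
    by (simp add: cinner_vec_def sum_nonneg cinner_ge_zero)
  show "norm x = sqrt (Re (cinner x x))"
    by (simp add: norm_vec_def L2_set_def cinner_vec_def norm_eq_sqrt_cinner cinner_ge_zero)
qed
end

instance vec :: (complex_hilbert, finite) complex_hilbert ..


section \<open>Operators\<close>

definition bounded_clinear_on ::
    "'a::complex_inner set \<Rightarrow> ('a \<Rightarrow> 'b::complex_inner) \<Rightarrow> bool" where
  "bounded_clinear_on V T \<longleftrightarrow>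
     (\<forall>x\<in>V. \<forall>y\<in>V. T (x + y) = T x + T y) \<and>
     (\<forall>c. \<forall>x\<in>V. T (c *\<^sub>C x) = c *\<^sub>C T x) \<and>
     (\<exists>C. \<forall>x\<in>V. norm (T x) \<le> C * norm x)"

abbreviation bounded_clinear :: "('a::complex_inner \<Rightarrow> 'b::complex_inner) \<Rightarrow> bool" where
  "bounded_clinear \<equiv> bounded_clinear_on UNIV"

definition selfadjoint_on :: "'a::complex_inner set \<Rightarrow> ('a \<Rightarrow> 'a) \<Rightarrow> bool" where
  "selfadjoint_on V T \<longleftrightarrow>
     bounded_clinear_on V T \<and> T ` V \<subseteq> V \<and>
     (\<forall>x\<in>V. \<forall>y\<in>V. cinner (T x) y = cinner x (T y))"

definition cadjoint :: "('a::complex_inner \<Rightarrow> 'b::complex_inner) \<Rightarrow> 'b \<Rightarrow> 'a" where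
  "cadjoint T = (THE S. \<forall>x y. cinner (S y) x = cinner y (T x))"

definition resolvent_set :: "('h::complex_inner \<Rightarrow> 'h) \<Rightarrow> complex set" where
  "resolvent_set A =
     {z. bij (\<lambda>x. A x - z *\<^sub>C x) \<and> bounded_clinear (inv (\<lambda>x. A x - z *\<^sub>C x))}"

definition linearly_similar_on ::
    "'h::complex_inner set \<Rightarrow> ('h \<Rightarrow> 'h) \<Rightarrow> ('h \<Rightarrow> 'h) \<Rightarrow> bool" where
  "linearly_similar_on V T B \<longleftrightarrow>
     (\<exists>S. bounded_clinear_on V S \<and> bij_betw S V V \<and> bounded_clinear_on V (inv_into V S) \<and>
          (\<forall>x\<in>V. S (T x) = B (S x)))"


section \<open>Spectral measures and absolutely continuous spectrum\<close>

definition spectral_measure_on ::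
    "'h::complex_inner set \<Rightarrow> (real set \<Rightarrow> 'h \<Rightarrow> 'h) \<Rightarrow> bool" where
  "spectral_measure_on V E \<longleftrightarrow>
     (\<forall>\<Delta>\<in>sets borel. selfadjoint_on V (E \<Delta>) \<and> (\<forall>x\<in>V. E \<Delta> (E \<Delta> x) = E \<Delta> x)) \<and>
     (\<forall>x\<in>V. E UNIV x = x) \<and>
     (\<forall>\<Delta>. range \<Delta> \<subseteq> sets borel \<and> disjoint_family \<Delta> \<longrightarrow>
        (\<forall>x\<in>V. (\<lambda>n::nat. E (\<Delta> n) x) sums E (\<Union>n. \<Delta> n) x))"

definition scalar_spectral_measure ::
    "(real set \<Rightarrow> 'h \<Rightarrow> 'h::complex_inner) \<Rightarrow> 'h \<Rightarrow> real measure" where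
  "scalar_spectral_measure E x =
     measure_of UNIV (sets borel) (\<lambda>\<Delta>. ennreal (Re (cinner x (E \<Delta> x))))"

text \<open>
  The spectral resolution of a bounded self-adjoint operator, given by its quadratic form.
  Requiring the identity function to be integrable for every vector forces the spectral
  measure to have bounded support.
\<close>

definition spectral_measure_of_on ::
    "'h::complex_inner set \<Rightarrow> ('h \<Rightarrow> 'h) \<Rightarrow> (real set \<Rightarrow> 'h \<Rightarrow> 'h) \<Rightarrow> bool" where
  "spectral_measure_of_on V B E \<longleftrightarrow>
     spectral_measure_on V E \<and>
     (\<forall>x\<in>V. integrable (scalar_spectral_measure E x) (\<lambda>t. t) \<and>
        cinner x (B x) = complex_of_real (LINT t|scalar_spectral_measure E x. t))"

definition abs_cont_spectrum_on :: "'h::complex_inner set \<Rightarrow> ('h \<Rightarrow> 'h) \<Rightarrow> bool" where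
  "abs_cont_spectrum_on V B \<longleftrightarrow>
     (\<exists>E. spectral_measure_of_on V B E \<and>
          (\<forall>x\<in>V. absolutely_continuous lborel (scalar_spectral_measure E x)))"


section \<open>The simple part\<close>

definition defect_space :: "('h::complex_inner \<Rightarrow> 'h) \<Rightarrow> 'h set" where
  "defect_space A = closure (range (\<lambda>x. A x - cadjoint A x))"

definition simple_space :: "('h::complex_inner \<Rightarrow> 'h) \<Rightarrow> 'h set" where
  "simple_space A =
     closure {(\<Sum>k<n. (A ^^ k) (d k)) | n d. \<forall>k<n. d k \<in> defect_space A}"


section \<open>Matrices and the characteristic operator function\<close>

definition mscale :: "complex \<Rightarrow> complex ^ 'n ^ 'm \<Rightarrow> complex ^ 'n ^ 'm" where
  "mscale c M = (\<chi> i j. c * M $ i $ j)"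

definition ctranspose :: "complex ^ 'n ^ 'm \<Rightarrow> complex ^ 'm ^ 'n" where
  "ctranspose M = (\<chi> i j. cnj (M $ j $ i))"

definition psd_matrix :: "complex ^ 'm ^ 'm \<Rightarrow> bool" where
  "psd_matrix M \<longleftrightarrow> (\<forall>v. Im (cinner v (M *v v)) = 0 \<and> 0 \<le> Re (cinner v (M *v v)))"

text \<open>Meaningful only for \<open>z\<close> in the resolvent set of \<open>A\<close>.\<close>

definition char_function ::
    "('h::complex_inner \<Rightarrow> 'h) \<Rightarrow> (complex ^ 'm \<Rightarrow> 'h) \<Rightarrow> complex ^ 'm ^ 'm \<Rightarrow>
     complex \<Rightarrow> complex ^ 'm ^ 'm" where
  "char_function A K J z =
     mat 1 - mscale (2 * \<i>)
       (matrix (\<lambda>v. cadjoint K (inv (\<lambda>x. A x - z *\<^sub>C x) (K v))) ** J)"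

text \<open>The limits \<open>W\<^sub>+(x)\<close> and \<open>W\<^sub>-(x)\<close> at a real point \<open>x\<close>.\<close>

definition boundary_values ::
    "(complex \<Rightarrow> complex ^ 'm ^ 'm) \<Rightarrow> real \<Rightarrow> complex ^ 'm ^ 'm \<Rightarrow> complex ^ 'm ^ 'm \<Rightarrow> bool"
  where
  "boundary_values W x Wp Wm \<longleftrightarrow>
     ((\<lambda>y. W (Complex x y)) \<longlongrightarrow> Wp) (at_right 0) \<and>
     ((\<lambda>y. W (Complex x y)) \<longlongrightarrow> Wm) (at_left 0)"

text \<open>
  The decomposition \<open>W\<^sub>+ = U R\<close>, \<open>W\<^sub>- = U R\<^sup>-\<^sup>1\<close> with \<open>U\<close> \<open>J\<close>-unitary and \<open>R\<close> the
  \<open>J\<close>-module. It determines \<open>R\<close>, as the square root of \<open>W\<^sub>-\<^sup>-\<^sup>1 W\<^sub>+\<close> with positive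
  spectrum, and hence \<open>U\<close>.
\<close>

definition J_polar_decomposition ::
    "complex ^ 'm ^ 'm \<Rightarrow> complex ^ 'm ^ 'm \<Rightarrow> complex ^ 'm ^ 'm \<Rightarrow>
     complex ^ 'm ^ 'm \<Rightarrow> complex ^ 'm ^ 'm \<Rightarrow> bool" where
  "J_polar_decomposition J Wp Wm U R \<longleftrightarrow>
     Wp = U ** R \<and> Wm = U ** matrix_inv R \<and>
     ctranspose U ** J ** U = J \<and>
     J ** R = ctranspose R ** J \<and>
     (\<forall>c v. v \<noteq> 0 \<and> R *v v = c *s v \<longrightarrow> (\<exists>r>0. c = complex_of_real r))"

text \<open>
  \<open>D(x)\<close>, set to zero also on the null set of points of \<open>[a,b]\<close> where a boundary limit
  of \<open>W\<close> fails to exist.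
\<close>

definition jump_density ::
    "complex ^ 'm ^ 'm \<Rightarrow> (complex \<Rightarrow> complex ^ 'm ^ 'm) \<Rightarrow> real \<Rightarrow> real \<Rightarrow>
     (real \<Rightarrow> complex ^ 'm ^ 'm) \<Rightarrow> real \<Rightarrow> complex ^ 'm ^ 'm" where
  "jump_density J W a b R x =
     (if x \<in> {a..b} \<and> (\<exists>Wp Wm. boundary_values W x Wp Wm)
      then J ** (R x - matrix_inv (R x)) else 0)"

text \<open>
  A \<open>k \<times> m\<close> matrix function is represented by its rows \<open>F\<^sub>1 x i\<close>, \<open>i < k\<close>, because \<open>k\<close> is
  computed from \<open>W\<close> and may be \<open>0\<close>. Thus \<open>F\<^sub>1\<^sup>* F\<^sub>1\<close> has entries
  \<open>\<Sum>i<k. cnj (F\<^sub>1 x i $ p) * F\<^sub>1 x i $ q\<close>, and the rows of \<open>F\<^sub>1 M\<close> are \<open>F\<^sub>1 x i v* M\<close>.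
\<close>

definition associated_factors ::
    "complex ^ 'm ^ 'm \<Rightarrow> (complex \<Rightarrow> complex ^ 'm ^ 'm) \<Rightarrow> real \<Rightarrow> real \<Rightarrow>
     (real \<Rightarrow> complex ^ 'm ^ 'm) \<Rightarrow> (real \<Rightarrow> complex ^ 'm ^ 'm) \<Rightarrow> nat \<Rightarrow>
     (real \<Rightarrow> nat \<Rightarrow> complex ^ 'm) \<Rightarrow> (real \<Rightarrow> nat \<Rightarrow> complex ^ 'm) \<Rightarrow> bool" where
  "associated_factors J W a b U R k F1 F2 \<longleftrightarrow>
     (\<forall>x\<in>{a..b}. \<forall>Wp Wm. boundary_values W x Wp Wm \<longrightarrow>
        J_polar_decomposition J Wp Wm (U x) (R x)) \<and>
     k = (SUP x\<in>{a..b}. rank (jump_density J W a b R x)) \<and>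
     (\<forall>x\<in>{a..b}. \<forall>p q.
        (\<Sum>i<k. cnj (F1 x i $ p) * F1 x i $ q) = jump_density J W a b R x $ p $ q) \<and>
     (\<forall>x\<in>{a..b}. \<forall>i<k. F2 x i = F1 x i v* (J ** ctranspose (U x)))"

definition bounded_rows_on ::
    "real set \<Rightarrow> nat \<Rightarrow> (real \<Rightarrow> nat \<Rightarrow> complex ^ 'm) \<Rightarrow> bool" where
  "bounded_rows_on X k G \<longleftrightarrow> (\<exists>C. \<forall>x\<in>X. \<forall>i<k. norm (G x i) \<le> C)"

end

theory Submission
  imports Defs "HOL-Real_Asymp.Real_Asymp" "HOL-Computational_Algebra.Polynomial"
begin

text \<open>
  Write \<open>W\<^sub>\<plusminus>\<close> for the boundary values of \<open>W\<close>, so that \<open>W\<^sub>+ - W\<^sub>- = F\<close>, and put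
  \<open>Q = W\<^sub>+\<^sup>* J W\<^sub>+ - W\<^sub>-\<^sup>* J W\<^sub>-\<close>, a nonnegative matrix weight on \<open>[a,b]\<close>. Expanding the resolvent at infinity gives
  \<open>K\<^sup>* A\<^sup>n K J = (1/4\<pi>) \<integral> x\<^sup>n F(x) dx\<close>, which determines the scalar products of the vectors
  \<open>u = \<Sum>\<^sub>i A\<^sup>i K v\<^sub>i\<close>. The key estimate is that \<open>\<parallel>u\<parallel>\<^sup>2\<close> is comparable with
  \<open>\<integral> \<langle>J p, Q J p\<rangle> dx\<close>, where \<open>p(x) = \<Sum>\<^sub>i x\<^sup>i v\<^sub>i\<close>. The upper bound for \<open>\<parallel>u\<parallel>\<close> follows from the
  \<open>L\<^sup>2\<close> bound of the Cauchy transform, because \<open>Q\<close> dominates \<open>F\<^sup>* F\<close> by the boundedness of \<open>F\<^sub>1\<close> and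
  \<open>F\<^sub>2\<close>; the lower bound follows by duality from the same estimate for \<open>A\<^sup>*\<close>. Hence the weighted integral extends to
  a scalar product equivalent to the given one on the closed span of the vectors \<open>A\<^sup>i K v\<close>, which contains the simple part.
  For this scalar product \<open>A\<close> is multiplication by \<open>x\<close>, so it is self-adjoint, and its spectral measures have densities.
\<close>

section \<open>Forms on complex Hilbert spaces\<close>

\<comment> \<open>Moving \<open>A\<close> across the scalar product costs
  \<open>A* = A - 2 i K J K*\<close>; the corrections accumulate into a remainder polynomial
  \<open>r\<close> with \<open>4 \<pi> <u, y> = \<integral> <r, F J q> dx\<close>, where
  \<open>q\<close> belongs to \<open>y\<close>. Off the real line \<open>r\<close> is
  \<open>J W J p\<close> plus a Cauchy integral. Being continuous, \<open>r\<close> has the same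
  limit from above and from below; averaging the two expressions brings in \<open>W+ + W-\<close>,
  and since \<open>W+* J W- = J\<close> the cross terms of \<open>(W+ + W-)* J (W+ - W-)\<close>
  cancel. This is where the weight \<open>Q\<close> comes from.

  No pointwise bound on \<open>U\<close>, \<open>W+\<close> or \<open>W-\<close> is assumed.
  Pointwise estimates are therefore relative to \<open>D = J (R - R^-1)\<close>, whose form is
  bounded at \<open>v\<close> through \<open>F1\<close> and at \<open>J U* v\<close> through
  \<open>F2\<close>. With \<open>M = R + R^-1\<close> one has \<open>Q = D M\<close> and
  \<open>M^2 = 4 + (J D)^2\<close>. The weight of \<open>A*\<close> is carried to \<open>Q\<close>
  by \<open>J U*\<close>, and \<open>J U* J (W+ + W-) = M\<close>; hence the test function
  \<open>J (W+ + W-) J p\<close> of the duality argument is again controlled by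
  \<open>Q\<close>.\<close>
subclass (in complex_hilbert) banach ..

section \<open>Elementary rules for complex scalar products\<close>

lemma scaleC_one [simp]: "1 *\<^sub>C x = (x::'a::complex_inner)"
 using scaleC_of_real[of 1 x] by simp

lemma scaleC_zero_left [simp]: "0 *\<^sub>C x = (0::'a::complex_inner)"
 using scaleC_of_real[of 0 x] by simp

lemma scaleC_zero_right [simp]: "c *\<^sub>C 0 = (0::'a::complex_inner)"
 using scaleC_add_right[of c 0 "0::'a"] by simp

lemma scaleC_minus_left [simp]: "(-c) *\<^sub>C x = - (c *\<^sub>C (x::'a::complex_inner))"
 using scaleC_add_left[of c "-c" x] by (simp add: minus_unique)

lemma scaleC_minus_right [simp]: "c *\<^sub>C (-x) = - (c *\<^sub>C (x::'a::complex_inner))"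
 using scaleC_add_right[of c x "-x"] by (simp add: minus_unique)

lemma scaleC_diff_right: "c *\<^sub>C (x - y) = c *\<^sub>C x - c *\<^sub>C (y::'a::complex_inner)"
 using scaleC_add_right[of c x "-y"] by simp

lemma scaleC_sum_right: "c *\<^sub>C (\<Sum>i\<in>I. f i) = (\<Sum>i\<in>I. c *\<^sub>C (f i::'a::complex_inner))"
 by (induction I rule: infinite_finite_induct) (simp_all add: scaleC_add_right)

lemma scaleC_scaleR: "c *\<^sub>C (r *\<^sub>R x) = r *\<^sub>R (c *\<^sub>C (x::'a::complex_inner))"
 by (simp flip: scaleC_of_real add: scaleC_scaleC mult.commute)

lemma scaleC_complex [simp]: "c *\<^sub>C (z::complex) = c * z"
 by (simp add: scaleC_complex_def)

lemma scaleC_vec_nth [simp]: "(c *\<^sub>C x) $ i = c *\<^sub>C (x $ i)"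
 by (simp add: scaleC_vec_def)

lemma cinner_add_left: "cinner (x + y) z = cinner x z + cinner (y::'a::complex_inner) z"
 by (metis cinner_commute cinner_add_right complex_cnj_add)

lemma cinner_scaleC_left: "cinner (c *\<^sub>C x) y = cnj c * cinner (x::'a::complex_inner) y"
 by (metis cinner_commute cinner_scaleC_right complex_cnj_mult)

lemma cinner_scaleR_right: "cinner x (r *\<^sub>R y) = of_real r * cinner (x::'a::complex_inner) y"
 by (simp flip: scaleC_of_real add: cinner_scaleC_right)

lemma cinner_scaleR_left: "cinner (r *\<^sub>R x) y = of_real r * cinner (x::'a::complex_inner) y"
 by (simp flip: scaleC_of_real add: cinner_scaleC_left)

lemma cinner_zero_right [simp]: "cinner (x::'a::complex_inner) 0 = 0"
 using cinner_scaleC_right[of x 0 0] by simp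

lemma cinner_zero_left [simp]: "cinner 0 (x::'a::complex_inner) = 0"
 using cinner_scaleC_left[of 0 0 x] by simp

lemma cinner_minus_right [simp]: "cinner (x::'a::complex_inner) (-y) = - cinner x y"
 using cinner_scaleC_right[of x "-1" y] by simp

lemma cinner_minus_left [simp]: "cinner (-x) (y::'a::complex_inner) = - cinner x y"
 using cinner_scaleC_left[of "-1" x y] by simp

lemma cinner_diff_right: "cinner (x::'a::complex_inner) (y - z) = cinner x y - cinner x z"
 using cinner_add_right[of x y "-z"] by simp

lemma cinner_diff_left: "cinner (x - y) (z::'a::complex_inner) = cinner x z - cinner y z"
 using cinner_add_left[of x "-y" z] by simp

lemmas cinner_simps = cinner_add_left cinner_add_right cinner_diff_left cinner_diff_right
 cinner_scaleC_left cinner_scaleC_right cinner_scaleR_left cinner_scaleR_right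

lemma cinner_self: "cinner x x = complex_of_real ((norm (x::'a::complex_inner))\<^sup>2)"
proof (rule complex_eqI)
 show "Re (cinner x x) = Re (complex_of_real ((norm x)\<^sup>2))"
  by (simp add: norm_eq_sqrt_cinner cinner_ge_zero)
 have "cnj (cinner x x) = cinner x x"
  by (metis cinner_commute)
 then show "Im (cinner x x) = Im (complex_of_real ((norm x)\<^sup>2))"
  by (metis Im_complex_of_real cnj.simps(2) equal_neg_zero)
qed

lemma norm_scaleC: "norm (c *\<^sub>C x) = cmod c * norm (x::'a::complex_inner)"
proof -
 have "complex_of_real ((norm (c *\<^sub>C x))\<^sup>2) = (c * cnj c) * cinner x x"
  unfolding cinner_self[symmetric] by (simp only: cinner_simps mult_ac)
 also have "... = complex_of_real ((cmod c * norm x)\<^sup>2)"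
  by (simp add: cinner_self power_mult_distrib flip: complex_norm_square)
 finally have "complex_of_real ((norm (c *\<^sub>C x))\<^sup>2) = complex_of_real ((cmod c * norm x)\<^sup>2)" .
 then show ?thesis
  by (simp only: of_real_eq_iff power2_eq_iff_nonneg norm_ge_zero mult_nonneg_nonneg)
qed

text \<open>Stated for forms, because it is also applied to forms other than the scalar product.\<close>

lemma form_Cauchy_Schwarz:
 fixes B :: "'a::complex_inner => 'a => complex"
 assumes V: "!!x y. x \<in> V ==> y \<in> V ==> x + y \<in> V" "!!c x. x \<in> V ==> c *\<^sub>C x \<in> V"
  and herm: "!!x y. x \<in> V ==> y \<in> V ==> B x y = cnj (B y x)"
  and add: "!!x y z. x \<in> V ==> y \<in> V ==> z \<in> V ==> B x (y + z) = B x y + B x z"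
  and scale: "!!c x y. x \<in> V ==> y \<in> V ==> B x (c *\<^sub>C y) = c * B x y"
  and pos: "!!x. x \<in> V ==> 0 <= Re (B x x)"
  and x: "x \<in> V" and y: "y \<in> V"
 shows "(cmod (B x y))\<^sup>2 <= Re (B x x) * Re (B y y)"
proof -
 have addl: "B (x + y) z = B x z + B y z" if "x \<in> V" "y \<in> V" "z \<in> V" for x y z
  using herm[of "x+y" z] herm[of x z] herm[of y z] add[of z x y] V that by simp
 have scalel: "B (c *\<^sub>C x) z = cnj c * B x z" if "x \<in> V" "z \<in> V" for x c z
  using herm[of "c *\<^sub>C x" z] herm[of x z] scale[of z x c] V that by simp
 have self: "B x x = of_real (Re (B x x))" if "x \<in> V" for x
  using herm[OF that that] by (simp add: complex_eq_iff)
 define a where "a = B x y"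
 have exp: "Re (B (x + c *\<^sub>C y) (x + c *\<^sub>C y)) =
   Re (B x x) + 2 * Re (c * a) + (cmod c)\<^sup>2 * Re (B y y)" for c
 proof -
  have "B (x + c *\<^sub>C y) (x + c *\<^sub>C y) = B x x + c * a + cnj c * cnj a + cnj c * c * B y y"
   using x y V by (simp add: add addl scale scalel a_def algebra_simps herm[of y x])
  also have "cnj c * c = of_real ((cmod c)\<^sup>2)"
   by (metis complex_norm_square mult.commute)
  finally show ?thesis
   by (simp flip: complex_cnj_mult)
 qed
 have ge: "0 <= Re (B x x) + 2 * Re (c * a) + (cmod c)\<^sup>2 * Re (B y y)" for c
  unfolding exp[symmetric] using x y V by (intro pos) auto
 show ?thesis
 proof (cases "Re (B y y) = 0")
  case False
  then have p: "Re (B y y) > 0" using pos[OF y] by simp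
  \<comment> \<open>The coefficient \<open>- cnj a / B y y\<close> minimizes the quadratic
    expression in \<open>ge\<close>.\<close>
  have "0 <= Re (B x x) + 2 * Re (- (cnj a / of_real (Re (B y y))) * a)
    + (cmod (- (cnj a / of_real (Re (B y y)))))\<^sup>2 * Re (B y y)"
   by (rule ge)
  also have "- (cnj a / of_real (Re (B y y))) * a = of_real (- ((cmod a)\<^sup>2 / Re (B y y)))"
   using complex_norm_square[of a] by (simp add: mult.commute)
  also have "(cmod (- (cnj a / of_real (Re (B y y)))))\<^sup>2 = (cmod a)\<^sup>2 / (Re (B y y))\<^sup>2"
   by (simp add: norm_divide power_divide)
  finally have "0 <= Re (B x x) - (cmod a)\<^sup>2 / Re (B y y)"
   using p by (simp add: power2_eq_square field_simps)
  then show ?thesis using p by (simp add: a_def field_simps)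
 next
  case True
  have "a = 0"
  proof (rule ccontr)
   assume "a \<noteq> 0"
   \<comment> \<open>Along multiples of \<open>cnj a\<close> the quadratic term is absent and the
     expression is affine in \<open>t\<close>; this \<open>t\<close> makes it equal to
     \<open>-1\<close>.\<close>
   define t where "t = - ((Re (B x x) + 1) / (2 * (cmod a)\<^sup>2))"
   have "0 <= Re (B x x) + 2 * Re (of_real t * cnj a * a)"
    using ge[of "of_real t * cnj a"] True by simp
   also have "of_real t * cnj a * a = of_real (t * (cmod a)\<^sup>2)"
    using complex_norm_square[of a] by (simp add: mult_ac)
   finally have "0 <= Re (B x x) + 2 * (t * (cmod a)\<^sup>2)" by simp
   then show False using \<open>a \<noteq> 0\<close> by (simp add: t_def field_simps)
  qed
  then show ?thesis using True pos[OF x] by (simp add: a_def)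
 qed
qed

lemma cinner_Cauchy_Schwarz: "cmod (cinner x y) <= norm x * norm (y::'a::complex_inner)"
proof -
 have "(cmod (cinner x y))\<^sup>2 <= Re (cinner x x) * Re (cinner y y)"
  by (rule form_Cauchy_Schwarz[where V=UNIV])
   (auto simp: cinner_simps cinner_ge_zero intro: cinner_commute)
 then have "(cmod (cinner x y))\<^sup>2 <= (norm x * norm y)\<^sup>2"
  by (simp add: cinner_self power_mult_distrib)
 then show ?thesis by (simp add: power2_le_iff_abs_le)
qed

lemma bounded_bilinear_cinner: "bounded_bilinear (cinner :: 'a::complex_inner => _)"
 by standard (auto simp: cinner_simps scaleR_conv_of_real intro!: exI[of _ 1] cinner_Cauchy_Schwarz)

lemmas tendsto_cinner [tendsto_intros] = bounded_bilinear.tendsto[OF bounded_bilinear_cinner]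
lemmas continuous_on_cinner [continuous_intros] = bounded_bilinear.continuous_on[OF bounded_bilinear_cinner]

lemma bounded_linear_scaleC: "bounded_linear (\<lambda>x::'a::complex_inner. c *\<^sub>C x)"
 by (rule bounded_linear_intro[where K="cmod c"])
  (auto simp: scaleC_add_right scaleC_scaleR norm_scaleC mult.commute)

lemma bounded_bilinear_scaleC: "bounded_bilinear (scaleC :: complex => 'a::complex_inner => 'a)"
 by standard (auto simp: scaleC_add_left scaleC_add_right scaleC_scaleR norm_scaleC scaleR_conv_of_real
   scaleC_of_real simp flip: scaleC_scaleC intro!: exI[of _ 1])

lemmas tendsto_scaleC [tendsto_intros] = bounded_bilinear.tendsto[OF bounded_bilinear_scaleC]
lemmas continuous_on_scaleC [continuous_intros] = bounded_bilinear.continuous_on[OF bounded_bilinear_scaleC]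

lemma norm_add_sq: "(norm (x + y))\<^sup>2 = (norm (x::'a::complex_inner))\<^sup>2 + 2 * Re (cinner x y) + (norm y)\<^sup>2"
proof -
 have "complex_of_real ((norm (x + y))\<^sup>2) = cinner (x + y) (x + y)" by (simp add: cinner_self)
 also have "... = of_real ((norm x)\<^sup>2) + (cinner x y + cnj (cinner x y)) + of_real ((norm y)\<^sup>2)"
  unfolding cinner_self[symmetric] cinner_commute[of x y, symmetric] cinner_commute[of y x, symmetric]
  by (simp only: cinner_simps add_ac)
 finally show ?thesis
  by (simp add: complex_add_cnj complex_eq_iff)
qed

lemma parallelogram_law:
 "(norm (x + y))\<^sup>2 + (norm (x - y))\<^sup>2 = 2 * (norm (x::'a::complex_inner))\<^sup>2 + 2 * (norm y)\<^sup>2"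
 using norm_add_sq[of x y] norm_add_sq[of x "-y"] by simp

text \<open>The difference \<open>x - y\<close> is itself a test vector. The set \<open>V\<close> is
  a parameter so that identities in an invariant subspace can be checked weakly inside that
  subspace.\<close>

lemma cinner_eqI:
 assumes "!!v. v \<in> V ==> cinner v x = cinner v y" "x - y \<in> V"
 shows "x = (y::'a::complex_inner)"
proof -
 have "cinner (x - y) (x - y) = 0"
  using assms(1)[OF assms(2)] by (simp add: cinner_diff_right)
 then show ?thesis by (simp add: cinner_self)
qed

lemma bounded_clinear_onI:
 assumes "!!x y. x \<in> V ==> y \<in> V ==> T (x + y) = T x + T y"
  "!!c x. x \<in> V ==> T (c *\<^sub>C x) = c *\<^sub>C T x"
  "!!x. x \<in> V ==> norm (T x) <= C * norm x"
 shows "bounded_clinear_on V T"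
 unfolding bounded_clinear_on_def using assms by blast

lemma bounded_clinear_imp_bounded_linear: "bounded_clinear T ==> bounded_linear T"
proof -
 assume "bounded_clinear T"
 then obtain C where T: "!!x y. T (x + y) = T x + T y" "!!c x. T (c *\<^sub>C x) = c *\<^sub>C T x"
  "!!x. norm (T x) <= C * norm x"
  unfolding bounded_clinear_on_def by blast
 show "bounded_linear T"
  by (rule bounded_linear_intro[where K=C])
   (use T in \<open>auto simp: mult.commute simp flip: scaleC_of_real\<close>)
qed

definition closed_csubspace :: "'a::complex_inner set => bool" where
 "closed_csubspace V \<longleftrightarrow> closed V \<and> 0 \<in> V \<and> (\<forall>x\<in>V. \<forall>y\<in>V. x + y \<in> V) \<and> (\<forall>c. \<forall>x\<in>V. c *\<^sub>C x \<in> V)"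

lemma closed_csubspaceD:
 assumes "closed_csubspace V"
 shows "closed V" "0 \<in> V" "x \<in> V ==> y \<in> V ==> x + y \<in> V" "x \<in> V ==> c *\<^sub>C x \<in> V"
  "x \<in> V ==> r *\<^sub>R x \<in> V" "x \<in> V ==> y \<in> V ==> x - y \<in> V"
proof -
 have *: "x + y \<in> V" if "x \<in> V" "y \<in> V" for x y using assms that by (auto simp: closed_csubspace_def)
 have **: "c *\<^sub>C x \<in> V" if "x \<in> V" for x c using assms that by (auto simp: closed_csubspace_def)
 show "closed V" "0 \<in> V" using assms by (auto simp: closed_csubspace_def)
 show "x + y \<in> V" if "x \<in> V" "y \<in> V" using * that .
 show "c *\<^sub>C x \<in> V" if "x \<in> V" using ** that .
 show "r *\<^sub>R x \<in> V" if "x \<in> V" using **[OF that, of "of_real r"] by (simp add: scaleC_of_real)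
 show "x - y \<in> V" if "x \<in> V" "y \<in> V"
  using *[OF that(1) **[OF that(2), of "-1"]] by simp
qed

text \<open>The representer minimizes \<open>\<parallel>v\<parallel>\<^sup>2 - 2 Re (l v)\<close>.\<close>

lemma Riesz_representation:
 fixes l :: "'a::complex_hilbert => complex"
 assumes V: "closed_csubspace V" and l: "bounded_clinear_on V l"
 shows "\<exists>g\<in>V. \<forall>v\<in>V. l v = cinner g v"
proof -
 note Vs = closed_csubspaceD[OF V]
 have ladd: "l (x + y) = l x + l y" if "x \<in> V" "y \<in> V" for x y
  using l that by (auto simp: bounded_clinear_on_def)
 have lscale: "l (c *\<^sub>C x) = c * l x" if "x \<in> V" for x c
  using l that by (auto simp: bounded_clinear_on_def)
 obtain C where C: "!!x. x \<in> V ==> cmod (l x) <= C * norm x"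
  using l unfolding bounded_clinear_on_def by blast
 define J where "J = (\<lambda>v. (norm v)\<^sup>2 - 2 * Re (l v))"
 have Jb: "J v \<ge> - C\<^sup>2" if "v \<in> V" for v
 proof -
  have "Re (l v) <= C * norm v" using C[OF that] complex_Re_le_cmod order_trans by blast
  moreover have "0 <= (norm v - C)\<^sup>2" by simp
  ultimately show ?thesis by (simp add: J_def power2_eq_square algebra_simps)
 qed
 define m where "m = Inf (J ` V)"
 have bdd: "bdd_below (J ` V)" using Jb by (auto intro!: bdd_belowI)
 have mle: "m <= J v" if "v \<in> V" for v
  unfolding m_def using that bdd by (intro cInf_lower) auto
 have "\<exists>v\<in>V. J v < m + 1 / real (Suc n)" for n
 proof -
  have "\<exists>j\<in>J ` V. j < m + 1 / real (Suc n)"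
   unfolding m_def using Vs(2) bdd by (subst cInf_less_iff[symmetric]) auto
  then show ?thesis by auto
 qed
 then obtain g where gV: "!!n. g n \<in> V" and gJ: "!!n. J (g n) < m + 1 / real (Suc n)" by metis
 have lhalf: "l ((1/2) *\<^sub>R (x + y)) = (l x + l y) / 2" if "x \<in> V" "y \<in> V" for x y
  using lscale[of "x+y" "of_real (1/2)"] ladd[OF that] Vs(3)[OF that] by (simp only: scaleC_of_real) simp
 \<comment> \<open>The linear part of \<open>J\<close> cancels in the parallelogram law, so a
   minimizing sequence of \<open>J\<close> is Cauchy because midpoints stay above the
   infimum.\<close>
 have par: "(norm (x - y))\<^sup>2 = 2 * J x + 2 * J y - 4 * J ((1/2) *\<^sub>R (x + y))"
  if "x \<in> V" "y \<in> V" for x y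
 proof -
  have e1: "(norm ((1/2) *\<^sub>R (x + y)))\<^sup>2 = (norm (x + y))\<^sup>2 / 4" by (simp add: power_divide)
  have e2: "Re ((l x + l y) / 2) = (Re (l x) + Re (l y)) / 2" by simp
  show ?thesis
   using parallelogram_law[of x y] unfolding J_def lhalf[OF that] e1 e2 by argo
 qed
 have cau: "(norm (g i - g j))\<^sup>2 <= 2 / real (Suc i) + 2 / real (Suc j)" for i j
 proof -
  have "m <= J ((1/2) *\<^sub>R (g i + g j))" by (intro mle Vs(5) Vs(3) gV)
  then show ?thesis using par[OF gV gV, of i j] gJ[of i] gJ[of j] by simp
 qed
 have "Cauchy g"
 proof (rule metric_CauchyI)
  fix e :: real assume e: "e > 0"
  obtain N where N: "4 / e\<^sup>2 < real N" using reals_Archimedean2 by blast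
  show "\<exists>M. \<forall>i\<ge>M. \<forall>j\<ge>M. dist (g i) (g j) < e"
  proof (intro exI[of _ N] allI impI)
   fix i j assume "N <= i" "N <= j"
   have *: "2 / real (Suc k) < e\<^sup>2 / 2" if "N <= k" for k
   proof -
    have "4 / e\<^sup>2 < real (Suc k)" using N that by linarith
    then show ?thesis using e by (simp add: field_simps)
   qed
   have "(norm (g i - g j))\<^sup>2 < e\<^sup>2"
    using cau[of i j] *[OF \<open>N <= i\<close>] *[OF \<open>N <= j\<close>] by linarith
   then show "dist (g i) (g j) < e" using e by (simp add: dist_norm power_less_imp_less_base)
  qed
 qed
 then obtain h where h: "g \<longlonglongrightarrow> h" using Cauchy_convergent convergent_def by blast
 have hV: "h \<in> V" using closed_sequentially[OF Vs(1)] gV h by blast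
 have llim: "(\<lambda>n. l (g n)) \<longlonglongrightarrow> l h"
 proof (rule LIM_zero_cancel, rule Lim_null_comparison)
  have "cmod (l (g n) - l h) <= C * norm (g n - h)" for n
   using C[OF Vs(6)[OF gV hV], of n] ladd[OF Vs(6)[OF gV hV] hV, of n] by simp
  then show "\<forall>\<^sub>F n in sequentially. norm (l (g n) - l h) <= C * norm (g n - h)" by simp
  show "(\<lambda>n. C * norm (g n - h)) \<longlonglongrightarrow> 0"
   using h by (auto intro!: tendsto_eq_intros LIM_zero)
 qed
 have "(\<lambda>n. J (g n)) \<longlonglongrightarrow> J h"
  unfolding J_def by (intro tendsto_intros h llim)
 moreover have "(\<lambda>n. m + 1 / real (Suc n)) \<longlonglongrightarrow> m + 0"
  by (intro tendsto_intros LIMSEQ_Suc[OF lim_1_over_n])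
 ultimately have Jh: "J h <= m"
  using gJ by (intro LIMSEQ_le[of "\<lambda>n. J (g n)" _ "\<lambda>n. m + 1 / real (Suc n)"]) (auto intro: less_imp_le)
 have key: "Re (cinner h v) = Re (l v)" if v: "v \<in> V" for v
 proof -
  have q: "0 <= 2 * t * (Re (cinner h v) - Re (l v)) + t\<^sup>2 * (norm v)\<^sup>2" for t :: real
  proof -
   have "J h <= J (h + t *\<^sub>R v)" using Jh mle[OF Vs(3)[OF hV Vs(5)[OF v]], of t] by simp
   moreover have "l (h + t *\<^sub>R v) = l h + of_real t * l v"
    using ladd[OF hV Vs(5)[OF v, of t]] lscale[OF v, of "of_real t"] by (simp add: scaleC_of_real)
   ultimately show ?thesis
    by (simp add: J_def norm_add_sq cinner_scaleR_right power_mult_distrib algebra_simps)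
  qed
  define d where "d = Re (cinner h v) - Re (l v)"
  \<comment> \<open>The first variation is tested at \<open>t = - d / s\<close>. The summand
    \<open>1\<close> keeps the divisor positive also for \<open>v = 0\<close>.\<close>
  define s where "s = (norm v)\<^sup>2 + 1"
  have s: "s > 0" by (simp add: s_def add_nonneg_pos)
  have "0 <= 2 * (- d / s) * d + (- d / s)\<^sup>2 * (norm v)\<^sup>2" using q[of "- d / s"] by (simp add: d_def)
  also have "... <= 2 * (- d / s) * d + (- d / s)\<^sup>2 * s"
   by (intro add_left_mono mult_left_mono) (auto simp: s_def)
  also have "... = - (d\<^sup>2 / s)" using s by (simp add: power2_eq_square field_simps)
  finally have "d\<^sup>2 / s <= 0" by simp
  then have "d\<^sup>2 <= 0" using s by (simp add: divide_le_0_iff)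
  then show ?thesis by (simp add: d_def)
 qed
 have "l v = cinner h v" if v: "v \<in> V" for v
 proof (rule complex_eqI)
  show "Re (l v) = Re (cinner h v)" using key[OF v] by simp
  show "Im (l v) = Im (cinner h v)"
   using key[OF Vs(4)[OF v, of "\<i>"]] lscale[OF v, of "\<i>"] by (simp add: cinner_scaleC_right)
 qed
 then show ?thesis using hV by blast
qed

lemma bounded_clinear_on_inv_into:
 assumes V: "closed_csubspace V" and S: "bounded_clinear_on V S" and bij: "bij_betw S V V"
  and d: "d > 0" "!!x. x \<in> V ==> d * norm x <= norm (S x)"
 shows "bounded_clinear_on V (inv_into V S)"
proof -
 note Vs = closed_csubspaceD[OF V]
 have add: "S (x + y) = S x + S y" if "x \<in> V" "y \<in> V" for x y
  using S that by (auto simp: bounded_clinear_on_def)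
 have scale: "S (c *\<^sub>C x) = c *\<^sub>C S x" if "x \<in> V" for x c
  using S that by (auto simp: bounded_clinear_on_def)
 have inV: "inv_into V S y \<in> V" if "y \<in> V" for y
  using bij that by (metis bij_betw_def inv_into_into)
 have Sinv: "S (inv_into V S y) = y" if "y \<in> V" for y
  using bij that by (metis bij_betw_inv_into_right)
 have invS: "inv_into V S (S x) = x" if "x \<in> V" for x
  using bij that by (metis bij_betw_inv_into_left)
 show ?thesis
 proof (rule bounded_clinear_onI[where C="1/d"])
  fix x y assume xy: "x \<in> V" "y \<in> V"
  have "S (inv_into V S x + inv_into V S y) = x + y"
   using xy by (simp add: add inV Sinv)
  then show "inv_into V S (x + y) = inv_into V S x + inv_into V S y"
   using invS[OF Vs(3)[OF inV[OF xy(1)] inV[OF xy(2)]]] by simp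
 next
  fix c x assume x: "x \<in> V"
  have "S (c *\<^sub>C inv_into V S x) = c *\<^sub>C x" using x by (simp add: scale inV Sinv)
  then show "inv_into V S (c *\<^sub>C x) = c *\<^sub>C inv_into V S x"
   using invS[OF Vs(4)[OF inV[OF x]]] by metis
 next
  fix x assume x: "x \<in> V"
  show "norm (inv_into V S x) <= 1 / d * norm x"
   using d(2)[OF inV[OF x]] d(1) Sinv[OF x] by (simp add: field_simps)
 qed
qed

text \<open>
 With \<open>X = 1 - G / C\<close>, where \<open>G\<close> is the Gram operator of \<open>B\<close>, the map \<open>S\<close> is the square root
 \<open>1 - Y\<close> of \<open>1 - X\<close>, and \<open>Y\<close> is found as the fixed point of the contraction \<open>Y \<mapsto> (X + Y\<^sup>2) / 2\<close>.
\<close>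

lemma form_similarity:
 fixes B :: "'a::complex_hilbert => 'a => complex"
 assumes V: "closed_csubspace V"
  and herm: "!!x y. x \<in> V ==> y \<in> V ==> B x y = cnj (B y x)"
  and add: "!!x y z. x \<in> V ==> y \<in> V ==> z \<in> V ==> B x (y + z) = B x y + B x z"
  and scale: "!!c x y. x \<in> V ==> y \<in> V ==> B x (c *\<^sub>C y) = c * B x y"
  and c: "0 < c" "c <= C"
  and lower: "!!x. x \<in> V ==> c * (norm x)\<^sup>2 <= Re (B x x)"
  and upper: "!!x. x \<in> V ==> Re (B x x) <= C * (norm x)\<^sup>2"
 shows "\<exists>S. bounded_clinear_on V S \<and> bij_betw S V V \<and> bounded_clinear_on V (inv_into V S) \<and>
  (\<forall>x\<in>V. \<forall>y\<in>V. B x y = of_real C * cinner (S x) (S y))"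
proof -
 note Vs = closed_csubspaceD[OF V]
 have C0: "0 < C" using c by simp
 \<comment> \<open>The form of \<open>1 - G / C\<close> lies between \<open>0\<close> and
   \<open>r\<close> times the squared norm. The strict inequality \<open>r < 1\<close> drives both
   fixed point arguments below and bounds \<open>S\<close> from below.\<close>
 define r where "r = 1 - c / C"
 have r: "0 <= r" "r < 1" using c C0 by (auto simp: r_def field_simps)
 define D where "D = (\<lambda>u v. cinner u v - B u v / of_real C)"
 have Dherm: "D x y = cnj (D y x)" if "x \<in> V" "y \<in> V" for x y
  using herm[OF that] cinner_commute[of x y] by (simp add: D_def)
 have Dadd: "D x (y + z) = D x y + D x z" if "x \<in> V" "y \<in> V" "z \<in> V" for x y z
  by (simp add: D_def add[OF that] cinner_simps add_divide_distrib)
 have Dscale: "D x (k *\<^sub>C y) = k * D x y" if "x \<in> V" "y \<in> V" for x y k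
  by (simp add: D_def scale[OF that] cinner_simps algebra_simps)
 have Dself: "Re (D x x) = (norm x)\<^sup>2 - Re (B x x) / C" for x
  by (simp add: D_def cinner_self)
 have Dpos: "0 <= Re (D x x)" if "x \<in> V" for x
  using upper[OF that] C0 by (simp add: Dself field_simps)
 have Dle: "Re (D x x) <= r * (norm x)\<^sup>2" if "x \<in> V" for x
  using lower[OF that] C0 by (simp add: Dself r_def field_simps)
 have Dbd: "cmod (D x y) <= r * norm x * norm y" if "x \<in> V" "y \<in> V" for x y
 proof -
  have "(cmod (D x y))\<^sup>2 <= Re (D x x) * Re (D y y)"
   using that by (intro form_Cauchy_Schwarz[where V=V] Vs(3,4) Dherm Dadd Dscale Dpos)
  also have "... <= (r * (norm x)\<^sup>2) * (r * (norm y)\<^sup>2)"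
   using that Dle Dpos r by (intro mult_mono) auto
  also have "... = (r * norm x * norm y)\<^sup>2" by (simp add: power_mult_distrib power2_eq_square)
  finally show ?thesis
   by (rule power2_le_imp_le) (use r in auto)
 qed
 have "\<exists>p\<in>V. \<forall>v\<in>V. cinner u v = cinner p v" for u
  by (rule Riesz_representation[OF V], rule bounded_clinear_onI[where C="norm u"])
   (auto simp: cinner_simps intro: cinner_Cauchy_Schwarz)
 \<comment> \<open>\<open>P\<close> is the orthogonal projection onto \<open>V\<close>. Composing
   with it makes \<open>X\<close> an operator on the whole space, so that the fixed point can be
   sought in the Banach space of total bounded operators.\<close>
 then obtain P where PV: "!!u. P u \<in> V" and P: "!!u v. v \<in> V ==> cinner u v = cinner (P u) v"
  by metis
 have P': "cinner v u = cinner v (P u)" if "v \<in> V" for u v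
  using P[OF that, of u] by (metis cinner_commute)
 have Pnorm: "norm (P u) <= norm u" for u
 proof -
  have "(norm (P u))\<^sup>2 = cmod (cinner u (P u))" using P[OF PV, of u u] by (simp add: cinner_self norm_power)
  also have "... <= norm u * norm (P u)" by (rule cinner_Cauchy_Schwarz)
  finally show ?thesis by (cases "norm (P u) = 0") (auto simp: power2_eq_square)
 qed
 have "\<exists>p\<in>V. \<forall>v\<in>V. D (P u) v = cinner p v" for u
  by (rule Riesz_representation[OF V], rule bounded_clinear_onI[where C="r * norm (P u)"])
   (use PV Dbd in \<open>auto simp: Dadd Dscale\<close>)
 then obtain X where XV: "!!u. X u \<in> V" and X: "!!u v. v \<in> V ==> D (P u) v = cinner (X u) v"
  by metis
 have Xsym: "cinner (X u) v = cinner u (X v)" for u v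
 proof -
  have "cinner (X u) v = D (P u) (P v)" by (subst P'[OF XV]) (simp add: X PV)
  also have "... = cnj (D (P v) (P u))" by (intro Dherm PV)
  also have "... = cnj (cinner (X v) u)" by (subst P'[OF XV]) (simp add: X PV)
  finally show ?thesis by (metis cinner_commute)
 qed
 have Xnorm: "norm (X u) <= r * norm u" for u
 proof -
  have "(norm (X u))\<^sup>2 = cmod (D (P u) (X u))" by (simp add: X XV cinner_self norm_power)
  also have "... <= r * norm (P u) * norm (X u)" by (rule Dbd[OF PV XV])
  also have "... <= r * norm u * norm (X u)" using Pnorm r by (intro mult_right_mono mult_left_mono) auto
  finally show ?thesis using r by (cases "norm (X u) = 0") (auto simp: power2_eq_square)
 qed
 \<comment> \<open>A symmetric map is automatically linear, as testing against arbitrary vectors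
   shows.\<close>
 have sym_add: "T (x + y) = T x + T y" and sym_scale: "T (k *\<^sub>C x) = k *\<^sub>C T x"
  if "!!u v. cinner (T u) v = cinner u (T v)" for T :: "'a => 'a" and x y k
  by (rule cinner_eqI[where V=UNIV]; simp add: that[symmetric] cinner_simps)+
 have Xbl: "bounded_linear X"
 proof (rule bounded_linear_intro[where K=r])
  show "X (x + y) = X x + X y" for x y by (rule sym_add[OF Xsym])
  show "X (k *\<^sub>R x) = k *\<^sub>R X x" for k x
   using sym_scale[OF Xsym, of "of_real k" x] by (simp add: scaleC_of_real)
  show "norm (X x) <= norm x * r" for x using Xnorm[of x] by (simp add: mult.commute)
 qed
 define XX where "XX = Blinfun X"
 have XX: "blinfun_apply XX = X" by (simp add: XX_def bounded_linear_Blinfun_apply[OF Xbl])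
 have XXn: "norm XX <= r" by (rule norm_blinfun_bound[OF r(1)]) (simp add: XX Xnorm)
 \<comment> \<open>All three conditions survive limits and the iteration. The bound \<open>r\<close>
   is at once the contraction constant and the reason why \<open>1 - Y\<close> is
   invertible.\<close>
 define Q where "Q = {Y::'a \<Rightarrow>\<^sub>L 'a. (\<forall>u. blinfun_apply Y u \<in> V) \<and>
  (\<forall>u v. cinner (blinfun_apply Y u) v = cinner u (blinfun_apply Y v)) \<and> norm Y <= r}"
 define T where "T = (\<lambda>Y::'a \<Rightarrow>\<^sub>L 'a. (1/2) *\<^sub>R (XX + (Y o\<^sub>L Y)))"
 have "\<exists>!Y\<in>Q. T Y = Y"
 proof (rule Banach_fix[where c=r])
  have "closed Q" unfolding closed_sequential_limits
  proof (intro allI impI, elim conjE)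
   fix Y l assume Y: "\<forall>n. Y n \<in> Q" and l: "Y \<longlonglongrightarrow> l"
   have lim: "(\<lambda>n. Y n u) \<longlonglongrightarrow> l u" for u by (intro tendsto_intros l)
   have "l u \<in> V" for u
    by (rule closed_sequentially[OF Vs(1) _ lim]) (use Y in \<open>auto simp: Q_def\<close>)
   moreover have "cinner (l u) v = cinner u (l v)" for u v
   proof (rule LIMSEQ_unique)
    show "(\<lambda>n. cinner (Y n u) v) \<longlonglongrightarrow> cinner (l u) v" by (intro tendsto_intros lim)
    have "(\<lambda>n. cinner u (Y n v)) \<longlonglongrightarrow> cinner u (l v)" by (intro tendsto_intros lim)
    then show "(\<lambda>n. cinner (Y n u) v) \<longlonglongrightarrow> cinner u (l v)" using Y by (simp add: Q_def)
   qed
   moreover have "norm l <= r"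
    by (rule tendsto_upperbound[OF tendsto_norm[OF l]]) (use Y in \<open>auto simp: Q_def\<close>)
   ultimately show "l \<in> Q" by (simp add: Q_def)
  qed
  then show "complete Q" by (simp add: complete_eq_closed)
  have "0 \<in> Q" using Vs(2) r by (simp add: Q_def)
  then show "Q \<noteq> {}" by blast
  show "0 <= r" "r < 1" by (fact r)+
  have nQ: "norm Y <= r" if "Y \<in> Q" for Y using that by (simp add: Q_def)
  have comp: "norm (Y o\<^sub>L Z) <= norm Y * norm Z" for Y Z :: "'a \<Rightarrow>\<^sub>L 'a"
   by (rule norm_blinfun_compose)
  show "T ` Q \<subseteq> Q"
  proof
   fix Z assume "Z \<in> T ` Q"
   then obtain Y where Y: "Y \<in> Q" and Z: "Z = T Y" by auto
   have app: "Z u = (1/2) *\<^sub>R (X u + Y (Y u))" for u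
    by (simp add: Z T_def blinfun.bilinear_simps XX)
   have "norm (Y o\<^sub>L Y) <= r * r"
    using comp[of Y Y] mult_mono[OF nQ[OF Y] nQ[OF Y]] r by simp
   also have "... <= r" using r by (simp add: mult_left_le)
   finally have "norm (XX + (Y o\<^sub>L Y)) <= r + r"
    using XXn by (intro norm_triangle_le add_mono)
   then have "norm Z <= r" by (simp add: Z T_def)
   moreover have "Z u \<in> V" for u
    unfolding app using Y by (intro Vs(5) Vs(3) XV) (auto simp: Q_def)
   moreover have "cinner (Z u) v = cinner u (Z v)" for u v
   proof -
    have "cinner (Y (Y u)) v = cinner u (Y (Y v))" using Y by (simp add: Q_def)
    then show ?thesis by (simp add: app cinner_simps Xsym)
   qed
   ultimately show "Z \<in> Q" by (simp add: Q_def)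
  qed
  show "dist (T Y) (T Z) <= r * dist Y Z" if Y: "Y \<in> Q" and Z: "Z \<in> Q" for Y Z
  proof -
   \<comment> \<open>This splitting of the difference of squares needs no commutation of
     \<open>Y\<close> and \<open>Z\<close>; the factor one half absorbs its two terms.\<close>
   have "T Y - T Z = (1/2) *\<^sub>R ((Y o\<^sub>L (Y - Z)) + ((Y - Z) o\<^sub>L Z))"
    by (rule blinfun_eqI) (simp add: T_def blinfun.bilinear_simps algebra_simps)
   moreover have "norm ((Y o\<^sub>L (Y - Z)) + ((Y - Z) o\<^sub>L Z)) <= r * norm (Y - Z) + norm (Y - Z) * r"
    using comp[of Y "Y - Z"] comp[of "Y - Z" Z] mult_right_mono[OF nQ[OF Y] norm_ge_zero[of "Y - Z"]]
     mult_left_mono[OF nQ[OF Z] norm_ge_zero[of "Y - Z"]]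
    by (intro norm_triangle_le) linarith
   ultimately show ?thesis by (simp add: dist_norm mult.commute)
  qed
 qed
 then obtain Y where YQ: "Y \<in> Q" and TY: "T Y = Y" by blast
 have YV: "Y u \<in> V" and Ysym: "cinner (Y u) v = cinner u (Y v)" and Yn: "norm Y <= r" for u v
  using YQ by (auto simp: Q_def)
 have Yn': "norm (Y u) <= r * norm u" for u
  using norm_blinfun[of Y u] Yn by (meson mult_right_mono norm_ge_zero order_trans)
 have YY: "Y (Y u) = 2 *\<^sub>R Y u - X u" for u
 proof -
  have "blinfun_apply (T Y) u = (1/2) *\<^sub>R (X u + Y (Y u))"
   by (simp add: T_def blinfun.bilinear_simps XX)
  then have "Y u = (1/2) *\<^sub>R (X u + Y (Y u))" by (simp only: TY)
  then have "2 *\<^sub>R Y u = X u + Y (Y u)" by (metis scaleR_half_double scaleR_2 scaleR_add_right)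
  then show ?thesis by simp
 qed
 define S where "S = (\<lambda>u. u - Y u)"
 have Ssym: "cinner (S u) v = cinner u (S v)" for u v by (simp add: S_def cinner_simps Ysym)
 have lowS: "(1 - r) * norm u <= norm (S u)" for u
  using Yn'[of u] norm_triangle_ineq2[of u "Y u"] by (simp add: S_def algebra_simps)
 have SV: "S u \<in> V" if "u \<in> V" for u using that by (simp add: S_def Vs(6) YV)
 have Sbd: "bounded_clinear_on V S"
 proof (rule bounded_clinear_onI[where C="1 + r"])
  show "S (x + y) = S x + S y" for x y by (rule sym_add[OF Ssym])
  show "S (k *\<^sub>C x) = k *\<^sub>C S x" for k x by (rule sym_scale[OF Ssym])
  show "norm (S x) <= (1 + r) * norm x" for x
   using Yn'[of x] norm_triangle_ineq4[of x "Y x"] by (simp add: S_def algebra_simps)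
 qed
 have "bij_betw S V V" unfolding bij_betw_def
 proof
  show "inj_on S V"
  proof
   fix x y assume "S x = S y"
   then have "S (x - y) = 0" using sym_add[OF Ssym, of "x - y" y] by simp
   then show "x = y" using lowS[of "x - y"] r by (simp add: mult_le_0_iff)
  qed
  show "S ` V = V"
  proof
   show "S ` V \<subseteq> V" using SV by auto
   show "V \<subseteq> S ` V"
   proof
    fix y assume y: "y \<in> V"
    have "\<exists>!x\<in>V. y + Y x = x"
    proof (rule Banach_fix[where c=r])
     show "complete V" using Vs(1) by (simp add: complete_eq_closed)
     show "V \<noteq> {}" "(\<lambda>x. y + Y x) ` V \<subseteq> V" using y Vs YV by auto
     show "dist (y + Y x) (y + Y z) <= r * dist x z" for x z
      using Yn' by (auto simp: dist_norm simp flip: blinfun.diff_right)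
    qed (use r in auto)
    then obtain x where "x \<in> V" "y + Y x = x" by blast
    then show "y \<in> S ` V" by (auto simp: S_def image_iff algebra_simps intro!: bexI[of _ x])
   qed
  qed
 qed
 moreover have "bounded_clinear_on V (inv_into V S)"
  by (rule bounded_clinear_on_inv_into[OF V Sbd \<open>bij_betw S V V\<close>, of "1 - r"]) (use r lowS in auto)
 moreover have "B x y = of_real C * cinner (S x) (S y)" if xy: "x \<in> V" "y \<in> V" for x y
 proof -
  have Px: "P x = x"
  proof (rule cinner_eqI[where V=V])
   show "cinner v (P x) = cinner v x" if "v \<in> V" for v using P'[OF that, of x] by simp
   show "P x - x \<in> V" using xy PV by (intro Vs(6))
  qed
  have "cinner (S x) (S y) = cinner x (S (S y))" by (simp add: Ssym)
  also have "S (S y) = y - X y" by (simp add: S_def blinfun.bilinear_simps YY scaleR_2)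
  also have "cinner x (y - X y) = cinner x y - cinner (X x) y" by (simp add: cinner_simps Xsym)
  also have "cinner (X x) y = D x y" using X[OF xy(2), of x] Px by simp
  finally show ?thesis using C0 by (simp add: D_def)
 qed
 ultimately show ?thesis using Sbd by blast
qed

section \<open>Cauchy integrals on the real line\<close>

lemma tendsto_einterval_ends:
 fixes f :: "real => 'a::topological_space"
 shows "(f \<longlongrightarrow> l) at_bot ==> ((f \<circ> real_of_ereal) \<longlongrightarrow> l) (at_right (-\<infinity>))"
  "(f \<longlongrightarrow> l) at_top ==> ((f \<circ> real_of_ereal) \<longlongrightarrow> l) (at_left \<infinity>)"
 by (simp_all add: at_left_PInf at_right_MInf filterlim_filtermap o_def)

lemma poisson_kernel_integral:
 fixes p q :: real
 assumes "q > 0"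
 shows "integrable lborel (\<lambda>s. q / ((s - p)\<^sup>2 + q\<^sup>2))" "(LBINT s. q / ((s - p)\<^sup>2 + q\<^sup>2)) = pi"
proof -
 have nz: "(s - p)\<^sup>2 + q\<^sup>2 > 0" for s using assms by (simp add: add_nonneg_pos)
 have D: "((\<lambda>s. arctan ((s - p) / q)) has_real_derivative q / ((s - p)\<^sup>2 + q\<^sup>2)) (at s)" for s
  using nz[of s] assms
  by (auto intro!: derivative_eq_intros simp: power2_eq_square field_simps)
 have c: "isCont (\<lambda>s. q / ((s - p)\<^sup>2 + q\<^sup>2)) s" for s
  using nz[of s] by (intro continuous_intros) auto
 have l1: "((\<lambda>s. arctan ((s - p) / q)) \<longlongrightarrow> - (pi / 2)) at_bot"
  using assms by real_asymp
 have l2: "((\<lambda>s. arctan ((s - p) / q)) \<longlongrightarrow> pi / 2) at_top"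
  using assms by real_asymp
 note * = interval_integral_FTC_nonneg[of "-\<infinity>" \<infinity> "\<lambda>s. arctan ((s - p) / q)" "\<lambda>s. q / ((s - p)\<^sup>2 + q\<^sup>2)",
   OF _ D c _ tendsto_einterval_ends(1)[OF l1] tendsto_einterval_ends(2)[OF l2]]
 show "integrable lborel (\<lambda>s. q / ((s - p)\<^sup>2 + q\<^sup>2))"
  using *(1) nz assms by (simp add: set_integrable_def less_imp_le)
 show "(LBINT s. q / ((s - p)\<^sup>2 + q\<^sup>2)) = pi"
  using *(2) nz assms by (simp add: interval_lebesgue_integral_def set_lebesgue_integral_def less_imp_le)
qed

lemma cmod_sq_of_real_minus: "(cmod (of_real s - \<alpha>))\<^sup>2 = (s - Re \<alpha>)\<^sup>2 + (Im \<alpha>)\<^sup>2"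
 by (simp add: cmod_power2)

lemma of_real_minus_nonreal: "Im \<alpha> \<noteq> 0 ==> of_real s - \<alpha> \<noteq> 0" "Im \<alpha> \<noteq> 0 ==> \<alpha> - of_real s \<noteq> 0"
 by (auto simp: complex_eq_iff)

lemma integrable_inverse_sq:
 assumes "Im \<alpha> \<noteq> 0"
 shows "integrable lborel (\<lambda>s. 1 / (cmod (of_real s - \<alpha>))\<^sup>2)"
  "(LBINT s. 1 / (cmod (of_real s - \<alpha>))\<^sup>2) = pi / \<bar>Im \<alpha>\<bar>"
proof -
 have eq: "(\<lambda>s. 1 / (cmod (of_real s - \<alpha>))\<^sup>2) = (\<lambda>s. (1 / \<bar>Im \<alpha>\<bar>) * (\<bar>Im \<alpha>\<bar> / ((s - Re \<alpha>)\<^sup>2 + \<bar>Im \<alpha>\<bar>\<^sup>2)))"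
  using assms by (simp add: cmod_sq_of_real_minus fun_eq_iff)
 show "integrable lborel (\<lambda>s. 1 / (cmod (of_real s - \<alpha>))\<^sup>2)"
  unfolding eq by (intro integrable_mult_right poisson_kernel_integral) (use assms in auto)
 show "(LBINT s. 1 / (cmod (of_real s - \<alpha>))\<^sup>2) = pi / \<bar>Im \<alpha>\<bar>"
  unfolding eq integral_mult_right_zero using poisson_kernel_integral(2)[of "\<bar>Im \<alpha>\<bar>" "Re \<alpha>"] assms by simp
qed

lemma mult_le_half_squares: "a * b <= (a\<^sup>2 + b\<^sup>2) / (2::real)"
 using sum_squares_bound[of a b] by simp

lemma integrable_cauchy_product:
 assumes "Im \<alpha> \<noteq> 0" "Im \<beta> \<noteq> 0"
 shows "integrable lborel (\<lambda>s. 1 / ((of_real s - \<alpha>) * (of_real s - \<beta>)))"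
proof (rule Bochner_Integration.integrable_bound)
 show "integrable lborel (\<lambda>s. (1 / (cmod (of_real s - \<alpha>))\<^sup>2 + 1 / (cmod (of_real s - \<beta>))\<^sup>2) / 2)"
  using assms by (intro integrable_divide_zero Bochner_Integration.integrable_add integrable_inverse_sq) auto
 show "AE s in lborel. norm (1 / ((of_real s - \<alpha>) * (of_real s - \<beta>)))
   <= norm ((1 / (cmod (of_real s - \<alpha>))\<^sup>2 + 1 / (cmod (of_real s - \<beta>))\<^sup>2) / 2)"
  using mult_le_half_squares[of "1 / cmod (of_real _ - \<alpha>)" "1 / cmod (of_real _ - \<beta>)"]
  by (simp add: norm_divide norm_mult power_divide)
qed measurable

text \<open>Evaluated by explicit primitives instead of residues. Poles on the same side of the line
  give \<open>0\<close>, and this decides which terms survive in later computations. For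
  \<open>\<alpha> = \<beta>\<close> the signs agree and division by zero yields \<open>0\<close>, so
  the formula covers this case too.\<close>

lemma cauchy_product_integral:
 assumes "Im \<alpha> \<noteq> 0" "Im \<beta> \<noteq> 0"
 shows "(LBINT s. 1 / ((of_real s - \<alpha>) * (of_real s - \<beta>))) =
  \<i> * of_real (pi * (sgn (Im \<alpha>) - sgn (Im \<beta>))) / (\<alpha> - \<beta>)"
proof -
 have FTC: "(LBINT s. 1 / ((of_real s - \<alpha>) * (of_real s - \<beta>))) = B - A"
  if D: "!!s. (F has_vector_derivative 1 / ((of_real s - \<alpha>) * (of_real s - \<beta>))) (at s)"
   and A: "(F \<longlongrightarrow> A) at_bot" and B: "(F \<longlongrightarrow> B) at_top" for F A B
 proof -
  have c: "isCont (\<lambda>s. 1 / ((complex_of_real s - \<alpha>) * (of_real s - \<beta>))) s" for s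
   using assms of_real_minus_nonreal by (intro continuous_intros) auto
  show ?thesis
   using interval_integral_FTC_integrable[of "-\<infinity>" \<infinity> F "\<lambda>s. 1 / ((of_real s - \<alpha>) * (of_real s - \<beta>))",
     OF _ D c _ tendsto_einterval_ends(1)[OF A] tendsto_einterval_ends(2)[OF B]]
    integrable_cauchy_product[OF assms]
   by (simp add: set_integrable_def interval_lebesgue_integral_def set_lebesgue_integral_def)
 qed
 show ?thesis
 proof (cases "\<alpha> = \<beta>")
  case True
  have D: "((\<lambda>s. - 1 / (of_real s - \<alpha>)) has_vector_derivative 1 / ((of_real s - \<alpha>) * (of_real s - \<beta>))) (at s)" for s
  proof -
   have "((\<lambda>z. - 1 / (z - \<alpha>)) has_field_derivative 1 / ((of_real s - \<alpha>) * (of_real s - \<beta>))) (at (of_real s))"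
    unfolding True[symmetric] using of_real_minus_nonreal[OF assms(1), of s]
    by (auto intro!: derivative_eq_intros simp: power2_eq_square)
   then show ?thesis by (rule has_vector_derivative_real_field)
  qed
  have lim: "((\<lambda>s. - 1 / (complex_of_real s - \<alpha>)) \<longlongrightarrow> 0) F"
   if F: "((\<lambda>s. 1 / \<bar>s - Re \<alpha>\<bar>) \<longlongrightarrow> 0) F" and nz: "eventually (\<lambda>s. s \<noteq> Re \<alpha>) F" for F
  proof (rule Lim_null_comparison[OF _ F], use nz in eventually_elim)
   case (elim s)
   have "\<bar>s - Re \<alpha>\<bar> <= cmod (of_real s - \<alpha>)" using abs_Re_le_cmod[of "of_real s - \<alpha>"] by simp
   then show ?case using elim by (auto simp: norm_divide intro!: divide_left_mono mult_pos_pos)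
  qed
  have "((\<lambda>s. - 1 / (complex_of_real s - \<alpha>)) \<longlongrightarrow> 0) at_bot"
   by (rule lim, real_asymp, rule eventually_mono[OF eventually_gt_at_bot[of "Re \<alpha>"]], simp)
  moreover have "((\<lambda>s. - 1 / (complex_of_real s - \<alpha>)) \<longlongrightarrow> 0) at_top"
   by (rule lim, real_asymp, rule eventually_mono[OF eventually_gt_at_top[of "Re \<alpha>"]], simp)
  ultimately show ?thesis using FTC[OF D] True by simp
 next
  case False
  \<comment> \<open>Up to a constant, \<open>L \<gamma>\<close> is a logarithm of
    \<open>s - \<gamma>\<close>. Writing its imaginary part with \<open>arctan\<close> keeps it
    smooth along the whole line; at both ends the real parts of \<open>L \<alpha>\<close> and
    \<open>L \<beta>\<close> cancel and the \<open>arctan\<close> terms give the signs.\<close>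
  define L where "L = (\<lambda>\<gamma> s. of_real (ln ((s - Re \<gamma>)\<^sup>2 + (Im \<gamma>)\<^sup>2) / 2) + \<i> * complex_of_real (arctan ((s - Re \<gamma>) / Im \<gamma>)))"
  have DL: "(L \<gamma> has_vector_derivative 1 / (of_real s - \<gamma>)) (at s)" if "Im \<gamma> \<noteq> 0" for \<gamma> s
  proof -
   have nz: "(s - Re \<gamma>)\<^sup>2 + (Im \<gamma>)\<^sup>2 > 0" using that by (simp add: add_nonneg_pos)
   have d1: "((\<lambda>s. ln ((s - Re \<gamma>)\<^sup>2 + (Im \<gamma>)\<^sup>2) / 2) has_real_derivative (s - Re \<gamma>) / ((s - Re \<gamma>)\<^sup>2 + (Im \<gamma>)\<^sup>2)) (at s)"
    using nz by (auto intro!: derivative_eq_intros simp: divide_simps) (simp_all add: algebra_simps)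
   have d2: "((\<lambda>s. arctan ((s - Re \<gamma>) / Im \<gamma>)) has_real_derivative Im \<gamma> / ((s - Re \<gamma>)\<^sup>2 + (Im \<gamma>)\<^sup>2)) (at s)"
    using nz that by (auto intro!: derivative_eq_intros simp: power2_eq_square field_simps)
   have e: "1 / (of_real s - \<gamma>) = of_real ((s - Re \<gamma>) / ((s - Re \<gamma>)\<^sup>2 + (Im \<gamma>)\<^sup>2))
     + \<i> * of_real (Im \<gamma> / ((s - Re \<gamma>)\<^sup>2 + (Im \<gamma>)\<^sup>2))"
    using nz by (simp add: complex_eq_iff Re_divide Im_divide power2_eq_square[of "(s - Re \<gamma>)\<^sup>2 + (Im \<gamma>)\<^sup>2"])
   show ?thesis
    unfolding L_def e
    by (intro has_vector_derivative_add has_vector_derivative_mult_right has_vector_derivative_of_real d1 d2)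
  qed
  have D: "((\<lambda>s. (L \<alpha> s - L \<beta> s) / (\<alpha> - \<beta>)) has_vector_derivative 1 / ((of_real s - \<alpha>) * (of_real s - \<beta>))) (at s)" for s
  proof -
   have "((\<lambda>s. (L \<alpha> s - L \<beta> s) / (\<alpha> - \<beta>)) has_vector_derivative (1 / (of_real s - \<alpha>) - 1 / (of_real s - \<beta>)) / (\<alpha> - \<beta>)) (at s)"
    by (intro has_vector_derivative_divide has_vector_derivative_diff DL assms)
   moreover have "(1 / (of_real s - \<alpha>) - 1 / (of_real s - \<beta>)) / (\<alpha> - \<beta>) = 1 / ((of_real s - \<alpha>) * (of_real s - \<beta>))"
    using of_real_minus_nonreal[OF assms(1), of s] of_real_minus_nonreal[OF assms(2), of s] False
    by (simp add: divide_simps)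
   ultimately show ?thesis by simp
  qed
  have at: "((\<lambda>s. arctan ((s - p) / q)) \<longlongrightarrow> sgn q * (pi / 2)) at_top"
   "((\<lambda>s. arctan ((s - p) / q)) \<longlongrightarrow> - (sgn q * (pi / 2))) at_bot" if "q \<noteq> 0" for p q :: real
   using that by (cases "q > 0"; simp; real_asymp)+
  have ln: "((\<lambda>s. ln ((s - p)\<^sup>2 + q\<^sup>2) / 2 - ln ((s - p')\<^sup>2 + q'\<^sup>2) / 2) \<longlongrightarrow> 0) at_top"
    "((\<lambda>s. ln ((s - p)\<^sup>2 + q\<^sup>2) / 2 - ln ((s - p')\<^sup>2 + q'\<^sup>2) / 2) \<longlongrightarrow> 0) at_bot" for p q p' q' :: real
   by real_asymp+
  have L: "L \<alpha> s - L \<beta> s = of_real (ln ((s - Re \<alpha>)\<^sup>2 + (Im \<alpha>)\<^sup>2) / 2 - ln ((s - Re \<beta>)\<^sup>2 + (Im \<beta>)\<^sup>2) / 2)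
    + \<i> * of_real (arctan ((s - Re \<alpha>) / Im \<alpha>) - arctan ((s - Re \<beta>) / Im \<beta>))" for s
   by (simp add: L_def algebra_simps)
  define u where "u = sgn (Im \<alpha>) * (pi / 2) - sgn (Im \<beta>) * (pi / 2)"
  have top: "((\<lambda>s. (L \<alpha> s - L \<beta> s) / (\<alpha> - \<beta>)) \<longlongrightarrow> (of_real 0 + \<i> * of_real u) / (\<alpha> - \<beta>)) at_top"
   unfolding L u_def using False assms by (intro tendsto_intros at ln) auto
  have u: "- u = - (sgn (Im \<alpha>) * (pi / 2)) - - (sgn (Im \<beta>) * (pi / 2))" by (simp add: u_def)
  have bot: "((\<lambda>s. (L \<alpha> s - L \<beta> s) / (\<alpha> - \<beta>)) \<longlongrightarrow> (of_real 0 + \<i> * of_real (- u)) / (\<alpha> - \<beta>)) at_bot"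
   unfolding L u using False assms by (intro tendsto_intros at ln) auto
  have "(LBINT s. 1 / ((of_real s - \<alpha>) * (of_real s - \<beta>))) = (\<i> * of_real (2 * u)) / (\<alpha> - \<beta>)"
   unfolding FTC[OF D bot top] by (simp flip: add_divide_distrib)
  also have "2 * u = pi * (sgn (Im \<alpha>) - sgn (Im \<beta>))" by (simp add: u_def algebra_simps)
  finally show ?thesis .
 qed
qed

text \<open>Completeness of the space of integrable functions, for functions rather than classes: a
  subsequence whose increments have integral below \<open>(1/2)^k\<close> telescopes to a series
  that converges absolutely almost everywhere.\<close>

lemma L1_Cauchy_limit:
 fixes f :: "nat => 'a => 'b::{banach, second_countable_topology}"
 assumes f: "!!n. integrable M (f n)"
  and cau: "!!e. e > 0 ==> \<exists>N. \<forall>m\<ge>N. \<forall>n\<ge>N. (\<integral>x. norm (f m x - f n x) \<partial>M) < e"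
 shows "\<exists>g. integrable M g \<and> (\<lambda>n. \<integral>x. norm (f n x - g x) \<partial>M) \<longlonglongrightarrow> 0"
proof -
 have "\<exists>N. \<forall>m\<ge>N. \<forall>n\<ge>N. (\<integral>x. norm (f m x - f n x) \<partial>M) < (1/2)^k" for k :: nat
  by (rule cau) simp
 then obtain N where N: "!!k m n. m \<ge> N k ==> n \<ge> N k ==> (\<integral>x. norm (f m x - f n x) \<partial>M) < (1/2)^k"
  by metis
 \<comment> \<open>The sum makes \<open>r\<close> increasing and at least \<open>N k\<close> at
   every \<open>k\<close>; the summand \<open>k\<close> makes it pass every bound.\<close>
 define r where "r = (\<lambda>k. k + (\<Sum>i\<le>k. N i))"
 have rN: "N k <= r k" for k using member_le_sum[of k "{..k}" N] by (simp add: r_def)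
 have rmono: "r k <= r (Suc k)" for k by (simp add: r_def)
 define d where "d = (\<lambda>k x. f (r (Suc k)) x - f (r k) x)"
 have dI: "integrable M (d k)" for k unfolding d_def by (intro Bochner_Integration.integrable_diff f)
 have dn: "(\<integral>x. norm (d k x) \<partial>M) < (1/2)^k" for k
  unfolding d_def by (rule N) (use rN rmono order_trans in blast)+
 have sm: "summable (\<lambda>k. \<integral>x. norm (d k x) \<partial>M)"
  by (rule summable_comparison_test'[of "\<lambda>k. (1/2)^k" 0]) (use dn in \<open>auto intro: less_imp_le\<close>)
 have "(\<integral>\<^sup>+x. (\<Sum>k. ennreal (norm (d k x))) \<partial>M) = (\<Sum>k. \<integral>\<^sup>+x. ennreal (norm (d k x)) \<partial>M)"
  using dI by (intro nn_integral_suminf) auto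
 also have "... = (\<Sum>k. ennreal (\<integral>x. norm (d k x) \<partial>M))"
  using dI by (simp add: nn_integral_eq_integral)
 also have "... < \<infinity>"
  using sm by (simp add: suminf_ennreal_eq[OF _ summable_sums] less_top)
 finally have "AE x in M. (\<Sum>k. ennreal (norm (d k x))) \<noteq> \<infinity>"
  using dI by (intro nn_integral_PInf_AE) auto
 then have ae: "AE x in M. summable (\<lambda>k. norm (d k x))"
  by eventually_elim (auto intro: summable_suminf_not_top)
 define g where "g = (\<lambda>x. f (r 0) x + (\<Sum>k. d k x))"
 have "integrable M (\<lambda>x. \<Sum>k. d k x)" by (rule integrable_suminf[OF dI ae sm])
 then have gI: "integrable M g" unfolding g_def by (intro Bochner_Integration.integrable_add f)
 have tel: "f (r n) x = f (r 0) x + (\<Sum>k<n. d k x)" for n x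
  by (induction n) (auto simp: d_def)
 have sub: "(\<integral>x. norm (f (r n) x - g x) \<partial>M) <= (\<Sum>k. \<integral>x. norm (d (k + n) x) \<partial>M)" for n
 proof -
  have sm': "summable (\<lambda>k. \<integral>x. norm (d (k + n) x) \<partial>M)" using summable_ignore_initial_segment[OF sm] .
  have ae': "AE x in M. summable (\<lambda>k. norm (norm (d (k + n) x)))"
   using ae by eventually_elim (auto dest: summable_ignore_initial_segment)
  have "(\<integral>x. norm (f (r n) x - g x) \<partial>M) <= (\<integral>x. (\<Sum>k. norm (d (k + n) x)) \<partial>M)"
  proof (rule integral_mono_AE)
   show "integrable M (\<lambda>x. norm (f (r n) x - g x))" using f gI by auto
   show "integrable M (\<lambda>x. \<Sum>k. norm (d (k + n) x))"
    by (rule integrable_suminf) (use dI sm' ae' in auto)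
   show "AE x in M. norm (f (r n) x - g x) <= (\<Sum>k. norm (d (k + n) x))"
    using ae
   proof eventually_elim
    case (elim x)
    have s: "summable (\<lambda>k. d k x)" using elim by (rule summable_norm_cancel)
    have "g x - f (r n) x = (\<Sum>k. d (k + n) x)"
     using suminf_split_initial_segment[OF s, of n] tel[of n x] by (simp add: g_def)
    then have "norm (f (r n) x - g x) = norm (\<Sum>k. d (k + n) x)" by (metis norm_minus_commute)
    also have "... <= (\<Sum>k. norm (d (k + n) x))"
     by (rule summable_norm) (use elim in \<open>auto dest: summable_ignore_initial_segment\<close>)
    finally show ?case .
   qed
  qed
  also have "... = (\<Sum>k. \<integral>x. norm (d (k + n) x) \<partial>M)"
   by (rule integral_suminf) (use dI sm' ae' in auto)
  finally show ?thesis .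
 qed
 have sub0: "(\<lambda>n. \<integral>x. norm (f (r n) x - g x) \<partial>M) \<longlonglongrightarrow> 0"
  by (rule tendsto_sandwich[OF _ _ tendsto_const suminf_exist_split2[OF sm]])
   (use sub in auto)
 have "(\<lambda>n. \<integral>x. norm (f n x - g x) \<partial>M) \<longlonglongrightarrow> 0"
 proof (rule LIMSEQ_I)
  fix e :: real assume e: "e > 0"
  obtain K where K: "!!m n. m \<ge> K ==> n \<ge> K ==> (\<integral>x. norm (f m x - f n x) \<partial>M) < e / 2"
   using cau[of "e/2"] e by auto
  show "\<exists>no. \<forall>n\<ge>no. norm ((\<integral>x. norm (f n x - g x) \<partial>M) - 0) < e"
  proof (intro exI[of _ "max K (N 0)"] allI impI)
   fix n assume n: "n \<ge> max K (N 0)"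
   obtain j where j: "(\<integral>x. norm (f (r j) x - g x) \<partial>M) < e / 2" "r j \<ge> K"
   proof -
    have "\<forall>\<^sub>F j in sequentially. (\<integral>x. norm (f (r j) x - g x) \<partial>M) < e / 2"
     by (rule order_tendstoD(2)[OF sub0]) (use e in simp)
    then obtain j0 where "!!j. j \<ge> j0 ==> (\<integral>x. norm (f (r j) x - g x) \<partial>M) < e / 2"
     unfolding eventually_sequentially by blast
    then show ?thesis using that[of "max j0 K"] by (simp add: r_def)
   qed
   have "(\<integral>x. norm (f n x - g x) \<partial>M) <= (\<integral>x. norm (f n x - f (r j) x) + norm (f (r j) x - g x) \<partial>M)"
   proof (rule integral_mono)
    show "norm (f n x - g x) <= norm (f n x - f (r j) x) + norm (f (r j) x - g x)" for x
     using dist_triangle[of "f n x" "g x" "f (r j) x"] by (simp add: dist_norm)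
   qed (use f gI in auto)
   also have "... = (\<integral>x. norm (f n x - f (r j) x) \<partial>M) + (\<integral>x. norm (f (r j) x - g x) \<partial>M)"
    using f gI by (intro Bochner_Integration.integral_add) auto
   also have "... < e / 2 + e / 2" using n j K by (intro add_strict_mono) auto
   finally show "norm ((\<integral>x. norm (f n x - g x) \<partial>M) - 0) < e" by simp
  qed
 qed
 then show ?thesis using gI by blast
qed

text \<open>The Cauchy integral without the factor \<open>1 / (2 \<pi> i)\<close>. Its jump across
  the real line is therefore \<open>2 \<pi> i h\<close>, and its imaginary part for real
  \<open>h\<close> tends to \<open>\<pi> h\<close>.\<close>

definition cauchy_transform :: "(real => complex) => complex => complex" where
 "cauchy_transform h z = (LBINT t. h t / (of_real t - z))"

lemma measurable_Complex [measurable (raw)]: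
 "f \<in> borel_measurable M ==> g \<in> borel_measurable M ==> (\<lambda>x. Complex (f x) (g x)) \<in> borel_measurable M"
 by (simp add: Complex_eq)

lemma borel_measurable_cauchy_transform [measurable]:
 assumes [measurable]: "h \<in> borel_measurable borel"
 shows "cauchy_transform h \<in> borel_measurable borel"
 unfolding cauchy_transform_def by measurable

text \<open>Exchanges the roles of the two real variables: as a function of \<open>x\<close>, the
  kernel has its pole at \<open>t - i y\<close>.\<close>

lemma cmod_real_minus_Complex:
 "cmod (of_real t - Complex x y) = cmod (of_real x - Complex t (- y))"
 by (simp add: cmod_def power2_commute)

lemma norm_inverse_nonreal: "Im z \<noteq> 0 ==> cmod (1 / (of_real t - z)) <= 1 / \<bar>Im z\<bar>"
 using abs_Im_le_cmod[of "of_real t - z"] by (simp add: norm_divide frac_le)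

lemma integrable_cauchy_integrand:
 assumes h: "integrable lborel h" and z: "Im z \<noteq> 0"
 shows "integrable lborel (\<lambda>t. h t / (of_real t - z))"
proof (rule Bochner_Integration.integrable_bound)
 show "integrable lborel (\<lambda>t. norm (h t) * (1 / \<bar>Im z\<bar>))" using h by simp
 show "AE t in lborel. norm (h t / (of_real t - z)) <= norm (norm (h t) * (1 / \<bar>Im z\<bar>))"
  using mult_left_mono[OF norm_inverse_nonreal[OF z], of "norm (h _)"] by (simp add: norm_divide)
qed (use h in measurable)

lemma cauchy_transform_add:
 assumes "integrable lborel g" "integrable lborel h" "Im z \<noteq> 0"
 shows "cauchy_transform (\<lambda>t. g t + h t) z = cauchy_transform g z + cauchy_transform h z"
 unfolding cauchy_transform_def add_divide_distrib
 by (intro Bochner_Integration.integral_add integrable_cauchy_integrand assms)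

lemma cauchy_transform_cmult: "cauchy_transform (\<lambda>t. c * h t) z = c * cauchy_transform h z"
 by (simp add: cauchy_transform_def mult.assoc flip: times_divide_eq_right)

lemma cauchy_transform_cnj: "cauchy_transform (\<lambda>t. cnj (h t)) (cnj z) = cnj (cauchy_transform h z)"
 unfolding cauchy_transform_def by (subst Bochner_Integration.integral_cnj[symmetric]) simp

text \<open>Square integrability of \<open>\<phi>\<close> is enough: the arithmetic-geometric
  inequality bounds the integral over \<open>x\<close> by a constant independent of
  \<open>t\<close>, and the factor \<open>h t\<close> is integrable.\<close>

lemma Fubini_cauchy_transform:
 assumes h: "integrable lborel h" and [measurable]: "\<phi> \<in> borel_measurable borel"
  and \<phi>: "integrable lborel (\<lambda>x. (cmod (\<phi> x))\<^sup>2)" and y: "y \<noteq> 0"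
 shows "integrable lborel (\<lambda>x. \<phi> x * cauchy_transform h (Complex x y))"
  "(LBINT x. \<phi> x * cauchy_transform h (Complex x y)) = (LBINT t. h t * (LBINT x. \<phi> x / (of_real t - Complex x y)))"
proof -
 have hm[measurable]: "h \<in> borel_measurable borel" using h by auto
 define f where "f = (\<lambda>t x. h t * (\<phi> x / (of_real t - Complex x y)))"
 have fm: "case_prod f \<in> borel_measurable (lborel \<Otimes>\<^sub>M lborel)"
  unfolding f_def Complex_eq by measurable
 define C where "C = ((LBINT x. (cmod (\<phi> x))\<^sup>2) + pi / \<bar>y\<bar>) / 2"
 have inv: "integrable lborel (\<lambda>x. 1 / (cmod (of_real t - Complex x y))\<^sup>2)"
   "(LBINT x. 1 / (cmod (of_real t - Complex x y))\<^sup>2) = pi / \<bar>y\<bar>" for t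
  using integrable_inverse_sq[of "Complex t (- y)"] y by (simp_all add: cmod_real_minus_Complex[of t])
 have dom: "integrable lborel (\<lambda>x. ((cmod (\<phi> x))\<^sup>2 + 1 / (cmod (of_real t - Complex x y))\<^sup>2) / 2)" for t
  by (intro integrable_divide_zero Bochner_Integration.integrable_add \<phi> inv)
 have le: "cmod (\<phi> x / (of_real t - Complex x y)) <= ((cmod (\<phi> x))\<^sup>2 + 1 / (cmod (of_real t - Complex x y))\<^sup>2) / 2" for t x
  using mult_le_half_squares[of "cmod (\<phi> x)" "1 / cmod (of_real t - Complex x y)"]
  by (simp add: norm_divide power_divide)
 have int1: "integrable lborel (\<lambda>x. \<phi> x / (of_real t - Complex x y))" for t
 proof (rule Bochner_Integration.integrable_bound[OF dom[of t]])
  show "AE x in lborel. norm (\<phi> x / (of_real t - Complex x y))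
    <= norm (((cmod (\<phi> x))\<^sup>2 + 1 / (cmod (of_real t - Complex x y))\<^sup>2) / 2)"
   using le by (intro AE_I2) (metis abs_ge_self order_trans real_norm_def)
 qed measurable
 have bd: "(LBINT x. norm (f t x)) <= norm (h t) * C" for t
 proof -
  have "(LBINT x. norm (f t x)) = norm (h t) * (LBINT x. norm (\<phi> x / (of_real t - Complex x y)))"
   unfolding f_def norm_mult by simp
  also have "(LBINT x. norm (\<phi> x / (of_real t - Complex x y))) \<le>
    (LBINT x. ((cmod (\<phi> x))\<^sup>2 + 1 / (cmod (of_real t - Complex x y))\<^sup>2) / 2)"
   by (rule integral_mono[OF integrable_norm[OF int1] dom le])
  also have "... = C"
   using \<phi> inv by (simp add: C_def)
  finally show ?thesis by (simp add: mult_left_mono)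
 qed
 have fint: "integrable (lborel \<Otimes>\<^sub>M lborel) (case_prod f)"
 proof (rule lborel_pair.Fubini_integrable[OF fm])
  have "integrable lborel (\<lambda>t. norm (h t) * C)" using h by simp
  then show "integrable lborel (\<lambda>t. LBINT x. norm (case_prod f (t, x)))"
  proof (rule Bochner_Integration.integrable_bound)
   show "(\<lambda>t. LBINT x. norm (case_prod f (t, x))) \<in> borel_measurable lborel"
    using fm by measurable
   show "AE t in lborel. norm (LBINT x. norm (case_prod f (t, x))) <= norm (norm (h t) * C)"
    using bd by (intro AE_I2) (simp, meson abs_ge_self order_trans)
  qed
  show "AE t in lborel. integrable lborel (\<lambda>x. case_prod f (t, x))"
   using int1 by (intro AE_I2) (simp add: f_def del: times_divide_eq_right)
 qed
 have eq: "(LBINT t. f t x) = \<phi> x * cauchy_transform h (Complex x y)" for x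
  unfolding f_def cauchy_transform_def by (simp add: mult.commute flip: integral_mult_right_zero)
 show "integrable lborel (\<lambda>x. \<phi> x * cauchy_transform h (Complex x y))"
  using lborel_pair.integrable_snd[OF fint] by (simp add: eq)
 show "(LBINT x. \<phi> x * cauchy_transform h (Complex x y)) = (LBINT t. h t * (LBINT x. \<phi> x / (of_real t - Complex x y)))"
  using lborel_pair.Fubini_integral[OF fint] unfolding eq by (simp add: f_def del: times_divide_eq_right)
qed

text \<open>Compact support gives decay of order \<open>1 / |z|\<close> along a horizontal line,
  which is what makes the transform square integrable there.\<close>

lemma cauchy_transform_bound:
 assumes h: "integrable lborel h" and supp: "!!t. \<bar>t\<bar> > L ==> h t = 0" and L: "L \<ge> 0" and y: "y \<noteq> 0"
 shows "cmod (cauchy_transform h (Complex x y)) <= (LBINT t. norm (h t)) * (1 + L / \<bar>y\<bar>) / cmod (of_real x - Complex 0 (- y))"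
proof -
 let ?z = "Complex x y"
 have z0: "?z \<noteq> 0" using y by (simp add: complex_eq_iff)
 have aux: "1 / A <= B / Z" if "Z <= A * B" "0 < A" "0 < Z" for A B Z :: real
  using that by (simp add: field_simps)
 have pw: "norm (h t / (of_real t - ?z)) <= norm (h t) * ((1 + L / \<bar>y\<bar>) / cmod ?z)" for t
 proof (cases "\<bar>t\<bar> > L")
  case False
  have y': "\<bar>y\<bar> <= cmod (of_real t - ?z)" using abs_Im_le_cmod[of "of_real t - ?z"] by simp
  have "cmod ?z <= cmod (of_real t - ?z) + L"
   using norm_triangle_ineq4[of "of_real t" "of_real t - ?z"] False by simp
  also have "L = \<bar>y\<bar> * (L / \<bar>y\<bar>)" using y by simp
  also have "... <= cmod (of_real t - ?z) * (L / \<bar>y\<bar>)" using y' L y by (intro mult_right_mono) auto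
  finally have "cmod ?z <= cmod (of_real t - ?z) * (1 + L / \<bar>y\<bar>)" by (simp add: algebra_simps)
  then have "1 / cmod (of_real t - ?z) <= (1 + L / \<bar>y\<bar>) / cmod ?z"
   by (rule aux) (use y' y z0 in auto)
  then have "norm (h t) * (1 / cmod (of_real t - ?z)) <= norm (h t) * ((1 + L / \<bar>y\<bar>) / cmod ?z)"
   by (intro mult_left_mono) auto
  then show ?thesis by (simp add: norm_divide)
 qed (simp add: supp)
 have "cmod (cauchy_transform h ?z) <= (LBINT t. norm (h t / (of_real t - ?z)))"
  unfolding cauchy_transform_def by (rule integral_norm_bound)
 also have "... <= (LBINT t. norm (h t) * ((1 + L / \<bar>y\<bar>) / cmod ?z))"
  using h y by (intro integral_mono integrable_norm integrable_cauchy_integrand pw) auto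
 also have "... = (LBINT t. norm (h t)) * (1 + L / \<bar>y\<bar>) / cmod ?z" by simp
 finally show ?thesis by (simp add: cmod_def)
qed

lemma cauchy_transform_square_integrable:
 assumes h: "integrable lborel h" and supp: "!!t. \<bar>t\<bar> > L ==> h t = 0" and L: "L \<ge> 0" and y: "y \<noteq> 0"
 shows "integrable lborel (\<lambda>x. (cmod (cauchy_transform h (Complex x y)))\<^sup>2)"
proof (rule Bochner_Integration.integrable_bound)
 define C where "C = (LBINT t. norm (h t)) * (1 + L / \<bar>y\<bar>)"
 show "integrable lborel (\<lambda>x. C\<^sup>2 * (1 / (cmod (of_real x - Complex 0 (- y)))\<^sup>2))"
  by (intro integrable_mult_right integrable_inverse_sq) (use y in auto)
 show "AE x in lborel. norm ((cmod (cauchy_transform h (Complex x y)))\<^sup>2) <= norm (C\<^sup>2 * (1 / (cmod (of_real x - Complex 0 (- y)))\<^sup>2))"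
 proof (rule AE_I2)
  fix x
  have "(cmod (cauchy_transform h (Complex x y)))\<^sup>2 <= (C / cmod (of_real x - Complex 0 (- y)))\<^sup>2"
   using cauchy_transform_bound[OF h supp L y, of x] by (intro power_mono) (auto simp: C_def)
  then show "norm ((cmod (cauchy_transform h (Complex x y)))\<^sup>2) <= norm (C\<^sup>2 * (1 / (cmod (of_real x - Complex 0 (- y)))\<^sup>2))"
   by (simp add: power_divide)
 qed
 have [measurable]: "h \<in> borel_measurable borel" using h by auto
 show "(\<lambda>x. (cmod (cauchy_transform h (Complex x y)))\<^sup>2) \<in> borel_measurable lborel" by measurable
qed

text \<open>Takes the place of the Plancherel theorem. After Fubini the integral over
  \<open>x\<close> contains two Cauchy kernels with poles on opposite sides of the line, and these
  reproduce a single kernel at height \<open>y + y'\<close>. Scalar products of horizontal slices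
  are thus expressed by the imaginary part of the transform, that is by the Poisson extension of
  \<open>h\<close>, whose boundary behaviour is accessible.\<close>

lemma cauchy_transform_L2_identity:
 fixes h :: "real => real"
 assumes h: "integrable lborel h" and supp: "!!t. \<bar>t\<bar> > L ==> h t = 0" and L: "L \<ge> 0" and y: "y > 0" "y' > 0"
 defines "H \<equiv> cauchy_transform (\<lambda>t. of_real (h t))"
 shows "integrable lborel (\<lambda>x. H (Complex x y) * cnj (H (Complex x y')))"
  "Re (LBINT x. H (Complex x y) * cnj (H (Complex x y'))) = 2 * pi * (LBINT s. h s * Im (H (Complex s (y + y'))))"
  "integrable lborel (\<lambda>s. h s * Im (H (Complex s (y + y'))))"
proof -
 have hc: "integrable lborel (\<lambda>t. complex_of_real (h t))" using h by simp
 have [measurable]: "h \<in> borel_measurable borel" using h by auto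
 have Hm[measurable]: "H \<in> borel_measurable borel" unfolding H_def by measurable
 have cnjH: "cnj (H (Complex x y')) = H (Complex x (- y'))" for x
  using cauchy_transform_cnj[of "\<lambda>t. of_real (h t)" "Complex x y'"] by (simp add: H_def complex_cnj)
 have sq: "integrable lborel (\<lambda>x. (cmod (H (Complex x y)))\<^sup>2)"
  unfolding H_def by (rule cauchy_transform_square_integrable[OF hc _ L]) (use supp y in auto)
 have inner: "(LBINT x. H (Complex x y) / (of_real s - Complex x (- y'))) = - 2 * pi * \<i> * H (Complex s (y + y'))" for s
 proof -
  let ?\<phi> = "\<lambda>x. 1 / (of_real s - Complex x (- y'))"
  have "(LBINT x. H (Complex x y) / (of_real s - Complex x (- y'))) = (LBINT x. ?\<phi> x * H (Complex x y))" by simp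
  also have "... = (LBINT t. of_real (h t) * (LBINT x. ?\<phi> x / (of_real t - Complex x y)))"
   unfolding H_def
  proof (rule Fubini_cauchy_transform(2)[OF hc])
   show "?\<phi> \<in> borel_measurable borel" unfolding Complex_eq by measurable
   show "integrable lborel (\<lambda>x. (cmod (?\<phi> x))\<^sup>2)"
    using integrable_inverse_sq(1)[of "Complex s y'"] y
    by (simp add: cmod_real_minus_Complex[of s] norm_divide power_divide)
  qed (use y in auto)
  also have "(\<lambda>t. LBINT x. ?\<phi> x / (of_real t - Complex x y)) = (\<lambda>t. - 2 * pi * \<i> * (1 / (of_real t - Complex s (y + y'))))"
  proof
   fix t
   have e1: "of_real s - Complex x (- y') = - (of_real x - Complex s y')" "of_real t - Complex x y = - (of_real x - Complex t (- y))" for x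
    by (simp_all add: complex_eq_iff)
   have neg: "complex_of_real (2 * pi) * \<i> / - X = complex_of_real (- 2 * pi) * \<i> * (1 / X)" for X :: complex by simp
   have gen: "1 / (- A) / (- B) = 1 / (A * B)" for A B :: complex by simp
   have "(LBINT x. ?\<phi> x / (of_real t - Complex x y)) = (LBINT x. 1 / ((of_real x - Complex s y') * (of_real x - Complex t (- y))))"
    unfolding e1 gen ..
   also have "... = \<i> * of_real (pi * (sgn y' - sgn (- y))) / (Complex s y' - Complex t (- y))"
    using cauchy_product_integral[of "Complex s y'" "Complex t (- y)"] y by simp
   also have "... = 2 * pi * \<i> / - (of_real t - Complex s (y + y'))"
    using y by (simp add: complex_eq_iff Complex_eq algebra_simps)
   also have "... = - 2 * pi * \<i> * (1 / (of_real t - Complex s (y + y')))"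
    by (rule neg)
   finally show "(LBINT x. ?\<phi> x / (of_real t - Complex x y)) = - 2 * pi * \<i> * (1 / (of_real t - Complex s (y + y')))" .
  qed
  also have "(LBINT t. of_real (h t) * (- 2 * pi * \<i> * (1 / (of_real t - Complex s (y + y'))))) = (LBINT t. (- 2 * pi * \<i>) * (of_real (h t) / (of_real t - Complex s (y + y'))))"
   by (simp add: mult_ac)
  also have "... = - 2 * pi * \<i> * H (Complex s (y + y'))"
   unfolding H_def cauchy_transform_def by (rule integral_mult_right_zero)
  finally show ?thesis .
 qed
 have F: "integrable lborel (\<lambda>x. H (Complex x y) * H (Complex x (- y')))"
  "(LBINT x. H (Complex x y) * H (Complex x (- y'))) = (LBINT s. of_real (h s) * (LBINT x. H (Complex x y) / (of_real s - Complex x (- y'))))"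
  using Fubini_cauchy_transform[OF hc _ sq, of "- y'"] y unfolding H_def[symmetric] by auto
 show "integrable lborel (\<lambda>x. H (Complex x y) * cnj (H (Complex x y')))" using F(1) by (simp add: cnjH)
 have int: "integrable lborel (\<lambda>s. of_real (h s) * H (Complex s (y + y')))"
 proof (rule Bochner_Integration.integrable_bound)
  show "integrable lborel (\<lambda>s. norm (h s) * ((LBINT t. norm (h t)) * (1 / (y + y'))))" using h by simp
  show "AE s in lborel. norm (of_real (h s) * H (Complex s (y + y'))) <= norm (norm (h s) * ((LBINT t. norm (h t)) * (1 / (y + y'))))"
  proof (rule AE_I2)
   fix s
   have "norm (H (Complex s (y + y'))) <= (LBINT t. norm (of_real (h t) / (of_real t - Complex s (y + y'))))"
    unfolding H_def cauchy_transform_def by (rule integral_norm_bound)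
   also have "... <= (LBINT t. norm (h t) * (1 / (y + y')))"
   proof (rule integral_mono)
    show "integrable lborel (\<lambda>t. norm (complex_of_real (h t) / (of_real t - Complex s (y + y'))))"
     using y by (intro integrable_norm integrable_cauchy_integrand hc) auto
    show "norm (of_real (h t) / (of_real t - Complex s (y + y'))) <= norm (h t) * (1 / (y + y'))" for t
     using mult_left_mono[OF norm_inverse_nonreal[of "Complex s (y + y')" t], of "norm (h t)"] y
     by (simp add: norm_divide)
   qed (use h in simp)
   also have "... = (LBINT t. norm (h t)) * (1 / (y + y'))" by simp
   finally have "norm (H (Complex s (y + y'))) <= (LBINT t. norm (h t)) * (1 / (y + y'))" .
   then have "norm (h s) * norm (H (Complex s (y + y'))) <= norm (h s) * ((LBINT t. norm (h t)) * (1 / (y + y')))"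
    by (intro mult_left_mono) auto
   then show "norm (of_real (h s) * H (Complex s (y + y'))) <= norm (norm (h s) * ((LBINT t. norm (h t)) * (1 / (y + y'))))"
    using y by (simp add: norm_mult)
  qed
 qed measurable
 show "integrable lborel (\<lambda>s. h s * Im (H (Complex s (y + y'))))"
  using integrable_Im[OF int] by simp
 have "(LBINT x. H (Complex x y) * cnj (H (Complex x y'))) = (LBINT s. (- 2 * pi * \<i>) * (of_real (h s) * H (Complex s (y + y'))))"
  unfolding cnjH F(2) inner by (simp add: mult_ac)
 also have "... = (- 2 * pi * \<i>) * (LBINT s. of_real (h s) * H (Complex s (y + y')))"
  by (rule integral_mult_right_zero)
 finally have "Re (LBINT x. H (Complex x y) * cnj (H (Complex x y'))) = 2 * pi * Im (LBINT s. of_real (h s) * H (Complex s (y + y')))"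
  by simp
 also have "Im (LBINT s. of_real (h s) * H (Complex s (y + y'))) = (LBINT s. h s * Im (H (Complex s (y + y'))))"
  using integral_Im[OF int] by simp
 finally show "Re (LBINT x. H (Complex x y) * cnj (H (Complex x y'))) = 2 * pi * (LBINT s. h s * Im (H (Complex s (y + y'))))" .
qed

text \<open>The semigroup property of the Poisson kernel. The kernel is a difference of Cauchy
  kernels with poles at \<open>x + i y'\<close> and \<open>x - i y'\<close>; the second pole lies on
  the same side as that of the transform and contributes nothing. The factor \<open>pi\<close> is
  the mass of the kernel.\<close>

lemma poisson_cauchy_transform:
 assumes h: "integrable lborel h" and y: "y > 0" "y' > 0"
 shows "(LBINT s. of_real (y' / ((s - x)\<^sup>2 + y'\<^sup>2)) * cauchy_transform h (Complex s y)) = pi * cauchy_transform h (Complex x (y + y'))"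
proof -
 let ?k = "\<lambda>s. complex_of_real (y' / ((s - x)\<^sup>2 + y'\<^sup>2))"
 have sq: "integrable lborel (\<lambda>s. (cmod (?k s))\<^sup>2)"
 proof (rule Bochner_Integration.integrable_bound)
  show "integrable lborel (\<lambda>s. (1 / y') * (y' / ((s - x)\<^sup>2 + y'\<^sup>2)))"
   by (intro integrable_mult_right poisson_kernel_integral y)
  show "AE s in lborel. norm ((cmod (?k s))\<^sup>2) <= norm ((1 / y') * (y' / ((s - x)\<^sup>2 + y'\<^sup>2)))"
  proof (rule AE_I2)
   fix s
   have p: "0 < (s - x)\<^sup>2 + y'\<^sup>2" using y by (simp add: add_nonneg_pos)
   have "y' / ((s - x)\<^sup>2 + y'\<^sup>2) <= y' / y'\<^sup>2"
    using y p by (intro divide_left_mono mult_pos_pos) auto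
   then have "y' / ((s - x)\<^sup>2 + y'\<^sup>2) <= 1 / y'" using y by (simp add: power2_eq_square)
   then have "(y' / ((s - x)\<^sup>2 + y'\<^sup>2)) * (y' / ((s - x)\<^sup>2 + y'\<^sup>2)) <= (1 / y') * (y' / ((s - x)\<^sup>2 + y'\<^sup>2))"
    using y p by (intro mult_right_mono) auto
   then show "norm ((cmod (?k s))\<^sup>2) <= norm ((1 / y') * (y' / ((s - x)\<^sup>2 + y'\<^sup>2)))"
    using y p unfolding norm_of_real real_norm_def power2_abs by (simp add: power2_eq_square)
  qed
 qed measurable
 have inner: "(LBINT s. ?k s / (of_real t - Complex s y)) = pi / (of_real t - Complex x (y + y'))" for t
 proof -
  let ?a = "Complex x y'" and ?b = "Complex t (- y)"
  have "(LBINT s. ?k s / (of_real t - Complex s y)) = (LBINT s. (- 1 / (2 * \<i>)) * (1 / ((of_real s - ?a) * (of_real s - ?b)) - 1 / ((of_real s - cnj ?a) * (of_real s - ?b))))"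
  proof (rule Bochner_Integration.integral_cong)
   fix s
   have nz: "of_real s - ?a \<noteq> 0" "of_real s - cnj ?a \<noteq> 0" "of_real s - ?b \<noteq> 0" using y by (auto simp: complex_eq_iff)
   have k: "?k s = (1 / (2 * \<i>)) * (1 / (of_real s - ?a) - 1 / (of_real s - cnj ?a))"
   proof -
    have "1 / (of_real s - ?a) - 1 / (of_real s - cnj ?a) = (?a - cnj ?a) / ((of_real s - ?a) * (of_real s - cnj ?a))"
     using nz by (simp add: divide_simps)
    also have "(of_real s - ?a) * (of_real s - cnj ?a) = of_real ((s - x)\<^sup>2 + y'\<^sup>2)"
     by (simp add: complex_eq_iff power2_eq_square algebra_simps)
    also have "?a - cnj ?a = 2 * \<i> * of_real y'" by (simp add: complex_eq_iff)
    finally show ?thesis by simp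
   qed
   have e: "of_real t - Complex s y = - (of_real s - ?b)" by (simp add: complex_eq_iff)
   have ring: "(w * (u - v)) / (- b) = (- w) * (u * (1/b) - v * (1/b))" for u v w b :: complex
    by (cases "b = 0") (auto simp: field_simps)
   have "?k s / (of_real t - Complex s y) = (- (1 / (2 * \<i>))) * (1 / (of_real s - ?a) * (1 / (of_real s - ?b)) - 1 / (of_real s - cnj ?a) * (1 / (of_real s - ?b)))"
    unfolding k e by (rule ring)
   then show "?k s / (of_real t - Complex s y) = (- 1 / (2 * \<i>)) * (1 / ((of_real s - ?a) * (of_real s - ?b)) - 1 / ((of_real s - cnj ?a) * (of_real s - ?b)))"
    by simp
  qed simp
  also have "... = (- 1 / (2 * \<i>)) * ((LBINT s. 1 / ((of_real s - ?a) * (of_real s - ?b))) - (LBINT s. 1 / ((of_real s - cnj ?a) * (of_real s - ?b))))"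
   unfolding integral_mult_right_zero
   by (subst Bochner_Integration.integral_diff) (use y in \<open>auto intro!: integrable_cauchy_product\<close>)
  also have "(LBINT s. 1 / ((of_real s - ?a) * (of_real s - ?b))) = 2 * \<i> * pi / (?a - ?b)"
   using cauchy_product_integral[of ?a ?b] y by simp
  also have "(LBINT s. 1 / ((of_real s - cnj ?a) * (of_real s - ?b))) = 0"
   using cauchy_product_integral[of "cnj ?a" ?b] y by simp
  also have "(- 1 / (2 * \<i>)) * (2 * \<i> * pi / (?a - ?b) - 0) = pi / (?b - ?a)"
   by (simp add: minus_divide_right[symmetric] flip: minus_divide_left) (metis minus_diff_eq minus_divide_right)
  also have "?b - ?a = of_real t - Complex x (y + y')" by (simp add: complex_eq_iff)
  finally show ?thesis .
 qed
 have "(LBINT s. ?k s * cauchy_transform h (Complex s y)) = (LBINT t. h t * (LBINT s. ?k s / (of_real t - Complex s y)))"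
  by (rule Fubini_cauchy_transform(2)[OF h _ sq]) (use y in auto)
 also have "... = (LBINT t. pi * (h t / (of_real t - Complex x (y + y'))))"
  unfolding inner by (simp add: mult_ac)
 also have "... = pi * cauchy_transform h (Complex x (y + y'))"
  unfolding cauchy_transform_def by (rule integral_mult_right_zero)
 finally show ?thesis .
qed

section \<open>Boundary values of Cauchy integrals\<close>

text \<open>Integration by parts, carried out by Fubini: the kernel \<open>k\<close> at
  \<open>s\<close> is \<open>k d\<close> plus the integral of \<open>m = - k'\<close> over
  \<open>[s,d]\<close>, so only the primitive of \<open>u\<close> is estimated, and \<open>m\<close>
  is nonnegative. The boundary term contributes \<open>d * k d\<close>, which cancels because
  \<open>arctan (y / q) - y * k y\<close> is a primitive of \<open>y * m y\<close>.\<close>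

lemma poisson_one_sided:
 fixes u :: "real => real"
 assumes u: "integrable lborel u" and supp: "!!s. s \<notin> {0..d} ==> u s = 0"
  and d: "d > 0" and q: "q > 0" and e: "e \<ge> 0"
  and prim: "!!y. 0 <= y ==> y <= d ==> \<bar>LBINT s. u s * indicator {0..y} s\<bar> <= e * y"
 shows "\<bar>LBINT s. u s * (q / (s\<^sup>2 + q\<^sup>2))\<bar> <= e * (pi / 2)"
proof -
 have [measurable]: "u \<in> borel_measurable borel" using u by auto
 have nz: "s\<^sup>2 + q\<^sup>2 > 0" for s using q by (simp add: add_nonneg_pos)
 have nz': "s\<^sup>2 + q\<^sup>2 \<noteq> 0" for s using nz[of s] by linarith
 define k where "k = (\<lambda>s. q / (s\<^sup>2 + q\<^sup>2))"
 define m where "m = (\<lambda>y. 2 * q * y / (y\<^sup>2 + q\<^sup>2)\<^sup>2)"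
 have k0: "0 <= k s" for s using nz[of s] q by (simp add: k_def)
 have kle: "k s <= 1 / q" for s
 proof -
  have "k s <= q / q\<^sup>2" unfolding k_def using q nz[of s] by (intro divide_left_mono mult_pos_pos) auto
  then show ?thesis using q by (simp add: power2_eq_square)
 qed
 have km: "k \<in> borel_measurable borel" "m \<in> borel_measurable borel" unfolding k_def m_def by measurable
 note km[measurable]
 have mc: "isCont m y" for y unfolding m_def using nz' by (intro continuous_intros) auto
 have Dk: "((\<lambda>y. - k y) has_real_derivative m y) (at y)" for y
  unfolding k_def m_def using nz'[of y] by (auto intro!: derivative_eq_intros simp: power2_eq_square)
 have Dky: "((\<lambda>y. arctan (y / q) - y * k y) has_real_derivative m y * y) (at y)" for y
 proof -
  have "((\<lambda>y. arctan (y / q)) has_real_derivative k y) (at y)"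
   unfolding k_def using nz[of y] q by (auto intro!: derivative_eq_intros simp: power2_eq_square field_simps)
  moreover have "((\<lambda>y. y * k y) has_real_derivative k y - m y * y) (at y)"
   using DERIV_mult[OF DERIV_ident DERIV_minus[OF Dk[of y]]] by (simp add: algebra_simps)
  ultimately show ?thesis using DERIV_diff by fastforce
 qed
 have mk: "(LBINT y. m y * indicator {s..d} y) = k s - k d" "integrable lborel (\<lambda>y. m y * indicator {s..d} y)" if "s <= d" for s
  using has_bochner_integral_FTC_Icc_real[OF that Dk mc] by (auto simp: has_bochner_integral_iff)
 have myi: "(LBINT y. (m y * y) * indicator {0..d} y) = arctan (d / q) - d * k d"
   "integrable lborel (\<lambda>y. (m y * y) * indicator {0..d} y)"
  using has_bochner_integral_FTC_Icc_real[OF less_imp_le[OF d] Dky, of ] mc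
  by (auto simp: has_bochner_integral_iff intro: continuous_intros)
 have m0: "0 <= m y" if "0 <= y" for y using that q nz[of y] by (simp add: m_def)
 define f where "f = (\<lambda>s y. u s * (if s <= y \<and> 0 <= y \<and> y <= d then m y else 0))"
 have fm: "case_prod f \<in> borel_measurable (lborel \<Otimes>\<^sub>M lborel)" unfolding f_def by measurable
 have fs: "f s y = u s * (m y * indicator {s..d} y)" for s y
  using supp[of s] by (auto simp: f_def indicator_def)
 have fint: "integrable (lborel \<Otimes>\<^sub>M lborel) (case_prod f)"
 proof (rule lborel_pair.Fubini_integrable[OF fm])
  have ab: "(LBINT y. norm (case_prod f (s, y))) = norm (u s) * (k s - k d)" for s
  proof (cases "s \<in> {0..d}")
   case True
   have "(LBINT y. norm (case_prod f (s, y))) = (LBINT y. norm (u s) * (m y * indicator {s..d} y))"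
    using True m0 by (intro Bochner_Integration.integral_cong) (auto simp: fs abs_mult indicator_def)
   then show ?thesis using mk(1)[of s] True by simp
  qed (simp add: fs supp)
  show "integrable lborel (\<lambda>s. LBINT y. norm (case_prod f (s, y)))"
   unfolding ab
  proof (rule Bochner_Integration.integrable_bound[of _ "\<lambda>s. norm (u s) * (2 / q)"])
   show "AE s in lborel. norm (norm (u s) * (k s - k d)) <= norm (norm (u s) * (2 / q))"
   proof (rule AE_I2)
    fix s
    have "\<bar>k s - k d\<bar> <= 2 / q" using k0[of s] k0[of d] kle[of s] kle[of d] q by (simp add: abs_le_iff add_divide_distrib[symmetric])
    then show "norm (norm (u s) * (k s - k d)) <= norm (norm (u s) * (2 / q))"
     using q by (simp add: abs_mult mult_left_mono del: times_divide_eq_right)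
   qed
  qed (use u in auto)
  show "AE s in lborel. integrable lborel (\<lambda>y. case_prod f (s, y))"
  proof (rule AE_I2)
   fix s show "integrable lborel (\<lambda>y. case_prod f (s, y))"
    using mk(2)[of s] by (cases "s <= d") (auto simp: fs supp)
  qed
 qed
 have fy: "(LBINT s. f s y) = m y * indicator {0..d} y * (LBINT s. u s * indicator {0..y} s)" for y
 proof -
  have "(LBINT s. f s y) = (LBINT s. (m y * indicator {0..d} y) * (u s * indicator {0..y} s))"
   using supp by (intro Bochner_Integration.integral_cong) (auto simp: f_def indicator_def)
  then show ?thesis by simp
 qed
 have fx: "(LBINT y. f s y) = u s * k s - u s * k d" for s
  using mk(1)[of s] supp[of s] by (cases "s \<in> {0..d}") (auto simp: fs right_diff_distrib)
 have uk: "integrable lborel (\<lambda>s. u s * k s)"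
  by (rule Bochner_Integration.integrable_bound[of _ "\<lambda>s. u s * (1 / q)"])
   (use u k0 kle q in \<open>auto intro!: AE_I2 mult_left_mono simp: abs_mult simp del: times_divide_eq_right mult_1_right\<close>)
 have "(LBINT s. u s * k s) = (LBINT s. u s * k d) + (LBINT s. LBINT y. f s y)"
  unfolding fx using uk u by (simp add: Bochner_Integration.integral_diff)
 also have "(LBINT s. LBINT y. f s y) = (LBINT y. LBINT s. f s y)"
  by (rule lborel_pair.Fubini_integral[OF fint, symmetric])
 also have "(LBINT s. u s * k d) = k d * (LBINT s. u s * indicator {0..d} s)"
  by (subst integral_mult_right_zero[symmetric], intro Bochner_Integration.integral_cong)
   (use supp in \<open>auto simp: indicator_def\<close>)
 finally have eq: "(LBINT s. u s * k s) = k d * (LBINT s. u s * indicator {0..d} s) + (LBINT y. LBINT s. f s y)" .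
 have "\<bar>LBINT y. LBINT s. f s y\<bar> <= (LBINT y. \<bar>LBINT s. f s y\<bar>)" by (rule integral_abs_bound)
 also have "... <= (LBINT y. e * ((m y * y) * indicator {0..d} y))"
 proof (rule integral_mono)
  show "integrable lborel (\<lambda>y. \<bar>LBINT s. f s y\<bar>)"
   using lborel_pair.integrable_snd[OF fint] by simp
  show "integrable lborel (\<lambda>y. e * ((m y * y) * indicator {0..d} y))" using myi(2) by simp
  show "\<bar>LBINT s. f s y\<bar> <= e * ((m y * y) * indicator {0..d} y)" for y
  proof (cases "y \<in> {0..d}")
   case True
   then have "\<bar>LBINT s. f s y\<bar> = m y * \<bar>LBINT s. u s * indicator {0..y} s\<bar>"
    using m0 by (simp add: fy abs_mult)
   also have "... <= m y * (e * y)" using True m0 prim by (intro mult_left_mono) auto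
   finally show ?thesis using True by (simp add: mult_ac)
  qed (simp add: fy)
 qed
 also have "... = e * (arctan (d / q) - d * k d)" using myi(1) by simp
 finally have b1: "\<bar>LBINT y. LBINT s. f s y\<bar> <= e * (arctan (d / q) - d * k d)" .
 have "\<bar>k d * (LBINT s. u s * indicator {0..d} s)\<bar> <= k d * (e * d)"
  using prim[of d] d k0 by (simp add: abs_mult mult_left_mono)
 with b1 have "\<bar>LBINT s. u s * k s\<bar> <= e * arctan (d / q)"
  unfolding eq
  using abs_triangle_ineq[of "k d * (LBINT s. u s * indicator {0..d} s)" "LBINT y. LBINT s. f s y"]
  by (simp add: algebra_simps)
 also have "... <= e * (pi / 2)" using e arctan_ubound[of "d / q"] by (intro mult_left_mono) auto
 finally show ?thesis by (simp add: k_def)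
qed

lemma AE_lborel_uminus:
 fixes P :: "real => bool"
 assumes "AE x in lborel. P x"
 shows "AE x in lborel. P (- x)"
proof -
 obtain N where N: "{x. \<not> P x} \<subseteq> N" "emeasure lborel N = 0" "N \<in> sets borel"
  using assms by (auto elim!: AE_E)
 have "emeasure lborel (uminus -` N) = emeasure (distr lborel borel uminus) N"
  using N by (subst emeasure_distr) auto
 also have "... = 0" using N by (simp add: lborel_distr_uminus)
 finally have "emeasure lborel (uminus -` N) = 0" .
 moreover have "uminus -` N \<in> sets lborel"
  using measurable_sets[of "uminus :: real => real" borel borel N] N by simp
 ultimately show ?thesis
  by (intro AE_I[of _ _ "uminus -` N"]) (use N in auto)
qed

text \<open>Phrased as an error bound on primitives, proportional to the length of the interval,
  because this is the hypothesis of \<open>poisson_one_sided\<close>.\<close>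

lemma Lebesgue_differentiation_right:
 fixes f :: "real => real"
 assumes f: "!!a b. integrable lborel (\<lambda>t. f t * indicator {a..b} t)"
 shows "AE x in lborel. \<forall>e>0. \<exists>d>0. \<forall>h. 0 < h \<and> h < d \<longrightarrow> \<bar>(LBINT t. f t * indicator {x..x + h} t) - h * f x\<bar> <= e * h"
proof -
 have si: "set_integrable lborel {a..b} f" for a b using f[of a b] by (simp add: set_integrable_def mult.commute)
 have "f integrable_on cbox a b" for a b
  using set_borel_integral_eq_integral(1)[OF si] by simp
 then obtain N where N: "negligible N" and
  D: "!!x e. x \<notin> N ==> 0 < e ==> \<exists>d>0. \<forall>h. 0 < h \<and> h < d \<longrightarrow>
     norm (integral (cbox x (x + h *\<^sub>R One)) f /\<^sub>R h ^ DIM(real) - f x) < e"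
  by (rule integrable_ccontinuous_explicit[of f]) blast
 have "AE x in lborel. x \<notin> N"
  using N unfolding negligible_iff_null_sets by (metis AE_completion_iff AE_not_in)
 then show ?thesis
 proof eventually_elim
  case (elim x)
  show ?case
  proof (intro allI impI)
   fix e :: real assume e: "e > 0"
   obtain d where d: "d > 0" and D': "!!h. 0 < h ==> h < d ==> \<bar>integral {x..x + h} f / h - f x\<bar> < e"
    using D[OF elim e] by (auto simp: divide_inverse_commute)
   show "\<exists>d>0. \<forall>h. 0 < h \<and> h < d \<longrightarrow> \<bar>(LBINT t. f t * indicator {x..x + h} t) - h * f x\<bar> <= e * h"
   proof (intro exI[of _ d] conjI allI impI d)
    fix h assume h: "0 < h \<and> h < d"
    have "(LBINT t. f t * indicator {x..x + h} t) = integral {x..x + h} f"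
     using set_borel_integral_eq_integral(2)[OF si[of x "x + h"]] by (simp add: set_lebesgue_integral_def mult.commute)
    moreover have "\<bar>integral {x..x + h} f - h * f x\<bar> = h * \<bar>integral {x..x + h} f / h - f x\<bar>"
     using h by (simp add: abs_mult_pos' field_simps flip: abs_mult)
    ultimately show "\<bar>(LBINT t. f t * indicator {x..x + h} t) - h * f x\<bar> <= e * h"
     using D'[of h] h by (simp add: mult.commute mult_left_mono less_imp_le)
   qed
  qed
 qed
qed

lemma Lebesgue_differentiation_left:
 fixes f :: "real => real"
 assumes f: "!!a b. integrable lborel (\<lambda>t. f t * indicator {a..b} t)"
 shows "AE x in lborel. \<forall>e>0. \<exists>d>0. \<forall>h. 0 < h \<and> h < d \<longrightarrow> \<bar>(LBINT t. f t * indicator {x - h..x} t) - h * f x\<bar> <= e * h"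
proof -
 have "integrable lborel (\<lambda>t. f (- t) * indicator {a..b} t)" for a b
 proof -
  have "integrable lborel (\<lambda>t. f (0 + (-1) * t) * indicator {-b..-a} (0 + (-1) * t))"
   by (rule lborel_integrable_real_affine[OF f]) simp
  then show ?thesis
   by (rule back_subst[where P="integrable lborel"]) (auto simp: indicator_def fun_eq_iff)
 qed
 from AE_lborel_uminus[OF Lebesgue_differentiation_right[OF this]]
 show ?thesis
 proof eventually_elim
  case (elim x)
  have "(LBINT t. f (- t) * indicator {- x..- x + h} t) = (LBINT t. f t * indicator {x - h..x} t)" for h
   by (subst lborel_integral_real_affine[where c="-1" and t=0])
    (auto intro!: Bochner_Integration.integral_cong simp: indicator_def)
  then show ?case using elim by simp
 qed
qed

text \<open>Compares the weight \<open>1 + t^2\<close> with the reciprocal of a Poisson kernel. The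
  constant degenerates as \<open>q\<close> tends to \<open>0\<close>, so it serves for integrability
  at a fixed height, or at a fixed distance from the singularity.\<close>

lemma one_plus_square_le:
 fixes q t x :: real
 assumes "q > 0"
 shows "1 + t\<^sup>2 <= (2 + (1 + 2 * x\<^sup>2) / q\<^sup>2) * ((t - x)\<^sup>2 + q\<^sup>2)"
proof -
 have "t\<^sup>2 <= 2 * (t - x)\<^sup>2 + 2 * x\<^sup>2"
  using zero_le_power2[of "t - 2 * x"] by (simp add: power2_eq_square algebra_simps)
 then have "1 + t\<^sup>2 <= 2 * (t - x)\<^sup>2 + (1 + 2 * x\<^sup>2) / q\<^sup>2 * q\<^sup>2" using assms by simp
 also have "... <= 2 * ((t - x)\<^sup>2 + q\<^sup>2) + (1 + 2 * x\<^sup>2) / q\<^sup>2 * ((t - x)\<^sup>2 + q\<^sup>2)"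
  by (intro add_mono mult_left_mono) auto
 finally show ?thesis by (simp add: algebra_simps)
qed

text \<open>Fatou's theorem on radial limits, at points where the one-sided derivatives of the
  primitive equal \<open>f x\<close>. After subtracting the constant \<open>f x\<close>, whose
  Poisson integral is exact, the two adjacent intervals are small by
  \<open>poisson_one_sided\<close> and the rest is of order \<open>q\<close>.\<close>

lemma poisson_Fatou:
 fixes f :: "real => real"
 assumes [measurable]: "f \<in> borel_measurable borel" and f: "integrable lborel (\<lambda>t. f t / (1 + t\<^sup>2))"
 shows "AE x in lborel. ((\<lambda>q. LBINT t. f t * (q / ((t - x)\<^sup>2 + q\<^sup>2))) \<longlongrightarrow> pi * f x) (at_right 0)"
proof -
 have loc: "integrable lborel (\<lambda>t. f t * indicator {a..b} t)" for a b
 proof (rule Bochner_Integration.integrable_bound)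
  define c where "c = max \<bar>a\<bar> \<bar>b\<bar>"
  show "integrable lborel (\<lambda>t. (1 + c\<^sup>2) * (f t / (1 + t\<^sup>2)))" using f by (rule integrable_mult_right)
  show "AE t in lborel. norm (f t * indicator {a..b} t) <= norm ((1 + c\<^sup>2) * (f t / (1 + t\<^sup>2)))"
  proof (rule AE_I2)
   fix t
   have "\<bar>f t\<bar> <= (1 + c\<^sup>2) * (\<bar>f t\<bar> / (1 + t\<^sup>2))" if "t \<in> {a..b}"
   proof -
    have "\<bar>t\<bar> <= \<bar>c\<bar>" using that by (auto simp: c_def)
    then have "1 + t\<^sup>2 <= 1 + c\<^sup>2" by (simp add: abs_le_square_iff)
    then have "\<bar>f t\<bar> * (1 + t\<^sup>2) <= \<bar>f t\<bar> * (1 + c\<^sup>2)" by (intro mult_left_mono) auto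
    moreover have "0 < 1 + t\<^sup>2" by (simp add: add_pos_nonneg)
    ultimately show ?thesis by (simp add: field_simps)
   qed
   then show "norm (f t * indicator {a..b} t) <= norm ((1 + c\<^sup>2) * (f t / (1 + t\<^sup>2)))"
    by (simp add: indicator_def abs_mult)
  qed
 qed measurable
 show ?thesis
  using Lebesgue_differentiation_right[OF loc] Lebesgue_differentiation_left[OF loc]
 proof eventually_elim
  case (elim x)
  define g where "g = (\<lambda>t. f t - f x)"
  have [measurable]: "g \<in> borel_measurable borel" unfolding g_def by measurable
  have gw: "integrable lborel (\<lambda>t. g t / (1 + t\<^sup>2))"
   using Bochner_Integration.integrable_diff[OF f integrable_mult_right[OF poisson_kernel_integral(1)[of 1 0], of "f x"]]
   by (simp add: g_def diff_divide_distrib add.commute)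
  have K0: "0 < (t - x)\<^sup>2 + q\<^sup>2" if "q > 0" for t q :: real using that by (simp add: add_nonneg_pos)
  have W0: "0 < 1 + (t::real)\<^sup>2" for t by (simp add: add_pos_nonneg)
  have gK: "integrable lborel (\<lambda>t. g t * (q / ((t - x)\<^sup>2 + q\<^sup>2)))" if q: "q > 0" for q
  proof (rule Bochner_Integration.integrable_bound)
   define C where "C = 2 + (1 + 2 * x\<^sup>2) / q\<^sup>2"
   show "integrable lborel (\<lambda>t. (q * C) * (g t / (1 + t\<^sup>2)))" using gw by (rule integrable_mult_right)
   show "AE t in lborel. norm (g t * (q / ((t - x)\<^sup>2 + q\<^sup>2))) <= norm ((q * C) * (g t / (1 + t\<^sup>2)))"
   proof (rule AE_I2)
    fix t
    have C0: "0 <= C" by (simp add: C_def)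
    have "1 / ((t - x)\<^sup>2 + q\<^sup>2) <= C / (1 + t\<^sup>2)"
     using one_plus_square_le[OF q, of t x] K0[OF q, of t] W0[of t] by (simp add: C_def[symmetric] field_simps)
    then have "(q * \<bar>g t\<bar>) * (1 / ((t - x)\<^sup>2 + q\<^sup>2)) <= (q * \<bar>g t\<bar>) * (C / (1 + t\<^sup>2))"
     using q by (intro mult_left_mono) auto
    then show "norm (g t * (q / ((t - x)\<^sup>2 + q\<^sup>2))) <= norm ((q * C) * (g t / (1 + t\<^sup>2)))"
     using q C0 by (simp add: abs_mult mult_ac)
   qed
  qed measurable
  have dec: "(LBINT t. f t * (q / ((t - x)\<^sup>2 + q\<^sup>2))) - pi * f x = (LBINT t. g t * (q / ((t - x)\<^sup>2 + q\<^sup>2)))" if q: "q > 0" for q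
  proof -
   have "(LBINT t. f t * (q / ((t - x)\<^sup>2 + q\<^sup>2))) = (LBINT t. g t * (q / ((t - x)\<^sup>2 + q\<^sup>2)) + f x * (q / ((t - x)\<^sup>2 + q\<^sup>2)))"
    by (simp add: g_def algebra_simps diff_divide_distrib)
   also have "... = (LBINT t. g t * (q / ((t - x)\<^sup>2 + q\<^sup>2))) + (LBINT t. f x * (q / ((t - x)\<^sup>2 + q\<^sup>2)))"
    by (intro Bochner_Integration.integral_add gK integrable_mult_right poisson_kernel_integral q)
   also have "(LBINT t. f x * (q / ((t - x)\<^sup>2 + q\<^sup>2))) = f x * pi"
    by (subst integral_mult_right_zero) (simp only: poisson_kernel_integral(2)[OF q])
   finally show ?thesis by simp
  qed
  have glim: "\<exists>B. \<forall>q>0. \<bar>LBINT t. g t * (q / ((t - x)\<^sup>2 + q\<^sup>2))\<bar> <= e * pi + q * B" if e: "e > 0" for e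
  proof -
   obtain d1 where d1: "d1 > 0" and D1: "!!h. 0 < h ==> h < d1 ==> \<bar>(LBINT t. f t * indicator {x..x + h} t) - h * f x\<bar> <= e * h"
    using elim(1) e by blast
   obtain d2 where d2: "d2 > 0" and D2: "!!h. 0 < h ==> h < d2 ==> \<bar>(LBINT t. f t * indicator {x - h..x} t) - h * f x\<bar> <= e * h"
    using elim(2) e by blast
   define d where "d = min d1 d2 / 2"
   have d: "0 < d" "d < d1" "d < d2" using d1 d2 by (auto simp: d_def)
   have ind: "integrable lborel (\<lambda>t::real. f x * indicator {a..b} t)" for a b
    by (intro integrable_mult_right integrable_real_indicator) (auto simp: emeasure_lborel_Icc_eq)
   have gloc: "integrable lborel (\<lambda>t. g t * indicator {a..b} t)" for a b
    using Bochner_Integration.integrable_diff[OF loc[of a b] ind[of a b]]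
    by (simp add: g_def left_diff_distrib)
   have gint: "(LBINT t. g t * indicator {a..b} t) = (LBINT t. f t * indicator {a..b} t) - (b - a) * f x" if "a <= b" for a b
    using Bochner_Integration.integral_diff[OF loc[of a b] ind[of a b]] that
    by (simp add: g_def left_diff_distrib mult.commute)
   have g1: "(LBINT t. g t * indicator {x} t) = 0"
    by (rule integral_eq_zero_AE, use AE_lborel_singleton[of x] in eventually_elim) auto
   \<comment> \<open>Bounds the far part: \<open>one_plus_square_le\<close> at height
     \<open>d\<close>, with a further factor \<open>2\<close> because
     \<open>d^2 <= (t - x)^2\<close> there.\<close>
   define B where "B = 2 * (2 + (1 + 2 * x\<^sup>2) / d\<^sup>2) * (LBINT t. \<bar>g t / (1 + t\<^sup>2)\<bar>)"
   have "\<bar>LBINT t. g t * (q / ((t - x)\<^sup>2 + q\<^sup>2))\<bar> <= e * pi + q * B" if q: "q > 0" for q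
   proof -
    let ?K = "\<lambda>t. q / ((t - x)\<^sup>2 + q\<^sup>2)"
    let ?R = "\<lambda>t. g t * ?K t * indicator {x..x + d} t" and ?L = "\<lambda>t. g t * ?K t * indicator {x - d..x} t"
     and ?F = "\<lambda>t. g t * ?K t * indicator {t. \<bar>t - x\<bar> > d} t"
    have S: "{t. \<bar>t - x\<bar> > d} \<in> sets borel" by measurable
    have ints: "integrable lborel ?R" "integrable lborel ?L" "integrable lborel ?F"
     by (intro integrable_real_mult_indicator gK q; use S in simp)+
    \<comment> \<open>The closed intervals on both sides share the point \<open>x\<close>, but
      \<open>g\<close> vanishes there.\<close>
    have "(LBINT t. g t * ?K t) = (LBINT t. ?R t + ?L t + ?F t)"
     using d by (intro Bochner_Integration.integral_cong) (auto simp: indicator_def g_def)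
    also have "... = (LBINT t. ?R t) + (LBINT t. ?L t) + (LBINT t. ?F t)"
     using ints by simp
    finally have split: "(LBINT t. g t * ?K t) = (LBINT t. ?R t) + (LBINT t. ?L t) + (LBINT t. ?F t)" .
    have R: "\<bar>LBINT t. ?R t\<bar> <= e * (pi / 2)"
    proof -
     have "(LBINT t. ?R t) = (LBINT s. (g (x + s) * indicator {0..d} s) * (q / (s\<^sup>2 + q\<^sup>2)))"
      by (subst lborel_integral_real_affine[where c=1 and t=x])
       (auto intro!: Bochner_Integration.integral_cong simp: indicator_def)
     moreover have "\<bar>...\<bar> <= e * (pi / 2)"
     proof (rule poisson_one_sided[OF _ _ d(1) q])
      have "integrable lborel (\<lambda>s. g (x + 1 * s) * indicator {x..x + d} (x + 1 * s))"
       by (rule lborel_integrable_real_affine[OF gloc]) simp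
      then show "integrable lborel (\<lambda>s. g (x + s) * indicator {0..d} s)"
       by (rule back_subst[where P="integrable lborel"]) (auto simp: indicator_def fun_eq_iff)
      fix y assume y: "0 <= y" "y <= d"
      have "(LBINT s. g (x + s) * indicator {0..d} s * indicator {0..y} s) = (LBINT t. g t * indicator {x..x + y} t)"
       by (subst (2) lborel_integral_real_affine[where c=1 and t=x])
        (use y in \<open>auto intro!: Bochner_Integration.integral_cong simp: indicator_def\<close>)
      also have "\<bar>...\<bar> <= e * y"
       using gint[of x "x + y"] D1[of y] y d g1 by (cases "y = 0") auto
      finally show "\<bar>LBINT s. g (x + s) * indicator {0..d} s * indicator {0..y} s\<bar> <= e * y" .
     qed (use e in auto)
     ultimately show ?thesis by simp
    qed
    have L: "\<bar>LBINT t. ?L t\<bar> <= e * (pi / 2)"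
    proof -
     have "(LBINT t. ?L t) = (LBINT s. (g (x - s) * indicator {0..d} s) * (q / (s\<^sup>2 + q\<^sup>2)))"
      by (subst lborel_integral_real_affine[where c="-1" and t=x])
       (auto intro!: Bochner_Integration.integral_cong simp: indicator_def)
     moreover have "\<bar>...\<bar> <= e * (pi / 2)"
     proof (rule poisson_one_sided[OF _ _ d(1) q])
      have "integrable lborel (\<lambda>s. g (x + (-1) * s) * indicator {x - d..x} (x + (-1) * s))"
       by (rule lborel_integrable_real_affine[OF gloc]) simp
      then show "integrable lborel (\<lambda>s. g (x - s) * indicator {0..d} s)"
       by (rule back_subst[where P="integrable lborel"]) (auto simp: indicator_def fun_eq_iff)
      fix y assume y: "0 <= y" "y <= d"
      have "(LBINT s. g (x - s) * indicator {0..d} s * indicator {0..y} s) = (LBINT t. g t * indicator {x - y..x} t)"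
       by (subst (2) lborel_integral_real_affine[where c="-1" and t=x])
        (use y in \<open>auto intro!: Bochner_Integration.integral_cong simp: indicator_def\<close>)
      also have "\<bar>...\<bar> <= e * y"
       using gint[of "x - y" x] D2[of y] y d g1 by (cases "y = 0") auto
      finally show "\<bar>LBINT s. g (x - s) * indicator {0..d} s * indicator {0..y} s\<bar> <= e * y" .
     qed (use e in auto)
     ultimately show ?thesis by simp
    qed
    have F: "\<bar>LBINT t. ?F t\<bar> <= q * B"
    proof -
     let ?C = "2 * (2 + (1 + 2 * x\<^sup>2) / d\<^sup>2)"
     have "\<bar>LBINT t. ?F t\<bar> <= (LBINT t. \<bar>?F t\<bar>)" by (rule integral_abs_bound)
     also have "... <= (LBINT t. (q * ?C) * \<bar>g t / (1 + t\<^sup>2)\<bar>)"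
     proof (rule integral_mono)
      show "integrable lborel (\<lambda>t. \<bar>?F t\<bar>)" by (rule integrable_abs[OF ints(3)])
      show "integrable lborel (\<lambda>t. (q * ?C) * \<bar>g t / (1 + t\<^sup>2)\<bar>)" by (intro integrable_mult_right integrable_abs gw)
      show "\<bar>?F t\<bar> <= (q * ?C) * \<bar>g t / (1 + t\<^sup>2)\<bar>" for t
      proof (cases "\<bar>t - x\<bar> > d")
       case True
       then have dd: "d\<^sup>2 <= (t - x)\<^sup>2" using d by (simp add: abs_le_square_iff[symmetric])
       have pos: "0 < (t - x)\<^sup>2" using dd d(1) by (smt (verit) zero_less_power)
       have "1 + t\<^sup>2 <= (2 + (1 + 2 * x\<^sup>2) / d\<^sup>2) * ((t - x)\<^sup>2 + d\<^sup>2)" by (rule one_plus_square_le[OF d(1)])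
       also have "... <= (2 + (1 + 2 * x\<^sup>2) / d\<^sup>2) * (2 * (t - x)\<^sup>2)" using dd by (intro mult_left_mono) auto
       finally have 1: "1 + t\<^sup>2 <= ?C * (t - x)\<^sup>2" by (simp add: algebra_simps)
       have aux: "1 / A <= C / Z" if "Z <= C * A" "0 < A" "0 < Z" for A C Z :: real
        using that by (simp add: field_simps)
       have "1 / ((t - x)\<^sup>2 + q\<^sup>2) <= 1 / (t - x)\<^sup>2" using pos by (intro divide_left_mono mult_pos_pos) (auto simp: add_pos_nonneg)
       also have "... <= ?C / (1 + t\<^sup>2)" by (rule aux[OF 1 pos W0])
       finally have "(q * \<bar>g t\<bar>) * (1 / ((t - x)\<^sup>2 + q\<^sup>2)) <= (q * \<bar>g t\<bar>) * (?C / (1 + t\<^sup>2))"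
        using q by (intro mult_left_mono) auto
       moreover have "\<bar>?F t\<bar> = (q * \<bar>g t\<bar>) * (1 / ((t - x)\<^sup>2 + q\<^sup>2))" using True q K0[OF q, of t] by (simp add: abs_mult)
       moreover have "(q * ?C) * \<bar>g t / (1 + t\<^sup>2)\<bar> = (q * \<bar>g t\<bar>) * (?C / (1 + t\<^sup>2))" using W0[of t] by (simp add: mult_ac)
       ultimately show ?thesis by linarith
      qed (use q in simp)
     qed
     also have "... = q * B" unfolding integral_mult_right_zero B_def by (simp add: mult_ac)
     finally show ?thesis .
    qed
    have tri: "\<bar>a + b + c\<bar> <= u + u + v" if "\<bar>a\<bar> <= u" "\<bar>b\<bar> <= u" "\<bar>c\<bar> <= v" for a b c u v :: real
     using that by linarith
    show ?thesis unfolding split using tri[OF R L F] by (simp add: mult.commute)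
   qed
   then show ?thesis by blast
  qed
  show ?case
  proof (rule tendstoI)
   fix e :: real assume e: "e > 0"
   obtain B where B: "!!q. q > 0 ==> \<bar>LBINT t. g t * (q / ((t - x)\<^sup>2 + q\<^sup>2))\<bar> <= (e / (4 * pi)) * pi + q * B"
    using glim[of "e / (4 * pi)"] e by auto
   have "((\<lambda>q. (e / (4 * pi)) * pi + q * B) \<longlongrightarrow> (e / (4 * pi)) * pi + 0 * B) (at_right 0)"
    by (intro tendsto_intros)
   then have "\<forall>\<^sub>F q in at_right 0. (e / (4 * pi)) * pi + q * B < e"
    by (rule order_tendstoD) (use e in simp)
   then show "\<forall>\<^sub>F q in at_right 0. dist (LBINT t. f t * (q / ((t - x)\<^sup>2 + q\<^sup>2))) (pi * f x) < e"
    using eventually_at_right_less[of "0::real"]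
   proof eventually_elim
    case (elim q)
    then show ?case using dec[of q] B[of q] by (simp add: dist_real_def)
   qed
  qed
 qed
qed

lemma norm_lebesgue_integral_le:
 fixes f :: "'a => 'b::{banach, second_countable_topology}"
 assumes "integrable M f" "integrable M g" "!!x. norm (f x) <= g x"
 shows "norm (\<integral>x. f x \<partial>M) <= (\<integral>x. g x \<partial>M)"
 using integral_norm_bound[of M f] integral_mono[OF integrable_norm[OF assms(1)] assms(2,3)] by (rule order_trans)

lemma filterlim_at_right_zeroI:
 fixes X :: "nat => real"
 assumes "!!n. X n > 0" "X \<longlonglongrightarrow> 0"
 shows "filterlim X (at_right 0) sequentially"
 unfolding filterlim_at using assms by (auto simp: order_less_imp_not_eq2 intro!: always_eventually)

lemma L2_Fatou:
 fixes f :: "nat => 'a => complex"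
 assumes [measurable]: "!!n. f n \<in> borel_measurable M" "g \<in> borel_measurable M"
  and f: "!!n. integrable M (\<lambda>x. (cmod (f n x))\<^sup>2)"
  and lim: "AE x in M. (\<lambda>n. f n x) \<longlonglongrightarrow> g x"
  and a: "(\<lambda>n. \<integral>x. (cmod (f n x))\<^sup>2 \<partial>M) \<longlonglongrightarrow> a"
 shows "integrable M (\<lambda>x. (cmod (g x))\<^sup>2)" "(\<integral>x. (cmod (g x))\<^sup>2 \<partial>M) <= a"
proof -
 have a0: "0 <= a" by (rule LIMSEQ_le_const[OF a]) auto
 have "(\<integral>\<^sup>+x. ennreal ((cmod (g x))\<^sup>2) \<partial>M) = (\<integral>\<^sup>+x. liminf (\<lambda>n. ennreal ((cmod (f n x))\<^sup>2)) \<partial>M)"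
 proof (rule nn_integral_cong_AE, use lim in eventually_elim)
  case (elim x)
  show ?case
   by (rule lim_imp_Liminf[symmetric], simp, intro tendsto_ennrealI tendsto_intros elim)
 qed
 also have "... <= liminf (\<lambda>n. \<integral>\<^sup>+x. ennreal ((cmod (f n x))\<^sup>2) \<partial>M)"
  by (rule nn_integral_liminf) measurable
 also have "(\<lambda>n. \<integral>\<^sup>+x. ennreal ((cmod (f n x))\<^sup>2) \<partial>M) = (\<lambda>n. ennreal (\<integral>x. (cmod (f n x))\<^sup>2 \<partial>M))"
  using f by (simp add: nn_integral_eq_integral)
 also have "liminf ... = ennreal a"
  by (rule lim_imp_Liminf) (auto intro!: tendsto_ennrealI a)
 finally have le: "(\<integral>\<^sup>+x. ennreal ((cmod (g x))\<^sup>2) \<partial>M) <= ennreal a" .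
 show int: "integrable M (\<lambda>x. (cmod (g x))\<^sup>2)"
  by (rule integrableI_bounded) (use le in \<open>auto simp: top.extremum_strict less_top intro: le_less_trans\<close>)
 show "(\<integral>x. (cmod (g x))\<^sup>2 \<partial>M) <= a"
  using le a0 by (simp add: nn_integral_eq_integral[OF int])
qed

lemma cauchy_transform_tendsto:
 assumes h: "integrable lborel h" and z: "Im z \<noteq> 0" and lim: "X \<longlonglongrightarrow> z" and im: "!!n. \<bar>Im (X n)\<bar> \<ge> c" "c > 0"
 shows "(\<lambda>n. cauchy_transform h (X n)) \<longlonglongrightarrow> cauchy_transform h z"
 unfolding cauchy_transform_def
proof (rule integral_dominated_convergence[where w="\<lambda>t. norm (h t) * (1 / c)"])
 have [measurable]: "h \<in> borel_measurable borel" using h by auto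
 show "(\<lambda>t. h t / (of_real t - z)) \<in> borel_measurable lborel" "(\<lambda>t. h t / (of_real t - X n)) \<in> borel_measurable lborel" for n
  by measurable
 show "integrable lborel (\<lambda>t. norm (h t) * (1 / c))" using h by simp
 show "AE t in lborel. (\<lambda>n. h t / (of_real t - X n)) \<longlonglongrightarrow> h t / (of_real t - z)"
  using of_real_minus_nonreal[OF z] by (intro AE_I2 tendsto_intros lim) auto
 show "AE t in lborel. norm (h t / (of_real t - X n)) <= norm (h t) * (1 / c)" for n
 proof (rule AE_I2)
  fix t
  have "cmod (1 / (of_real t - X n)) <= 1 / \<bar>Im (X n)\<bar>" by (rule norm_inverse_nonreal) (use im(1)[of n] im(2) in auto)
  also have "... <= 1 / c" using im(1)[of n] im(2) by (intro divide_left_mono mult_pos_pos) auto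
  finally show "norm (h t / (of_real t - X n)) <= norm (h t) * (1 / c)"
   using mult_left_mono[of "cmod (1 / (of_real t - X n))" "1 / c" "norm (h t)"] by (simp add: norm_divide)
 qed
qed

lemma Im_cauchy_transform_real:
 fixes h :: "real => real"
 assumes h: "integrable lborel h" and y: "y > 0"
 shows "Im (cauchy_transform (\<lambda>t. of_real (h t)) (Complex x y)) = (LBINT t. h t * (y / ((t - x)\<^sup>2 + y\<^sup>2)))"
proof -
 have "integrable lborel (\<lambda>t. of_real (h t) / (of_real t - Complex x y))"
  using h y by (intro integrable_cauchy_integrand) auto
 then have "Im (cauchy_transform (\<lambda>t. of_real (h t)) (Complex x y)) = (LBINT t. Im (of_real (h t) / (of_real t - Complex x y)))"
  unfolding cauchy_transform_def by (simp add: integral_Im)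
 also have "... = (LBINT t. h t * (y / ((t - x)\<^sup>2 + y\<^sup>2)))"
  by (intro Bochner_Integration.integral_cong) (auto simp: Im_divide)
 finally show ?thesis .
qed

text \<open>For real \<open>h\<close> the imaginary part of the transform is a Poisson integral and
  has limits by \<open>poisson_Fatou\<close>; the real part is a conjugate function and is not
  reached that way. The \<open>L2\<close> identity shows that the slices are Cauchy as the height
  tends to \<open>0\<close>. Their limit \<open>G\<close> represents the transform as a Poisson
  integral, and \<open>poisson_Fatou\<close> applied to \<open>G\<close> turns mean convergence into
  pointwise limits.\<close>

lemma cauchy_transform_boundary_real:
 fixes h :: "real => real"
 assumes hm: "h \<in> borel_measurable borel" and bd: "!!t. \<bar>h t\<bar> <= M" and supp: "!!t. \<bar>t\<bar> > L ==> h t = 0" and L: "L \<ge> 0"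
 defines "H \<equiv> cauchy_transform (\<lambda>t. of_real (h t))"
 shows "\<exists>G. G \<in> borel_measurable borel \<and> integrable lborel (\<lambda>x. (cmod (G x))\<^sup>2) \<and>
  (LBINT x. (cmod (G x))\<^sup>2) <= 2 * pi\<^sup>2 * (LBINT x. (h x)\<^sup>2) \<and>
  (AE x in lborel. ((\<lambda>y. H (Complex x y)) \<longlongrightarrow> G x) (at_right 0) \<and> Im (G x) = pi * h x)"
proof -
 note hm[measurable]
 have M0: "0 <= M" using bd[of 0] by linarith
 have h: "integrable lborel h"
 proof (rule Bochner_Integration.integrable_bound)
  show "integrable lborel (\<lambda>t. M * indicator {-L..L} t)"
   by (intro integrable_mult_right integrable_real_indicator) (auto simp: emeasure_lborel_Icc_eq)
  show "AE t in lborel. norm (h t) <= norm (M * indicator {-L..L} t)"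
   using bd supp M0 by (intro AE_I2) (auto simp: indicator_def)
 qed measurable
 have hc: "integrable lborel (\<lambda>t. complex_of_real (h t))" using h by simp
 have h2: "integrable lborel (\<lambda>t. (h t)\<^sup>2)"
 proof (rule Bochner_Integration.integrable_bound)
  show "integrable lborel (\<lambda>t. M * h t)" using h by simp
  show "AE t in lborel. norm ((h t)\<^sup>2) <= norm (M * h t)"
  proof (rule AE_I2)
   fix t
   have "(h t)\<^sup>2 = \<bar>h t\<bar> * \<bar>h t\<bar>" by (simp add: power2_eq_square)
   also have "... <= M * \<bar>h t\<bar>" by (rule mult_right_mono[OF bd]) simp
   finally show "norm ((h t)\<^sup>2) <= norm (M * h t)" using M0 by (simp add: abs_mult)
  qed
 qed measurable
 have Hm[measurable]: "H \<in> borel_measurable borel" unfolding H_def by measurable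
 have sq: "integrable lborel (\<lambda>x. (cmod (H (Complex x y)))\<^sup>2)" if "y \<noteq> 0" for y
  unfolding H_def by (rule cauchy_transform_square_integrable[OF hc _ L that]) (use supp in auto)
 have W0: "0 < 1 + (t::real)\<^sup>2" for t by (simp add: add_pos_nonneg)
 have Wint: "integrable lborel (\<lambda>t::real. 1 / (1 + t\<^sup>2))" "(LBINT t. 1 / (1 + t\<^sup>2)) = pi"
  using poisson_kernel_integral[of 1 0] by (simp_all add: add.commute)
 \<comment> \<open>By the \<open>L2\<close> identity this one function of the height determines all
   real parts of scalar products of slices. Only its convergence as the height tends to
   \<open>0\<close> is needed below.\<close>
 define PI where "PI = (\<lambda>y. LBINT s. h s * Im (H (Complex s y)))"
 have ImH: "Im (H (Complex x y)) = (LBINT t. h t * (y / ((t - x)\<^sup>2 + y\<^sup>2)))" if "y > 0" for x y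
  unfolding H_def by (rule Im_cauchy_transform_real[OF h that])
 have ImHb: "\<bar>Im (H (Complex x y))\<bar> <= M * pi" if y: "y > 0" for x y
 proof -
  have k0: "0 <= y / ((t - x)\<^sup>2 + y\<^sup>2)" for t using y by simp
  have "norm (LBINT t. h t * (y / ((t - x)\<^sup>2 + y\<^sup>2))) <= (LBINT t. M * (y / ((t - x)\<^sup>2 + y\<^sup>2)))"
  proof (rule norm_lebesgue_integral_le)
   show ib: "integrable lborel (\<lambda>t. M * (y / ((t - x)\<^sup>2 + y\<^sup>2)))"
    by (intro integrable_mult_right poisson_kernel_integral y)
   show le: "norm (h t * (y / ((t - x)\<^sup>2 + y\<^sup>2))) <= M * (y / ((t - x)\<^sup>2 + y\<^sup>2))" for t
    unfolding real_norm_def abs_mult abs_of_nonneg[OF k0] by (intro mult_right_mono bd k0)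
   show "integrable lborel (\<lambda>t. h t * (y / ((t - x)\<^sup>2 + y\<^sup>2)))"
   proof (rule Bochner_Integration.integrable_bound[OF ib])
    show "AE t in lborel. norm (h t * (y / ((t - x)\<^sup>2 + y\<^sup>2))) <= norm (M * (y / ((t - x)\<^sup>2 + y\<^sup>2)))"
     unfolding real_norm_def[of "M * _"] by (intro AE_I2 order_trans[OF le abs_ge_self])
   qed measurable
  qed
  also have "... = M * pi" by (subst integral_mult_right_zero) (simp only: poisson_kernel_integral(2)[OF y])
  finally show ?thesis by (simp add: ImH[OF y])
 qed
 have hw: "integrable lborel (\<lambda>t. h t / (1 + t\<^sup>2))"
 proof (rule Bochner_Integration.integrable_bound[OF h])
  show "AE t in lborel. norm (h t / (1 + t\<^sup>2)) <= norm (h t)"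
  proof (rule AE_I2)
   fix t
   have "\<bar>h t\<bar> / (1 + t\<^sup>2) <= \<bar>h t\<bar> / 1" using W0[of t] by (intro divide_left_mono) auto
   then show "norm (h t / (1 + t\<^sup>2)) <= norm (h t)" using W0[of t] by simp
  qed
 qed measurable
 have ImHlim: "AE x in lborel. ((\<lambda>y. Im (H (Complex x y))) \<longlongrightarrow> pi * h x) (at_right 0)"
  using poisson_Fatou[OF hm hw]
 proof eventually_elim
  case (elim x)
  show ?case
   by (rule Lim_transform_eventually[OF elim]) (auto simp: eventually_at_right_less ImH intro: eventually_mono[OF eventually_at_right_less])
 qed
 have PIlim: "(PI \<longlongrightarrow> pi * (LBINT x. (h x)\<^sup>2)) (at_right 0)"
  unfolding tendsto_at_iff_sequentially
 proof (intro allI impI)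
  fix X :: "nat => real" assume X: "\<forall>i. X i \<in> {0<..} - {0}" "X \<longlonglongrightarrow> 0"
  then have Xp: "X i > 0" for i by auto
  have fX: "filterlim X (at_right 0) sequentially"
   using X Xp by (intro filterlim_at_right_zeroI)
  have "(\<lambda>n. LBINT s. h s * Im (H (Complex s (X n)))) \<longlonglongrightarrow> (LBINT s. h s * (pi * h s))"
  proof (rule integral_dominated_convergence[where w="\<lambda>s. \<bar>h s\<bar> * (M * pi)"])
   show "integrable lborel (\<lambda>s. \<bar>h s\<bar> * (M * pi))" using h by simp
   show "AE s in lborel. (\<lambda>n. h s * Im (H (Complex s (X n)))) \<longlonglongrightarrow> h s * (pi * h s)"
    using ImHlim by eventually_elim (intro tendsto_intros filterlim_compose[OF _ fX])
   show "AE s in lborel. norm (h s * Im (H (Complex s (X n)))) <= \<bar>h s\<bar> * (M * pi)" for n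
    using ImHb[OF Xp] by (intro AE_I2) (simp add: abs_mult mult_left_mono)
  qed measurable
  also have "(LBINT s. h s * (pi * h s)) = pi * (LBINT x. (h x)\<^sup>2)"
   by (simp add: power2_eq_square mult_ac)
  finally show "((PI \<circ> X) \<longlonglongrightarrow> pi * (LBINT x. (h x)\<^sup>2))" by (simp add: PI_def o_def)
 qed
 note L2 = cauchy_transform_L2_identity[OF h supp L, folded H_def, simplified]
 have L2': "Re (LBINT x. H (Complex x y) * cnj (H (Complex x y'))) = 2 * pi * PI (y + y')"
  "integrable lborel (\<lambda>x. H (Complex x y) * cnj (H (Complex x y')))" if "y > 0" "y' > 0" for y y'
  using L2(1)[of y y'] L2(2)[of y y'] that by (simp_all add: PI_def)
 have sqPI: "(LBINT x. (cmod (H (Complex x y)))\<^sup>2) = 2 * pi * PI (2 * y)" if "y > 0" for y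
 proof -
  have "(LBINT x. (cmod (H (Complex x y)))\<^sup>2) = (LBINT x. Re (H (Complex x y) * cnj (H (Complex x y))))"
   by (simp flip: complex_norm_square)
  also have "... = Re (LBINT x. H (Complex x y) * cnj (H (Complex x y)))"
   by (rule integral_Re[OF L2'(2)[OF that that]])
  finally show ?thesis using L2'(1)[OF that that] by simp
 qed
 \<comment> \<open>By polarization the squared distance of two slices is a second difference of
   \<open>PI\<close>, which becomes small because \<open>PI\<close> has a limit at
   \<open>0\<close>.\<close>
 have diffPI: "(LBINT x. (cmod (H (Complex x y) - H (Complex x y')))\<^sup>2) = 2 * pi * (PI (2 * y) + PI (2 * y') - 2 * PI (y + y'))"
  "integrable lborel (\<lambda>x. (cmod (H (Complex x y) - H (Complex x y')))\<^sup>2)" if y: "y > 0" "y' > 0" for y y'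
 proof -
  have e: "(cmod (A - B))\<^sup>2 = Re (A * cnj A) + Re (B * cnj B) - 2 * Re (A * cnj B)" for A B :: complex
   unfolding cmod_power2 by (simp add: power2_eq_square algebra_simps)
  have i: "integrable lborel (\<lambda>x. Re (H (Complex x u) * cnj (H (Complex x v))))" if "u > 0" "v > 0" for u v
   using L2'(2)[OF that] by (rule integrable_Re)
  have v: "(LBINT x. Re (H (Complex x u) * cnj (H (Complex x v)))) = 2 * pi * PI (u + v)" if "u > 0" "v > 0" for u v
   using L2'(1)[OF that] integral_Re[OF L2'(2)[OF that]] by simp
  show "integrable lborel (\<lambda>x. (cmod (H (Complex x y) - H (Complex x y')))\<^sup>2)"
   unfolding e using i y by (intro Bochner_Integration.integrable_diff Bochner_Integration.integrable_add integrable_mult_right) auto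
  have "(LBINT x. (cmod (H (Complex x y) - H (Complex x y')))\<^sup>2) = 2 * pi * PI (y + y) + 2 * pi * PI (y' + y') - 2 * (2 * pi * PI (y + y'))"
   unfolding e
   by (subst Bochner_Integration.integral_diff, (intro Bochner_Integration.integrable_add i integrable_mult_right y)+,
     subst Bochner_Integration.integral_add, (intro i y)+, subst integral_mult_right_zero) (simp only: v y)
  then show "(LBINT x. (cmod (H (Complex x y) - H (Complex x y')))\<^sup>2) = 2 * pi * (PI (2 * y) + PI (2 * y') - 2 * PI (y + y'))"
   by (simp add: algebra_simps)
 qed
 define y where "y = (\<lambda>n. 1 / real (Suc n))"
 have yp: "y n > 0" for n by (simp add: y_def)
 have y0: "y \<longlonglongrightarrow> 0" unfolding y_def by (rule LIMSEQ_Suc[OF lim_1_over_n])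
 have yr: "filterlim y (at_right 0) sequentially" by (intro filterlim_at_right_zeroI y0 yp)
 have wint: "integrable lborel (\<lambda>x. H (Complex x (y n)) / (1 + x\<^sup>2))" for n
 proof (rule Bochner_Integration.integrable_bound)
  show "integrable lborel (\<lambda>x. (cmod (H (Complex x (y n))))\<^sup>2 + 1 / (1 + x\<^sup>2))"
   by (intro Bochner_Integration.integrable_add sq Wint) (use yp[of n] in simp)
  show "AE x in lborel. norm (H (Complex x (y n)) / (1 + x\<^sup>2)) <= norm ((cmod (H (Complex x (y n))))\<^sup>2 + 1 / (1 + x\<^sup>2))"
  proof (rule AE_I2)
   fix x :: real
   let ?a = "cmod (H (Complex x (y n)))" and ?b = "1 / (1 + x\<^sup>2)"
   have "?b\<^sup>2 <= ?b" using W0[of x] by (simp add: power2_eq_square divide_le_eq)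
   have aux: "p <= A + b" if "p <= (A + B) / 2" "B <= b" "0 <= A" "0 <= b" for p A B b :: real
    using that by simp
   have "?a * ?b <= ?a\<^sup>2 + ?b"
    by (rule aux[OF mult_le_half_squares \<open>?b\<^sup>2 <= ?b\<close>]) (use W0[of x] in simp_all)
   moreover have "cmod (1 + (complex_of_real x)\<^sup>2) = 1 + x\<^sup>2"
    using W0[of x] by (metis abs_of_pos norm_of_real of_real_1 of_real_add of_real_power)
   ultimately show "norm (H (Complex x (y n)) / (1 + x\<^sup>2)) <= norm (?a\<^sup>2 + ?b)"
    using W0[of x] by (simp add: norm_divide)
  qed
 qed measurable
 have cnorm: "cmod (of_real (1 + x\<^sup>2)) = 1 + x\<^sup>2" for x :: real using W0[of x] by (simp only: norm_of_real)
 \<comment> \<open>Dividing by \<open>1 + x^2\<close>, a weight with integral \<open>pi\<close>,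
   turns square-mean convergence into convergence in mean, where \<open>L1_Cauchy_limit\<close>
   applies.\<close>
 have "\<exists>g. integrable lborel g \<and> (\<lambda>n. LBINT x. norm (H (Complex x (y n)) / of_real (1 + x\<^sup>2) - g x)) \<longlonglongrightarrow> 0"
 proof (rule L1_Cauchy_limit)
  show "integrable lborel (\<lambda>x. H (Complex x (y n)) / of_real (1 + x\<^sup>2))" for n using wint[of n] by simp
  fix e :: real assume e: "e > 0"
  \<comment> \<open>\<open>c\<close> is the parameter of the weighted arithmetic-geometric
    inequality: with squared distance below \<open>c * e\<close> the estimate becomes
    \<open>(e + c * pi) / 2 = e\<close>. The \<open>d\<close> below is such that
    \<open>2 * pi * (4 * d)\<close> is half of \<open>c * e\<close>.\<close>
  define c where "c = e / pi"
  have c: "c > 0" using e by (simp add: c_def)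
  define A where "A = pi * (LBINT x. (h x)\<^sup>2)"
  define d where "d = c * e / (16 * pi)"
  have d: "d > 0" using c e by (simp add: d_def)
  have "\<forall>\<^sub>F y in at_right 0. dist (PI y) A < d"
   using PIlim d unfolding A_def by (rule tendstoD)
  then obtain b where b: "b > 0" "!!y. 0 < y ==> y < b ==> \<bar>PI y - A\<bar> < d"
   by (auto simp: eventually_at_right_field dist_real_def)
  have "\<forall>\<^sub>F n in sequentially. y n < b / 2" using order_tendstoD(2)[OF y0, of "b / 2"] b by simp
  then obtain N where N: "!!n. n \<ge> N ==> y n < b / 2" by (auto simp: eventually_sequentially)
  show "\<exists>N. \<forall>m\<ge>N. \<forall>n\<ge>N. (LBINT x. norm (H (Complex x (y m)) / of_real (1 + x\<^sup>2) - H (Complex x (y n)) / of_real (1 + x\<^sup>2))) < e"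
  proof (intro exI[of _ N] allI impI)
   fix m n assume mn: "m \<ge> N" "n \<ge> N"
   let ?D = "\<lambda>x. H (Complex x (y m)) - H (Complex x (y n))"
   have 1: "(LBINT x. (cmod (?D x))\<^sup>2) < c * e"
   proof -
    have "\<bar>PI (2 * y m) - A\<bar> < d" "\<bar>PI (2 * y n) - A\<bar> < d" "\<bar>PI (y m + y n) - A\<bar> < d"
     using N[OF mn(1)] N[OF mn(2)] yp[of m] yp[of n] by (auto intro!: b(2))
    then have "PI (2 * y m) + PI (2 * y n) - 2 * PI (y m + y n) < 4 * d" by linarith
    then have "2 * pi * (PI (2 * y m) + PI (2 * y n) - 2 * PI (y m + y n)) < 2 * pi * (4 * d)"
     by (intro mult_strict_left_mono) auto
    also have "... = c * e / 2" by (simp add: d_def)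
    also have "... < c * e" using c e by simp
    finally show ?thesis by (simp add: diffPI yp)
   qed
   have "(LBINT x. norm (H (Complex x (y m)) / of_real (1 + x\<^sup>2) - H (Complex x (y n)) / of_real (1 + x\<^sup>2)))
     <= (LBINT x. ((1 / c) * (cmod (?D x))\<^sup>2 + c * (1 / (1 + x\<^sup>2))) / 2)"
   proof (rule integral_mono)
    show "integrable lborel (\<lambda>x. norm (H (Complex x (y m)) / of_real (1 + x\<^sup>2) - H (Complex x (y n)) / of_real (1 + x\<^sup>2)))"
     using wint[of m] wint[of n] by simp
    show "integrable lborel (\<lambda>x. ((1 / c) * (cmod (?D x))\<^sup>2 + c * (1 / (1 + x\<^sup>2))) / 2)"
     by (intro integrable_divide_zero Bochner_Integration.integrable_add integrable_mult_right diffPI yp Wint)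
    fix x :: real
    let ?a = "cmod (?D x)" and ?b = "1 / (1 + x\<^sup>2)"
    have "norm (H (Complex x (y m)) / of_real (1 + x\<^sup>2) - H (Complex x (y n)) / of_real (1 + x\<^sup>2)) = ?a * ?b"
     unfolding diff_divide_distrib[symmetric] norm_divide cnorm by simp
    also have "... <= ((1 / c) * ?a\<^sup>2 + c * ?b\<^sup>2) / 2"
    proof -
     have aux: "(1 / c) * (u - c * v)\<^sup>2 = (1 / c) * u\<^sup>2 - 2 * (u * v) + c * v\<^sup>2" for u v :: real
      using c by (simp add: power2_eq_square field_simps)
     have "0 <= (1 / c) * (?a - c * ?b)\<^sup>2" using c by simp
     also have "... = (1 / c) * ?a\<^sup>2 - 2 * (?a * ?b) + c * ?b\<^sup>2" by (rule aux)
     finally show ?thesis by simp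
    qed
    also have "... <= ((1 / c) * ?a\<^sup>2 + c * ?b) / 2"
    proof -
     have "?b\<^sup>2 <= ?b" using W0[of x] by (simp add: power2_eq_square divide_le_eq)
     then have "c * ?b\<^sup>2 <= c * ?b" using c by (intro mult_left_mono) auto
     then show ?thesis by (intro divide_right_mono add_left_mono) auto
    qed
    finally show "norm (H (Complex x (y m)) / of_real (1 + x\<^sup>2) - H (Complex x (y n)) / of_real (1 + x\<^sup>2)) <= ((1 / c) * ?a\<^sup>2 + c * ?b) / 2" .
   qed
   also have "... = ((1 / c) * (LBINT x. (cmod (?D x))\<^sup>2) + c * pi) / 2"
    by (subst integral_divide_zero, subst Bochner_Integration.integral_add, (intro integrable_mult_right diffPI yp Wint)+,
      simp only: integral_mult_right_zero Wint(2))
   also have "... < ((1 / c) * (c * e) + c * pi) / 2"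
    using 1 c by (intro divide_strict_right_mono add_strict_right_mono mult_strict_left_mono) auto
   also have "... = e" using c by (simp add: c_def)
   finally show "(LBINT x. norm (H (Complex x (y m)) / of_real (1 + x\<^sup>2) - H (Complex x (y n)) / of_real (1 + x\<^sup>2))) < e" .
  qed
 qed
 then obtain g where g: "integrable lborel g" and glim: "(\<lambda>n. LBINT x. norm (H (Complex x (y n)) / of_real (1 + x\<^sup>2) - g x)) \<longlonglongrightarrow> 0" by blast
 have gm[measurable]: "g \<in> borel_measurable borel" using g by auto
 define G where "G = (\<lambda>x. of_real (1 + x\<^sup>2) * g x)"
 have Gm[measurable]: "G \<in> borel_measurable borel" unfolding G_def by measurable
 have Gw: "G t / of_real (1 + t\<^sup>2) = g t" for t using W0[of t] by (simp only: G_def) (simp del: of_real_add)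
 \<comment> \<open>\<open>poisson_cauchy_transform\<close> at the heights \<open>y n\<close> passes
   to the limit, since at a fixed height \<open>q\<close> the Poisson kernel is at most a multiple
   of \<open>1 / (1 + s^2)\<close>.\<close>
 have rep: "integrable lborel (\<lambda>s. of_real (q / ((s - x)\<^sup>2 + q\<^sup>2)) * G s)"
  "(LBINT s. of_real (q / ((s - x)\<^sup>2 + q\<^sup>2)) * G s) = pi * H (Complex x q)" if q: "q > 0" for x q
 proof -
  let ?k = "\<lambda>s. q / ((s - x)\<^sup>2 + q\<^sup>2)"
  define C where "C = q * (2 + (1 + 2 * x\<^sup>2) / q\<^sup>2)"
  have kp: "0 <= ?k s" for s using q by simp
  have kC: "?k s * (1 + s\<^sup>2) <= C" for s
  proof -
   have "0 < (s - x)\<^sup>2 + q\<^sup>2" using q by (simp add: add_nonneg_pos)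
   moreover have "q * (1 + s\<^sup>2) <= q * ((2 + (1 + 2 * x\<^sup>2) / q\<^sup>2) * ((s - x)\<^sup>2 + q\<^sup>2))"
    using one_plus_square_le[OF q, of s x] q by (intro mult_left_mono) auto
   ultimately show ?thesis by (simp add: C_def pos_divide_le_eq mult.assoc)
  qed
  have C0: "0 <= C" using q by (simp add: C_def)
  have kle: "norm (of_real (?k s) * (of_real (1 + s\<^sup>2) * u)) <= C * norm u" for s and u :: complex
  proof -
   have "norm (of_real (?k s) * (of_real (1 + s\<^sup>2) * u)) = (?k s * (1 + s\<^sup>2)) * norm u"
    unfolding norm_mult cnorm unfolding norm_of_real abs_of_nonneg[OF kp] by (simp only: mult.assoc)
   also have "... <= C * norm u" by (intro mult_right_mono kC) auto
   finally show ?thesis .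
  qed
  have i: "integrable lborel (\<lambda>s. of_real (?k s) * G s)"
   by (rule Bochner_Integration.integrable_bound[of _ "\<lambda>s. C * norm (g s)"])
    (use g kle C0 in \<open>auto simp: G_def abs_mult simp del: of_real_add of_real_divide norm_mult\<close>)
  have Hs: "H (Complex s (y n)) = of_real (1 + s\<^sup>2) * (H (Complex s (y n)) / of_real (1 + s\<^sup>2))" for s n
   using W0[of s] by (simp del: of_real_add)
  have i2: "integrable lborel (\<lambda>s. of_real (?k s) * H (Complex s (y n)))" for n
  proof (rule Bochner_Integration.integrable_bound[of _ "\<lambda>s. C * norm (H (Complex s (y n)) / of_real (1 + s\<^sup>2))"])
   show "AE s in lborel. norm (of_real (?k s) * H (Complex s (y n))) <= norm (C * norm (H (Complex s (y n)) / of_real (1 + s\<^sup>2)))"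
    using kle C0 by (intro AE_I2, subst Hs) (simp add: abs_mult del: of_real_add of_real_divide norm_mult norm_divide times_divide_eq_right nonzero_mult_div_cancel_left)
  qed (use wint[of n] in auto)
  have "(\<lambda>n. (LBINT s. of_real (?k s) * H (Complex s (y n))) - (LBINT s. of_real (?k s) * G s)) \<longlonglongrightarrow> 0"
  proof (rule Lim_null_comparison)
   show "(\<lambda>n. C * (LBINT x. norm (H (Complex x (y n)) / of_real (1 + x\<^sup>2) - g x))) \<longlonglongrightarrow> 0"
    using tendsto_mult_right_zero[OF glim] .
   show "\<forall>\<^sub>F n in sequentially. norm ((LBINT s. of_real (?k s) * H (Complex s (y n))) - (LBINT s. of_real (?k s) * G s))
     <= C * (LBINT x. norm (H (Complex x (y n)) / of_real (1 + x\<^sup>2) - g x))"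
   proof (rule always_eventually, rule allI)
    fix n
    have "(LBINT s. of_real (?k s) * H (Complex s (y n))) - (LBINT s. of_real (?k s) * G s) =
      (LBINT s. of_real (?k s) * (of_real (1 + s\<^sup>2) * (H (Complex s (y n)) / of_real (1 + s\<^sup>2) - g s)))"
     unfolding Bochner_Integration.integral_diff[OF i2 i, symmetric]
     unfolding right_diff_distrib Hs[symmetric] G_def ..
    also have "norm ... <= (LBINT s. C * norm (H (Complex s (y n)) / of_real (1 + s\<^sup>2) - g s))"
    proof (rule norm_lebesgue_integral_le[OF _ _ kle])
     show "integrable lborel (\<lambda>s. of_real (?k s) * (of_real (1 + s\<^sup>2) * (H (Complex s (y n)) / of_real (1 + s\<^sup>2) - g s)))"
      using Bochner_Integration.integrable_diff[OF i2 i] unfolding right_diff_distrib Hs[symmetric] G_def .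
     show "integrable lborel (\<lambda>s. C * norm (H (Complex s (y n)) / of_real (1 + s\<^sup>2) - g s))"
      using wint[of n] g by simp
    qed
    finally show "norm ((LBINT s. of_real (?k s) * H (Complex s (y n))) - (LBINT s. of_real (?k s) * G s))
     <= C * (LBINT x. norm (H (Complex x (y n)) / of_real (1 + x\<^sup>2) - g x))" by simp
   qed
  qed
  then have 1: "(\<lambda>n. LBINT s. of_real (?k s) * H (Complex s (y n))) \<longlonglongrightarrow> (LBINT s. of_real (?k s) * G s)"
   by (rule LIM_zero_cancel)
  have e: "(LBINT s. of_real (?k s) * H (Complex s (y n))) = pi * H (Complex x (y n + q))" for n
   unfolding H_def by (rule poisson_cauchy_transform[OF hc yp q])
  have l: "(\<lambda>n. pi * H (Complex x (y n + q))) \<longlonglongrightarrow> pi * H (Complex x q)"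
   unfolding H_def
  proof (rule tendsto_mult[OF tendsto_const], rule cauchy_transform_tendsto[OF hc, where c=q])
   show "(\<lambda>n. Complex x (y n + q)) \<longlonglongrightarrow> Complex x q"
    using tendsto_Complex[OF tendsto_const tendsto_add[OF y0 tendsto_const], of x q] by simp
  qed (use q yp less_imp_le in \<open>auto simp: abs_of_pos add_pos_pos\<close>)
  have fin: "(LBINT s. of_real (?k s) * G s) = pi * H (Complex x q)"
   using 1 l unfolding e by (rule LIMSEQ_unique)
  show "integrable lborel (\<lambda>s. of_real (q / ((s - x)\<^sup>2 + q\<^sup>2)) * G s)" by (fact i)
  show "(LBINT s. of_real (q / ((s - x)\<^sup>2 + q\<^sup>2)) * G s) = pi * H (Complex x q)" by (fact fin)
 qed
 have ReG: "integrable lborel (\<lambda>t. Re (G t) / (1 + t\<^sup>2))" and ImG: "integrable lborel (\<lambda>t. Im (G t) / (1 + t\<^sup>2))"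
  using integrable_Re[OF g] integrable_Im[OF g] unfolding Gw[symmetric] by (simp_all del: of_real_add)
 have mRe: "(\<lambda>t. Re (G t)) \<in> borel_measurable borel" and mIm: "(\<lambda>t. Im (G t)) \<in> borel_measurable borel" by measurable
 have lim: "AE x in lborel. ((\<lambda>y. H (Complex x y)) \<longlongrightarrow> G x) (at_right 0)"
  using poisson_Fatou[OF mRe ReG] poisson_Fatou[OF mIm ImG]
 proof eventually_elim
  case (elim x)
  have "((\<lambda>q. Complex ((LBINT t. Re (G t) * (q / ((t - x)\<^sup>2 + q\<^sup>2))) / pi) ((LBINT t. Im (G t) * (q / ((t - x)\<^sup>2 + q\<^sup>2))) / pi)) \<longlongrightarrow>
     Complex (pi * Re (G x) / pi) (pi * Im (G x) / pi)) (at_right 0)"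
   by (intro tendsto_Complex tendsto_divide elim tendsto_const) auto
  then have "((\<lambda>q. Complex ((LBINT t. Re (G t) * (q / ((t - x)\<^sup>2 + q\<^sup>2))) / pi) ((LBINT t. Im (G t) * (q / ((t - x)\<^sup>2 + q\<^sup>2))) / pi)) \<longlongrightarrow> G x) (at_right 0)"
   by simp
  then show ?case
  proof (rule Lim_transform_eventually)
   show "\<forall>\<^sub>F q in at_right 0. Complex ((LBINT t. Re (G t) * (q / ((t - x)\<^sup>2 + q\<^sup>2))) / pi) ((LBINT t. Im (G t) * (q / ((t - x)\<^sup>2 + q\<^sup>2))) / pi) = H (Complex x q)"
    using eventually_at_right_less
   proof eventually_elim
    case (elim q)
    have re: "Re (pi * H (Complex x q)) = (LBINT t. Re (G t) * (q / ((t - x)\<^sup>2 + q\<^sup>2)))"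
     unfolding rep(2)[OF elim, symmetric] integral_Re[OF rep(1)[OF elim], symmetric]
     by (intro Bochner_Integration.integral_cong) (auto simp: mult.commute simp del: of_real_divide of_real_add of_real_power)
    have im: "Im (pi * H (Complex x q)) = (LBINT t. Im (G t) * (q / ((t - x)\<^sup>2 + q\<^sup>2)))"
     unfolding rep(2)[OF elim, symmetric] integral_Im[OF rep(1)[OF elim], symmetric]
     by (intro Bochner_Integration.integral_cong) (auto simp: mult.commute simp del: of_real_divide of_real_add of_real_power)
    show ?case using re im by (simp add: complex_eq_iff divide_eq_eq mult.commute[of _ pi])
   qed
  qed
 qed
 have lim2: "AE x in lborel. (\<lambda>n. H (Complex x (y n))) \<longlonglongrightarrow> G x"
  using lim by eventually_elim (rule filterlim_compose[OF _ yr])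
 have y2: "filterlim (\<lambda>n. 2 * y n) (at_right 0) sequentially"
  using tendsto_mult[OF tendsto_const[of 2] y0] yp by (intro filterlim_at_right_zeroI) auto
 have norms: "(\<lambda>n. LBINT x. (cmod (H (Complex x (y n))))\<^sup>2) \<longlonglongrightarrow> 2 * pi * (pi * (LBINT x. (h x)\<^sup>2))"
  unfolding sqPI[OF yp] by (intro tendsto_intros filterlim_compose[OF PIlim y2])
 have "y n \<noteq> 0" for n using yp[of n] by simp
 note sqy = sq[OF this]
 have "integrable lborel (\<lambda>x. (cmod (G x))\<^sup>2)" "(LBINT x. (cmod (G x))\<^sup>2) <= 2 * pi * (pi * (LBINT x. (h x)\<^sup>2))"
  by (rule L2_Fatou[OF _ _ sqy lim2 norms]; measurable)+
 moreover have "AE x in lborel. ((\<lambda>y. H (Complex x y)) \<longlongrightarrow> G x) (at_right 0) \<and> Im (G x) = pi * h x"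
  using lim ImHlim
 proof eventually_elim
  case (elim x)
  have "Im (G x) = pi * h x"
   by (rule tendsto_unique[OF _ tendsto_Im[OF elim(1)] elim(2)]) simp
  then show ?case using elim by simp
 qed
 ultimately show ?thesis using Gm by (auto simp: power2_eq_square mult.assoc intro!: exI[of _ G])
qed

text \<open>Real and imaginary parts of \<open>h\<close> are treated separately, because the
  reflection \<open>H (cnj z) = cnj (H z)\<close>, which supplies the boundary values from below,
  requires a real density. Recombining them by \<open>|u + i v|^2 <= 2 |u|^2 + 2 |v|^2\<close>
  doubles the constant.\<close>

lemma cauchy_transform_boundary:
 fixes h :: "real => complex"
 assumes hm: "h \<in> borel_measurable borel" and bd: "!!t. cmod (h t) <= M" and supp: "!!t. \<bar>t\<bar> > L ==> h t = 0" and L: "L \<ge> 0"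
 shows "\<exists>Gp Gm. Gp \<in> borel_measurable borel \<and> Gm \<in> borel_measurable borel \<and>
  integrable lborel (\<lambda>x. (cmod (Gp x))\<^sup>2) \<and> integrable lborel (\<lambda>x. (cmod (Gm x))\<^sup>2) \<and>
  (LBINT x. (cmod (Gp x))\<^sup>2) <= 4 * pi\<^sup>2 * (LBINT x. (cmod (h x))\<^sup>2) \<and>
  (LBINT x. (cmod (Gm x))\<^sup>2) <= 4 * pi\<^sup>2 * (LBINT x. (cmod (h x))\<^sup>2) \<and>
  (AE x in lborel. ((\<lambda>y. cauchy_transform h (Complex x y)) \<longlongrightarrow> Gp x) (at_right 0) \<and>
    ((\<lambda>y. cauchy_transform h (Complex x (- y))) \<longlongrightarrow> Gm x) (at_right 0) \<and>
    Gp x - Gm x = 2 * of_real pi * \<i> * h x)"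
proof -
 note hm[measurable]
 let ?c = "\<lambda>f t. complex_of_real (f t)"
 define h1 where "h1 = (\<lambda>t. Re (h t))"
 define h2 where "h2 = (\<lambda>t. Im (h t))"
 have hm12[measurable]: "h1 \<in> borel_measurable borel" "h2 \<in> borel_measurable borel" unfolding h1_def h2_def by measurable
 have bd12: "\<bar>h1 t\<bar> <= M" "\<bar>h2 t\<bar> <= M" for t
  using order_trans[OF abs_Re_le_cmod bd] order_trans[OF abs_Im_le_cmod bd] by (auto simp: h1_def h2_def)
 have supp12: "h1 t = 0" "h2 t = 0" if "\<bar>t\<bar> > L" for t using supp[OF that] by (auto simp: h1_def h2_def)
 obtain G1 where G1: "G1 \<in> borel_measurable borel" "integrable lborel (\<lambda>x. (cmod (G1 x))\<^sup>2)"
  "(LBINT x. (cmod (G1 x))\<^sup>2) <= 2 * pi\<^sup>2 * (LBINT x. (h1 x)\<^sup>2)"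
  "AE x in lborel. ((\<lambda>y. cauchy_transform (?c h1) (Complex x y)) \<longlongrightarrow> G1 x) (at_right 0) \<and> Im (G1 x) = pi * h1 x"
  using cauchy_transform_boundary_real[OF hm12(1) bd12(1) supp12(1) L] by blast
 obtain G2 where G2: "G2 \<in> borel_measurable borel" "integrable lborel (\<lambda>x. (cmod (G2 x))\<^sup>2)"
  "(LBINT x. (cmod (G2 x))\<^sup>2) <= 2 * pi\<^sup>2 * (LBINT x. (h2 x)\<^sup>2)"
  "AE x in lborel. ((\<lambda>y. cauchy_transform (?c h2) (Complex x y)) \<longlongrightarrow> G2 x) (at_right 0) \<and> Im (G2 x) = pi * h2 x"
  using cauchy_transform_boundary_real[OF hm12(2) bd12(2) supp12(2) L] by blast
 note G1(1)[measurable] G2(1)[measurable]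
 have int: "integrable lborel f" if f: "f \<in> borel_measurable borel" "!!t. \<bar>f t\<bar> <= N" "!!t. \<bar>t\<bar> > L ==> f t = 0" for f :: "real => real" and N
 proof (rule Bochner_Integration.integrable_bound)
  show "integrable lborel (\<lambda>t. N * indicator {-L..L} t)"
   by (intro integrable_mult_right integrable_real_indicator) (auto simp: emeasure_lborel_Icc_eq)
  have "0 <= N" using f(2)[of 0] by linarith
  then show "AE t in lborel. norm (f t) <= norm (N * indicator {-L..L} t)"
   using f(2,3) by (intro AE_I2) (auto simp: indicator_def)
 qed (use f in simp)
 have i12: "integrable lborel h1" "integrable lborel h2"
  using int[OF hm12(1) bd12(1) supp12(1)] int[OF hm12(2) bd12(2) supp12(2)] by auto
 have sq: "f t ^ 2 <= M\<^sup>2" if "\<bar>f t\<bar> <= M" for f :: "real => real" and t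
  using that power_mono[of "\<bar>f t\<bar>" M 2] by simp
 have s12: "integrable lborel (\<lambda>x. (h1 x)\<^sup>2)" "integrable lborel (\<lambda>x. (h2 x)\<^sup>2)"
  using int[of "\<lambda>x. (h1 x)\<^sup>2" "M\<^sup>2"] int[of "\<lambda>x. (h2 x)\<^sup>2" "M\<^sup>2"] sq bd12 supp12 by simp_all
 have "(LBINT x. (cmod (h x))\<^sup>2) = (LBINT x. (h1 x)\<^sup>2 + (h2 x)\<^sup>2)" by (simp add: h1_def h2_def cmod_power2)
 then have hsum: "(LBINT x. (cmod (h x))\<^sup>2) = (LBINT x. (h1 x)\<^sup>2) + (LBINT x. (h2 x)\<^sup>2)"
  using s12 by simp
 have split: "cauchy_transform h z = cauchy_transform (?c h1) z + \<i> * cauchy_transform (?c h2) z" if "Im z \<noteq> 0" for z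
 proof -
  have "h = (\<lambda>t. ?c h1 t + \<i> * ?c h2 t)" by (simp add: h1_def h2_def fun_eq_iff complex_eq[symmetric])
  then have "cauchy_transform h z = cauchy_transform (\<lambda>t. ?c h1 t + \<i> * ?c h2 t) z" by simp
  also have "... = cauchy_transform (?c h1) z + cauchy_transform (\<lambda>t. \<i> * ?c h2 t) z"
   using i12 that by (intro cauchy_transform_add) auto
  finally show ?thesis by (simp add: cauchy_transform_cmult)
 qed
 have conj: "cauchy_transform (?c f) (Complex x (- y)) = cnj (cauchy_transform (?c f) (Complex x y))" for f x y
  using cauchy_transform_cnj[of "?c f" "Complex x y"] by (simp add: complex_cnj)
 have le2: "(cmod (u + \<i> * v))\<^sup>2 <= 2 * (cmod u)\<^sup>2 + 2 * (cmod v)\<^sup>2" for u v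
 proof -
  have "(cmod (u + \<i> * v))\<^sup>2 <= (cmod u + cmod v)\<^sup>2"
   using norm_triangle_ineq[of u "\<i> * v"] by (intro power_mono) (auto simp: norm_mult)
  also have "... <= 2 * (cmod u)\<^sup>2 + 2 * (cmod v)\<^sup>2"
   using mult_le_half_squares[of "cmod u" "cmod v"] by (simp add: power2_sum)
  finally show ?thesis .
 qed
 have dom: "integrable lborel (\<lambda>x. 2 * (cmod (G1 x))\<^sup>2 + 2 * (cmod (G2 x))\<^sup>2)"
  using G1(2) G2(2) by simp
 have domv: "(LBINT x. 2 * (cmod (G1 x))\<^sup>2 + 2 * (cmod (G2 x))\<^sup>2) <= 4 * pi\<^sup>2 * (LBINT x. (cmod (h x))\<^sup>2)"
  using G1(2,3) G2(2,3) unfolding hsum by (simp add: algebra_simps)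
 have main: "integrable lborel (\<lambda>x. (cmod (u x + \<i> * v x))\<^sup>2)" "(LBINT x. (cmod (u x + \<i> * v x))\<^sup>2) <= 4 * pi\<^sup>2 * (LBINT x. (cmod (h x))\<^sup>2)"
  if [measurable]: "u \<in> borel_measurable borel" "v \<in> borel_measurable borel" and n: "!!x. cmod (u x) = cmod (G1 x)" "!!x. cmod (v x) = cmod (G2 x)" for u v
 proof -
  show i: "integrable lborel (\<lambda>x. (cmod (u x + \<i> * v x))\<^sup>2)"
   by (rule Bochner_Integration.integrable_bound[OF dom])
    (use le2[of "u _" "v _"] n in \<open>auto intro!: AE_I2\<close>)
  have "(LBINT x. (cmod (u x + \<i> * v x))\<^sup>2) <= (LBINT x. 2 * (cmod (G1 x))\<^sup>2 + 2 * (cmod (G2 x))\<^sup>2)"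
   using le2[of "u _" "v _"] n by (intro integral_mono i dom) simp
  then show "(LBINT x. (cmod (u x + \<i> * v x))\<^sup>2) <= 4 * pi\<^sup>2 * (LBINT x. (cmod (h x))\<^sup>2)" using domv by linarith
 qed
 define Gp where "Gp = (\<lambda>x. G1 x + \<i> * G2 x)"
 define Gm where "Gm = (\<lambda>x. cnj (G1 x) + \<i> * cnj (G2 x))"
 have cn: "(\<lambda>x. cnj (g x)) \<in> borel_measurable borel" if "g \<in> borel_measurable borel" for g :: "real => complex"
  by (rule borel_measurable_continuous_on[OF _ that]) (intro continuous_intros)
 note c1[measurable] = cn[OF G1(1)] and c2[measurable] = cn[OF G2(1)]
 have m: "Gp \<in> borel_measurable borel" "Gm \<in> borel_measurable borel" unfolding Gp_def Gm_def by measurable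
 have p: "integrable lborel (\<lambda>x. (cmod (Gp x))\<^sup>2)" "(LBINT x. (cmod (Gp x))\<^sup>2) <= 4 * pi\<^sup>2 * (LBINT x. (cmod (h x))\<^sup>2)"
  unfolding Gp_def by (rule main[OF G1(1) G2(1)]; simp)+
 have q: "integrable lborel (\<lambda>x. (cmod (Gm x))\<^sup>2)" "(LBINT x. (cmod (Gm x))\<^sup>2) <= 4 * pi\<^sup>2 * (LBINT x. (cmod (h x))\<^sup>2)"
  unfolding Gm_def by (rule main[OF c1 c2]; simp)+
 have ae: "AE x in lborel. ((\<lambda>y. cauchy_transform h (Complex x y)) \<longlongrightarrow> Gp x) (at_right 0) \<and>
    ((\<lambda>y. cauchy_transform h (Complex x (- y))) \<longlongrightarrow> Gm x) (at_right 0) \<and>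
    Gp x - Gm x = 2 * of_real pi * \<i> * h x"
  using G1(4) G2(4)
 proof eventually_elim
  case (elim x)
  have ev: "\<forall>\<^sub>F y in at_right (0::real). y > 0" by (rule eventually_at_right_less)
  have "((\<lambda>y. cauchy_transform (?c h1) (Complex x y) + \<i> * cauchy_transform (?c h2) (Complex x y)) \<longlongrightarrow> Gp x) (at_right 0)"
   unfolding Gp_def using elim by (intro tendsto_intros) auto
  then have 1: "((\<lambda>y. cauchy_transform h (Complex x y)) \<longlongrightarrow> Gp x) (at_right 0)"
   by (rule Lim_transform_eventually) (use ev in eventually_elim, simp add: split)
  have "((\<lambda>y. cnj (cauchy_transform (?c h1) (Complex x y)) + \<i> * cnj (cauchy_transform (?c h2) (Complex x y))) \<longlongrightarrow> Gm x) (at_right 0)"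
   unfolding Gm_def using elim by (intro tendsto_intros) auto
  then have 2: "((\<lambda>y. cauchy_transform h (Complex x (- y))) \<longlongrightarrow> Gm x) (at_right 0)"
   by (rule Lim_transform_eventually) (use ev in eventually_elim, simp add: split conj)
  have "Gp x - Gm x = 2 * of_real pi * \<i> * h x"
   using elim by (simp add: Gp_def Gm_def h1_def h2_def complex_eq_iff)
  with 1 2 show ?case by blast
 qed
 show ?thesis using m p q ae by blast
qed

section \<open>Estimates from the polar decomposition\<close>

lemma ctranspose_nth [simp]: "ctranspose M $ i $ j = cnj (M $ j $ i)"
 by (simp add: ctranspose_def)

lemma mscale_nth [simp]: "mscale c M $ i $ j = c * M $ i $ j"
 by (simp add: mscale_def)

lemma ctranspose_ctranspose [simp]: "ctranspose (ctranspose M) = M"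
 by (simp add: vec_eq_iff)

lemma ctranspose_mult: "ctranspose (A ** B) = ctranspose B ** ctranspose (A::complex^'n^'m)"
 by (simp add: vec_eq_iff matrix_matrix_mult_def mult.commute)

lemma ctranspose_diff: "ctranspose (A - B) = ctranspose A - ctranspose B"
 by (simp add: vec_eq_iff)

lemma ctranspose_add: "ctranspose (A + B) = ctranspose A + ctranspose B"
 by (simp add: vec_eq_iff)

lemma ctranspose_one [simp]: "ctranspose (mat 1) = mat 1"
 by (simp add: vec_eq_iff mat_def)

lemma matrix_mult_diff_right: "A ** (B - C) = A ** B - A ** (C::complex^'n^'m)"
 by (simp add: vec_eq_iff matrix_matrix_mult_def sum_subtractf algebra_simps)

lemma matrix_mult_diff_left: "(B - C) ** A = B ** A - C ** (A::complex^'n^'m)"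
 by (simp add: vec_eq_iff matrix_matrix_mult_def sum_subtractf algebra_simps)

lemma matrix_mult_add_right: "A ** (B + C) = A ** B + A ** (C::complex^'n^'m)"
 by (simp add: vec_eq_iff matrix_matrix_mult_def sum.distrib algebra_simps)

lemma matrix_mult_add_left: "(B + C) ** A = B ** A + C ** (A::complex^'n^'m)"
 by (simp add: vec_eq_iff matrix_matrix_mult_def sum.distrib algebra_simps)

lemma matrix_vector_mult_scaleC: "M *v (c *\<^sub>C x) = c *\<^sub>C (M *v (x::complex^'n))"
 by (simp add: vec_eq_iff matrix_vector_mult_def sum_distrib_left mult_ac)

lemma mscale_mult_vector: "mscale c M *v x = c *\<^sub>C (M *v x)"
 by (simp add: vec_eq_iff matrix_vector_mult_def sum_distrib_left mult_ac)

lemma cinner_matrix_left: "cinner (M *v x) y = cinner (x::complex^'n) (ctranspose M *v (y::complex^'m))"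
proof -
 have "cinner (M *v x) y = (\<Sum>i\<in>UNIV. \<Sum>j\<in>UNIV. cnj (M $ i $ j) * cnj (x $ j) * y $ i)"
  by (simp add: cinner_vec_def cinner_complex_def matrix_vector_mult_def sum_distrib_right)
 also have "... = (\<Sum>j\<in>UNIV. \<Sum>i\<in>UNIV. cnj (M $ i $ j) * cnj (x $ j) * y $ i)" by (rule sum.swap)
 also have "... = cinner x (ctranspose M *v y)"
  by (simp add: cinner_vec_def cinner_complex_def matrix_vector_mult_def sum_distrib_left mult_ac)
 finally show ?thesis .
qed

lemma cinner_matrix_right: "cinner x (M *v y) = cinner (ctranspose M *v x) (y::complex^'n)"
 by (simp add: cinner_matrix_left)

lemma matrix_vector_mult_assoc': "A *v (B *v x) = (A ** B) *v (x::complex^'n)"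
 by (rule matrix_vector_mul_assoc)

lemma psd_Cauchy_Schwarz:
 fixes P :: "complex^'m^'m"
 assumes "ctranspose P = P" "!!v. 0 <= Re (cinner v (P *v v))"
 shows "(cmod (cinner x (P *v y)))\<^sup>2 <= Re (cinner x (P *v x)) * Re (cinner y (P *v y))"
proof (rule form_Cauchy_Schwarz[where V=UNIV])
 show "cinner x (P *v y) = cnj (cinner y (P *v x))" for x y
  by (metis assms(1) cinner_commute cinner_matrix_left)
qed (use assms in \<open>auto simp: matrix_vector_right_distrib matrix_vector_mult_scaleC cinner_simps\<close>)

text \<open>Everything is measured by \<open>n\<close>, the form of \<open>D = J (R - R^-1)\<close>:
  bounded \<open>F1\<close> controls \<open>n q\<close>, bounded \<open>F2\<close> controls
  \<open>n (J U* v)\<close>, and no bound on \<open>U\<close> is at hand. With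
  \<open>M = R + R^-1\<close> one has \<open>Q1 = D M\<close> and \<open>M^2 = 4 + (J D)^2\<close>,
  so that \<open>n q\<close>, \<open>n (M q)\<close> and \<open><q, Q1 q>\<close> are comparable up
  to powers of \<open>k = 4 + c^2\<close>. The form of \<open>Q2\<close> at \<open>v\<close> is that
  of \<open>Q1\<close> at \<open>J U* v\<close>. The constant \<open>C\<close> is a crude common
  bound for \<open>k * c\<close> and \<open>k^3\<close>.\<close>

lemma J_polar_bounds:
 fixes J U R Wp Wm :: "complex^'m^'m" and n :: "complex^'m => real"
 assumes J: "ctranspose J = J" "J ** J = mat 1"
  and polar: "J_polar_decomposition J Wp Wm U R"
  and WJ: "ctranspose Wp ** J ** Wm = J"
  and psdp: "psd_matrix (ctranspose Wp ** J ** Wp - J)"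
  and psdm: "psd_matrix (J - ctranspose Wm ** J ** Wm)"
  and n: "!!q. cinner q ((J ** (R - matrix_inv R)) *v q) = of_real (n q)" "!!q. 0 <= n q"
  and c: "0 <= c" "!!q. n q <= c * (norm q)\<^sup>2" "!!v. n ((J ** ctranspose U) *v v) <= c * (norm v)\<^sup>2"
 defines "Q1 \<equiv> ctranspose Wp ** J ** Wp - ctranspose Wm ** J ** Wm"
  and "Q2 \<equiv> Wp ** J ** ctranspose Wp - Wm ** J ** ctranspose Wm"
  and "C \<equiv> (4 + c\<^sup>2)^3 * (1 + c + c\<^sup>2)"
 shows "Im (cinner q (Q1 *v q)) = 0" "Im (cinner v (Q2 *v v)) = 0"
  "0 <= Re (cinner q (Q1 *v q))" "Re (cinner q (Q1 *v q)) <= C * (norm q)\<^sup>2"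
  "0 <= Re (cinner v (Q2 *v v))" "Re (cinner v (Q2 *v v)) <= C * (norm v)\<^sup>2"
  "(norm ((Wp - Wm) *v q))\<^sup>2 <= C * Re (cinner q (Q1 *v q))"
  "(norm (ctranspose (Wp - Wm) *v v))\<^sup>2 <= C * Re (cinner v (Q2 *v v))"
  "Re (cinner ((J ** (Wp + Wm)) *v q) (Q2 *v ((J ** (Wp + Wm)) *v q))) <= C * Re (cinner q (Q1 *v q))"
proof -
 define Ri where "Ri = matrix_inv R"
 have P: "Wp = U ** R" "Wm = U ** Ri" "ctranspose U ** J ** U = J" "J ** R = ctranspose R ** J"
  using polar by (auto simp: J_polar_decomposition_def Ri_def)
 \<comment> \<open>\<open>matrix_inv R\<close> can be computed with only once \<open>R\<close> is
   known to be invertible. The relation between the boundary values provides the left inverse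
   \<open>J Wm* J U\<close>.\<close>
 have "ctranspose (ctranspose Wp ** J ** Wm) = J" using WJ J by simp
 then have WJ': "ctranspose Wm ** (J ** Wp) = J" by (simp add: ctranspose_mult J)
 have "(J ** ctranspose Wm ** J ** U) ** R = J ** (ctranspose Wm ** (J ** Wp))"
  by (simp add: P(1) matrix_mul_assoc)
 also have "... = mat 1" by (simp add: WJ' J)
 finally have "invertible R" using invertible_left_inverse by blast
 then have "\<exists>S. R ** S = mat 1 \<and> S ** R = mat 1" by (simp add: invertible_def)
 then have RRi: "R ** Ri = mat 1" "Ri ** R = mat 1"
  unfolding Ri_def matrix_inv_def by (rule someI2_ex; blast)+
 have cR: "ctranspose Ri ** ctranspose R = mat 1" "ctranspose R ** ctranspose Ri = mat 1"
  by (simp_all flip: ctranspose_mult add: RRi)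
 have JRi: "J ** Ri = ctranspose Ri ** J"
 proof -
  have "J ** Ri = (ctranspose Ri ** ctranspose R) ** J ** Ri" by (simp add: cR)
  also have "... = ctranspose Ri ** (J ** R) ** Ri" by (simp add: P(4) matrix_mul_assoc)
  also have "... = ctranspose Ri ** J ** (R ** Ri)" by (simp only: matrix_mul_assoc)
  finally show ?thesis by (simp add: RRi)
 qed
 have RJ: "R ** J = J ** ctranspose R" if "J ** R = ctranspose R ** J" for R
 proof -
  have "R ** J = J ** (J ** R) ** J" by (simp add: matrix_mul_assoc J)
  also have "... = J ** ctranspose R ** (J ** J)" by (simp only: that matrix_mul_assoc)
  finally show ?thesis by (simp add: J)
 qed
 have "(J ** ctranspose U ** J) ** U = J ** (ctranspose U ** J ** U)" by (simp only: matrix_mul_assoc)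
 also have "... = mat 1" by (simp only: P(3) J)
 finally have "U ** (J ** ctranspose U ** J) = mat 1" by (simp add: matrix_left_right_inverse)
 then have "U ** J ** ctranspose U ** (J ** J) = mat 1 ** J" by (simp only: matrix_mul_assoc)
 then have UJU: "U ** J ** ctranspose U = J" by (simp add: J)
 define D where "D = J ** (R - Ri)"
 define M where "M = R + Ri"
 have JD: "J ** D = R - Ri" by (simp add: D_def matrix_mul_assoc J)
 have DD: "ctranspose D = D"
  by (simp add: D_def ctranspose_mult ctranspose_diff J matrix_mult_diff_right matrix_mult_diff_left P(4) JRi)
 have DM: "D ** M = J ** (R ** R) - J ** (Ri ** Ri)"
  by (simp add: D_def M_def matrix_mult_diff_right matrix_mult_diff_left matrix_mult_add_right matrix_mult_add_left
    matrix_mul_assoc[symmetric] RRi)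
 have Q1: "Q1 = D ** M"
 proof -
  have e: "ctranspose (U ** S) ** J ** (U ** S) = J ** (S ** S)" if "J ** S = ctranspose S ** J" for S
  proof -
   have "ctranspose (U ** S) ** J ** (U ** S) = ctranspose S ** (ctranspose U ** J ** U) ** S"
    by (simp only: ctranspose_mult matrix_mul_assoc)
   also have "... = J ** (S ** S)" by (simp only: P(3) that[symmetric] matrix_mul_assoc)
   finally show ?thesis .
  qed
  show ?thesis unfolding Q1_def DM P(1,2) by (simp only: e[OF P(4)] e[OF JRi])
 qed
 have Q2: "Q2 = U ** (J ** (D ** M)) ** (J ** ctranspose U)"
 proof -
  have e: "(U ** S) ** J ** ctranspose (U ** S) = U ** (J ** (J ** (S ** S))) ** (J ** ctranspose U)" if "J ** S = ctranspose S ** J" for S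
  proof -
   have "(U ** S) ** J ** ctranspose (U ** S) = U ** S ** (J ** ctranspose S) ** ctranspose U"
    by (simp only: ctranspose_mult matrix_mul_assoc)
   also have "... = U ** S ** (S ** J) ** ctranspose U" by (simp only: RJ[OF that])
   also have "... = U ** ((J ** J) ** (S ** S)) ** (J ** ctranspose U)" by (simp add: J matrix_mul_assoc)
   finally show ?thesis by (simp only: matrix_mul_assoc)
  qed
  show ?thesis unfolding Q2_def DM P(1,2)
   by (simp only: e[OF P(4)] e[OF JRi] matrix_mult_diff_right matrix_mult_diff_left)
 qed
 have Q1h: "ctranspose Q1 = Q1" by (simp add: Q1_def ctranspose_mult ctranspose_diff J matrix_mul_assoc)
 have MD: "ctranspose M ** D = Q1" using Q1h by (simp add: Q1 ctranspose_mult DD)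
 have MM: "M ** M = mat 1 + mat 1 + mat 1 + mat 1 + (J ** D) ** (J ** D)"
  unfolding JD M_def
  by (simp add: matrix_mult_diff_right matrix_mult_diff_left matrix_mult_add_right matrix_mult_add_left RRi)
 have nq: "cinner q (D *v q) = of_real (n q)" for q using n by (simp add: D_def Ri_def)
 have JJ: "norm (J *v x) = norm x" for x
 proof -
  have "cinner (J *v x) (J *v x) = cinner x x"
   by (simp add: cinner_matrix_left J matrix_vector_mult_assoc')
  then have "(norm (J *v x))\<^sup>2 = (norm x)\<^sup>2" unfolding cinner_self of_real_eq_iff .
  then show ?thesis by simp
 qed
 \<comment> \<open>As \<open>Q1 = D M\<close> is Hermitian, \<open>M* D = D M\<close>; hence
   \<open>M* D M = D M^2\<close>, and the formula for \<open>M^2\<close> applies. In particular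
   \<open>4 * n q <= n (M q)\<close>.\<close>
 have nM: "n (M *v q) = 4 * n q + n ((J ** D) *v q)" for q
 proof -
  have h: "cinner q ((ctranspose (J ** D) ** D ** (J ** D)) *v q) = of_real (n ((J ** D) *v q))"
   unfolding nq[symmetric] by (simp only: cinner_matrix_left matrix_vector_mult_assoc' matrix_mul_assoc)
  have "of_real (n (M *v q)) = cinner q ((ctranspose M ** D ** M) *v q)"
   unfolding nq[symmetric] by (simp add: cinner_matrix_left matrix_vector_mult_assoc' matrix_mul_assoc)
  also have "ctranspose M ** D ** M = D ** (M ** M)" by (simp only: MD Q1 matrix_mul_assoc)
  also have "... = D + D + D + D + ctranspose (J ** D) ** D ** (J ** D)"
   by (simp only: MM matrix_mult_add_right ctranspose_mult J DD matrix_mul_assoc matrix_mul_rid)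
  also have "cinner q (... *v q) = of_real (n q) + of_real (n q) + of_real (n q) + of_real (n q) + of_real (n ((J ** D) *v q))"
   by (simp only: matrix_vector_mult_add_rdistrib cinner_add_right nq h)
  also have "... = of_real (4 * n q + n ((J ** D) *v q))" by simp
  finally show ?thesis by (simp only: of_real_eq_iff)
 qed
 have CSD: "(cmod (cinner x (D *v y)))\<^sup>2 <= n x * n y" for x y
  using psd_Cauchy_Schwarz[OF DD, of x y] n(2) by (simp add: nq)
 have sq: "(norm x)\<^sup>2 <= B" if "((norm x)\<^sup>2)\<^sup>2 <= (norm x)\<^sup>2 * B" "0 <= B" for x :: "complex^'m" and B
  proof (cases "norm x = 0")
  case False
  have "(norm x)\<^sup>2 * (norm x)\<^sup>2 <= (norm x)\<^sup>2 * B" using that(1) by (simp only: power2_eq_square)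
  then show ?thesis by (rule mult_left_le_imp_le) (use False in simp)
 qed (use that in simp)
 have Dq: "(norm (D *v q))\<^sup>2 <= c * n q" for q
 proof (rule sq)
  have "((norm (D *v q))\<^sup>2)\<^sup>2 = (cmod (cinner (D *v q) (D *v q)))\<^sup>2" by (simp add: cinner_self norm_power)
  also have "... <= n (D *v q) * n q" by (rule CSD)
  also have "... <= (c * (norm (D *v q))\<^sup>2) * n q" by (intro mult_right_mono c n)
  finally show "((norm (D *v q))\<^sup>2)\<^sup>2 <= (norm (D *v q))\<^sup>2 * (c * n q)" by (simp only: mult_ac)
 qed (use c n in simp)
 define k where "k = 4 + c\<^sup>2"
 have k: "4 <= k" "1 <= k" "0 <= k" by (simp_all add: k_def add_nonneg_nonneg)
 have nMk: "n (M *v q) <= k * n q" for q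
 proof -
  have "n ((J ** D) *v q) <= c * (norm ((J ** D) *v q))\<^sup>2" by (rule c)
  also have "norm ((J ** D) *v q) = norm (D *v q)" by (simp add: JJ flip: matrix_vector_mult_assoc')
  also have "c * (norm (D *v q))\<^sup>2 <= c * (c * n q)" by (intro mult_left_mono Dq c)
  finally show ?thesis by (simp add: nM k_def power2_eq_square algebra_simps)
 qed
 have Q1pos: "Im (cinner q (Q1 *v q)) = 0" "0 <= Re (cinner q (Q1 *v q))" for q
 proof -
  have "Q1 *v q = (ctranspose Wp ** J ** Wp - J) *v q + (J - ctranspose Wm ** J ** Wm) *v q"
   by (simp add: Q1_def matrix_vector_mult_diff_rdistrib)
  then show "Im (cinner q (Q1 *v q)) = 0" "0 <= Re (cinner q (Q1 *v q))"
   using psdp psdm by (auto simp: psd_matrix_def cinner_add_right)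
 qed
 have Q1v: "cinner x (Q1 *v y) = cinner x (D *v (M *v y))" for x y
  by (simp add: Q1 matrix_vector_mult_assoc')
 have Q1up: "Re (cinner q (Q1 *v q)) <= k * n q" for q
 proof -
  have "(Re (cinner q (Q1 *v q)))\<^sup>2 <= (cmod (cinner q (D *v (M *v q))))\<^sup>2"
   unfolding Q1v[symmetric] by (rule power2_le_iff_abs_le[THEN iffD2]) (auto simp: abs_Re_le_cmod)
  also have "... <= n q * n (M *v q)" by (rule CSD)
  also have "... <= n q * (k * n q)" by (intro mult_left_mono nMk n)
  also have "... <= (k * n q)\<^sup>2"
   using mult_right_mono[of 1 k "k * (n q * n q)"] k n(2)[of q] by (simp add: power2_eq_square mult_ac)
  finally show ?thesis by (rule power2_le_imp_le) (use k n in auto)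
 qed
 \<comment> \<open>The converse comparison. Here \<open>n (M q)\<close> is also
   \<open><M q, Q1 q>\<close>; Cauchy-Schwarz for the nonnegative form \<open>Q1\<close>, followed
   by \<open>Q1up\<close> at \<open>M q\<close>, leaves one factor \<open>n (M q)\<close> to
   cancel.\<close>
 have nMQ: "n (M *v q) <= k * Re (cinner q (Q1 *v q))" for q
 proof -
  have "(n (M *v q))\<^sup>2 = (cmod (cinner (M *v q) (Q1 *v q)))\<^sup>2"
   unfolding Q1v nq by (simp add: n)
  also have "... <= Re (cinner (M *v q) (Q1 *v (M *v q))) * Re (cinner q (Q1 *v q))"
   by (rule psd_Cauchy_Schwarz[OF Q1h Q1pos(2)])
  also have "... <= (k * n (M *v q)) * Re (cinner q (Q1 *v q))"
   by (intro mult_right_mono Q1up Q1pos)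
  finally have "n (M *v q) * n (M *v q) <= n (M *v q) * (k * Re (cinner q (Q1 *v q)))"
   by (simp add: power2_eq_square mult_ac)
  then show ?thesis
   using n(2)[of "M *v q"] k Q1pos(2)[of q] by (cases "n (M *v q) = 0") (auto simp: mult_le_cancel_left)
 qed
 have nQ: "n q <= k * Re (cinner q (Q1 *v q))" for q
  using nMQ[of q] nM[of q] n(2)[of q] n(2)[of "(J ** D) *v q"] by linarith
 let ?w = "\<lambda>v. (J ** ctranspose U) *v v"
 have Q2v: "cinner v (Q2 *v v) = cinner (?w v) (Q1 *v ?w v)" for v
  by (simp add: Q2 Q1 cinner_matrix_left ctranspose_mult J matrix_vector_mult_assoc' matrix_mul_assoc)
 have F: "Wp - Wm = U ** (J ** D)" by (simp add: P(1,2) JD matrix_mult_diff_right)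
 have Fv: "cinner v ((Wp - Wm) *v q) = cinner (?w v) (D *v q)" for v q
  by (simp add: F cinner_matrix_left ctranspose_mult J matrix_vector_mult_assoc' matrix_mul_assoc)
 have C1: "k * c <= C" "c\<^sup>2 * k <= C" "k ^ 3 <= C" "0 <= C"
 proof -
  have kk: "k <= k ^ 3" using power_increasing[of 1 3 k] k by simp
  have "k * c <= k^3 * c" "c\<^sup>2 * k <= c\<^sup>2 * k^3" using kk c by (intro mult_right_mono mult_left_mono; simp)+
  moreover have "C = k^3 + k^3 * c + c\<^sup>2 * k^3" by (simp add: C_def k_def algebra_simps)
  moreover have "0 <= k^3" "0 <= k^3 * c" "0 <= c\<^sup>2 * k^3" using k c by auto
  ultimately show "k * c <= C" "c\<^sup>2 * k <= C" "k ^ 3 <= C" "0 <= C" by linarith+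
 qed
 show "Im (cinner q (Q1 *v q)) = 0" "0 <= Re (cinner q (Q1 *v q))" by (rule Q1pos)+
 show "Im (cinner v (Q2 *v v)) = 0" "0 <= Re (cinner v (Q2 *v v))" unfolding Q2v by (rule Q1pos)+
 show "Re (cinner q (Q1 *v q)) <= C * (norm q)\<^sup>2"
 proof -
  have "Re (cinner q (Q1 *v q)) <= k * (c * (norm q)\<^sup>2)"
   by (rule order_trans[OF Q1up mult_left_mono[OF c(2) k(3)]])
  also have "... <= C * (norm q)\<^sup>2" using mult_right_mono[OF C1(1), of "(norm q)\<^sup>2"] by (simp add: mult.assoc)
  finally show ?thesis .
 qed
 show "Re (cinner v (Q2 *v v)) <= C * (norm v)\<^sup>2"
 proof -
  have "Re (cinner v (Q2 *v v)) <= k * (c * (norm v)\<^sup>2)"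
   unfolding Q2v by (rule order_trans[OF Q1up mult_left_mono[OF c(3) k(3)]])
  also have "... <= C * (norm v)\<^sup>2" using mult_right_mono[OF C1(1), of "(norm v)\<^sup>2"] by (simp add: mult.assoc)
  finally show ?thesis .
 qed
 show "(norm ((Wp - Wm) *v q))\<^sup>2 <= C * Re (cinner q (Q1 *v q))"
 proof -
  let ?x = "(Wp - Wm) *v q"
  have "(norm ?x)\<^sup>2 <= c * n q"
  proof (rule sq)
   have "((norm ?x)\<^sup>2)\<^sup>2 = (cmod (cinner ?x ?x))\<^sup>2" by (simp add: cinner_self norm_power)
   also have "... <= n (?w ?x) * n q" unfolding Fv by (rule CSD)
   also have "... <= (c * (norm ?x)\<^sup>2) * n q" by (intro mult_right_mono c n)
   finally show "((norm ?x)\<^sup>2)\<^sup>2 <= (norm ?x)\<^sup>2 * (c * n q)" by (simp add: mult_ac)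
  qed (use c n in simp)
  also have "... <= c * (k * Re (cinner q (Q1 *v q)))" by (intro mult_left_mono nQ c)
  also have "... <= C * Re (cinner q (Q1 *v q))"
   using mult_right_mono[OF C1(1) Q1pos(2)[of q]] by (simp add: mult_ac)
  finally show ?thesis .
 qed
 show "(norm (ctranspose (Wp - Wm) *v v))\<^sup>2 <= C * Re (cinner v (Q2 *v v))"
 proof -
  let ?x = "ctranspose (Wp - Wm) *v v"
  have "(norm ?x)\<^sup>2 <= c * n (?w v)"
  proof (rule sq)
   have "((norm ?x)\<^sup>2)\<^sup>2 = (cmod (cinner ?x ?x))\<^sup>2" by (simp add: cinner_self norm_power)
   also have "cinner ?x ?x = cinner v ((Wp - Wm) *v ?x)" by (simp add: cinner_matrix_right)
   also have "(cmod (cinner v ((Wp - Wm) *v ?x)))\<^sup>2 <= n (?w v) * n ?x" unfolding Fv by (rule CSD)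
   also have "... <= n (?w v) * (c * (norm ?x)\<^sup>2)" by (intro mult_left_mono c n)
   finally show "((norm ?x)\<^sup>2)\<^sup>2 <= (norm ?x)\<^sup>2 * (c * n (?w v))" by (simp add: mult_ac)
  qed (use c n in simp)
  also have "... <= c * (k * Re (cinner (?w v) (Q1 *v ?w v)))" by (intro mult_left_mono nQ c)
  also have "... <= C * Re (cinner (?w v) (Q1 *v ?w v))"
   using mult_right_mono[OF C1(1) Q1pos(2)[of "?w v"]] by (simp add: mult_ac)
  finally show ?thesis unfolding Q2v .
 qed
 show "Re (cinner ((J ** (Wp + Wm)) *v q) (Q2 *v ((J ** (Wp + Wm)) *v q))) <= C * Re (cinner q (Q1 *v q))"
 proof -
  have "(J ** ctranspose U) ** (J ** (Wp + Wm)) = J ** (ctranspose U ** J ** U) ** M"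
   by (simp add: P(1,2) M_def matrix_mult_add_right matrix_mul_assoc)
  also have "... = M" by (simp only: P(3) J matrix_mul_lid)
  finally have "?w ((J ** (Wp + Wm)) *v q) = M *v q" by (simp only: matrix_vector_mult_assoc')
  then have "Re (cinner ((J ** (Wp + Wm)) *v q) (Q2 *v ((J ** (Wp + Wm)) *v q))) = Re (cinner (M *v q) (Q1 *v (M *v q)))"
   by (simp only: Q2v)
  also have "... <= k * n (M *v q)" by (rule Q1up)
  also have "... <= k * (k * n q)" by (intro mult_left_mono nMk k)
  also have "... <= k * (k * (k * Re (cinner q (Q1 *v q))))" by (intro mult_left_mono nQ k)
  also have "... <= C * Re (cinner q (Q1 *v q))"
   using mult_right_mono[OF C1(3) Q1pos(2)[of q]] by (simp add: power3_eq_cube mult_ac)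
  finally show ?thesis .
 qed
qed

section \<open>Measurability and integrability of matrix functions\<close>

lemma bounded_bilinear_matrix_vector_mult:
 "bounded_bilinear (\<lambda>(M::complex^'n^'m) v. M *v v)"
proof (rule bounded_bilinear.intro)
 fix M M' :: "complex^'n^'m" and v v' :: "complex^'n" and r :: real
 show "(M + M') *v v = M *v v + M' *v v" by (rule matrix_vector_mult_add_rdistrib)
 show "M *v (v + v') = M *v v + M *v v'" by (rule matrix_vector_right_distrib)
 show "(r *\<^sub>R M) *v v = r *\<^sub>R (M *v v)" "M *v (r *\<^sub>R v) = r *\<^sub>R (M *v v)"
  by (simp_all add: vec_eq_iff matrix_vector_mult_def scaleR_sum_right)
 show "\<exists>K. \<forall>M v. norm ((M::complex^'n^'m) *v v) <= norm M * norm v * K"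
 proof (intro exI allI)
  fix M :: "complex^'n^'m" and v :: "complex^'n"
  have "norm (M *v v) <= (\<Sum>i\<in>UNIV. norm ((M *v v) $ i))"
   unfolding norm_vec_def[of "M *v v"] by (rule L2_set_le_sum) simp
  also have "... <= (\<Sum>i\<in>(UNIV::'m set). \<Sum>j\<in>(UNIV::'n set). norm M * norm v)"
  proof (intro sum_mono)
   fix i
   have "norm ((M *v v) $ i) <= (\<Sum>j\<in>UNIV. norm (M $ i $ j) * norm (v $ j))"
    unfolding matrix_vector_mult_def by (auto intro!: sum_norm_le simp: norm_mult)
   also have "... <= (\<Sum>j\<in>(UNIV::'n set). norm M * norm v)"
    by (intro sum_mono mult_mono Finite_Cartesian_Product.norm_nth_le order_trans[OF Finite_Cartesian_Product.norm_nth_le]) auto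
   finally show "norm ((M *v v) $ i) <= (\<Sum>j\<in>(UNIV::'n set). norm M * norm v)" .
  qed
  finally show "norm (M *v v) <= norm M * norm v * (real CARD('m) * real CARD('n))"
   by (simp add: mult_ac)
 qed
qed

lemma borel_measurable_matrix_vector_mult [measurable (raw)]:
 fixes F :: "'a => complex^'n^'m"
 assumes "F \<in> borel_measurable M" "v \<in> borel_measurable M"
 shows "(\<lambda>x. F x *v v x) \<in> borel_measurable M"
 by (rule borel_measurable_continuous_Pair[OF assms])
  (intro bounded_bilinear.continuous_on[OF bounded_bilinear_matrix_vector_mult] continuous_intros)

lemma borel_measurable_cinner [measurable (raw)]:
 fixes u :: "'a => complex^'n"
 assumes "u \<in> borel_measurable M" "v \<in> borel_measurable M"
 shows "(\<lambda>x. cinner (u x) (v x)) \<in> borel_measurable M"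
 by (rule borel_measurable_continuous_Pair[OF assms]) (intro continuous_intros)

lemma borel_measurable_scaleC [measurable (raw)]:
 fixes v :: "'a => complex^'n"
 assumes "c \<in> borel_measurable M" "v \<in> borel_measurable M"
 shows "(\<lambda>x. c x *\<^sub>C v x) \<in> borel_measurable M"
 by (rule borel_measurable_continuous_Pair[OF assms]) (intro continuous_intros)

lemma borel_measurable_ctranspose [measurable (raw)]:
 fixes F :: "'a => complex^'n^'m"
 assumes "F \<in> borel_measurable M"
 shows "(\<lambda>x. ctranspose (F x)) \<in> borel_measurable M"
proof -
 have "continuous_on UNIV (ctranspose :: complex^'n^'m => _)"
  unfolding ctranspose_def by (intro continuous_intros)
 then show ?thesis using assms by (rule borel_measurable_continuous_on)
qed

lemma borel_measurable_matrix_mult [measurable (raw)]: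
 fixes F :: "'a => complex^'n^'m" and G :: "'a => complex^'k^'n"
 assumes "F \<in> borel_measurable M" "G \<in> borel_measurable M"
 shows "(\<lambda>x. F x ** G x) \<in> borel_measurable M"
 by (rule borel_measurable_continuous_Pair[OF assms])
  (unfold matrix_matrix_mult_def, intro continuous_intros)

lemma integrable_bounded_support:
 fixes f :: "real => 'b::{banach, second_countable_topology}"
 assumes "f \<in> borel_measurable borel" "!!x. x \<in> {a..b} ==> norm (f x) <= B" "!!x. x \<notin> {a..b} ==> f x = 0"
 shows "integrable lborel f"
proof (rule Bochner_Integration.integrable_bound)
 show "integrable lborel (\<lambda>x. \<bar>B\<bar> * indicator {a..b} x)"
  by (intro integrable_mult_right integrable_real_indicator) (auto simp: emeasure_lborel_Icc_eq)
 show "AE x in lborel. norm (f x) <= norm (\<bar>B\<bar> * indicator {a..b} x)"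
  using assms(2,3) order_trans[OF assms(2) abs_ge_self] by (intro AE_I2) (auto simp: indicator_def)
qed (use assms(1) in simp)

lemma continuous_bounded_Icc:
 fixes f :: "real => 'b::real_normed_vector"
 assumes "continuous_on {a..b} f"
 obtains B where "B \<ge> 0" "!!x. x \<in> {a..b} ==> norm (f x) <= B"
proof -
 have "bounded (f ` {a..b})" by (intro compact_imp_bounded compact_continuous_image assms compact_Icc)
 then obtain B where "!!x. x \<in> {a..b} ==> norm (f x) <= B" unfolding bounded_iff by blast
 then show ?thesis using that[of "max 0 B"] by fastforce
qed

text \<open>A measurable function is almost everywhere a limit of continuous ones. These are
  truncated at level \<open>M\<close> and replaced on \<open>[a,b]\<close> by polynomials with error
  below \<open>1 / (n + 1)\<close>. The bound independent of \<open>n\<close> is what later permits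
  dominated convergence.\<close>

lemma bounded_measurable_poly_limit_real:
 fixes f :: "real => real"
 assumes [measurable]: "f \<in> borel_measurable borel" and M: "!!t. \<bar>f t\<bar> <= M"
 shows "\<exists>P::nat => complex poly. (\<forall>n. \<forall>t\<in>{a..b}. cmod (poly (P n) (of_real t)) <= M + 1) \<and>
  (AE t in lborel. t \<in> {a..b} \<longrightarrow> (\<lambda>n. poly (P n) (of_real t)) \<longlonglongrightarrow> of_real (f t))"
proof -
 have "f \<in> borel_measurable (lebesgue_on UNIV)" by (simp add: lebesgue_on_UNIV_eq measurable_completion)
 then have "f measurable_on UNIV" by (subst measurable_on_iff_borel_measurable) auto
 then obtain N g where N: "negligible N" and g: "!!n. continuous_on UNIV (g n)"
  and lim: "!!x. x \<notin> N ==> (\<lambda>n. g n x) \<longlonglongrightarrow> f x"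
  unfolding measurable_on_def by auto
 define h where "h = (\<lambda>n x. max (- M) (min M (g n x)))"
 have M0: "0 <= M" using M[of 0] by linarith
 have hM: "\<bar>h n x\<bar> <= M" for n x using M0 by (auto simp: h_def abs_le_iff)
 have hc: "continuous_on {a..b} (h n)" for n
  unfolding h_def by (intro continuous_intros continuous_on_subset[OF g]) auto
 have hlim: "(\<lambda>n. h n x) \<longlonglongrightarrow> f x" if "x \<notin> N" for x
 proof -
  have "(\<lambda>n. h n x) \<longlonglongrightarrow> max (- M) (min M (f x))"
   unfolding h_def by (intro tendsto_max tendsto_min tendsto_const lim that)
  then show ?thesis using M[of x] by (simp add: abs_le_iff min_def max_def split: if_splits)
 qed
 have "\<exists>P::complex poly. \<forall>t\<in>{a..b}. cmod (of_real (h n t) - poly P (of_real t)) < 1 / real (Suc n)" for n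
 proof -
  obtain p where p: "real_polynomial_function p" "!!x. x \<in> {a..b} ==> \<bar>h n x - p x\<bar> < 1 / real (Suc n)"
   using Stone_Weierstrass_real_polynomial_function[OF compact_Icc hc[of n], of "1 / real (Suc n)"] by auto
  obtain c k where ck: "p = (\<lambda>x. \<Sum>i\<le>k. c i * x ^ i)"
   using p(1) unfolding real_polynomial_function_iff_sum by blast
  define P where "P = (\<Sum>i\<le>k. monom (complex_of_real (c i)) i)"
  have P: "poly P (of_real t) = of_real (p t)" for t
   by (simp add: P_def ck poly_sum poly_monom)
  show ?thesis
   by (intro exI[of _ P] ballI) (use p(2) in \<open>simp add: P flip: of_real_diff\<close>)
 qed
 then obtain P where P: "!!n t. t \<in> {a..b} ==> cmod (of_real (h n t) - poly (P n) (of_real t)) < 1 / real (Suc n)" by metis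
 show ?thesis
 proof (intro exI[of _ P] conjI allI ballI)
  fix n t assume t: "t \<in> {a..b}"
  have "cmod (poly (P n) (of_real t)) <= cmod (of_real (h n t)) + cmod (of_real (h n t) - poly (P n) (of_real t))"
   by (metis add_diff_cancel_left' diff_add_cancel norm_minus_commute norm_triangle_sub)
  also have "... <= M + 1"
   using hM[of n t] P[OF t, of n] by (intro add_mono) (auto intro: order_trans[OF less_imp_le])
  finally show "cmod (poly (P n) (of_real t)) <= M + 1" .
 next
  have "AE t in lborel. t \<notin> N"
   using N unfolding negligible_iff_null_sets by (metis AE_completion_iff AE_not_in)
  then show "AE t in lborel. t \<in> {a..b} \<longrightarrow> (\<lambda>n. poly (P n) (of_real t)) \<longlonglongrightarrow> of_real (f t)"
  proof eventually_elim
   case (elim t)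
   show ?case
   proof
    assume t: "t \<in> {a..b}"
    have "(\<lambda>n. of_real (h n t) - poly (P n) (of_real t)) \<longlonglongrightarrow> 0"
     by (rule Lim_null_comparison[OF _ LIMSEQ_Suc[OF lim_1_over_n]])
      (rule always_eventually, rule allI, rule less_imp_le, rule P[OF t])
    from tendsto_diff[OF tendsto_of_real[OF hlim[OF elim]] this]
    show "(\<lambda>n. poly (P n) (of_real t)) \<longlonglongrightarrow> of_real (f t)" by simp
   qed
  qed
 qed
qed

lemma bounded_measurable_poly_limit:
 fixes f :: "real => complex"
 assumes [measurable]: "f \<in> borel_measurable borel" and M: "!!t. cmod (f t) <= M"
 shows "\<exists>P::nat => complex poly. (\<forall>n. \<forall>t\<in>{a..b}. cmod (poly (P n) (of_real t)) <= 2 * M + 2) \<and>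
  (AE t in lborel. t \<in> {a..b} \<longrightarrow> (\<lambda>n. poly (P n) (of_real t)) \<longlonglongrightarrow> f t)"
proof -
 have re: "\<bar>Re (f t)\<bar> <= M" and im: "\<bar>Im (f t)\<bar> <= M" for t
  using order_trans[OF abs_Re_le_cmod M] order_trans[OF abs_Im_le_cmod M] by auto
 obtain P :: "nat => complex poly" where P: "!!n t. t \<in> {a..b} ==> cmod (poly (P n) (of_real t)) <= M + 1"
  "AE t in lborel. t \<in> {a..b} \<longrightarrow> (\<lambda>n. poly (P n) (of_real t)) \<longlonglongrightarrow> of_real (Re (f t))"
 proof -
  have "\<exists>P::nat => complex poly. (\<forall>n. \<forall>t\<in>{a..b}. cmod (poly (P n) (of_real t)) <= M + 1) \<and>
   (AE t in lborel. t \<in> {a..b} \<longrightarrow> (\<lambda>n. poly (P n) (of_real t)) \<longlonglongrightarrow> of_real (Re (f t)))"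
   by (rule bounded_measurable_poly_limit_real[OF _ re]) measurable
  then show thesis using that by blast
 qed
 obtain Q :: "nat => complex poly" where Q: "!!n t. t \<in> {a..b} ==> cmod (poly (Q n) (of_real t)) <= M + 1"
  "AE t in lborel. t \<in> {a..b} \<longrightarrow> (\<lambda>n. poly (Q n) (of_real t)) \<longlonglongrightarrow> of_real (Im (f t))"
 proof -
  have "\<exists>P::nat => complex poly. (\<forall>n. \<forall>t\<in>{a..b}. cmod (poly (P n) (of_real t)) <= M + 1) \<and>
   (AE t in lborel. t \<in> {a..b} \<longrightarrow> (\<lambda>n. poly (P n) (of_real t)) \<longlonglongrightarrow> of_real (Im (f t)))"
   by (rule bounded_measurable_poly_limit_real[OF _ im]) measurable
  then show thesis using that by blast
 qed
 show ?thesis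
 proof (intro exI[of _ "\<lambda>n. P n + smult \<i> (Q n)"] conjI allI ballI)
  fix n t assume t: "t \<in> {a..b}"
  have "cmod (poly (P n) (of_real t) + \<i> * poly (Q n) (of_real t)) <= (M + 1) + (M + 1)"
   using P(1)[OF t, of n] Q(1)[OF t, of n] by (intro norm_triangle_le add_mono) (auto simp: norm_mult)
  then show "cmod (poly (P n + smult \<i> (Q n)) (of_real t)) <= 2 * M + 2" by simp
 next
  show "AE t in lborel. t \<in> {a..b} \<longrightarrow> (\<lambda>n. poly (P n + smult \<i> (Q n)) (of_real t)) \<longlonglongrightarrow> f t"
   using P(2) Q(2)
  proof eventually_elim
   case (elim t)
   show ?case
   proof
    assume "t \<in> {a..b}"
    then have "(\<lambda>n. poly (P n) (of_real t) + \<i> * poly (Q n) (of_real t)) \<longlonglongrightarrow> of_real (Re (f t)) + \<i> * of_real (Im (f t))"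
     using elim by (intro tendsto_intros) auto
    then show "(\<lambda>n. poly (P n + smult \<i> (Q n)) (of_real t)) \<longlonglongrightarrow> f t"
     by (simp flip: complex_eq)
   qed
  qed
 qed
qed

section \<open>Polynomial vectors and the norm estimate\<close>

text \<open>
 \<open>horner A K u p\<close> says that \<open>u = \<Sum>\<^sub>i A\<^sup>i K v\<^sub>i\<close> and \<open>p(z) = \<Sum>\<^sub>i z\<^sup>i v\<^sub>i\<close> for some finite family
 of coefficients \<open>v\<^sub>i\<close>.
\<close>

inductive horner :: "('h::complex_inner => 'h) => ('v::complex_inner => 'h) => 'h => (complex => 'v) => bool"
 for A :: "'h::complex_inner => 'h" and K :: "'v::complex_inner => 'h" where
 horner_zero: "horner A K 0 (\<lambda>z. 0)"
| horner_step: "horner A K u p ==> horner A K (A u + K v) (\<lambda>z. z *\<^sub>C p z + v)"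

lemma bounded_clinearD:
 assumes "bounded_clinear T"
 shows "T (x + y) = T x + T y" "T (c *\<^sub>C x) = c *\<^sub>C T x" "T 0 = 0" "T (x - y) = T x - T y"
  "T (- x) = - T x" "T (r *\<^sub>R x) = r *\<^sub>R T x"
 using assms bounded_clinear_imp_bounded_linear[OF assms]
 by (auto simp: bounded_clinear_on_def linear_simps)

lemma horner_add:
 assumes A: "bounded_clinear A" and K: "bounded_clinear K"
 shows "horner A K u p ==> horner A K w q ==> horner A K (u + w) (\<lambda>z. p z + q z)"
proof (induction arbitrary: w q rule: horner.induct)
 case horner_zero
 then show ?case by simp
next
 case (horner_step u p v)
 from horner_step.prems show ?case
 proof cases
  case horner_zero
  then show ?thesis using horner.horner_step[OF horner_step.hyps, of v] by simp
 next
  case (horner_step u' p' v')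
  have "horner A K (A (u + u') + K (v + v')) (\<lambda>z. z *\<^sub>C (p z + p' z) + (v + v'))"
   by (intro horner.horner_step horner_step.IH horner_step)
  moreover have "A (u + u') + K (v + v') = A u + K v + w"
   using horner_step by (simp add: bounded_clinearD[OF A] bounded_clinearD[OF K])
  moreover have "(\<lambda>z. z *\<^sub>C (p z + p' z) + (v + v')) = (\<lambda>z. z *\<^sub>C p z + v + q z)"
   using horner_step by (simp add: scaleC_add_right fun_eq_iff)
  ultimately show ?thesis by simp
 qed
qed

lemma horner_scale:
 assumes A: "bounded_clinear A" and K: "bounded_clinear K" and "horner A K u p"
 shows "horner A K (c *\<^sub>C u) (\<lambda>z. c *\<^sub>C p z)"
 using assms(3)
proof (induction rule: horner.induct)
 case horner_zero
 then show ?case by (simp add: horner.horner_zero)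
next
 case (horner_step u p v)
 have "horner A K (A (c *\<^sub>C u) + K (c *\<^sub>C v)) (\<lambda>z. z *\<^sub>C (c *\<^sub>C p z) + c *\<^sub>C v)"
  by (rule horner.horner_step[OF horner_step.IH])
 then show ?case
  by (simp add: bounded_clinearD[OF A] bounded_clinearD[OF K] scaleC_add_right scaleC_scaleC mult.commute)
qed

lemma horner_diff:
 assumes A: "bounded_clinear A" and K: "bounded_clinear K" and "horner A K u p" "horner A K w q"
 shows "horner A K (u - w) (\<lambda>z. p z - q z)"
 using horner_add[OF A K assms(3) horner_scale[OF A K assms(4), of "-1"]] by simp

lemma horner_apply: "bounded_clinear K ==> horner A K u p ==> horner A K (A u) (\<lambda>z. z *\<^sub>C p z)"
 using horner_step[of A K u p 0] by (simp add: bounded_clinearD)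

lemma horner_const: "bounded_clinear A ==> horner A K (K v) (\<lambda>z. v)"
 using horner_step[OF horner_zero, of A K v] by (simp add: bounded_clinearD)

lemma horner_continuous: "horner A K u p ==> continuous_on S p"
 by (induction rule: horner.induct) (auto intro!: continuous_intros)

lemma horner_poly:
 assumes A: "bounded_clinear A" and K: "bounded_clinear K"
 shows "\<exists>u. horner A K u (\<lambda>z. poly P z *\<^sub>C v)"
proof (induction P)
 case 0
 then show ?case using horner_zero by auto
next
 case (pCons c P)
 then obtain u where "horner A K u (\<lambda>z. poly P z *\<^sub>C v)" by blast
 from horner_step[OF this, of "c *\<^sub>C v"] show ?case
  by (auto simp: scaleC_add_left scaleC_scaleC add.commute)
qed

lemma horner_sum:
 assumes A: "bounded_clinear A" and K: "bounded_clinear K" and "finite I" and "!!i. i \<in> I ==> horner A K (u i) (p i)"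
 shows "horner A K (\<Sum>i\<in>I. u i) (\<lambda>z. \<Sum>i\<in>I. p i z)"
 using assms(3,4) by (induction I) (auto intro: horner_zero horner_add[OF A K])

section \<open>Integrals of vector-valued functions\<close>

lemma integral_vec_nth:
 fixes f :: "'a => complex^'m"
 assumes "integrable M f"
 shows "(\<integral>x. f x \<partial>M) $ i = (\<integral>x. f x $ i \<partial>M)"
 using integral_bounded_linear[OF bounded_linear_vec_nth assms] by simp

lemma integral_scaleC:
 fixes f :: "'a => complex^'m"
 assumes "integrable M f"
 shows "integrable M (\<lambda>x. c *\<^sub>C f x)" "(\<integral>x. c *\<^sub>C f x \<partial>M) = c *\<^sub>C (\<integral>x. f x \<partial>M)"
 by (rule integrable_bounded_linear[OF bounded_linear_scaleC assms])
  (rule integral_bounded_linear[OF bounded_linear_scaleC assms])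

lemma bounded_linear_cinner_right: "bounded_linear (\<lambda>y. cinner (x::'a::complex_inner) y)"
 by (rule bounded_bilinear.bounded_linear_right[OF bounded_bilinear_cinner])

lemma integral_cinner_right:
 fixes f :: "'a => complex^'m"
 assumes "integrable M f"
 shows "integrable M (\<lambda>x. cinner w (f x))" "(\<integral>x. cinner w (f x) \<partial>M) = cinner w (\<integral>x. f x \<partial>M)"
 by (rule integrable_bounded_linear[OF bounded_linear_cinner_right assms])
  (rule integral_bounded_linear[OF bounded_linear_cinner_right assms])

lemma norm_vec_sq: "(norm (x::complex^'m))\<^sup>2 = (\<Sum>i\<in>UNIV. (cmod (x $ i))\<^sup>2)"
 by (simp add: norm_vec_def L2_set_def sum_nonneg)

lemma norm_sum_sq_le: "(norm (x + y))\<^sup>2 <= 2 * (norm x)\<^sup>2 + 2 * (norm (y::'a::complex_inner))\<^sup>2"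
 using parallelogram_law[of x y] zero_le_power2[of "norm (x - y)"] by linarith

lemma borel_measurable_vec_component:
 fixes f :: "'a => complex^'m"
 assumes "f \<in> borel_measurable M"
 shows "(\<lambda>x. f x $ i) \<in> borel_measurable M"
 by (rule borel_measurable_continuous_on[OF _ assms]) (intro continuous_intros)

lemma vec_as_sum: "v = (\<Sum>i\<in>UNIV. v $ i *\<^sub>C axis i (1::complex))"
 by (simp add: vec_eq_iff axis_def if_distrib[of "\<lambda>x. _ * x"] cong: if_cong)

lemma borel_measurable_vec_of_components:
 fixes f :: "'m::finite => 'a => complex"
 assumes [measurable]: "!!i. f i \<in> borel_measurable M"
 shows "(\<lambda>x. \<chi> i. f i x) \<in> borel_measurable M"
proof -
 have "(\<lambda>x. \<chi> i. f i x) = (\<lambda>x. \<Sum>i\<in>UNIV. f i x *\<^sub>C axis i 1)"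
  by (rule ext) (subst vec_as_sum, simp)
 then show ?thesis by simp
qed

lemma measurable_complex_continuous [measurable]:
 fixes p :: "complex => complex^'m"
 assumes "continuous_on UNIV p"
 shows "(\<lambda>x. p (complex_of_real x)) \<in> borel_measurable borel"
 by (rule borel_measurable_continuous_on[OF assms]) measurable

lemma matrix_vector_mult_scaleR: "M *v (r *\<^sub>R v) = r *\<^sub>R (M *v (v::complex^'n))"
 using matrix_vector_mult_scaleC[of M "of_real r" v] by (simp add: scaleC_of_real)

locale node =
 fixes A As :: "'h::complex_hilbert => 'h" and K :: "complex^'m => 'h" and Ks :: "'h => complex^'m"
  and J :: "complex^'m^'m" and F :: "real => complex^'m^'m" and a b :: real
 assumes A: "bounded_clinear A" and K: "bounded_clinear K" and Ks: "bounded_clinear Ks"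
  and As: "!!x y. cinner (As x) y = cinner x (A y)"
  and Ks_adj: "!!x v. cinner (Ks x) v = cinner x (K v)"
  and As_eq: "!!x. As x = A x - (2 * \<i>) *\<^sub>C K (J *v Ks x)"
  and J: "ctranspose J = J" "J ** J = mat 1"
  and F_measurable [measurable]: "F \<in> borel_measurable borel"
  and F_bounded: "bounded (range F)" and F_support: "!!x. x \<notin> {a..b} ==> F x = 0"
  and moments: "!!n v. Ks ((A ^^ n) (K v)) = (1 / (4 * pi)) *\<^sub>R (LBINT x. x ^ n *\<^sub>R (F x *v (J *v v)))"
begin

definition F_norm where "F_norm = (SOME B. \<forall>x. norm (F x) <= B)"

lemma F_bound: "norm (F x) <= F_norm"
proof -
 have "\<exists>B. \<forall>x. norm (F x) <= B" using F_bounded by (auto simp: bounded_iff)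
 then show ?thesis unfolding F_norm_def by (rule someI2_ex) blast
qed

lemma J_vector [simp]: "J *v (J *v x) = x"
 by (simp add: matrix_vector_mul_assoc J)

lemma cinner_J: "cinner (J *v x) y = cinner x (J *v y)"
 by (simp add: cinner_matrix_left J)

lemma norm_J [simp]: "norm (J *v x) = norm x"
proof -
 have "(norm (J *v x))\<^sup>2 = (norm x)\<^sup>2"
  using cinner_J[of x "J *v x"] unfolding J_vector cinner_self of_real_eq_iff .
 then show ?thesis by simp
qed

lemma integrable_F:
 assumes "w \<in> borel_measurable borel" "!!x. x \<in> {a..b} ==> norm (w x) <= C"
 shows "integrable lborel (\<lambda>x. F x *v w x)"
proof -
 obtain k where k: "!!(M::complex^'m^'m) v. norm (M *v v) <= norm M * norm v * k" "k \<ge> 0"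
  using bounded_bilinear.nonneg_bounded[OF bounded_bilinear_matrix_vector_mult] by blast
 have B0: "0 <= F_norm" using F_bound[of 0] norm_ge_zero order_trans by blast
 show ?thesis
 proof (rule integrable_bounded_support[where B="F_norm * C * k"])
  show "(\<lambda>x. F x *v w x) \<in> borel_measurable borel" using assms by measurable
  fix x
  show "F x *v w x = 0" if "x \<notin> {a..b}" using F_support[OF that] by simp
  show "norm (F x *v w x) <= F_norm * C * k" if "x \<in> {a..b}"
   using k(1)[of "F x" "w x"] mult_right_mono[OF mult_mono[OF F_bound assms(2)[OF that] B0 norm_ge_zero] k(2)]
   by (rule order_trans)
 qed
qed

lemma integrable_F_horner:
 assumes p: "continuous_on UNIV p" and c: "c \<in> borel_measurable borel" "!!x. x \<in> {a..b} ==> cmod (c x) <= C"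
 shows "integrable lborel (\<lambda>x. c x *\<^sub>C (F x *v (J *v p (complex_of_real x))))"
proof -
 have "continuous_on {a..b} (\<lambda>x. p (complex_of_real x))"
  by (rule continuous_on_compose2[OF p]) (auto intro!: continuous_intros)
 then obtain C' where C': "C' \<ge> 0" "!!x. x \<in> {a..b} ==> norm (p (complex_of_real x)) <= C'"
  by (rule continuous_bounded_Icc) blast
 have "integrable lborel (\<lambda>x. F x *v (c x *\<^sub>C (J *v p (complex_of_real x))))"
 proof (rule integrable_F)
  show "(\<lambda>x. c x *\<^sub>C (J *v p (complex_of_real x))) \<in> borel_measurable borel"
   using p c(1) by measurable
  show "norm (c x *\<^sub>C (J *v p (complex_of_real x))) <= \<bar>C\<bar> * C'" if "x \<in> {a..b}" for x
   unfolding norm_scaleC norm_J using C'(2)[OF that] c(2)[OF that] by (intro mult_mono) auto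
 qed
 then show ?thesis by (simp add: matrix_vector_mult_scaleC)
qed

lemma horner_moment:
 assumes "horner A K u p"
 shows "Ks ((A ^^ n) u) = (1 / (4 * pi)) *\<^sub>R (LBINT x. x ^ n *\<^sub>R (F x *v (J *v p (of_real x))))"
 using assms
proof (induction arbitrary: n rule: horner.induct)
 case horner_zero
 have "(A ^^ n) 0 = 0" for n by (induction n) (simp_all add: bounded_clinearD[OF A])
 then show ?case by (simp add: bounded_clinearD[OF Ks])
next
 case (horner_step u p v)
 have add: "(A ^^ n) (x + y) = (A ^^ n) x + (A ^^ n) y" for n x y
  by (induction n) (simp_all add: bounded_clinearD[OF A])
 have p: "continuous_on UNIV p" using horner_step.hyps by (rule horner_continuous)
 have i: "integrable lborel (\<lambda>x. x ^ n *\<^sub>R (F x *v (J *v q (complex_of_real x))))" if q: "continuous_on UNIV q" for q n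
 proof -
  obtain C where C: "C \<ge> 0" "!!x. x \<in> {a..b} ==> norm (x ^ n) <= C"
   by (rule continuous_bounded_Icc[of a b "\<lambda>x. x ^ n"]) (auto intro!: continuous_intros)
  have "integrable lborel (\<lambda>x. of_real (x ^ n) *\<^sub>C (F x *v (J *v q (complex_of_real x))))"
   by (rule integrable_F_horner[OF q, where C=C]) (use C(2) in \<open>auto simp: norm_power power_abs\<close>)
  then show ?thesis by (simp only: scaleC_of_real)
 qed
 have "Ks ((A ^^ n) (A u + K v)) = Ks ((A ^^ Suc n) u) + Ks ((A ^^ n) (K v))"
  by (simp add: add bounded_clinearD[OF Ks] funpow_swap1)
 also have "... = (1 / (4 * pi)) *\<^sub>R ((LBINT x. x ^ Suc n *\<^sub>R (F x *v (J *v p (of_real x)))) + (LBINT x. x ^ n *\<^sub>R (F x *v (J *v v))))"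
  by (simp only: horner_step.IH moments scaleR_add_right)
 also have "(LBINT x. x ^ Suc n *\<^sub>R (F x *v (J *v p (of_real x)))) + (LBINT x. x ^ n *\<^sub>R (F x *v (J *v v)))
   = (LBINT x. x ^ n *\<^sub>R (F x *v (J *v (of_real x *\<^sub>C p (of_real x) + v))))"
 proof (subst Bochner_Integration.integral_add[symmetric])
  show "integrable lborel (\<lambda>x. x ^ Suc n *\<^sub>R (F x *v (J *v p (of_real x))))" by (rule i[OF p])
  show "integrable lborel (\<lambda>x. x ^ n *\<^sub>R (F x *v (J *v v)))" by (rule i[of "\<lambda>_. v"]) (rule continuous_on_const)
  show "(LBINT x. x ^ Suc n *\<^sub>R (F x *v (J *v p (of_real x))) + x ^ n *\<^sub>R (F x *v (J *v v))) =
    (LBINT x. x ^ n *\<^sub>R (F x *v (J *v (of_real x *\<^sub>C p (of_real x) + v))))"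
   by (simp add: matrix_vector_right_distrib scaleR_add_right matrix_vector_mult_scaleR scaleC_of_real mult.commute)
 qed
 finally show ?case .
qed

definition ctrans :: "(real => complex^'m) => complex => complex^'m" where
 "ctrans w z = (LBINT x. (1 / (complex_of_real x - z)) *\<^sub>C (F x *v w x))"

text \<open>This is \<open>W(z) w\<close>, written through the Cauchy representation, so that the
  estimates refer to the density \<open>F\<close> alone.\<close>

definition char_action :: "complex => complex^'m => complex^'m" where
 "char_action z w = w + (1 / (2 * of_real pi * \<i>)) *\<^sub>C ctrans (\<lambda>_. w) z"

lemma integrable_ctrans:
 assumes p: "continuous_on UNIV p" and z: "Im z \<noteq> 0"
 shows "integrable lborel (\<lambda>x. (1 / (complex_of_real x - z)) *\<^sub>C (F x *v (J *v p (complex_of_real x))))"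
 by (rule integrable_F_horner[OF p _ norm_inverse_nonreal[OF z]]) measurable

text \<open>Moving \<open>A\<close> to the right replaces it by \<open>As\<close>; the correction
  \<open>K (J *v Ks u)\<close> enters the next constant coefficient, whence the recursion
  \<open>r' = z r + v + 2 i J Ks u\<close>. The last clause is an identity between a polynomial and
  Cauchy integrals: the two integrals combine to one with the divided difference
  \<open>(p z - p x) / (x - z)\<close> in place of the singular kernel.\<close>

lemma remainder_polynomial:
 assumes "horner A K u p"
 shows "\<exists>r. continuous_on UNIV r \<and>
  (\<forall>y q. horner A K y q \<longrightarrow> cinner u y = of_real (1 / (4 * pi)) * (LBINT x. cinner (r (of_real x)) (F x *v (J *v q (of_real x))))) \<and>
  (\<forall>z. Im z \<noteq> 0 \<longrightarrow> r z = J *v char_action z (J *v p z) + (2 * \<i>) *\<^sub>C (J *v ((1 / (4 * pi)) *\<^sub>R ctrans (\<lambda>x. J *v p (of_real x)) z)))"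
 using assms
proof (induction rule: horner.induct)
 case horner_zero
 show ?case
  by (rule exI[of _ "\<lambda>_. 0"]) (simp add: char_action_def ctrans_def)
next
 case (horner_step u p v)
 then obtain r where r: "continuous_on UNIV r"
  and pair: "!!y q. horner A K y q ==> cinner u y = of_real (1 / (4 * pi)) * (LBINT x. cinner (r (of_real x)) (F x *v (J *v q (of_real x))))"
  and rz: "!!z. Im z \<noteq> 0 ==> r z = J *v char_action z (J *v p z) + (2 * \<i>) *\<^sub>C (J *v ((1 / (4 * pi)) *\<^sub>R ctrans (\<lambda>x. J *v p (of_real x)) z))"
  by blast
 have p: "continuous_on UNIV p" using horner_step.hyps by (rule horner_continuous)
 define w where "w = v + (2 * \<i>) *\<^sub>C (J *v Ks u)"
 define r' where "r' = (\<lambda>z. z *\<^sub>C r z + w)"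
 have rm: "(\<lambda>x. r (complex_of_real x)) \<in> borel_measurable borel" using r by measurable
 have Ks0: "Ks y = (1 / (4 * pi)) *\<^sub>R (LBINT x. F x *v (J *v q (of_real x)))" if "horner A K y q" for y q
  using horner_moment[OF that, of 0] by simp
 have i1: "integrable lborel (\<lambda>x. F x *v (J *v q (complex_of_real x)))" if q: "continuous_on UNIV q" for q
  using integrable_F_horner[OF q, of "\<lambda>_. 1" 1] by simp
 show ?case
 proof (intro exI[of _ r'] conjI allI impI)
  show "continuous_on UNIV r'" unfolding r'_def by (intro continuous_intros r)
 next
  fix y q assume y: "horner A K y q"
  have q: "continuous_on UNIV q" using y by (rule horner_continuous)
  have "cinner (A u + K v) y = cinner u (As y) + cinner v (Ks y)"
   unfolding cinner_add_left by (metis As Ks_adj cinner_commute)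
  also have "cinner u (As y) = cinner u (A y) + cinner ((2 * \<i>) *\<^sub>C (J *v Ks u)) (Ks y)"
   by (simp add: As_eq cinner_diff_right cinner_scaleC_right cinner_scaleC_left cinner_J flip: Ks_adj)
  finally have 1: "cinner (A u + K v) y = cinner u (A y) + cinner w (Ks y)"
   by (simp add: w_def cinner_add_left)
  have int1: "integrable lborel (\<lambda>x. cinner (of_real x *\<^sub>C r (of_real x)) (F x *v (J *v q (of_real x))))"
  proof -
   have "continuous_on {a..b} (\<lambda>x. of_real x *\<^sub>C r (complex_of_real x))"
    by (intro continuous_intros continuous_on_compose2[OF r]) auto
   then obtain C where C: "C \<ge> 0" "!!x. x \<in> {a..b} ==> norm (of_real x *\<^sub>C r (complex_of_real x)) <= C"
    by (rule continuous_bounded_Icc) blast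
   show ?thesis
   proof (rule Bochner_Integration.integrable_bound)
    show "integrable lborel (\<lambda>x. C * norm (F x *v (J *v q (of_real x))))"
     using i1[OF q] by simp
    show "(\<lambda>x. cinner (of_real x *\<^sub>C r (of_real x)) (F x *v (J *v q (of_real x)))) \<in> borel_measurable lborel"
     using rm q by measurable
    show "AE x in lborel. norm (cinner (of_real x *\<^sub>C r (of_real x)) (F x *v (J *v q (of_real x)))) <= norm (C * norm (F x *v (J *v q (of_real x))))"
    proof (rule AE_I2)
     fix x
     show "norm (cinner (of_real x *\<^sub>C r (of_real x)) (F x *v (J *v q (of_real x)))) <= norm (C * norm (F x *v (J *v q (of_real x))))"
     proof (cases "x \<in> {a..b}")
      case True
      have "norm (cinner (of_real x *\<^sub>C r (of_real x)) (F x *v (J *v q (of_real x)))) <= norm (of_real x *\<^sub>C r (complex_of_real x)) * norm (F x *v (J *v q (of_real x)))"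
       by (rule cinner_Cauchy_Schwarz)
      also have "... <= C * norm (F x *v (J *v q (of_real x)))" by (intro mult_right_mono C(2) True) simp
      finally show ?thesis using C(1) by (simp add: abs_mult)
     qed (simp add: F_support)
    qed
   qed
  qed
  have "cinner u (A y) = of_real (1 / (4 * pi)) * (LBINT x. cinner (of_real x *\<^sub>C r (of_real x)) (F x *v (J *v q (of_real x))))"
   using pair[OF horner_apply[OF K y]] by (simp add: matrix_vector_mult_scaleC cinner_scaleC_right cinner_scaleC_left)
  moreover have "cinner w (Ks y) = of_real (1 / (4 * pi)) * (LBINT x. cinner w (F x *v (J *v q (of_real x))))"
   unfolding Ks0[OF y] cinner_scaleR_right integral_cinner_right(2)[OF i1[OF q]] ..
  ultimately have "cinner (A u + K v) y = of_real (1 / (4 * pi)) * ((LBINT x. cinner (of_real x *\<^sub>C r (of_real x)) (F x *v (J *v q (of_real x)))) + (LBINT x. cinner w (F x *v (J *v q (of_real x)))))"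
   unfolding 1 by (simp only: distrib_left)
  also have "(LBINT x. cinner (of_real x *\<^sub>C r (of_real x)) (F x *v (J *v q (of_real x)))) + (LBINT x. cinner w (F x *v (J *v q (of_real x))))
    = (LBINT x. cinner (r' (of_real x)) (F x *v (J *v q (of_real x))))"
   by (subst Bochner_Integration.integral_add[OF int1 integral_cinner_right(1)[OF i1[OF q]], symmetric])
    (simp add: r'_def cinner_add_left)
  finally show "cinner (A u + K v) y = of_real (1 / (4 * pi)) * (LBINT x. cinner (r' (of_real x)) (F x *v (J *v q (of_real x))))" .
 next
  fix z assume z: "Im z \<noteq> 0"
  have nz: "complex_of_real x - z \<noteq> 0" for x by (rule of_real_minus_nonreal(1)[OF z])
  let ?g = "ctrans (\<lambda>x. J *v p (of_real x)) z" and ?I = "ctrans (\<lambda>_. J *v v) z"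
  have Iv: "integrable lborel (\<lambda>x. (1 / (complex_of_real x - z)) *\<^sub>C (F x *v (J *v v)))"
   using integrable_ctrans[of "\<lambda>_. v", OF _ z] by simp
  have g': "ctrans (\<lambda>x. J *v (of_real x *\<^sub>C p (of_real x) + v)) z = (LBINT x. F x *v (J *v p (of_real x))) + z *\<^sub>C ?g + ?I"
  proof -
   have "(1 / (complex_of_real x - z)) *\<^sub>C (F x *v (J *v (of_real x *\<^sub>C p (of_real x) + v))) =
     F x *v (J *v p (of_real x)) + z *\<^sub>C ((1 / (complex_of_real x - z)) *\<^sub>C (F x *v (J *v p (of_real x)))) + (1 / (complex_of_real x - z)) *\<^sub>C (F x *v (J *v v))" for x
   proof -
    have "(1 / (complex_of_real x - z)) * of_real x = 1 + z * (1 / (complex_of_real x - z))"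
     using nz[of x] by (simp add: field_simps)
    then show ?thesis
     by (simp add: matrix_vector_right_distrib scaleC_add_right matrix_vector_mult_scaleC scaleC_scaleC)
      (simp add: scaleC_add_left)
   qed
   then show ?thesis
    unfolding ctrans_def
    by (simp add: Iv i1[OF p] integrable_ctrans[OF p z] integral_scaleC[OF integrable_ctrans[OF p z]])
  qed
  have lin: "char_action z (J *v (z *\<^sub>C p z + v)) = z *\<^sub>C char_action z (J *v p z) + char_action z (J *v v)"
  proof -
   have Ip: "integrable lborel (\<lambda>x. (1 / (complex_of_real x - z)) *\<^sub>C (F x *v (J *v p z)))"
    using integrable_ctrans[of "\<lambda>_. p z", OF _ z] by simp
   have "ctrans (\<lambda>_. J *v (z *\<^sub>C p z + v)) z = z *\<^sub>C ctrans (\<lambda>_. J *v p z) z + ctrans (\<lambda>_. J *v v) z"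
   proof -
    have "(1 / (complex_of_real x - z)) *\<^sub>C (F x *v (J *v (z *\<^sub>C p z + v))) =
      z *\<^sub>C ((1 / (complex_of_real x - z)) *\<^sub>C (F x *v (J *v p z))) + (1 / (complex_of_real x - z)) *\<^sub>C (F x *v (J *v v))" for x
     by (simp add: matrix_vector_right_distrib scaleC_add_right matrix_vector_mult_scaleC scaleC_scaleC mult.commute)
    then show ?thesis
     unfolding ctrans_def by (simp add: Iv integral_scaleC[OF Ip])
   qed
   then show ?thesis
    by (simp add: char_action_def matrix_vector_right_distrib scaleC_add_right matrix_vector_mult_scaleC scaleC_scaleC mult.commute)
  qed
  have Ksu: "(1 / (4 * pi)) *\<^sub>R (LBINT x. F x *v (J *v p (of_real x))) = Ks u"
   using Ks0[OF horner_step.hyps] by simp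
  \<comment> \<open>The Cauchy integral of the constant \<open>v\<close> enters with the factor
    \<open>1 / (2 \<pi> i)\<close> through \<open>char_action\<close> and with
    \<open>2 i / (4 \<pi>)\<close> through the density. These are opposite numbers, so the new
    coefficient leaves only a polynomial contribution.\<close>
  have cancel: "(1 / (2 * of_real pi * \<i>)) *\<^sub>C (J *v ?I) + (2 * \<i>) *\<^sub>C (J *v ((1 / (4 * pi)) *\<^sub>R ?I)) = 0"
  proof -
   have "(2 * \<i>) *\<^sub>C (J *v ((1 / (4 * pi)) *\<^sub>R ?I)) = (2 * \<i> * of_real (1 / (4 * pi))) *\<^sub>C (J *v ?I)"
    unfolding scaleC_of_real[symmetric] by (simp only: matrix_vector_mult_scaleC scaleC_scaleC)
   moreover have "1 / (2 * of_real pi * \<i>) + 2 * \<i> * complex_of_real (1 / (4 * pi)) = 0"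
    by (simp add: field_simps)
   ultimately show ?thesis by (metis scaleC_add_left scaleC_zero_left)
  qed
  have "J *v char_action z (J *v v) = v + (1 / (2 * of_real pi * \<i>)) *\<^sub>C (J *v ?I)"
   by (simp add: char_action_def matrix_vector_right_distrib matrix_vector_mult_scaleC)
  then have "J *v char_action z (J *v (z *\<^sub>C p z + v)) = z *\<^sub>C (J *v char_action z (J *v p z)) + v + (1 / (2 * of_real pi * \<i>)) *\<^sub>C (J *v ?I)"
   by (simp only: lin matrix_vector_right_distrib[of J "z *\<^sub>C char_action z (J *v p z)"] matrix_vector_mult_scaleC add.assoc)
  moreover have "(2 * \<i>) *\<^sub>C (J *v ((1 / (4 * pi)) *\<^sub>R ctrans (\<lambda>x. J *v (of_real x *\<^sub>C p (of_real x) + v)) z))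
    = (2 * \<i>) *\<^sub>C (J *v Ks u) + z *\<^sub>C ((2 * \<i>) *\<^sub>C (J *v ((1 / (4 * pi)) *\<^sub>R ?g))) + (2 * \<i>) *\<^sub>C (J *v ((1 / (4 * pi)) *\<^sub>R ?I))"
   unfolding g' scaleR_add_right Ksu
   by (simp add: matrix_vector_right_distrib scaleC_add_right matrix_vector_mult_scaleC scaleC_scaleC mult.commute flip: scaleC_scaleR)
  ultimately show "r' z = J *v char_action z (J *v (z *\<^sub>C p z + v)) + (2 * \<i>) *\<^sub>C (J *v ((1 / (4 * pi)) *\<^sub>R ctrans (\<lambda>x. J *v (of_real x *\<^sub>C p (of_real x) + v)) z))"
   using cancel by (simp add: r'_def rz[OF z] w_def scaleC_add_right add_ac)
 qed
qed

lemma ctrans_boundary: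
 assumes w[measurable]: "w \<in> borel_measurable borel" and wC: "!!x. x \<in> {a..b} ==> norm (w x) <= C"
 shows "\<exists>Gp Gm :: real => complex^'m. Gp \<in> borel_measurable borel \<and> Gm \<in> borel_measurable borel \<and>
  integrable lborel (\<lambda>x. (norm (Gp x))\<^sup>2) \<and> integrable lborel (\<lambda>x. (norm (Gm x))\<^sup>2) \<and>
  (LBINT x. (norm (Gp x))\<^sup>2) <= 4 * pi\<^sup>2 * (LBINT x. (norm (F x *v w x))\<^sup>2) \<and>
  (LBINT x. (norm (Gm x))\<^sup>2) <= 4 * pi\<^sup>2 * (LBINT x. (norm (F x *v w x))\<^sup>2) \<and>
  (AE x in lborel. ((\<lambda>y. ctrans w (Complex x y)) \<longlongrightarrow> Gp x) (at_right 0) \<and>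
    ((\<lambda>y. ctrans w (Complex x (- y))) \<longlongrightarrow> Gm x) (at_right 0) \<and>
    Gp x - Gm x = (2 * of_real pi * \<i>) *\<^sub>C (F x *v w x))"
proof -
 obtain k where k: "!!(M::complex^'m^'m) v. norm (M *v v) <= norm M * norm v * k" "k \<ge> 0"
  using bounded_bilinear.nonneg_bounded[OF bounded_bilinear_matrix_vector_mult] by blast
 have B0: "0 <= F_norm" using F_bound[of 0] norm_ge_zero order_trans by blast
 define M where "M = \<bar>F_norm * C * k\<bar>"
 have FwM: "norm (F x *v w x) <= M" for x
 proof (cases "x \<in> {a..b}")
  case True
  have "norm (F x *v w x) <= norm (F x) * norm (w x) * k" by (rule k)
  also have "... <= F_norm * C * k" using wC[OF True] F_bound B0 k(2) by (intro mult_right_mono mult_mono) auto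
  finally show ?thesis by (simp add: M_def)
 qed (simp add: F_support M_def)
 define L where "L = max \<bar>a\<bar> \<bar>b\<bar>"
 have L: "L \<ge> 0" by (simp add: L_def)
 have supp: "F x *v w x = 0" if "\<bar>x\<bar> > L" for x
 proof -
  have "x \<notin> {a..b}" using that by (auto simp: L_def)
  then show ?thesis by (simp add: F_support)
 qed
 define h where "h = (\<lambda>i x. (F x *v w x) $ i)"
 have hm[measurable]: "h i \<in> borel_measurable borel" for i
  unfolding h_def by (rule borel_measurable_vec_component) measurable
 have hM: "cmod (h i x) <= M" for i x
  unfolding h_def using Finite_Cartesian_Product.norm_nth_le FwM order_trans by blast
 have hs: "h i x = 0" if "\<bar>x\<bar> > L" for i x using supp[OF that] by (simp add: h_def)
 define PP where "PP = (\<lambda>i Gp Gm. Gp \<in> borel_measurable borel \<and> Gm \<in> borel_measurable borel \<and>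
  integrable lborel (\<lambda>x. (cmod (Gp x))\<^sup>2) \<and> integrable lborel (\<lambda>x. (cmod (Gm x))\<^sup>2) \<and>
  (LBINT x. (cmod (Gp x))\<^sup>2) <= 4 * pi\<^sup>2 * (LBINT x. (cmod (h i x))\<^sup>2) \<and>
  (LBINT x. (cmod (Gm x))\<^sup>2) <= 4 * pi\<^sup>2 * (LBINT x. (cmod (h i x))\<^sup>2) \<and>
  (AE x in lborel. ((\<lambda>y. cauchy_transform (h i) (Complex x y)) \<longlongrightarrow> Gp x) (at_right 0) \<and>
    ((\<lambda>y. cauchy_transform (h i) (Complex x (- y))) \<longlongrightarrow> Gm x) (at_right 0) \<and>
    Gp x - Gm x = 2 * of_real pi * \<i> * h i x))"
 have "\<forall>i. \<exists>G H. PP i G H"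
  unfolding PP_def by (intro allI cauchy_transform_boundary[OF hm hM hs L])
 then obtain gp where "\<forall>i. \<exists>H. PP i (gp i) H"
  using choice[of "\<lambda>i G. \<exists>H. PP i G H"] by blast
 then obtain gm where "\<forall>i. PP i (gp i) (gm i)"
  using choice[of "\<lambda>i H. PP i (gp i) H"] by blast
 then have g: "!!i. gp i \<in> borel_measurable borel" "!!i. gm i \<in> borel_measurable borel"
  "!!i. integrable lborel (\<lambda>x. (cmod (gp i x))\<^sup>2)" "!!i. integrable lborel (\<lambda>x. (cmod (gm i x))\<^sup>2)"
  "!!i. (LBINT x. (cmod (gp i x))\<^sup>2) <= 4 * pi\<^sup>2 * (LBINT x. (cmod (h i x))\<^sup>2)"
  "!!i. (LBINT x. (cmod (gm i x))\<^sup>2) <= 4 * pi\<^sup>2 * (LBINT x. (cmod (h i x))\<^sup>2)"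
  "!!i. AE x in lborel. ((\<lambda>y. cauchy_transform (h i) (Complex x y)) \<longlongrightarrow> gp i x) (at_right 0) \<and>
    ((\<lambda>y. cauchy_transform (h i) (Complex x (- y))) \<longlongrightarrow> gm i x) (at_right 0) \<and>
    gp i x - gm i x = 2 * of_real pi * \<i> * h i x"
  unfolding PP_def by blast+
 define Gp :: "real => complex^'m" where "Gp = (\<lambda>x. \<chi> i. gp i x)"
 define Gm :: "real => complex^'m" where "Gm = (\<lambda>x. \<chi> i. gm i x)"
 have meas: "Gp \<in> borel_measurable borel" "Gm \<in> borel_measurable borel"
  unfolding Gp_def Gm_def using g(1,2) by (auto intro!: borel_measurable_vec_of_components)
 have iF: "integrable lborel (\<lambda>x. F x *v w x)" by (rule integrable_F[OF w wC])
 have ih: "integrable lborel (h i)" for i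
  unfolding h_def by (rule integrable_bounded_linear[OF bounded_linear_vec_nth iF])
 have ihsq: "integrable lborel (\<lambda>x. (cmod (h i x))\<^sup>2)" for i
  by (rule integrable_bounded_support[where B="M\<^sup>2" and a="-L" and b=L])
   (use hM hs in \<open>auto simp: power_mono\<close>)
 have nFw: "(LBINT x. (norm (F x *v w x))\<^sup>2) = (\<Sum>i\<in>UNIV. LBINT x. (cmod (h i x))\<^sup>2)"
  unfolding norm_vec_sq by (subst Bochner_Integration.integral_sum[symmetric]) (use ihsq in \<open>auto simp: h_def\<close>)
 have norms: "integrable lborel (\<lambda>x. (norm (\<chi> i. f i x))\<^sup>2)"
  "(LBINT x. (norm (\<chi> i. f i x))\<^sup>2) <= 4 * pi\<^sup>2 * (LBINT x. (norm (F x *v w x))\<^sup>2)"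
  if f: "!!i::'m. integrable lborel (\<lambda>x. (cmod (f i x))\<^sup>2)" "!!i. (LBINT x. (cmod (f i x))\<^sup>2) <= 4 * pi\<^sup>2 * (LBINT x. (cmod (h i x))\<^sup>2)" for f :: "'m => real => complex"
 proof -
  show "integrable lborel (\<lambda>x. (norm (\<chi> i. f i x))\<^sup>2)" using f(1) by (simp add: norm_vec_sq)
  have "(LBINT x. (norm (\<chi> i. f i x))\<^sup>2) = (\<Sum>i\<in>UNIV. LBINT x. (cmod (f i x))\<^sup>2)"
   using f(1) by (simp add: norm_vec_sq)
  also have "... <= (\<Sum>i\<in>UNIV. 4 * pi\<^sup>2 * (LBINT x. (cmod (h i x))\<^sup>2))" by (intro sum_mono f)
  finally show "(LBINT x. (norm (\<chi> i. f i x))\<^sup>2) <= 4 * pi\<^sup>2 * (LBINT x. (norm (F x *v w x))\<^sup>2)"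
   by (simp add: nFw sum_distrib_left)
 qed
 have comp: "ctrans w z $ i = cauchy_transform (h i) z" if z: "Im z \<noteq> 0" for z i
 proof -
  have "integrable lborel (\<lambda>x. (1 / (complex_of_real x - z)) *\<^sub>C (F x *v w x))"
  proof (rule Bochner_Integration.integrable_bound)
   show "integrable lborel (\<lambda>x. (1 / \<bar>Im z\<bar>) * norm (F x *v w x))" using iF by simp
   show "AE x in lborel. norm ((1 / (complex_of_real x - z)) *\<^sub>C (F x *v w x)) <= norm ((1 / \<bar>Im z\<bar>) * norm (F x *v w x))"
    unfolding norm_scaleC norm_mult using norm_inverse_nonreal[OF z] by (intro AE_I2 mult_mono) (auto simp: norm_divide)
  qed measurable
  then show ?thesis
   unfolding ctrans_def cauchy_transform_def by (simp add: integral_vec_nth h_def)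
 qed
 have ae: "AE x in lborel. ((\<lambda>y. ctrans w (Complex x y)) \<longlongrightarrow> Gp x) (at_right 0) \<and>
    ((\<lambda>y. ctrans w (Complex x (- y))) \<longlongrightarrow> Gm x) (at_right 0) \<and>
    Gp x - Gm x = (2 * of_real pi * \<i>) *\<^sub>C (F x *v w x)"
 proof -
  have "AE x in lborel. \<forall>i. ((\<lambda>y. cauchy_transform (h i) (Complex x y)) \<longlongrightarrow> gp i x) (at_right 0) \<and>
    ((\<lambda>y. cauchy_transform (h i) (Complex x (- y))) \<longlongrightarrow> gm i x) (at_right 0) \<and>
    gp i x - gm i x = 2 * of_real pi * \<i> * h i x"
   using g(7) by (intro AE_all_countable[THEN iffD2] allI)
  then show ?thesis
  proof eventually_elim
   case (elim x)
   have ev: "\<forall>\<^sub>F y in at_right (0::real). y > 0" by (rule eventually_at_right_less)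
   have "((\<lambda>y. ctrans w (Complex x y)) \<longlongrightarrow> Gp x) (at_right 0)"
   proof (rule vec_tendstoI)
    fix i
    have "((\<lambda>y. cauchy_transform (h i) (Complex x y)) \<longlongrightarrow> Gp x $ i) (at_right 0)" using elim by (simp add: Gp_def)
    then show "((\<lambda>y. ctrans w (Complex x y) $ i) \<longlongrightarrow> Gp x $ i) (at_right 0)"
     by (rule Lim_transform_eventually) (use ev in eventually_elim, simp add: comp)
   qed
   moreover have "((\<lambda>y. ctrans w (Complex x (- y))) \<longlongrightarrow> Gm x) (at_right 0)"
   proof (rule vec_tendstoI)
    fix i
    have "((\<lambda>y. cauchy_transform (h i) (Complex x (- y))) \<longlongrightarrow> Gm x $ i) (at_right 0)" using elim by (simp add: Gm_def)
    then show "((\<lambda>y. ctrans w (Complex x (- y)) $ i) \<longlongrightarrow> Gm x $ i) (at_right 0)"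
     by (rule Lim_transform_eventually) (use ev in eventually_elim, simp add: comp)
   qed
   moreover have "Gp x - Gm x = (2 * of_real pi * \<i>) *\<^sub>C (F x *v w x)"
    using elim by (simp add: vec_eq_iff Gp_def Gm_def h_def)
   ultimately show ?case by blast
  qed
 qed
 show ?thesis
  using meas norms[OF g(3,5)] norms[OF g(4,6)] ae unfolding Gp_def Gm_def by blast
qed

end

text \<open>Isolates what the upper estimate uses. \<open>Q_eq\<close> says that the averaged
  boundary value, paired with the jump \<open>F\<close>, gives the weight. The weight is abstract
  because the estimate is applied twice: with \<open>Q1\<close> to a node, and with
  \<open>J ** Q2 x ** J\<close> to its adjoint.\<close>

locale boundary_node = node A As K Ks J F a b
 for A As :: "'h::complex_hilbert => 'h" and K :: "complex^'m => 'h" and Ks J F a b +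
 fixes Wp Wm Q :: "real => complex^'m^'m" and C :: real
 assumes boundary: "!!w. AE x in lborel. x \<in> {a..b} \<longrightarrow>
   ((\<lambda>y. char_action (Complex x y) w) \<longlongrightarrow> Wp x *v w) (at_right 0) \<and>
   ((\<lambda>y. char_action (Complex x (- y)) w) \<longlongrightarrow> Wm x *v w) (at_right 0)"
  and Q_measurable [measurable]: "Q \<in> borel_measurable borel" and Q_support: "!!x. x \<notin> {a..b} ==> Q x = 0"
  and Q_eq: "AE x in lborel. x \<in> {a..b} \<longrightarrow> (\<forall>v. cinner ((J ** (Wp x + Wm x)) *v v) (F x *v v) = cinner v (Q x *v v))"
  and Q_bounds: "AE x in lborel. x \<in> {a..b} \<longrightarrow> (\<forall>v. 0 <= Re (cinner v (Q x *v v)) \<and> Re (cinner v (Q x *v v)) <= C * (norm v)\<^sup>2)"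
  and F_le_Q: "AE x in lborel. x \<in> {a..b} \<longrightarrow> (\<forall>v. (norm (F x *v v))\<^sup>2 <= C * Re (cinner v (Q x *v v)))"
begin

lemma Q_nonneg: "AE x in lborel. \<forall>v. 0 <= Re (cinner v (Q x *v v))"
 using Q_bounds
proof eventually_elim
 case (elim x)
 then show ?case by (cases "x \<in> {a..b}") (auto simp: Q_support)
qed

lemma integrable_Q:
 assumes [measurable]: "w \<in> borel_measurable borel" and w: "!!x. x \<in> {a..b} ==> norm (w x) <= D"
 shows "integrable lborel (\<lambda>x. Re (cinner (w x) (Q x *v w x)))"
proof (rule Bochner_Integration.integrable_bound)
 show "integrable lborel (\<lambda>x. \<bar>C * D\<^sup>2\<bar> * indicator {a..b} x)"
  by (intro integrable_mult_right integrable_real_indicator) (auto simp: emeasure_lborel_Icc_eq)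
 show "AE x in lborel. norm (Re (cinner (w x) (Q x *v w x))) <= norm (\<bar>C * D\<^sup>2\<bar> * indicator {a..b} x)"
  using Q_bounds
 proof eventually_elim
  case (elim x)
  show ?case
  proof (cases "x \<in> {a..b}")
   case True
   have "Re (cinner (w x) (Q x *v w x)) <= \<bar>C\<bar> * D\<^sup>2"
   proof -
    have "Re (cinner (w x) (Q x *v w x)) <= C * (norm (w x))\<^sup>2" using elim True by blast
    also have "... <= \<bar>C\<bar> * (norm (w x))\<^sup>2" by (intro mult_right_mono) auto
    also have "... <= \<bar>C\<bar> * D\<^sup>2" by (intro mult_left_mono power_mono w True) auto
    finally show ?thesis .
   qed
   then show ?thesis using elim True by (simp add: abs_mult)
  qed (simp add: Q_support)
 qed
qed measurable

text \<open>
 On the boundary the remainder polynomial is \<open>r = J W\<^sub>\<plusminus> J p + 2 i J g\<^sub>\<plusminus>\<close>. In the average of both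
 representations the first term pairs with \<open>F J p\<close> to half the weight, and the Cauchy integrals \<open>g\<^sub>\<plusminus>\<close>
 are bounded in \<open>L\<^sup>2\<close> by their density \<open>F J p\<close>.
\<close>

lemma horner_norm_bound:
 assumes u: "horner A K u p"
 shows "(norm u)\<^sup>2 <= (1 / (4 * pi)) * (1 / 2 + C) * (LBINT x. Re (cinner (J *v p (of_real x)) (Q x *v (J *v p (of_real x)))))"
proof -
 define q where "q = (\<lambda>x. J *v p (complex_of_real x))"
 have p: "continuous_on UNIV p" using u by (rule horner_continuous)
 have qm[measurable]: "q \<in> borel_measurable borel" unfolding q_def using p by measurable
 have "continuous_on {a..b} (\<lambda>x. p (complex_of_real x))"
  by (rule continuous_on_compose2[OF p]) (auto intro!: continuous_intros)
 then obtain D where D: "!!x. x \<in> {a..b} ==> norm (p (complex_of_real x)) <= D"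
  by (rule continuous_bounded_Icc) blast
 have qD: "norm (q x) <= D" if "x \<in> {a..b}" for x using D[OF that] by (simp add: q_def)
 obtain r where r: "continuous_on UNIV r"
  and pair: "!!y q. horner A K y q ==> cinner u y = of_real (1 / (4 * pi)) * (LBINT x. cinner (r (of_real x)) (F x *v (J *v q (of_real x))))"
  and rz: "!!z. Im z \<noteq> 0 ==> r z = J *v char_action z (J *v p z) + (2 * \<i>) *\<^sub>C (J *v ((1 / (4 * pi)) *\<^sub>R ctrans (\<lambda>x. J *v p (of_real x)) z))"
  using remainder_polynomial[OF u] by blast
 obtain Gp Gm :: "real => complex^'m" where G [measurable]: "Gp \<in> borel_measurable borel" "Gm \<in> borel_measurable borel"
  and Gi: "integrable lborel (\<lambda>x. (norm (Gp x))\<^sup>2)" "integrable lborel (\<lambda>x. (norm (Gm x))\<^sup>2)"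
  and Gn: "(LBINT x. (norm (Gp x))\<^sup>2) <= 4 * pi\<^sup>2 * (LBINT x. (norm (F x *v q x))\<^sup>2)"
   "(LBINT x. (norm (Gm x))\<^sup>2) <= 4 * pi\<^sup>2 * (LBINT x. (norm (F x *v q x))\<^sup>2)"
  and Gl: "AE x in lborel. ((\<lambda>y. ctrans q (Complex x y)) \<longlongrightarrow> Gp x) (at_right 0) \<and>
    ((\<lambda>y. ctrans q (Complex x (- y))) \<longlongrightarrow> Gm x) (at_right 0) \<and>
    Gp x - Gm x = (2 * of_real pi * \<i>) *\<^sub>C (F x *v q x)"
  using ctrans_boundary[OF qm qD] by blast
 have iQ: "integrable lborel (\<lambda>x. Re (cinner (q x) (Q x *v q x)))" by (rule integrable_Q[OF qm qD])
 have Q0: "0 <= (LBINT x. Re (cinner (q x) (Q x *v q x)))"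
  by (rule integral_nonneg_AE, use Q_nonneg in eventually_elim) blast
 have iF: "integrable lborel (\<lambda>x. (norm (F x *v q x))\<^sup>2)"
  and FQ: "(LBINT x. (norm (F x *v q x))\<^sup>2) <= C * (LBINT x. Re (cinner (q x) (Q x *v q x)))"
 proof -
  have le: "AE x in lborel. (norm (F x *v q x))\<^sup>2 <= C * Re (cinner (q x) (Q x *v q x))"
   using F_le_Q
  proof eventually_elim
   case (elim x)
   then show ?case by (cases "x \<in> {a..b}") (auto simp: F_support Q_support)
  qed
  have i: "integrable lborel (\<lambda>x. C * Re (cinner (q x) (Q x *v q x)))" using iQ by simp
  show iF: "integrable lborel (\<lambda>x. (norm (F x *v q x))\<^sup>2)"
   by (rule Bochner_Integration.integrable_bound[OF i]) (measurable, use le in eventually_elim, auto intro: order_trans[OF _ abs_ge_self])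
  show "(LBINT x. (norm (F x *v q x))\<^sup>2) <= C * (LBINT x. Re (cinner (q x) (Q x *v q x)))"
   using integral_mono_AE[OF iF i le] by simp
 qed
 define w where "w = (1 / (4 * pi)) * (1 / (4 * pi))"
 have w0: "w \<ge> 0" by (simp add: w_def)
 \<comment> \<open>The limits hold almost everywhere for each fixed vector. A common null set for
   the basis vectors suffices, since by linearity the vector may then vary with \<open>z\<close>, as
   \<open>J *v p z\<close> does.\<close>
 have axis: "AE x in lborel. \<forall>i. x \<in> {a..b} \<longrightarrow> ((\<lambda>y. char_action (Complex x y) (axis i 1)) \<longlongrightarrow> Wp x *v axis i 1) (at_right 0) \<and>
   ((\<lambda>y. char_action (Complex x (- y)) (axis i 1)) \<longlongrightarrow> Wm x *v axis i 1) (at_right 0)"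
  using boundary by (intro AE_all_countable[THEN iffD2] allI)
 have char_lin: "char_action z v = (\<Sum>i\<in>UNIV. v $ i *\<^sub>C char_action z (axis i 1))" if z: "Im z \<noteq> 0" for z v
 proof -
  have I: "integrable lborel (\<lambda>x. (1 / (complex_of_real x - z)) *\<^sub>C (F x *v v))" for v
   using integrable_ctrans[of "\<lambda>_. J *v v", OF _ z] by simp
  have v: "v = (\<Sum>i\<in>UNIV. v $ i *\<^sub>C axis i 1)" by (rule vec_as_sum)
  have "(1 / (complex_of_real x - z)) *\<^sub>C (F x *v v) = (\<Sum>i\<in>UNIV. v $ i *\<^sub>C ((1 / (complex_of_real x - z)) *\<^sub>C (F x *v axis i 1)))" for x
   by (subst (1) v) (simp add: scaleC_sum_right matrix_vector_mult_scaleC scaleC_scaleC mult.commute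
     linear_sum[OF bounded_linear.linear[OF bounded_bilinear.bounded_linear_right[OF bounded_bilinear_matrix_vector_mult]]])
  then have "ctrans (\<lambda>_. v) z = (\<Sum>i\<in>UNIV. v $ i *\<^sub>C ctrans (\<lambda>_. axis i 1) z)"
   unfolding ctrans_def by (simp add: integral_scaleC[OF I])
  then show ?thesis
   unfolding char_action_def scaleC_add_right sum.distrib v[symmetric]
   by (simp add: scaleC_sum_right scaleC_scaleC mult.commute)
 qed
 have key: "AE x in lborel. Re (cinner (r (of_real x)) (F x *v q x)) \<le>
   (1 / 2) * Re (cinner (q x) (Q x *v q x)) + w * (norm (Gp x))\<^sup>2 + w * (norm (Gm x))\<^sup>2 + (1 / 2) * (norm (F x *v q x))\<^sup>2"
  using axis Gl Q_eq
 proof eventually_elim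
  case (elim x)
  show ?case
  proof (cases "x \<in> {a..b}")
   case False
   then show ?thesis using w0 by (simp add: F_support Q_support)
  next
   case True
   have Wv: "(\<Sum>i\<in>UNIV. v $ i *\<^sub>C (M *v axis i 1)) = M *v v" for M :: "complex^'m^'m" and v
    by (simp add: vec_eq_iff matrix_vector_mult_def axis_def if_distrib[of "\<lambda>x. _ * x"] mult.commute cong: if_cong)
   have pc: "(p \<longlongrightarrow> p (of_real x)) (nhds (of_real x))"
    using p by (simp add: continuous_on_eq_continuous_at continuous_within tendsto_nhds_iff isCont_def)
   have rc: "(r \<longlongrightarrow> r (of_real x)) (nhds (of_real x))"
    using r by (simp add: continuous_on_eq_continuous_at continuous_within tendsto_nhds_iff isCont_def)
   \<comment> \<open>The sign \<open>s\<close> selects the half-plane. Both approaches must yield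
     the same value of the continuous function \<open>r\<close>, although \<open>W\<close> and
     \<open>G\<close> differ.\<close>
   have one: "r (of_real x) = J *v (W *v q x) + (2 * \<i>) *\<^sub>C (J *v ((1 / (4 * pi)) *\<^sub>R G))"
    if s: "s = 1 \<or> s = -1"
     and lim: "!!i. ((\<lambda>y. char_action (Complex x (s * y)) (axis i 1)) \<longlongrightarrow> W *v axis i 1) (at_right 0)"
     and g: "((\<lambda>y. ctrans q (Complex x (s * y))) \<longlongrightarrow> G) (at_right 0)" for s :: real and W G
   proof -
    have z: "((\<lambda>y. Complex x (s * y)) \<longlongrightarrow> of_real x) (at_right 0)"
    proof -
     have "((\<lambda>y. Complex x (s * y)) \<longlongrightarrow> Complex x (s * 0)) (at_right 0)" by (intro tendsto_intros)
     then show ?thesis by (simp add: complex_of_real_def)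
    qed
    have Jlim: "((\<lambda>y. J *v f y) \<longlongrightarrow> J *v l) (at_right 0)" if "(f \<longlongrightarrow> l) (at_right 0)" for f :: "real => complex^'m" and l
     by (rule bounded_linear.tendsto[OF bounded_bilinear.bounded_linear_right[OF bounded_bilinear_matrix_vector_mult] that])
    have pl: "((\<lambda>y. J *v p (Complex x (s * y))) \<longlongrightarrow> q x) (at_right 0)"
     unfolding q_def by (intro Jlim filterlim_compose[OF pc z])
    have "((\<lambda>y. \<Sum>i\<in>UNIV. (J *v p (Complex x (s * y))) $ i *\<^sub>C char_action (Complex x (s * y)) (axis i 1)) \<longlongrightarrow> (\<Sum>i\<in>UNIV. q x $ i *\<^sub>C (W *v axis i 1))) (at_right 0)"
     by (intro tendsto_sum tendsto_scaleC tendsto_vec_nth pl lim)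
    then have cl: "((\<lambda>y. char_action (Complex x (s * y)) (J *v p (Complex x (s * y)))) \<longlongrightarrow> W *v q x) (at_right 0)"
     unfolding Wv
    proof (rule Lim_transform_eventually)
     show "\<forall>\<^sub>F y in at_right 0. (\<Sum>i\<in>UNIV. (J *v p (Complex x (s * y))) $ i *\<^sub>C char_action (Complex x (s * y)) (axis i 1)) = char_action (Complex x (s * y)) (J *v p (Complex x (s * y)))"
      using eventually_at_right_less[of "0::real"]
      by eventually_elim (rule char_lin[symmetric], use s in auto)
    qed
    have "((\<lambda>y. J *v char_action (Complex x (s * y)) (J *v p (Complex x (s * y))) + (2 * \<i>) *\<^sub>C (J *v ((1 / (4 * pi)) *\<^sub>R ctrans q (Complex x (s * y))))) \<longlongrightarrow>
      J *v (W *v q x) + (2 * \<i>) *\<^sub>C (J *v ((1 / (4 * pi)) *\<^sub>R G))) (at_right 0)"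
     by (intro tendsto_add Jlim cl tendsto_scaleC tendsto_const tendsto_scaleR g)
    then have "((\<lambda>y. r (Complex x (s * y))) \<longlongrightarrow> J *v (W *v q x) + (2 * \<i>) *\<^sub>C (J *v ((1 / (4 * pi)) *\<^sub>R G))) (at_right 0)"
    proof (rule Lim_transform_eventually)
     show "\<forall>\<^sub>F y in at_right 0. J *v char_action (Complex x (s * y)) (J *v p (Complex x (s * y))) + (2 * \<i>) *\<^sub>C (J *v ((1 / (4 * pi)) *\<^sub>R ctrans q (Complex x (s * y)))) = r (Complex x (s * y))"
      using eventually_at_right_less[of "0::real"]
      by eventually_elim (unfold q_def, rule rz[symmetric], use s in auto)
    qed
    moreover have "((\<lambda>y. r (Complex x (s * y))) \<longlongrightarrow> r (of_real x)) (at_right 0)"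
     by (rule filterlim_compose[OF rc z])
    ultimately show ?thesis by (intro tendsto_unique[OF trivial_limit_at_right_real])
   qed
   have rp: "r (of_real x) = J *v (Wp x *v q x) + (2 * \<i>) *\<^sub>C (J *v ((1 / (4 * pi)) *\<^sub>R Gp x))"
    by (rule one[of 1]) (use elim True in auto)
   have rm: "r (of_real x) = J *v (Wm x *v q x) + (2 * \<i>) *\<^sub>C (J *v ((1 / (4 * pi)) *\<^sub>R Gm x))"
    by (rule one[of "-1"]) (use elim True in auto)
   define g where "g = \<i> *\<^sub>C (J *v ((1 / (4 * pi)) *\<^sub>R (Gp x + Gm x)))"
   have i2: "(2 * \<i>) *\<^sub>C v = \<i> *\<^sub>C v + \<i> *\<^sub>C v" for v :: "complex^'m"
    by (simp flip: scaleC_add_left)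
   have "2 *\<^sub>R r (of_real x) = (J ** (Wp x + Wm x)) *v q x + 2 *\<^sub>R g"
   proof -
    have "2 *\<^sub>R r (of_real x) = r (of_real x) + r (of_real x)" by (rule scaleR_2)
    also have "... = (J *v (Wp x *v q x) + (2 * \<i>) *\<^sub>C (J *v ((1 / (4 * pi)) *\<^sub>R Gp x))) + (J *v (Wm x *v q x) + (2 * \<i>) *\<^sub>C (J *v ((1 / (4 * pi)) *\<^sub>R Gm x)))"
     using rp rm by simp
    also have "... = (J ** (Wp x + Wm x)) *v q x + 2 *\<^sub>R g"
     unfolding g_def scaleR_2 i2
     by (simp add: matrix_vector_mult_assoc'[symmetric] matrix_vector_mult_add_rdistrib matrix_vector_right_distrib scaleR_add_right scaleC_add_right)
    finally show ?thesis .
   qed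
   then have "2 * cinner (r (of_real x)) (F x *v q x) = cinner (q x) (Q x *v q x) + 2 * cinner g (F x *v q x)"
    using elim(3) True by (metis cinner_add_left cinner_scaleR_left of_real_numeral)
   then have "Re (cinner (r (of_real x)) (F x *v q x)) = (1 / 2) * Re (cinner (q x) (Q x *v q x)) + Re (cinner g (F x *v q x))"
    by (simp add: complex_eq_iff)
   moreover have "Re (cinner g (F x *v q x)) <= w * (norm (Gp x))\<^sup>2 + w * (norm (Gm x))\<^sup>2 + (1 / 2) * (norm (F x *v q x))\<^sup>2"
   proof -
    have "Re (cinner g (F x *v q x)) <= norm g * norm (F x *v q x)"
     using complex_Re_le_cmod cinner_Cauchy_Schwarz order_trans by blast
    also have "... <= ((norm g)\<^sup>2 + (norm (F x *v q x))\<^sup>2) / 2" by (rule mult_le_half_squares)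
    also have "(norm g)\<^sup>2 = w * (norm (Gp x + Gm x))\<^sup>2"
     by (simp add: g_def norm_scaleC w_def power_mult_distrib power2_eq_square)
    also have "w * (norm (Gp x + Gm x))\<^sup>2 <= w * (2 * (norm (Gp x))\<^sup>2 + 2 * (norm (Gm x))\<^sup>2)"
     by (intro mult_left_mono norm_sum_sq_le w0)
    finally show ?thesis by (simp add: algebra_simps)
   qed
   ultimately show ?thesis by linarith
  qed
 qed
 have ir: "integrable lborel (\<lambda>x. cinner (r (of_real x)) (F x *v q x))"
 proof -
  have "continuous_on {a..b} (\<lambda>x. r (complex_of_real x))"
   by (rule continuous_on_compose2[OF r]) (auto intro!: continuous_intros)
  then obtain E where E: "E \<ge> 0" "!!x. x \<in> {a..b} ==> norm (r (complex_of_real x)) <= E"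
   by (rule continuous_bounded_Icc) blast
  have [measurable]: "(\<lambda>x. r (complex_of_real x)) \<in> borel_measurable borel" using r by measurable
  show ?thesis
  proof (rule Bochner_Integration.integrable_bound)
   show "integrable lborel (\<lambda>x. E * norm (F x *v q x))" using integrable_F[OF qm qD] by simp
   show "AE x in lborel. norm (cinner (r (of_real x)) (F x *v q x)) <= norm (E * norm (F x *v q x))"
   proof (rule AE_I2)
    fix x
    show "norm (cinner (r (of_real x)) (F x *v q x)) <= norm (E * norm (F x *v q x))"
    proof (cases "x \<in> {a..b}")
     case True
     have "norm (cinner (r (of_real x)) (F x *v q x)) <= norm (r (complex_of_real x)) * norm (F x *v q x)"
      by (rule cinner_Cauchy_Schwarz)
     also have "... <= E * norm (F x *v q x)" by (intro mult_right_mono E(2) True) simp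
     finally show ?thesis using E(1) by (simp add: abs_mult)
    qed (simp add: F_support)
   qed
  qed measurable
 qed
 have i1: "integrable lborel (\<lambda>x. (1 / 2) * Re (cinner (q x) (Q x *v q x)))"
  and i2: "integrable lborel (\<lambda>x. w * (norm (Gp x))\<^sup>2)" and i3: "integrable lborel (\<lambda>x. w * (norm (Gm x))\<^sup>2)"
  and i4: "integrable lborel (\<lambda>x. (1 / 2) * (norm (F x *v q x))\<^sup>2)"
  by (intro integrable_mult_right iQ Gi iF)+
 note i12 = Bochner_Integration.integrable_add[OF i1 i2]
 note i123 = Bochner_Integration.integrable_add[OF i12 i3]
 note i1234 = Bochner_Integration.integrable_add[OF i123 i4]
 let ?X = "LBINT x. Re (cinner (q x) (Q x *v q x))" and ?Y = "LBINT x. (norm (F x *v q x))\<^sup>2"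
 have "complex_of_real ((norm u)\<^sup>2) = of_real (1 / (4 * pi)) * (LBINT x. cinner (r (of_real x)) (F x *v q x))"
  using pair[OF u] by (simp add: cinner_self q_def)
 then have "(norm u)\<^sup>2 = Re (of_real (1 / (4 * pi)) * (LBINT x. cinner (r (of_real x)) (F x *v q x)))"
  by (metis Re_complex_of_real)
 also have "... = (1 / (4 * pi)) * Re (LBINT x. cinner (r (of_real x)) (F x *v q x))"
  by simp
 finally have nu: "(norm u)\<^sup>2 = (1 / (4 * pi)) * Re (LBINT x. cinner (r (of_real x)) (F x *v q x))" .
 have "Re (LBINT x. cinner (r (of_real x)) (F x *v q x)) = (LBINT x. Re (cinner (r (of_real x)) (F x *v q x)))"
  by (rule integral_Re[OF ir, symmetric])
 also have "... <= (LBINT x. (1 / 2) * Re (cinner (q x) (Q x *v q x)) + w * (norm (Gp x))\<^sup>2 + w * (norm (Gm x))\<^sup>2 + (1 / 2) * (norm (F x *v q x))\<^sup>2)"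
  by (rule integral_mono_AE[OF integrable_Re[OF ir] i1234 key])
 also have "... = (1 / 2) * ?X + w * (LBINT x. (norm (Gp x))\<^sup>2) + w * (LBINT x. (norm (Gm x))\<^sup>2) + (1 / 2) * ?Y"
  unfolding Bochner_Integration.integral_add[OF i123 i4] Bochner_Integration.integral_add[OF i12 i3]
   Bochner_Integration.integral_add[OF i1 i2] integral_mult_right_zero ..
 also have "... <= (1 / 2) * ?X + w * (4 * pi\<^sup>2 * ?Y) + w * (4 * pi\<^sup>2 * ?Y) + (1 / 2) * ?Y"
  by (intro add_mono mult_left_mono Gn w0) auto
 \<comment> \<open>\<open>w * (4 * pi^2)\<close> is one quarter, and it occurs twice next to the
   coefficient one half.\<close>
 also have "... = (1 / 2) * ?X + ?Y" by (simp add: w_def power2_eq_square)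
 also have "... <= (1 / 2) * ?X + C * ?X" using FQ by simp
 also have "... = (1 / 2 + C) * ?X" by (simp only: distrib_right)
 finally have "(norm u)\<^sup>2 <= (1 / (4 * pi)) * ((1 / 2 + C) * ?X)"
  unfolding nu by (rule mult_left_mono) simp
 then show ?thesis by (simp only: q_def mult.assoc)
qed

end

text \<open>Provides test vectors: a bounded measurable function is reached by polynomials that
  belong to vectors of the Hilbert space, boundedly and almost everywhere, so that integrals against
  the density converge.\<close>

lemma horner_approximation:
 fixes f :: "real => complex^'m" and K :: "complex^'m => 'h::complex_inner"
 assumes A: "bounded_clinear A" and K: "bounded_clinear K"
  and fm: "f \<in> borel_measurable borel" and f: "!!x. norm (f x) <= M"
 shows "\<exists>y s D. (\<forall>n. horner A K (y n) (s n)) \<and> (\<forall>n. \<forall>x\<in>{a..b}. norm (s n (complex_of_real x)) <= D) \<and>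
  (AE x in lborel. x \<in> {a..b} \<longrightarrow> (\<lambda>n::nat. s n (complex_of_real x)) \<longlonglongrightarrow> f x)"
proof -
 have "\<forall>i. \<exists>P::nat => complex poly. (\<forall>n. \<forall>t\<in>{a..b}. cmod (poly (P n) (of_real t)) <= 2 * M + 2) \<and>
   (AE t in lborel. t \<in> {a..b} \<longrightarrow> (\<lambda>n. poly (P n) (of_real t)) \<longlonglongrightarrow> f t $ i)"
 proof (intro allI bounded_measurable_poly_limit)
  show "(\<lambda>t. f t $ i) \<in> borel_measurable borel" for i by (rule borel_measurable_vec_component[OF fm])
  show "cmod (f t $ i) <= M" for t i using Finite_Cartesian_Product.norm_nth_le[of "f t" i] f[of t] by (rule order_trans)
 qed
 from choice[OF this] obtain P :: "'m => nat => complex poly"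
  where P: "!!i n t. t \<in> {a..b} ==> cmod (poly (P i n) (of_real t)) <= 2 * M + 2"
   and Pl: "!!i. AE t in lborel. t \<in> {a..b} \<longrightarrow> (\<lambda>n. poly (P i n) (of_real t)) \<longlonglongrightarrow> f t $ i" by blast
 define s where "s = (\<lambda>n z. \<Sum>i\<in>UNIV. poly (P i n) z *\<^sub>C axis i (1::complex))"
 have "\<exists>u. horner A K u (s n)" for n
 proof -
  have "\<forall>i. \<exists>u. horner A K u (\<lambda>z. poly (P i n) z *\<^sub>C axis i 1)" using horner_poly[OF A K] by blast
  from choice[OF this] obtain u where "!!i. horner A K (u i) (\<lambda>z. poly (P i n) z *\<^sub>C axis i 1)" by blast
  then have "horner A K (\<Sum>i\<in>UNIV. u i) (\<lambda>z. \<Sum>i\<in>UNIV. poly (P i n) z *\<^sub>C axis i 1)"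
   by (intro horner_sum[OF A K]) auto
  then show ?thesis unfolding s_def by blast
 qed
 then have "\<forall>n. \<exists>u. horner A K u (s n)" by blast
 from choice[OF this] obtain y where y: "\<forall>n. horner A K (y n) (s n)" by blast
 have "norm (s n (complex_of_real x)) <= real CARD('m) * (2 * M + 2)" if "x \<in> {a..b}" for n x
 proof -
  have "norm (s n (complex_of_real x)) <= (\<Sum>i\<in>(UNIV::'m set). 2 * M + 2)"
   unfolding s_def
  proof (rule sum_norm_le)
   fix i
   show "norm (poly (P i n) (complex_of_real x) *\<^sub>C axis i (1::complex)) <= 2 * M + 2"
    using P[OF that, of i n] by (simp add: norm_scaleC)
  qed
  then show ?thesis by simp
 qed
 moreover have "AE x in lborel. x \<in> {a..b} \<longrightarrow> (\<lambda>n. s n (complex_of_real x)) \<longlonglongrightarrow> f x"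
 proof -
  have "AE x in lborel. \<forall>i. x \<in> {a..b} \<longrightarrow> (\<lambda>n. poly (P i n) (of_real x)) \<longlonglongrightarrow> f x $ i"
   using Pl by (intro AE_all_countable[THEN iffD2] allI)
  then show ?thesis
  proof eventually_elim
   case (elim x)
   show ?case
   proof
    assume "x \<in> {a..b}"
    then have "(\<lambda>n. \<Sum>i\<in>UNIV. poly (P i n) (of_real x) *\<^sub>C axis i (1::complex)) \<longlonglongrightarrow> (\<Sum>i\<in>UNIV. f x $ i *\<^sub>C axis i 1)"
     using elim by (intro tendsto_sum tendsto_scaleC tendsto_const) auto
    then show "(\<lambda>n. s n (complex_of_real x)) \<longlonglongrightarrow> f x"
     unfolding s_def vec_as_sum[symmetric] .
   qed
  qed
 qed
 ultimately show ?thesis using y by blast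
qed

text \<open>Between a polynomial vector of \<open>As\<close> and one of \<open>A\<close> no
  remainder appears: \<open>As\<close> moves across the scalar product as \<open>A\<close> exactly,
  and only the moments enter.\<close>

lemma (in node) horner_duality:
 assumes "horner As K y s" "horner A K u p"
 shows "cinner y u = of_real (1 / (4 * pi)) * (LBINT x. cinner (s (of_real x)) (F x *v (J *v p (of_real x))))"
 using assms
proof (induction arbitrary: u p rule: horner.induct)
 case horner_zero
 then show ?case by simp
next
 case (horner_step y s v)
 have p: "continuous_on UNIV p" using horner_step.prems by (rule horner_continuous)
 have s: "continuous_on UNIV s" using horner_step.hyps by (rule horner_continuous)
 have iF: "integrable lborel (\<lambda>x. F x *v (J *v p (complex_of_real x)))"
  using integrable_F_horner[OF p, of "\<lambda>_. 1" 1] by simp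
 have iF': "integrable lborel (\<lambda>x. cinner (of_real x *\<^sub>C s (of_real x)) (F x *v (J *v p (of_real x))))"
 proof -
  have "continuous_on {a..b} (\<lambda>x. of_real x *\<^sub>C s (complex_of_real x))"
   by (intro continuous_intros continuous_on_compose2[OF s]) auto
  then obtain C where C: "C \<ge> 0" "!!x. x \<in> {a..b} ==> norm (of_real x *\<^sub>C s (complex_of_real x)) <= C"
   by (rule continuous_bounded_Icc) blast
  show ?thesis
  proof (rule Bochner_Integration.integrable_bound)
   show "integrable lborel (\<lambda>x. C * norm (F x *v (J *v p (of_real x))))" using iF by simp
   show "(\<lambda>x. cinner (of_real x *\<^sub>C s (of_real x)) (F x *v (J *v p (of_real x)))) \<in> borel_measurable lborel"
    using s p by measurable
   show "AE x in lborel. norm (cinner (of_real x *\<^sub>C s (of_real x)) (F x *v (J *v p (of_real x)))) <= norm (C * norm (F x *v (J *v p (of_real x))))"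
   proof (rule AE_I2)
    fix x
    show "norm (cinner (of_real x *\<^sub>C s (of_real x)) (F x *v (J *v p (of_real x)))) <= norm (C * norm (F x *v (J *v p (of_real x))))"
    proof (cases "x \<in> {a..b}")
     case True
     have "norm (cinner (of_real x *\<^sub>C s (of_real x)) (F x *v (J *v p (of_real x)))) <= norm (of_real x *\<^sub>C s (complex_of_real x)) * norm (F x *v (J *v p (of_real x)))"
      by (rule cinner_Cauchy_Schwarz)
     also have "... <= C * norm (F x *v (J *v p (of_real x)))" by (intro mult_right_mono C(2) True) simp
     finally show ?thesis using C(1) by (simp add: abs_mult)
    qed (simp add: F_support)
   qed
  qed
 qed
 have "cinner (As y + K v) u = cinner y (A u) + cinner v (Ks u)"
  unfolding cinner_add_left As by (metis Ks_adj cinner_commute)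
 also have "cinner y (A u) = of_real (1 / (4 * pi)) * (LBINT x. cinner (of_real x *\<^sub>C s (of_real x)) (F x *v (J *v p (of_real x))))"
  using horner_step.IH[OF horner_apply[OF K horner_step.prems]]
  by (simp add: matrix_vector_mult_scaleC cinner_scaleC_right cinner_scaleC_left)
 also have "cinner v (Ks u) = of_real (1 / (4 * pi)) * (LBINT x. cinner v (F x *v (J *v p (of_real x))))"
 proof -
  have "Ks u = (1 / (4 * pi)) *\<^sub>R (LBINT x. F x *v (J *v p (of_real x)))"
   using horner_moment[OF horner_step.prems, of 0] by simp
  then show ?thesis by (simp only: cinner_scaleR_right integral_cinner_right(2)[OF iF])
 qed
 also have "of_real (1 / (4 * pi)) * (LBINT x. cinner (of_real x *\<^sub>C s (of_real x)) (F x *v (J *v p (of_real x)))) + of_real (1 / (4 * pi)) * (LBINT x. cinner v (F x *v (J *v p (of_real x))))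
   = of_real (1 / (4 * pi)) * (LBINT x. cinner (of_real x *\<^sub>C s (of_real x) + v) (F x *v (J *v p (of_real x))))"
  unfolding cinner_add_left Bochner_Integration.integral_add[OF iF' integral_cinner_right(1)[OF iF]] distrib_left ..
 finally show ?case .
qed

text \<open>Collects, almost everywhere, the pointwise bounds for both weights.
  \<open>weight1\<close> serves the estimate for \<open>A\<close>, \<open>weight2\<close> the one
  for \<open>As\<close>, and \<open>weight12\<close> ties the two weights along the multiplier
  \<open>J (Wp + Wm)\<close> of the duality argument.\<close>

locale node_pair = node A As K Ks J F a b
 for A As :: "'h::complex_hilbert => 'h" and K :: "complex^'m => 'h" and Ks J F a b +
 fixes Wp Wm :: "real => complex^'m^'m" and C :: real
 assumes boundary: "!!w. AE x in lborel. x \<in> {a..b} \<longrightarrow>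
   ((\<lambda>y. char_action (Complex x y) w) \<longlongrightarrow> Wp x *v w) (at_right 0) \<and>
   ((\<lambda>y. char_action (Complex x (- y)) w) \<longlongrightarrow> Wm x *v w) (at_right 0)"
  and W_measurable [measurable]: "Wp \<in> borel_measurable borel" "Wm \<in> borel_measurable borel"
  and C0: "0 <= C"
  and jump: "AE x in lborel. x \<in> {a..b} \<longrightarrow> F x = Wp x - Wm x"
  and W_J: "AE x in lborel. x \<in> {a..b} \<longrightarrow> ctranspose (Wp x) ** J ** Wm x = J"
  and weight1: "AE x in lborel. x \<in> {a..b} \<longrightarrow> (\<forall>q.
   let W1 = cinner q ((ctranspose (Wp x) ** J ** Wp x - ctranspose (Wm x) ** J ** Wm x) *v q) in
   Im W1 = 0 \<and> 0 <= Re W1 \<and> Re W1 <= C * (norm q)\<^sup>2 \<and> (norm (F x *v q))\<^sup>2 <= C * Re W1)"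
  and weight2: "AE x in lborel. x \<in> {a..b} \<longrightarrow> (\<forall>v.
   let W2 = cinner v ((Wp x ** J ** ctranspose (Wp x) - Wm x ** J ** ctranspose (Wm x)) *v v) in
   0 <= Re W2 \<and> Re W2 <= C * (norm v)\<^sup>2 \<and> (norm (ctranspose (F x) *v v))\<^sup>2 <= C * Re W2)"
  and weight12: "AE x in lborel. x \<in> {a..b} \<longrightarrow> (\<forall>q.
   Re (cinner ((J ** (Wp x + Wm x)) *v q) ((Wp x ** J ** ctranspose (Wp x) - Wm x ** J ** ctranspose (Wm x)) *v ((J ** (Wp x + Wm x)) *v q)))
   <= C * Re (cinner q ((ctranspose (Wp x) ** J ** Wp x - ctranspose (Wm x) ** J ** Wm x) *v q)))"
begin

text \<open>The value \<open>0\<close> is imposed off \<open>[a,b]\<close>, where nothing is assumed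
  about \<open>Wp\<close> and \<open>Wm\<close>.\<close>

definition Q1 :: "real => complex^'m^'m" where
 "Q1 x = (if x \<in> {a..b} then ctranspose (Wp x) ** J ** Wp x - ctranspose (Wm x) ** J ** Wm x else 0)"

definition Q2 :: "real => complex^'m^'m" where
 "Q2 x = (if x \<in> {a..b} then Wp x ** J ** ctranspose (Wp x) - Wm x ** J ** ctranspose (Wm x) else 0)"

lemma Q_measurable [measurable]: "Q1 \<in> borel_measurable borel" "Q2 \<in> borel_measurable borel"
 unfolding Q1_def Q2_def by measurable

sublocale forward: boundary_node A As K Ks J F a b Wp Wm Q1 C
proof
 fix w
 show "AE x in lborel. x \<in> {a..b} \<longrightarrow>
   ((\<lambda>y. char_action (Complex x y) w) \<longlongrightarrow> Wp x *v w) (at_right 0) \<and>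
   ((\<lambda>y. char_action (Complex x (- y)) w) \<longlongrightarrow> Wm x *v w) (at_right 0)" by (rule boundary)
next
 show "Q1 \<in> borel_measurable borel" by measurable
 show "Q1 x = 0" if "x \<notin> {a..b}" for x using that by (simp only: Q1_def if_False)
 show "AE x in lborel. x \<in> {a..b} \<longrightarrow> (\<forall>v. cinner ((J ** (Wp x + Wm x)) *v v) (F x *v v) = cinner v (Q1 x *v v))"
  using jump W_J
 proof eventually_elim
  case (elim x)
  show ?case
  proof (intro impI allI)
   fix v assume x: "x \<in> {a..b}"
   have 1: "ctranspose (Wp x) ** J ** Wm x = J" using elim x by blast
   have 2: "ctranspose (Wm x) ** J ** Wp x = J"
    using arg_cong[OF 1, of ctranspose] by (simp add: ctranspose_mult J matrix_mul_assoc)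
   have "cinner ((J ** (Wp x + Wm x)) *v v) (F x *v v) = cinner v (((ctranspose (Wp x) + ctranspose (Wm x)) ** J ** (Wp x - Wm x)) *v v)"
    using elim x by (simp add: cinner_matrix_left ctranspose_mult ctranspose_add J matrix_vector_mult_assoc' matrix_mul_assoc)
   \<comment> \<open>The mixed products are \<open>J\<close> with opposite signs, by
     \<open>1\<close> and \<open>2\<close>.\<close>
   also have "(ctranspose (Wp x) + ctranspose (Wm x)) ** J ** (Wp x - Wm x) = Q1 x"
    using x by (simp add: Q1_def matrix_mult_diff_right matrix_mult_add_left 1 2 matrix_mul_assoc)
   finally show "cinner ((J ** (Wp x + Wm x)) *v v) (F x *v v) = cinner v (Q1 x *v v)" .
  qed
 qed
 show "AE x in lborel. x \<in> {a..b} \<longrightarrow> (\<forall>v. 0 <= Re (cinner v (Q1 x *v v)) \<and> Re (cinner v (Q1 x *v v)) <= C * (norm v)\<^sup>2)"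
  using weight1 by eventually_elim (simp add: Q1_def Let_def)
 show "AE x in lborel. x \<in> {a..b} \<longrightarrow> (\<forall>v. (norm (F x *v v))\<^sup>2 <= C * Re (cinner v (Q1 x *v v)))"
  using weight1 by eventually_elim (simp add: Q1_def Let_def)
qed

abbreviation Fs :: "real => complex^'m^'m" where "Fs \<equiv> \<lambda>x. - (J ** ctranspose (F x) ** J)"

lemma Fs_vector: "Fs x *v v = - (J *v (ctranspose (F x) *v (J *v v)))"
proof -
 have "- M *v v = - (M *v v)" for M :: "complex^'m^'m"
  using matrix_vector_mult_diff_rdistrib[of 0 M v] by simp
 then show ?thesis by (simp add: matrix_vector_mult_assoc' matrix_mul_assoc)
qed

lemma neg_vector: "(- M) *v v = - (M *v (v::complex^'m))"
 using matrix_vector_mult_diff_rdistrib[of 0 M v] by simp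

lemma vector_neg: "M *v (- v) = - (M *v (v::complex^'m))"
 using matrix_vector_mult_diff_distrib[of M 0 v] by simp

lemma bounded_linear_star: "bounded_linear (\<lambda>M. - (J ** ctranspose M ** J))"
proof -
 have c: "cnj (r *\<^sub>R z) = r *\<^sub>R cnj z" for r z by (simp add: complex_eq_iff)
 have "linear (\<lambda>M. - (J ** ctranspose M ** J))"
 proof (rule linearI)
  fix M N :: "complex^'m^'m" and r :: real
  show "- (J ** ctranspose (M + N) ** J) = - (J ** ctranspose M ** J) + - (J ** ctranspose N ** J)"
   by (simp add: ctranspose_add matrix_mult_add_left matrix_mult_add_right)
  show "- (J ** ctranspose (r *\<^sub>R M) ** J) = r *\<^sub>R - (J ** ctranspose M ** J)"
   by (simp add: vec_eq_iff matrix_matrix_mult_def ctranspose_def c flip: scaleR_sum_right)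
 qed
 then show ?thesis by (rule linear_conv_bounded_linear[THEN iffD1])
qed

text \<open>The adjoint node, with \<open>J\<close>, \<open>F\<close> and \<open>W(z)\<close> replaced by \<open>-J\<close>, \<open>-J F\<^sup>* J\<close> and \<open>J W(cnj z)\<^sup>* J\<close>.\<close>

lemma adjoint_node: "node As A K Ks (- J) Fs a b"
proof
 show clAs: "bounded_clinear As"
 proof -
  obtain CA where CA: "!!x. norm (A x) <= CA * norm x" using A by (auto simp: bounded_clinear_on_def)
  obtain CK where CK: "!!x. norm (K x) <= CK * norm x" using K by (auto simp: bounded_clinear_on_def)
  obtain CKs where CKs: "!!x. norm (Ks x) <= CKs * norm x" using Ks by (auto simp: bounded_clinear_on_def)
  show ?thesis
  proof (rule bounded_clinear_onI[where C="CA + 2 * (\<bar>CK\<bar> * \<bar>CKs\<bar>)"])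
   show "As (x + y) = As x + As y" for x y
    by (simp add: As_eq bounded_clinearD[OF A] bounded_clinearD[OF K] bounded_clinearD[OF Ks] matrix_vector_right_distrib scaleC_add_right)
   show "As (c *\<^sub>C x) = c *\<^sub>C As x" for c x
    by (simp add: As_eq bounded_clinearD[OF A] bounded_clinearD[OF K] bounded_clinearD[OF Ks] matrix_vector_mult_scaleC
      scaleC_diff_right scaleC_scaleC mult.commute)
   show "norm (As x) <= (CA + 2 * (\<bar>CK\<bar> * \<bar>CKs\<bar>)) * norm x" for x
   proof -
    have "norm (As x) <= norm (A x) + 2 * norm (K (J *v Ks x))"
     unfolding As_eq using norm_triangle_ineq4[of "A x" "(2 * \<i>) *\<^sub>C K (J *v Ks x)"] by (simp add: norm_scaleC norm_mult)
    moreover have "norm (K (J *v Ks x)) <= \<bar>CK\<bar> * (\<bar>CKs\<bar> * norm x)"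
    proof -
     have "norm (K (J *v Ks x)) <= CK * norm (J *v Ks x)" by (rule CK)
     also have "... <= \<bar>CK\<bar> * norm (Ks x)" by (simp add: mult_right_mono)
     also have "... <= \<bar>CK\<bar> * (\<bar>CKs\<bar> * norm x)"
      by (intro mult_left_mono order_trans[OF CKs] mult_right_mono) auto
     finally show ?thesis .
    qed
    ultimately show ?thesis using CA[of x] by (simp add: algebra_simps)
   qed
  qed
 qed
 show "bounded_clinear K" "bounded_clinear Ks" by (fact K, fact Ks)
 show "cinner (A x) y = cinner x (As y)" for x y by (metis As cinner_commute)
 show "cinner (Ks x) v = cinner x (K v)" for x v by (rule Ks_adj)
 show "A x = As x - (2 * \<i>) *\<^sub>C K ((- J) *v Ks x)" for x
  by (simp add: As_eq neg_vector bounded_clinearD[OF K])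
 show "ctranspose (- J) = - J" using J(1) ctranspose_diff[of 0 J] by (simp add: vec_eq_iff)
 show "- J ** - J = mat 1"
  using matrix_mult_diff_left[of 0 J "- J"] matrix_mult_diff_right[of J 0 J] J(2)
  by (simp add: matrix_matrix_mult_def vec_eq_iff sum_negf)
 show "Fs \<in> borel_measurable borel"
  by (rule borel_measurable_continuous_on[OF linear_continuous_on[OF bounded_linear_star]]) measurable
 have "bounded ((\<lambda>M. - (J ** ctranspose M ** J)) ` range F)"
  by (rule bounded_linear_image[OF F_bounded bounded_linear_star])
 then show "bounded (range Fs)" by (simp add: image_image)
 show "Fs x = 0" if "x \<notin> {a..b}" for x
  using F_support[OF that] linear_0[OF bounded_linear.linear[OF bounded_linear_star]] by simp
 fix n v
 have i: "integrable lborel (\<lambda>x. x ^ n *\<^sub>R (J *v (ctranspose (F x) *v v)))"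
 proof -
  have bl: "bounded_linear (\<lambda>M. - (J ** ctranspose M ** J) *v (- (J *v v)))"
   by (rule bounded_linear_compose[OF bounded_bilinear.bounded_linear_left[OF bounded_bilinear_matrix_vector_mult] bounded_linear_star])
  have F1: "integrable lborel (\<lambda>x. x ^ n *\<^sub>R F x)"
  proof -
   obtain E where E: "E \<ge> 0" "!!x. x \<in> {a..b} ==> norm (x ^ n) <= E"
    by (rule continuous_bounded_Icc[of a b "\<lambda>x. x ^ n"]) (auto intro!: continuous_intros)
   show ?thesis
   proof (rule integrable_bounded_support[where B="E * F_norm"])
    show "norm (x ^ n *\<^sub>R F x) <= E * F_norm" if "x \<in> {a..b}" for x
     unfolding norm_scaleR using E that F_bound[of x] by (intro mult_mono) auto
   qed (auto simp: F_support)
  qed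
  have "integrable lborel (\<lambda>x. - (J ** ctranspose (x ^ n *\<^sub>R F x) ** J) *v (- (J *v v)))"
   by (rule integrable_bounded_linear[OF bl F1])
  moreover have "- (J ** ctranspose (x ^ n *\<^sub>R F x) ** J) *v (- (J *v v)) = x ^ n *\<^sub>R (J *v (ctranspose (F x) *v v))" for x
  proof -
   have "- (J ** ctranspose (x ^ n *\<^sub>R F x) ** J) *v (- (J *v v)) = x ^ n *\<^sub>R (Fs x *v (- (J *v v)))"
    by (rule linear_scale[OF bounded_linear.linear[OF bl]])
   also have "Fs x *v (- (J *v v)) = J *v (ctranspose (F x) *v v)"
    unfolding Fs_vector by (simp add: vector_neg)
   finally show ?thesis .
  qed
  ultimately show ?thesis by simp
 qed
 show "Ks ((As ^^ n) (K v)) = (1 / (4 * pi)) *\<^sub>R (LBINT x. x ^ n *\<^sub>R (Fs x *v ((- J) *v v)))"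
 proof (rule cinner_eqI[where V=UNIV])
  fix w :: "complex^'m"
  \<comment> \<open>The moments of the adjoint node are the adjoints of the given ones, so both
    sides are compared after pairing with an arbitrary \<open>w\<close>.\<close>
  have An: "cinner ((As ^^ n) x) y = cinner x ((A ^^ n) y)" for x y
   by (induction n arbitrary: x y) (simp_all add: As funpow_swap1)
  have iF: "integrable lborel (\<lambda>x. x ^ n *\<^sub>R (F x *v (J *v w)))"
  proof -
   obtain E where E: "E \<ge> 0" "!!x. x \<in> {a..b} ==> norm (x ^ n) <= E"
    by (rule continuous_bounded_Icc[of a b "\<lambda>x. x ^ n"]) (auto intro!: continuous_intros)
   have "integrable lborel (\<lambda>x. of_real (x ^ n) *\<^sub>C (F x *v (J *v w)))"
    by (rule integrable_F_horner[of "\<lambda>_. w", where C=E]) (use E(2) in \<open>auto simp: norm_power power_abs\<close>)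
   then show ?thesis by (simp only: scaleC_of_real)
  qed
  have "cinner (Ks ((As ^^ n) (K v))) w = cinner v (Ks ((A ^^ n) (K w)))"
   by (simp add: Ks_adj An) (metis Ks_adj cinner_commute)
  also have "... = of_real (1 / (4 * pi)) * (LBINT x. cinner v (x ^ n *\<^sub>R (F x *v (J *v w))))"
   unfolding moments cinner_scaleR_right[of v "1 / (4 * pi)"] integral_cinner_right(2)[OF iF] ..
  also have "(\<lambda>x. cinner v (x ^ n *\<^sub>R (F x *v (J *v w)))) = (\<lambda>x. cnj (cinner w (x ^ n *\<^sub>R (J *v (ctranspose (F x) *v v)))))"
  proof
   fix x
   have "cinner v (x ^ n *\<^sub>R (F x *v (J *v w))) = cinner (x ^ n *\<^sub>R (J *v (ctranspose (F x) *v v))) w"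
    by (simp add: cinner_scaleR_left cinner_scaleR_right cinner_J cinner_matrix_left J)
   then show "cinner v (x ^ n *\<^sub>R (F x *v (J *v w))) = cnj (cinner w (x ^ n *\<^sub>R (J *v (ctranspose (F x) *v v))))"
    by (metis cinner_commute)
  qed
  also have "(LBINT x. cnj (cinner w (x ^ n *\<^sub>R (J *v (ctranspose (F x) *v v))))) = cnj (cinner w (LBINT x. x ^ n *\<^sub>R (J *v (ctranspose (F x) *v v))))"
   by (simp only: Bochner_Integration.integral_cnj integral_cinner_right(2)[OF i])
  also have "of_real (1 / (4 * pi)) * ... = cnj (cinner w ((1 / (4 * pi)) *\<^sub>R (LBINT x. x ^ n *\<^sub>R (Fs x *v ((- J) *v v)))))"
   proof -
   have "Fs x *v ((- J) *v v) = J *v (ctranspose (F x) *v v)" for x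
    unfolding neg_vector[of J v] Fs_vector by (simp add: vector_neg)
   then show ?thesis unfolding cinner_scaleR_right by simp
  qed
  finally have e: "cinner (Ks ((As ^^ n) (K v))) w = cnj (cinner w ((1 / (4 * pi)) *\<^sub>R (LBINT x. x ^ n *\<^sub>R (Fs x *v ((- J) *v v)))))" .
  show "cinner w (Ks ((As ^^ n) (K v))) = cinner w ((1 / (4 * pi)) *\<^sub>R (LBINT x. x ^ n *\<^sub>R (Fs x *v ((- J) *v v))))"
   using e unfolding cinner_commute[of "Ks ((As ^^ n) (K v))" w] complex_cnj_cancel_iff .
 qed simp
qed

end

context node_pair
begin

lemma As_linear: "bounded_clinear As"
 using adjoint_node by (rule node.A)

text \<open>Given in weak form, since boundary limits of the adjoint characteristic function are
  then read off from those of \<open>char_action\<close> at the conjugate point, component by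
  component.\<close>

lemma char_action_adjoint:
 assumes z: "Im z \<noteq> 0"
 shows "cinner (node.char_action Fs z w) v = cinner w (J *v char_action (cnj z) (J *v v))"
proof -
 interpret star: node As A K Ks "- J" Fs a b by (rule adjoint_node)
 have z': "Im (cnj z) \<noteq> 0" using z by simp
 have i1: "integrable lborel (\<lambda>x. (1 / (complex_of_real x - z)) *\<^sub>C (Fs x *v w))"
  using star.integrable_ctrans[of "\<lambda>_. - (J *v w)", OF _ z] by (simp add: neg_vector vector_neg)
 have i2: "integrable lborel (\<lambda>x. (1 / (complex_of_real x - cnj z)) *\<^sub>C (F x *v (J *v v)))"
  using integrable_ctrans[of "\<lambda>_. v", OF _ z'] by simp
 have pt: "cinner v ((1 / (complex_of_real x - z)) *\<^sub>C (Fs x *v w)) = - cnj (cinner (J *v w) ((1 / (complex_of_real x - cnj z)) *\<^sub>C (F x *v (J *v v))))" for x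
 proof -
  have "cinner v (Fs x *v w) = - cinner (F x *v (J *v v)) (J *v w)"
   by (simp add: Fs_vector cinner_matrix_left J)
  also have "cinner (F x *v (J *v v)) (J *v w) = cnj (cinner (J *v w) (F x *v (J *v v)))" by (rule cinner_commute)
  finally show ?thesis by (simp add: cinner_scaleC_right)
 qed
 have "cinner v (star.ctrans (\<lambda>_. w) z) = (LBINT x. cinner v ((1 / (complex_of_real x - z)) *\<^sub>C (Fs x *v w)))"
  unfolding star.ctrans_def by (rule integral_cinner_right(2)[OF i1, symmetric])
 also have "... = - cnj (cinner (J *v w) (ctrans (\<lambda>_. J *v v) (cnj z)))"
  unfolding pt ctrans_def by (simp only: Bochner_Integration.integral_minus Bochner_Integration.integral_cnj integral_cinner_right(2)[OF i2])
 finally have c: "cinner v (star.ctrans (\<lambda>_. w) z) = - cnj (cinner (J *v w) (ctrans (\<lambda>_. J *v v) (cnj z)))" .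
 have k: "cnj (1 / (2 * complex_of_real pi * \<i>)) = - (1 / (2 * complex_of_real pi * \<i>))" by simp
 have "cinner (star.char_action z w) v = cnj (cinner v (star.char_action z w))" by (rule cinner_commute)
 also have "... = cnj (cinner v w) + cnj (1 / (2 * complex_of_real pi * \<i>)) * cnj (cinner v (star.ctrans (\<lambda>_. w) z))"
  by (simp only: star.char_action_def cinner_add_right cinner_scaleC_right complex_cnj_add complex_cnj_mult)
 also have "... = cinner w v + (1 / (2 * complex_of_real pi * \<i>)) * cinner (J *v w) (ctrans (\<lambda>_. J *v v) (cnj z))"
  unfolding c k by (simp add: cinner_commute[of w v])
 also have "... = cinner w (J *v char_action (cnj z) (J *v v))"
  by (simp add: char_action_def matrix_vector_right_distrib matrix_vector_mult_scaleC cinner_add_right cinner_scaleC_right cinner_J)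
 finally show ?thesis .
qed

text \<open>Conjugation of \<open>z\<close> interchanges the half-planes, which is why
  \<open>Wm\<close> supplies the upper boundary value and \<open>Wp\<close> the lower one. The two
  signs, of \<open>- J\<close> and of \<open>Fs\<close>, cancel in the pairing that defines the
  weight.\<close>

lemma adjoint_boundary_node:
 "boundary_node As A K Ks (- J) Fs a b (\<lambda>x. J ** ctranspose (Wm x) ** J) (\<lambda>x. J ** ctranspose (Wp x) ** J)
  (\<lambda>x. J ** Q2 x ** J) C"
proof -
 interpret star: node As A K Ks "- J" Fs a b by (rule adjoint_node)
 have JMJ: "(J ** M ** J) *v v = J *v (M *v (J *v v))" for M v by (simp add: matrix_vector_mult_assoc' matrix_mul_assoc)
 have lim: "((\<lambda>y. star.char_action (Complex x (s * y)) w) \<longlongrightarrow> (J ** ctranspose W ** J) *v w) (at_right 0)"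
  if s: "s = 1 \<or> s = -1" and W: "!!i. ((\<lambda>y. char_action (Complex x (- s * y)) (J *v axis i 1)) \<longlongrightarrow> W *v (J *v axis i 1)) (at_right 0)" for x s W w
 proof (rule vec_tendstoI)
  fix i
  have comp: "u $ i = cnj (cinner u (axis i 1))" for u :: "complex^'m"
   by (simp add: cinner_vec_def cinner_complex_def axis_def if_distrib[of "\<lambda>x. _ * x"] cong: if_cong)
  have "((\<lambda>y. cnj (cinner w (J *v char_action (Complex x (- s * y)) (J *v axis i 1)))) \<longlongrightarrow> cnj (cinner w (J *v (W *v (J *v axis i 1))))) (at_right 0)"
   by (intro tendsto_cnj tendsto_cinner tendsto_const W bounded_linear.tendsto[OF bounded_bilinear.bounded_linear_right[OF bounded_bilinear_matrix_vector_mult]])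
  moreover have "cinner w (J *v (W *v (J *v axis i 1))) = cinner ((J ** ctranspose W ** J) *v w) (axis i 1)"
   by (simp add: JMJ cinner_J cinner_matrix_left J)
  ultimately have "((\<lambda>y. cnj (cinner w (J *v char_action (Complex x (- s * y)) (J *v axis i 1)))) \<longlongrightarrow> ((J ** ctranspose W ** J) *v w) $ i) (at_right 0)"
   by (simp add: comp[symmetric])
  then show "((\<lambda>y. star.char_action (Complex x (s * y)) w $ i) \<longlongrightarrow> ((J ** ctranspose W ** J) *v w) $ i) (at_right 0)"
  proof (rule Lim_transform_eventually)
   show "\<forall>\<^sub>F y in at_right 0. cnj (cinner w (J *v char_action (Complex x (- s * y)) (J *v axis i 1))) = star.char_action (Complex x (s * y)) w $ i"
    using eventually_at_right_less[of "0::real"]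
   proof eventually_elim
    case (elim y)
    have "Im (Complex x (s * y)) \<noteq> 0" using elim s by auto
    from char_action_adjoint[OF this, of w "axis i 1"] show ?case by (simp add: comp[of "star.char_action _ _"] complex_cnj)
   qed
  qed
 qed
 show ?thesis
 proof
  fix w
  have "AE x in lborel. \<forall>i. x \<in> {a..b} \<longrightarrow> ((\<lambda>y. char_action (Complex x y) (J *v axis i 1)) \<longlongrightarrow> Wp x *v (J *v axis i 1)) (at_right 0) \<and>
   ((\<lambda>y. char_action (Complex x (- y)) (J *v axis i 1)) \<longlongrightarrow> Wm x *v (J *v axis i 1)) (at_right 0)"
   using boundary by (intro AE_all_countable[THEN iffD2] allI)
  then show "AE x in lborel. x \<in> {a..b} \<longrightarrow>
   ((\<lambda>y. star.char_action (Complex x y) w) \<longlongrightarrow> (J ** ctranspose (Wm x) ** J) *v w) (at_right 0) \<and>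
   ((\<lambda>y. star.char_action (Complex x (- y)) w) \<longlongrightarrow> (J ** ctranspose (Wp x) ** J) *v w) (at_right 0)"
  proof eventually_elim
   case (elim x)
   show ?case using lim[of 1 x "Wm x" w] lim[of "-1" x "Wp x" w] elim by simp
  qed
 next
  show "(\<lambda>x. J ** Q2 x ** J) \<in> borel_measurable borel" by measurable
  show "J ** Q2 x ** J = 0" if "x \<notin> {a..b}" for x
  proof -
   have z: "Q2 x = 0" using that by (simp only: Q2_def if_False)
   show ?thesis unfolding z by (simp add: vec_eq_iff matrix_matrix_mult_def)
  qed
  show "AE x in lborel. x \<in> {a..b} \<longrightarrow> (\<forall>v. cinner ((- J ** (J ** ctranspose (Wm x) ** J + J ** ctranspose (Wp x) ** J)) *v v) (Fs x *v v) = cinner v ((J ** Q2 x ** J) *v v))"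
   using jump W_J
  proof eventually_elim
   case (elim x)
   show ?case
   proof (intro impI allI)
    fix v assume x: "x \<in> {a..b}"
    have e1: "ctranspose (Wp x) ** J ** Wm x = J" using elim x by blast
    \<comment> \<open>Square matrices with a left inverse have it as a right inverse. This turns
      \<open>Wp* J Wm = J\<close> into the relation with the factors in the other order, needed for
      \<open>Q2\<close>.\<close>
    have "(J ** ctranspose (Wp x) ** J) ** Wm x = J ** (ctranspose (Wp x) ** J ** Wm x)" by (simp only: matrix_mul_assoc)
    also have "... = mat 1" by (simp only: e1 J)
    finally have "Wm x ** (J ** ctranspose (Wp x) ** J) = mat 1" by (simp add: matrix_left_right_inverse)
    then have "Wm x ** J ** ctranspose (Wp x) ** (J ** J) = mat 1 ** J" by (simp only: matrix_mul_assoc)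
    then have 1: "Wm x ** J ** ctranspose (Wp x) = J" by (simp add: J)
    have 2: "Wp x ** J ** ctranspose (Wm x) = J"
     using arg_cong[OF 1, of ctranspose] by (simp add: ctranspose_mult J matrix_mul_assoc)
    define u where "u = J *v v"
    have l: "(- J ** (J ** ctranspose (Wm x) ** J + J ** ctranspose (Wp x) ** J)) *v v = - (ctranspose (Wm x + Wp x) *v u)"
     by (simp add: u_def matrix_vector_mult_assoc'[symmetric] matrix_vector_mult_add_rdistrib neg_vector matrix_vector_right_distrib ctranspose_add)
    have r: "Fs x *v v = - (J *v (ctranspose (Wp x - Wm x) *v u))"
     unfolding Fs_vector unfolding u_def elim(1)[rule_format, OF x] ..
    have "cinner ((- J ** (J ** ctranspose (Wm x) ** J + J ** ctranspose (Wp x) ** J)) *v v) (Fs x *v v)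
     = cinner u ((Wm x + Wp x) *v (J *v (ctranspose (Wp x - Wm x) *v u)))"
     unfolding l r by (simp add: cinner_matrix_left)
    also have "... = cinner u (((Wm x + Wp x) ** J ** (ctranspose (Wp x) - ctranspose (Wm x))) *v u)"
     by (simp only: matrix_vector_mult_assoc' ctranspose_diff matrix_mul_assoc)
    also have "(Wm x + Wp x) ** J ** (ctranspose (Wp x) - ctranspose (Wm x)) = Q2 x"
     using x by (simp add: Q2_def matrix_mult_diff_right matrix_mult_add_left 1 2 matrix_mul_assoc)
    also have "cinner u (Q2 x *v u) = cinner v ((J ** Q2 x ** J) *v v)"
     by (simp add: u_def JMJ cinner_J)
    finally show "cinner ((- J ** (J ** ctranspose (Wm x) ** J + J ** ctranspose (Wp x) ** J)) *v v) (Fs x *v v) = cinner v ((J ** Q2 x ** J) *v v)" .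
   qed
  qed
  have c: "cinner v ((J ** Q2 x ** J) *v v) = cinner (J *v v) (Q2 x *v (J *v v))" for x v
   by (simp add: JMJ cinner_J)
  show "AE x in lborel. x \<in> {a..b} \<longrightarrow> (\<forall>v. 0 <= Re (cinner v ((J ** Q2 x ** J) *v v)) \<and> Re (cinner v ((J ** Q2 x ** J) *v v)) <= C * (norm v)\<^sup>2)"
   using weight2
  proof eventually_elim
   case (elim x)
   show ?case
   proof (intro impI allI)
    fix v assume x: "x \<in> {a..b}"
    show "0 <= Re (cinner v ((J ** Q2 x ** J) *v v)) \<and> Re (cinner v ((J ** Q2 x ** J) *v v)) <= C * (norm v)\<^sup>2"
     unfolding c using elim[rule_format, OF x, of "J *v v"] x by (simp add: Q2_def Let_def)
   qed
  qed
  show "AE x in lborel. x \<in> {a..b} \<longrightarrow> (\<forall>v. (norm (Fs x *v v))\<^sup>2 <= C * Re (cinner v ((J ** Q2 x ** J) *v v)))"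
   using weight2
  proof eventually_elim
   case (elim x)
   show ?case
   proof (intro impI allI)
    fix v assume x: "x \<in> {a..b}"
    show "(norm (Fs x *v v))\<^sup>2 <= C * Re (cinner v ((J ** Q2 x ** J) *v v))"
     unfolding c Fs_vector norm_minus_cancel norm_J
     using elim[rule_format, OF x, of "J *v v"] x by (simp add: Q2_def Let_def)
   qed
  qed
 qed
qed

lemma adjoint_norm_bound:
 assumes "horner As K y s"
 shows "(norm y)\<^sup>2 <= (1 / (4 * pi)) * (1 / 2 + C) * (LBINT x. Re (cinner (s (of_real x)) (Q2 x *v s (of_real x))))"
proof -
 interpret star: boundary_node As A K Ks "- J" Fs a b "\<lambda>x. J ** ctranspose (Wm x) ** J" "\<lambda>x. J ** ctranspose (Wp x) ** J"
  "\<lambda>x. J ** Q2 x ** J" C by (rule adjoint_boundary_node)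
 have JMJ: "(J ** M ** J) *v v = J *v (M *v (J *v v))" for M v by (simp add: matrix_vector_mult_assoc' matrix_mul_assoc)
 show ?thesis
  using star.horner_norm_bound[OF assms] by (simp add: neg_vector vector_neg JMJ cinner_J)
qed

text \<open>
 The lower bound is obtained by pairing \<open>u\<close> with the vectors of the adjoint node that approximate
 \<open>J (W\<^sub>+ + W\<^sub>-) J p\<close>, since \<open>(W\<^sub>+ + W\<^sub>-)\<^sup>* J F\<close> is the weight \<open>Q1\<close>.
\<close>

lemma horner_norm_lower_bound:
 "\<exists>c>0. \<forall>u p. horner A K u p \<longrightarrow> (LBINT x. Re (cinner (J *v p (of_real x)) (Q1 x *v (J *v p (of_real x))))) <= c * (norm u)\<^sup>2"
proof -
 define c0 where "c0 = (1 / (4 * pi)) * (1 / 2 + C)"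
 have c0: "c0 > 0" using C0 by (simp add: c0_def)
 \<comment> \<open>Comes from solving \<open>(X / (4 \<pi>))^2 <= c0 * C * X * |u|^2\<close> for
   \<open>X\<close>, where \<open>c0\<close> is the constant of the upper estimate for
   \<open>As\<close>.\<close>
 define c where "c = 16 * pi\<^sup>2 * c0 * C"
 have "(LBINT x. Re (cinner (J *v p (of_real x)) (Q1 x *v (J *v p (of_real x))))) <= c * (norm u)\<^sup>2" if u: "horner A K u p" for u p
 proof -
  define q where "q = (\<lambda>x. J *v p (complex_of_real x))"
  have p: "continuous_on UNIV p" using u by (rule horner_continuous)
  have qm[measurable]: "q \<in> borel_measurable borel" unfolding q_def using p by measurable
  have "continuous_on {a..b} (\<lambda>x. p (complex_of_real x))"
   by (rule continuous_on_compose2[OF p]) (auto intro!: continuous_intros)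
  then obtain D where D: "!!x. x \<in> {a..b} ==> norm (p (complex_of_real x)) <= D"
   by (rule continuous_bounded_Icc) blast
  have qD: "norm (q x) <= D" if "x \<in> {a..b}" for x using D[OF that] by (simp add: q_def)
  have iQ: "integrable lborel (\<lambda>x. Re (cinner (q x) (Q1 x *v q x)))" by (rule forward.integrable_Q[OF qm qD])
  have iF: "integrable lborel (\<lambda>x. F x *v q x)" by (rule integrable_F[OF qm qD])
  define ps where "ps = (\<lambda>x. (J ** (Wp x + Wm x)) *v q x)"
  have psm[measurable]: "ps \<in> borel_measurable borel" unfolding ps_def by measurable
  \<comment> \<open>The test function \<open>ps\<close> need not be bounded, whereas polynomial
    approximation requires a bounded one. It is cut off where its norm exceeds \<open>N\<close>; the
    bound on \<open>X N\<close> does not depend on \<open>N\<close>, and \<open>N\<close> tends to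
    infinity at the end.\<close>
  define T where "T = (\<lambda>(N::nat) x. x \<in> {a..b} \<and> norm (ps x) <= real N)"
  define X where "X = (\<lambda>N. LBINT x. (if T N x then Re (cinner (q x) (Q1 x *v q x)) else 0))"
  have XN: "X N <= c * (norm u)\<^sup>2" and X0: "0 <= X N" for N
  proof -
   define f where "f = (\<lambda>x. if T N x then ps x else 0)"
   have fm[measurable]: "f \<in> borel_measurable borel" unfolding f_def T_def by measurable
   have fN: "norm (f x) <= real N" for x by (simp add: f_def T_def)
   obtain y s E where y: "!!n. horner As K (y n) (s n)" and sE: "!!n x. x \<in> {a..b} ==> norm (s n (complex_of_real x)) <= E"
    and sl: "AE x in lborel. x \<in> {a..b} \<longrightarrow> (\<lambda>n::nat. s n (complex_of_real x)) \<longlonglongrightarrow> f x"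
    using horner_approximation[OF As_linear K fm fN, of a b] by blast
   have sm[measurable]: "(\<lambda>x. s n (complex_of_real x)) \<in> borel_measurable borel" for n
    using horner_continuous[OF y] by measurable
   have iX: "integrable lborel (\<lambda>x. if T N x then Re (cinner (q x) (Q1 x *v q x)) else 0)"
    by (rule Bochner_Integration.integrable_bound[OF iQ]) (auto simp: T_def)
   show "0 <= X N"
    unfolding X_def by (rule integral_nonneg_AE, use forward.Q_nonneg in eventually_elim) auto
   have lim1: "(\<lambda>n. LBINT x. cinner (s n (of_real x)) (F x *v q x)) \<longlonglongrightarrow> (LBINT x. cinner (f x) (F x *v q x))"
   proof (rule integral_dominated_convergence[where w="\<lambda>x. \<bar>E\<bar> * norm (F x *v q x)"])
    show "integrable lborel (\<lambda>x. \<bar>E\<bar> * norm (F x *v q x))" using iF by simp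
    show "AE x in lborel. (\<lambda>n. cinner (s n (of_real x)) (F x *v q x)) \<longlonglongrightarrow> cinner (f x) (F x *v q x)"
     using sl
    proof eventually_elim
     case (elim x)
     show ?case using elim by (cases "x \<in> {a..b}") (auto simp: F_support intro!: tendsto_cinner)
    qed
    show "AE x in lborel. norm (cinner (s n (of_real x)) (F x *v q x)) <= \<bar>E\<bar> * norm (F x *v q x)" for n
    proof (rule AE_I2)
     fix x
     show "norm (cinner (s n (of_real x)) (F x *v q x)) <= \<bar>E\<bar> * norm (F x *v q x)"
     proof (cases "x \<in> {a..b}")
      case True
      have "norm (cinner (s n (of_real x)) (F x *v q x)) <= norm (s n (complex_of_real x)) * norm (F x *v q x)"
       by (rule cinner_Cauchy_Schwarz)
      also have "... <= \<bar>E\<bar> * norm (F x *v q x)"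
       using sE[OF True, of n] by (intro mult_right_mono) auto
      finally show ?thesis .
     qed (simp add: F_support)
    qed
   qed measurable
   have lim2: "(\<lambda>n. LBINT x. Re (cinner (s n (of_real x)) (Q2 x *v s n (of_real x)))) \<longlonglongrightarrow> (LBINT x. Re (cinner (f x) (Q2 x *v f x)))"
   proof (rule integral_dominated_convergence[where w="\<lambda>x. C * E\<^sup>2 * indicator {a..b} x"])
    show "integrable lborel (\<lambda>x. C * E\<^sup>2 * indicator {a..b} x)"
     by (intro integrable_mult_right integrable_real_indicator) (auto simp: emeasure_lborel_Icc_eq)
    show "AE x in lborel. (\<lambda>n. Re (cinner (s n (of_real x)) (Q2 x *v s n (of_real x)))) \<longlonglongrightarrow> Re (cinner (f x) (Q2 x *v f x))"
     using sl
    proof eventually_elim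
     case (elim x)
     show ?case
     proof (cases "x \<in> {a..b}")
      case True
      then have "(\<lambda>n. s n (complex_of_real x)) \<longlonglongrightarrow> f x" using elim by blast
      then show ?thesis
       by (intro tendsto_Re tendsto_cinner bounded_linear.tendsto[OF bounded_bilinear.bounded_linear_right[OF bounded_bilinear_matrix_vector_mult]])
     next
      case False
      then have "Q2 x = 0" by (simp only: Q2_def if_False)
      then show ?thesis by simp
     qed
    qed
    show "AE x in lborel. norm (Re (cinner (s n (of_real x)) (Q2 x *v s n (of_real x)))) <= C * E\<^sup>2 * indicator {a..b} x" for n
     using weight2
    proof eventually_elim
     case (elim x)
     show ?case
     proof (cases "x \<in> {a..b}")
      case True
      let ?v = "s n (complex_of_real x)"
      have w: "0 <= Re (cinner ?v (Q2 x *v ?v))" "Re (cinner ?v (Q2 x *v ?v)) <= C * (norm ?v)\<^sup>2"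
       using elim[rule_format, OF True, of ?v] True by (simp_all add: Q2_def Let_def)
      have "C * (norm ?v)\<^sup>2 <= C * E\<^sup>2" using sE[OF True, of n] C0 by (intro mult_left_mono power_mono) auto
      then show ?thesis using w True by simp
     next
      case False
      then have "Q2 x = 0" by (simp only: Q2_def if_False)
      then show ?thesis using False by simp
     qed
    qed
   qed measurable
   have F1: "(LBINT x. cinner (f x) (F x *v q x)) = of_real (X N)"
   proof -
    have "(LBINT x. cinner (f x) (F x *v q x)) = (LBINT x. complex_of_real (if T N x then Re (cinner (q x) (Q1 x *v q x)) else 0))"
    proof (rule integral_cong_AE)
     show "AE x in lborel. cinner (f x) (F x *v q x) = complex_of_real (if T N x then Re (cinner (q x) (Q1 x *v q x)) else 0)"
      using forward.Q_eq weight1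
     proof eventually_elim
      case (elim x)
      show ?case
      proof (cases "T N x")
       case True
       then have x: "x \<in> {a..b}" by (simp add: T_def)
       have "cinner (ps x) (F x *v q x) = cinner (q x) (Q1 x *v q x)" unfolding ps_def using elim(1) x by blast
       moreover have "Im (cinner (q x) (Q1 x *v q x)) = 0"
        using elim(2)[rule_format, OF x, of "q x"] x by (simp add: Q1_def Let_def)
       ultimately show ?thesis using True by (simp add: f_def complex_eq_iff)
      qed (simp add: f_def)
     qed
     show "(\<lambda>x. complex_of_real (if T N x then Re (cinner (q x) (Q1 x *v q x)) else 0)) \<in> borel_measurable lborel"
      unfolding T_def by measurable
    qed measurable
    then show ?thesis by (simp only: X_def integral_complex_of_real)
   qed
   have F2: "(LBINT x. Re (cinner (f x) (Q2 x *v f x))) <= C * X N"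
   proof -
    have le: "AE x in lborel. Re (cinner (f x) (Q2 x *v f x)) <= C * (if T N x then Re (cinner (q x) (Q1 x *v q x)) else 0)"
     using weight12
    proof eventually_elim
     case (elim x)
     show ?case
     proof (cases "T N x")
      case True
      then have x: "x \<in> {a..b}" by (simp add: T_def)
      show ?thesis using elim[rule_format, OF x, of "q x"] x True by (simp add: f_def ps_def Q1_def Q2_def)
     qed (simp add: f_def)
    qed
    have iC: "integrable lborel (\<lambda>x. C * (if T N x then Re (cinner (q x) (Q1 x *v q x)) else 0))" using iX by simp
    have nn: "AE x in lborel. 0 <= Re (cinner (f x) (Q2 x *v f x))"
     using weight2
    proof eventually_elim
     case (elim x)
     show ?case
     proof (cases "x \<in> {a..b}")
      case True
      show ?thesis using elim[rule_format, OF True, of "f x"] True by (simp add: Q2_def Let_def)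
     next
      case False
      then have "Q2 x = 0" by (simp only: Q2_def if_False)
      then show ?thesis using False by simp
     qed
    qed
    have "integrable lborel (\<lambda>x. Re (cinner (f x) (Q2 x *v f x)))"
    proof (rule Bochner_Integration.integrable_bound[OF iC])
     show "AE x in lborel. norm (Re (cinner (f x) (Q2 x *v f x))) <= norm (C * (if T N x then Re (cinner (q x) (Q1 x *v q x)) else 0))"
      using le nn by eventually_elim (simp only: real_norm_def abs_of_nonneg order_trans[OF _ abs_ge_self])
    qed measurable
    from integral_mono_AE[OF this iC le] show ?thesis by (simp only: X_def integral_mult_right_zero)
   qed
   have ineq: "(cmod (of_real (1 / (4 * pi)) * (LBINT x. cinner (s n (of_real x)) (F x *v q x))))\<^sup>2
     <= c0 * (LBINT x. Re (cinner (s n (of_real x)) (Q2 x *v s n (of_real x)))) * (norm u)\<^sup>2" for n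
   proof -
    have "(cmod (cinner (y n) u))\<^sup>2 <= (norm (y n) * norm u)\<^sup>2" by (intro power_mono cinner_Cauchy_Schwarz) simp
    also have "... <= c0 * (LBINT x. Re (cinner (s n (of_real x)) (Q2 x *v s n (of_real x)))) * (norm u)\<^sup>2"
     unfolding power_mult_distrib c0_def by (intro mult_right_mono adjoint_norm_bound y) simp
    finally show ?thesis using horner_duality[OF y u, of n] by (simp only: q_def)
   qed
   have "(cmod (of_real (1 / (4 * pi)) * (LBINT x. cinner (f x) (F x *v q x))))\<^sup>2 <= c0 * (LBINT x. Re (cinner (f x) (Q2 x *v f x))) * (norm u)\<^sup>2"
    by (rule LIMSEQ_le[of "\<lambda>n. (cmod (of_real (1 / (4 * pi)) * (LBINT x. cinner (s n (of_real x)) (F x *v q x))))\<^sup>2" _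
       "\<lambda>n. c0 * (LBINT x. Re (cinner (s n (of_real x)) (Q2 x *v s n (of_real x)))) * (norm u)\<^sup>2"])
     (use ineq in \<open>auto intro!: tendsto_intros lim1 lim2\<close>)
   also have "... <= c0 * (C * X N) * (norm u)\<^sup>2" using c0 F2 by (intro mult_right_mono mult_left_mono) auto
   finally have "(1 / (4 * pi) * X N)\<^sup>2 <= c0 * (C * X N) * (norm u)\<^sup>2"
    unfolding F1 using \<open>0 <= X N\<close> by (simp add: norm_mult norm_divide)
   then have "X N * X N <= X N * (c * (norm u)\<^sup>2)"
    by (simp add: c_def power2_eq_square field_simps)
   moreover have "0 <= c * (norm u)\<^sup>2" using c0 C0 by (simp add: c_def)
   ultimately show "X N <= c * (norm u)\<^sup>2" using \<open>0 <= X N\<close> by (cases "X N = 0") auto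
  qed
  have "X \<longlonglongrightarrow> (LBINT x. Re (cinner (q x) (Q1 x *v q x)))"
   unfolding X_def
  proof (rule integral_dominated_convergence[where w="\<lambda>x. Re (cinner (q x) (Q1 x *v q x))"])
   show "(\<lambda>x. if T N x then Re (cinner (q x) (Q1 x *v q x)) else 0) \<in> borel_measurable lborel" for N unfolding T_def by measurable
   show "AE x in lborel. norm (if T N x then Re (cinner (q x) (Q1 x *v q x)) else 0) <= Re (cinner (q x) (Q1 x *v q x))" for N
    using forward.Q_nonneg by eventually_elim auto
   show "AE x in lborel. (\<lambda>N. if T N x then Re (cinner (q x) (Q1 x *v q x)) else 0) \<longlonglongrightarrow> Re (cinner (q x) (Q1 x *v q x))"
   proof (rule AE_I2)
    fix x
    show "(\<lambda>N. if T N x then Re (cinner (q x) (Q1 x *v q x)) else 0) \<longlonglongrightarrow> Re (cinner (q x) (Q1 x *v q x))"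
    proof (cases "x \<in> {a..b}")
     case True
     obtain N0 :: nat where "norm (ps x) <= real N0" using real_arch_simple by blast
     then have "\<forall>\<^sub>F N in sequentially. (if T N x then Re (cinner (q x) (Q1 x *v q x)) else 0) = Re (cinner (q x) (Q1 x *v q x))"
      using True by (intro eventually_sequentiallyI[of N0]) (auto simp: T_def)
     then show ?thesis by (rule tendsto_eventually)
    next
     case False
     then have "Q1 x = 0" by (simp only: Q1_def if_False)
     then show ?thesis by (simp cong: if_cong)
    qed
   qed
  qed (use iQ in auto)
  then have "(LBINT x. Re (cinner (q x) (Q1 x *v q x))) <= c * (norm u)\<^sup>2"
   by (rule LIMSEQ_le_const2) (use XN in auto)
  then show ?thesis unfolding q_def .
 qed
 \<comment> \<open>\<open>c\<close> is \<open>0\<close> when \<open>C = 0\<close>, so a strictly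
   positive constant is obtained by adding \<open>1\<close>.\<close>
 moreover have "c * (norm u)\<^sup>2 <= (c + 1) * (norm u)\<^sup>2" for u :: 'h by (intro mult_right_mono) auto
 moreover have "0 < c + 1" using c0 C0 by (simp add: c_def add_nonneg_pos)
 ultimately show ?thesis by (meson order_trans)
qed

end

section \<open>The spectral form\<close>

text \<open>The best choice is \<open>t = sqrt y / sqrt x\<close>. Keeping \<open>t\<close> free
  until after integration yields the Cauchy-Schwarz inequality for integrals from pointwise bounds
  that are linear in the two integrands.\<close>

lemma le_sqrt_mult_sqrt:
 fixes X :: real
 assumes le: "!!t. t > 0 ==> X <= (t * x + y / t) / 2" and nn: "0 <= x" "0 <= y"
 shows "X <= sqrt x * sqrt y"
proof (rule ccontr)
 assume neg: "\<not> X <= sqrt x * sqrt y"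
 have X0: "X > 0" using neg mult_nonneg_nonneg[of "sqrt x" "sqrt y"] nn by (smt (verit) real_sqrt_ge_zero)
 consider "x > 0" "y > 0" | "x = 0" | "y = 0" using nn by linarith
 then show False
 proof cases
  case 1
  have "(sqrt y / sqrt x) * x = sqrt x * sqrt y"
   using 1 by (simp add: field_simps)
  moreover have "y / (sqrt y / sqrt x) = sqrt x * sqrt y"
   using 1 by (simp add: field_simps)
  ultimately have "X <= (sqrt x * sqrt y + sqrt x * sqrt y) / 2"
   using le[of "sqrt y / sqrt x"] 1 by simp
  then show False using neg by simp
 next
  case 2
  \<comment> \<open>In the degenerate case a large \<open>t\<close> is enough; the summand
    \<open>1\<close> keeps it positive when \<open>y = 0\<close> as well.\<close>
  have "X <= y / ((y + 1) / X) / 2" using le[of "(y + 1) / X"] X0 nn 2 by simp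
  also have "... = X * (y / (2 * (y + 1)))" using X0 nn by (simp add: field_simps)
  also have "... < X * 1" using X0 nn by (intro mult_strict_left_mono) (auto simp: divide_less_eq)
  finally show False by simp
 next
  case 3
  have "X <= (X / (x + 1)) * x / 2" using le[of "X / (x + 1)"] X0 nn 3 by simp
  also have "... = X * (x / (2 * (x + 1)))" using nn by (simp add: field_simps)
  also have "... < X * 1" using X0 nn by (intro mult_strict_left_mono) (auto simp: divide_less_eq)
  finally show False by simp
 qed
qed

section \<open>Bounded Borel functions as multipliers\<close>

definition bounded_borel :: "(real => complex) => bool" where
 "bounded_borel \<phi> \<longleftrightarrow> \<phi> \<in> borel_measurable borel \<and> (\<exists>M. \<forall>x. cmod (\<phi> x) <= M)"

lemma bounded_borelI: "\<phi> \<in> borel_measurable borel ==> (!!x. cmod (\<phi> x) <= M) ==> bounded_borel \<phi>"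
 by (auto simp: bounded_borel_def)

lemma bounded_borelE:
 assumes "bounded_borel \<phi>"
 obtains M where "\<phi> \<in> borel_measurable borel" "0 <= M" "!!x. cmod (\<phi> x) <= M"
proof -
 obtain M where M: "\<phi> \<in> borel_measurable borel" "!!x. cmod (\<phi> x) <= M" using assms by (auto simp: bounded_borel_def)
 moreover have "0 <= M" using M(2)[of 0] norm_ge_zero order_trans by blast
 ultimately show ?thesis using that by blast
qed

lemma bounded_borel_mult: "bounded_borel \<phi> ==> bounded_borel \<psi> ==> bounded_borel (\<lambda>x. \<phi> x * \<psi> x)"
proof -
 assume "bounded_borel \<phi>" "bounded_borel \<psi>"
 then obtain M N where [measurable]: "\<phi> \<in> borel_measurable borel" "\<psi> \<in> borel_measurable borel"
  and "0 <= M" "!!x. cmod (\<phi> x) <= M" "0 <= N" "!!x. cmod (\<psi> x) <= N" by (metis bounded_borelE)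
 then show ?thesis by (intro bounded_borelI[where M="M * N"]) (auto simp: norm_mult intro!: mult_mono)
qed

lemma bounded_borel_add: "bounded_borel \<phi> ==> bounded_borel \<psi> ==> bounded_borel (\<lambda>x. \<phi> x + \<psi> x)"
proof -
 assume "bounded_borel \<phi>" "bounded_borel \<psi>"
 then obtain M N where [measurable]: "\<phi> \<in> borel_measurable borel" "\<psi> \<in> borel_measurable borel"
  and "0 <= M" "!!x. cmod (\<phi> x) <= M" "0 <= N" "!!x. cmod (\<psi> x) <= N" by (metis bounded_borelE)
 then show ?thesis by (intro bounded_borelI[where M="M + N"]) (auto intro!: norm_triangle_le add_mono)
qed

lemma bounded_borel_const: "bounded_borel (\<lambda>_. c)"
 by (rule bounded_borelI[where M="cmod c"]) auto

lemma bounded_borel_indicator: "D \<in> sets borel ==> bounded_borel (\<lambda>x. indicator D x)"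
 by (rule bounded_borelI[where M=1]) (auto simp: indicator_def)

lemma bounded_borel_cmult: "bounded_borel \<phi> ==> bounded_borel (\<lambda>x. c * \<phi> x)"
 using bounded_borel_mult[OF bounded_borel_const] .

lemma bounded_borel_diff: "bounded_borel \<phi> ==> bounded_borel \<psi> ==> bounded_borel (\<lambda>x. \<phi> x - \<psi> x)"
 using bounded_borel_add[OF _ bounded_borel_cmult[of \<psi> "-1"], of \<phi>] by simp

lemma bounded_borel_cnj: "bounded_borel \<phi> ==> bounded_borel (\<lambda>x. cnj (\<phi> x))"
proof -
 assume "bounded_borel \<phi>"
 then obtain M where m: "\<phi> \<in> borel_measurable borel" and "0 <= M" "!!x. cmod (\<phi> x) <= M" by (rule bounded_borelE) blast
 moreover have "(\<lambda>x. cnj (\<phi> x)) \<in> borel_measurable borel"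
  by (rule borel_measurable_continuous_on[OF _ m]) (intro continuous_intros)
 ultimately show ?thesis by (intro bounded_borelI[where M=M]) auto
qed

lemma bounded_borel_continuous:
 assumes "continuous_on UNIV f"
 shows "bounded_borel (\<lambda>x. f (complex_of_real x) * indicator {a..b} x)"
proof -
 have c: "continuous_on UNIV (\<lambda>x::real. f (complex_of_real x))"
  by (rule continuous_on_compose2[OF assms]) (auto intro!: continuous_intros)
 obtain M where M: "M \<ge> 0" "!!x. x \<in> {a..b} ==> norm (f (complex_of_real x)) <= M"
  by (rule continuous_bounded_Icc[OF continuous_on_subset[OF c, of "{a..b}"]]) auto
 have [measurable]: "(\<lambda>x. f (complex_of_real x)) \<in> borel_measurable borel"
  using c by (rule borel_measurable_continuous_onI)
 show ?thesis by (rule bounded_borelI[where M=M]) (use M in \<open>auto simp: indicator_def\<close>)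
qed

lemma integrable_bounded_borel_mult:
 assumes "bounded_borel \<phi>" and g: "integrable lborel (g :: real => complex)"
 shows "integrable lborel (\<lambda>x. \<phi> x * g x)"
proof -
 obtain M where [measurable]: "\<phi> \<in> borel_measurable borel" and M: "0 <= M" "!!x. cmod (\<phi> x) <= M"
  using assms(1) by (rule bounded_borelE) blast
 have [measurable]: "g \<in> borel_measurable borel" using g by auto
 show ?thesis
 proof (rule Bochner_Integration.integrable_bound)
  show "integrable lborel (\<lambda>x. M * norm (g x))" using g by simp
  show "AE x in lborel. norm (\<phi> x * g x) <= norm (M * norm (g x))"
   using M by (intro AE_I2) (simp add: norm_mult mult_right_mono)
 qed measurable
qed

text \<open>The outcome of the two norm estimates: on polynomial vectors the form with weight
  \<open>P\<close> is equivalent to the scalar product. Everything that follows uses this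
  equivalence and no longer the functions \<open>F\<close> and \<open>W\<close>.\<close>

locale spectral_model =
 fixes A :: "'h::complex_hilbert => 'h" and K :: "complex^'m => 'h" and P :: "real => complex^'m^'m"
  and a b c1 c2 :: real
 assumes A: "bounded_clinear A" and K: "bounded_clinear K"
  and P_measurable [measurable]: "P \<in> borel_measurable borel"
  and P_herm: "!!x. ctranspose (P x) = P x" and P_support: "!!x. x \<notin> {a..b} ==> P x = 0"
  and P_nonneg: "AE x in lborel. \<forall>v. 0 <= Re (cinner v (P x *v v))"
  and P_integrable: "!!u p. horner A K u p ==> integrable lborel (\<lambda>x. Re (cinner (p (of_real x)) (P x *v p (of_real x))))"
  and c: "0 < c1" "0 < c2"
  and lower: "!!u p. horner A K u p ==> c1 * (norm u)\<^sup>2 <= (LBINT x. Re (cinner (p (of_real x)) (P x *v p (of_real x))))"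
  and upper: "!!u p. horner A K u p ==> (LBINT x. Re (cinner (p (of_real x)) (P x *v p (of_real x)))) <= c2 * (norm u)\<^sup>2"
begin

definition e :: "(complex => complex^'m) => (complex => complex^'m) => real => complex" where
 "e p q x = cinner (p (of_real x)) (P x *v q (of_real x))"

definition H :: "'h set" where "H = closure {u. \<exists>p. horner A K u p}"

lemma e_measurable: "horner A K u p ==> horner A K w q ==> e p q \<in> borel_measurable borel"
proof -
 assume "horner A K u p" "horner A K w q"
 then have "continuous_on UNIV p" "continuous_on UNIV q" by (auto intro: horner_continuous)
 then show ?thesis unfolding e_def by measurable
qed

lemma e_add_right: "e p (\<lambda>z. q z + r z) x = e p q x + e p r x"
 and e_diff_right: "e p (\<lambda>z. q z - r z) x = e p q x - e p r x"
 and e_diff_left: "e (\<lambda>z. p z - r z) q x = e p q x - e r q x"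
 and e_scale_right: "e p (\<lambda>z. k *\<^sub>C q z) x = k * e p q x"
 and e_cnj: "e p q x = cnj (e q p x)"
 and e_support: "x \<notin> {a..b} ==> e p q x = 0"
proof -
 show "e p (\<lambda>z. q z + r z) x = e p q x + e p r x" "e p (\<lambda>z. q z - r z) x = e p q x - e p r x"
  "e (\<lambda>z. p z - r z) q x = e p q x - e r q x" "e p (\<lambda>z. k *\<^sub>C q z) x = k * e p q x"
  "x \<notin> {a..b} ==> e p q x = 0"
  by (simp_all add: e_def matrix_vector_right_distrib matrix_vector_mult_diff_distrib matrix_vector_mult_scaleC cinner_simps P_support)
 show "e p q x = cnj (e q p x)"
  unfolding e_def by (metis P_herm cinner_commute cinner_matrix_left)
qed

text \<open>Cauchy-Schwarz in arithmetic-geometric form, with \<open>t\<close> free so that it can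
  be optimized after integration by \<open>le_sqrt_mult_sqrt\<close>.\<close>

lemma e_bound: "AE x in lborel. \<forall>t>0. cmod (e p q x) <= (t * Re (e p p x) + Re (e q q x) / t) / 2"
 using P_nonneg
proof eventually_elim
 case (elim x)
 show ?case
 proof (intro allI impI)
  fix t :: real assume t: "t > 0"
  let ?x = "Re (e p p x)" and ?y = "Re (e q q x)"
  have nn: "0 <= ?x" "0 <= ?y" using elim by (auto simp: e_def)
  have "(cmod (e p q x))\<^sup>2 <= ?x * ?y"
   unfolding e_def using elim by (intro psd_Cauchy_Schwarz P_herm) auto
  also have "... = (t * ?x) * (?y / t)" using t by simp
  also have "... <= ((t * ?x + ?y / t) / 2)\<^sup>2"
  proof -
   have "0 <= (t * ?x - ?y / t)\<^sup>2" by simp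
   moreover have "X * Y <= ((X + Y) / 2)\<^sup>2" if "0 <= (X - Y)\<^sup>2" for X Y :: real
    using that by (simp add: power2_eq_square field_simps)
   ultimately show ?thesis by blast
  qed
  finally show "cmod (e p q x) <= (t * ?x + ?y / t) / 2"
   by (rule power2_le_imp_le) (use nn t in auto)
 qed
qed

lemma e_integrable:
 assumes u: "horner A K u p" and w: "horner A K w q"
 shows "integrable lborel (e p q)" "(LBINT x. norm (e p q x)) <= c2 * norm u * norm w"
proof -
 have i: "integrable lborel (\<lambda>x. Re (e p p x))" "integrable lborel (\<lambda>x. Re (e q q x))"
  using P_integrable[OF u] P_integrable[OF w] by (simp_all add: e_def)
 have dom: "integrable lborel (\<lambda>x. (t * Re (e p p x) + Re (e q q x) / t) / 2)" for t
  using i by simp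
 have [measurable]: "e p q \<in> borel_measurable borel" by (rule e_measurable[OF u w])
 show ii: "integrable lborel (e p q)"
 proof (rule Bochner_Integration.integrable_bound[OF dom[of 1]])
  show "AE x in lborel. norm (e p q x) <= norm ((1 * Re (e p p x) + Re (e q q x) / 1) / 2)"
   using e_bound[of p q]
  proof eventually_elim
   case (elim x)
   then have "cmod (e p q x) <= (1 * Re (e p p x) + Re (e q q x) / 1) / 2" using zero_less_one by blast
   also have "... <= norm ((1 * Re (e p p x) + Re (e q q x) / 1) / 2)" unfolding real_norm_def by (rule abs_ge_self)
   finally show ?case .
  qed
 qed measurable
 have "(LBINT x. norm (e p q x)) <= (t * (c2 * (norm u)\<^sup>2) + (c2 * (norm w)\<^sup>2) / t) / 2" if t: "t > 0" for t
 proof -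
  have "(LBINT x. norm (e p q x)) <= (LBINT x. (t * Re (e p p x) + Re (e q q x) / t) / 2)"
  proof (rule integral_mono_AE[OF integrable_norm[OF ii] dom])
   show "AE x in lborel. norm (e p q x) <= (t * Re (e p p x) + Re (e q q x) / t) / 2"
    using e_bound[of p q] by eventually_elim (use t in blast)
  qed
  also have "... = (t * (LBINT x. Re (e p p x)) + (LBINT x. Re (e q q x)) / t) / 2"
   using i by simp
  also have "... <= (t * (c2 * (norm u)\<^sup>2) + (c2 * (norm w)\<^sup>2) / t) / 2"
   using upper[OF u] upper[OF w] t by (intro divide_right_mono add_mono mult_left_mono) (auto simp: e_def)
  finally show ?thesis .
 qed
 then have "(LBINT x. norm (e p q x)) <= sqrt (c2 * (norm u)\<^sup>2) * sqrt (c2 * (norm w)\<^sup>2)"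
  using c by (intro le_sqrt_mult_sqrt) auto
 also have "... = c2 * norm u * norm w" using c by (simp add: real_sqrt_mult)
 finally show "(LBINT x. norm (e p q x)) <= c2 * norm u * norm w" .
qed

text \<open>Makes the passage from vectors to densities continuous in mean. In particular the
  density depends, up to null sets, only on the vectors, although a vector may have several
  polynomials.\<close>

lemma e_close:
 assumes "horner A K u p" "horner A K w q" "horner A K u' p'" "horner A K w' q'"
 shows "(LBINT x. norm (e p q x - e p' q' x)) <= c2 * (norm (u - u') * norm w + norm u' * norm (w - w'))"
proof -
 note i1 = e_integrable[OF horner_diff[OF A K assms(1,3)] assms(2)]
 note i2 = e_integrable[OF assms(3) horner_diff[OF A K assms(2,4)]]
 have "(LBINT x. norm (e p q x - e p' q' x)) <= (LBINT x. norm (e (\<lambda>z. p z - p' z) q x) + norm (e p' (\<lambda>z. q z - q' z) x))"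
 proof (rule integral_mono)
  show "integrable lborel (\<lambda>x. norm (e p q x - e p' q' x))"
   using e_integrable(1)[OF assms(1,2)] e_integrable(1)[OF assms(3,4)] by simp
  show "integrable lborel (\<lambda>x. norm (e (\<lambda>z. p z - p' z) q x) + norm (e p' (\<lambda>z. q z - q' z) x))"
   using i1(1) i2(1) by simp
  show "norm (e p q x - e p' q' x) <= norm (e (\<lambda>z. p z - p' z) q x) + norm (e p' (\<lambda>z. q z - q' z) x)" for x
   using norm_triangle_ineq[of "e (\<lambda>z. p z - p' z) q x" "e p' (\<lambda>z. q z - q' z) x"]
   by (simp add: e_diff_left e_diff_right)
 qed
 also have "... = (LBINT x. norm (e (\<lambda>z. p z - p' z) q x)) + (LBINT x. norm (e p' (\<lambda>z. q z - q' z) x))"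
  using i1(1) i2(1) by simp
 also have "... <= c2 * (norm (u - u') * norm w + norm u' * norm (w - w'))"
  using i1(2) i2(2) by (simp add: algebra_simps)
 finally show ?thesis .
qed

lemma H_approx:
 assumes "u \<in> H"
 obtains x p where "!!n. horner A K (x n) (p n)" "x \<longlonglongrightarrow> u"
proof -
 obtain x where x: "\<forall>n. x n \<in> {u. \<exists>p. horner A K u p}" "x \<longlonglongrightarrow> u"
  using assms unfolding H_def closure_sequential by blast
 then have "\<forall>n. \<exists>p. horner A K (x n) p" by blast
 from choice[OF this] obtain p where "\<forall>n. horner A K (x n) (p n)" by blast
 then show ?thesis using that x(2) by blast
qed

lemma H_limit: "(!!n. horner A K (x n) (p n)) ==> x \<longlonglongrightarrow> u ==> u \<in> H"
 unfolding H_def closure_sequential by blast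

lemma horner_H: "horner A K u p ==> u \<in> H"
 unfolding H_def by (rule closure_subset[THEN subsetD]) blast

lemma H_subspace: "closed_csubspace H"
 unfolding closed_csubspace_def
proof (intro conjI ballI allI)
 show "closed H" by (simp add: H_def)
 show "0 \<in> H" by (rule horner_H[OF horner_zero])
 fix u assume u: "u \<in> H"
 obtain x p where x: "!!n. horner A K (x n) (p n)" "x \<longlonglongrightarrow> u" by (rule H_approx[OF u]) blast
 show "k *\<^sub>C u \<in> H" for k
  by (rule H_limit[OF horner_scale[OF A K x(1)] tendsto_scaleC[OF tendsto_const x(2)]])
 fix w assume w: "w \<in> H"
 obtain y q where y: "!!n. horner A K (y n) (q n)" "y \<longlonglongrightarrow> w" by (rule H_approx[OF w]) blast
 show "u + w \<in> H" by (rule H_limit[OF horner_add[OF A K x(1) y(1)] tendsto_add[OF x(2) y(2)]])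
qed

lemma A_tendsto: "x \<longlonglongrightarrow> u ==> (\<lambda>n. A (x n)) \<longlonglongrightarrow> A u"
 by (rule bounded_linear.tendsto[OF bounded_clinear_imp_bounded_linear[OF A]])

lemma H_apply: "u \<in> H ==> A u \<in> H"
 by (rule H_approx, assumption) (blast intro: H_limit[OF horner_apply[OF K] A_tendsto])

text \<open>The density of the spectral form, obtained from polynomial vectors by continuity in \<open>L\<^sup>1\<close>.\<close>

definition is_density :: "'h => 'h => (real => complex) => bool" where
 "is_density u w g \<longleftrightarrow> integrable lborel g \<and> (\<forall>u' p w' q. horner A K u' p \<longrightarrow> horner A K w' q \<longrightarrow>
   (LBINT x. norm (e p q x - g x)) <= c2 * (norm (u' - u) * norm w' + norm u * norm (w' - w)))"

definition density_of :: "'h => 'h => real => complex" where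
 "density_of u w = (SOME g. is_density u w g)"

lemma is_density_density_of:
 assumes u: "u \<in> H" and w: "w \<in> H"
 shows "is_density u w (density_of u w)"
proof -
 obtain x p where x: "!!n. horner A K (x n) (p n)" "x \<longlonglongrightarrow> u" by (rule H_approx[OF u]) blast
 obtain y q where y: "!!n. horner A K (y n) (q n)" "y \<longlonglongrightarrow> w" by (rule H_approx[OF w]) blast
 have i: "integrable lborel (e (p n) (q m))" for n m by (rule e_integrable(1)[OF x(1) y(1)])
 have "\<exists>g. integrable lborel g \<and> (\<lambda>n. LBINT t. norm (e (p n) (q n) t - g t)) \<longlonglongrightarrow> 0"
 proof (rule L1_Cauchy_limit)
  show "integrable lborel (e (p n) (q n))" for n by (rule i)
  fix \<epsilon> :: real assume \<epsilon>: "\<epsilon> > 0"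
  obtain Mx where Mx: "!!n. norm (x n) <= Mx" "Mx > 0" using convergent_imp_Bseq[OF convergentI[OF x(2)]] by (rule BseqE) blast
  obtain My where My: "!!n. norm (y n) <= My" "My > 0" using convergent_imp_Bseq[OF convergentI[OF y(2)]] by (rule BseqE) blast
  define d where "d = \<epsilon> / (2 * (c2 * (Mx + My)))"
  have d: "d > 0" using \<epsilon> c Mx My by (simp add: d_def)
  obtain N1 where N1: "!!m n. m \<ge> N1 ==> n \<ge> N1 ==> norm (x m - x n) < d"
   using LIMSEQ_imp_Cauchy[OF x(2)] d unfolding Cauchy_iff by blast
  obtain N2 where N2: "!!m n. m \<ge> N2 ==> n \<ge> N2 ==> norm (y m - y n) < d"
   using LIMSEQ_imp_Cauchy[OF y(2)] d unfolding Cauchy_iff by blast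
  show "\<exists>N. \<forall>m\<ge>N. \<forall>n\<ge>N. (LBINT t. norm (e (p m) (q m) t - e (p n) (q n) t)) < \<epsilon>"
  proof (intro exI[of _ "max N1 N2"] allI impI)
   fix m n assume mn: "m \<ge> max N1 N2" "n \<ge> max N1 N2"
   have "(LBINT t. norm (e (p m) (q m) t - e (p n) (q n) t)) <= c2 * (norm (x m - x n) * norm (y m) + norm (x n) * norm (y m - y n))"
    by (rule e_close[OF x(1) y(1) x(1) y(1)])
   also have "... <= c2 * (d * My + Mx * d)"
    using N1[of m n] N2[of m n] mn Mx My c d by (intro mult_left_mono add_mono mult_mono) auto
   also have "... = \<epsilon> / 2"
   proof -
    have "c2 * (d * My + Mx * d) = (c2 * (Mx + My)) * d" by (simp add: algebra_simps)
    also have "... = \<epsilon> / 2"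
    proof -
     have "X * (\<epsilon> / (2 * X)) = \<epsilon> / 2" if "X > 0" for X using that by simp
     then show ?thesis unfolding d_def using c Mx(2) My(2) by simp
    qed
    finally show ?thesis .
   qed
   also have "... < \<epsilon>" using \<epsilon> by simp
   finally show "(LBINT t. norm (e (p m) (q m) t - e (p n) (q n) t)) < \<epsilon>" .
  qed
 qed
 then obtain g where g: "integrable lborel g" "(\<lambda>n. LBINT t. norm (e (p n) (q n) t - g t)) \<longlonglongrightarrow> 0" by blast
 have "is_density u w g"
  unfolding is_density_def
 proof (intro conjI allI impI g(1))
  fix u' p' w' q' assume u': "horner A K u' p'" and w': "horner A K w' q'"
  have i': "integrable lborel (e p' q')" by (rule e_integrable(1)[OF u' w'])
  have le: "(LBINT t. norm (e p' q' t - g t)) <= c2 * (norm (u' - x n) * norm w' + norm (x n) * norm (w' - y n)) + (LBINT t. norm (e (p n) (q n) t - g t))" for n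
  proof -
   have "(LBINT t. norm (e p' q' t - g t)) <= (LBINT t. norm (e p' q' t - e (p n) (q n) t) + norm (e (p n) (q n) t - g t))"
   proof (rule integral_mono)
    show "norm (e p' q' t - g t) <= norm (e p' q' t - e (p n) (q n) t) + norm (e (p n) (q n) t - g t)" for t
     using dist_triangle[of "e p' q' t" "g t" "e (p n) (q n) t"] by (simp add: dist_norm)
   qed (use i i' g in auto)
   also have "... = (LBINT t. norm (e p' q' t - e (p n) (q n) t)) + (LBINT t. norm (e (p n) (q n) t - g t))"
    using i i' g by simp
   also have "... <= c2 * (norm (u' - x n) * norm w' + norm (x n) * norm (w' - y n)) + (LBINT t. norm (e (p n) (q n) t - g t))"
    using e_close[OF u' w' x(1) y(1), of n n] by simp
   finally show ?thesis .
  qed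
  have "(\<lambda>n. c2 * (norm (u' - x n) * norm w' + norm (x n) * norm (w' - y n)) + (LBINT t. norm (e (p n) (q n) t - g t)))
    \<longlonglongrightarrow> c2 * (norm (u' - u) * norm w' + norm u * norm (w' - w)) + 0"
   by (intro tendsto_intros x y g)
  then show "(LBINT t. norm (e p' q' t - g t)) <= c2 * (norm (u' - u) * norm w' + norm u * norm (w' - w))"
   by (intro LIMSEQ_le_const[of _ "c2 * (norm (u' - u) * norm w' + norm u * norm (w' - w))"]) (use le in auto)
 qed
 then show ?thesis unfolding density_of_def by (rule someI[where P="is_density u w"])
qed

text \<open>For the constant \<open>1\<close> this is the new scalar product on \<open>H\<close>; in
  general it is the form of multiplication by \<open>\<phi>\<close> with respect to it.\<close>

definition B :: "(real => complex) => 'h => 'h => complex" where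
 "B \<phi> u w = (LBINT x. \<phi> x * density_of u w x)"

lemma density_integrable: "u \<in> H ==> w \<in> H ==> integrable lborel (density_of u w)"
 using is_density_density_of by (auto simp: is_density_def)

text \<open>Reduces each algebraic property of \<open>B\<close> to polynomial vectors, where the
  integrand is explicit, because every element of \<open>H\<close> is a limit of such
  vectors.\<close>

lemma B_limit:
 assumes \<phi>: "bounded_borel \<phi>" and x: "!!n. horner A K (x n) (p n)" "x \<longlonglongrightarrow> u" and y: "!!n. horner A K (y n) (q n)" "y \<longlonglongrightarrow> w"
 shows "(\<lambda>n. LBINT t. \<phi> t * e (p n) (q n) t) \<longlonglongrightarrow> B \<phi> u w"
proof -
 obtain M where M: "\<phi> \<in> borel_measurable borel" "0 <= M" "!!x. cmod (\<phi> x) <= M" using \<phi> by (rule bounded_borelE) blast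
 show ?thesis
 proof (rule LIM_zero_cancel, rule Lim_null_comparison)
 have u: "u \<in> H" and w: "w \<in> H" using H_limit x y by blast+
 note D = is_density_density_of[OF u w]
 have ig: "integrable lborel (density_of u w)" using D by (simp add: is_density_def)
 show "\<forall>\<^sub>F n in sequentially. norm ((LBINT t. \<phi> t * e (p n) (q n) t) - B \<phi> u w) <= M * (c2 * (norm (x n - u) * norm (y n) + norm u * norm (y n - w)))"
 proof (rule always_eventually, rule allI)
  fix n
  have ie: "integrable lborel (e (p n) (q n))" by (rule e_integrable(1)[OF x(1) y(1)])
  have "(LBINT t. \<phi> t * e (p n) (q n) t) - B \<phi> u w = (LBINT t. \<phi> t * e (p n) (q n) t - \<phi> t * density_of u w t)"
   unfolding B_def
   by (rule Bochner_Integration.integral_diff[symmetric]) (intro integrable_bounded_borel_mult \<phi> ie ig)+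
  also have "... = (LBINT t. \<phi> t * (e (p n) (q n) t - density_of u w t))" by (simp add: right_diff_distrib)
  also have "norm ... <= (LBINT t. M * norm (e (p n) (q n) t - density_of u w t))"
  proof (rule norm_lebesgue_integral_le)
   show "integrable lborel (\<lambda>t. \<phi> t * (e (p n) (q n) t - density_of u w t))"
    using ie ig by (intro integrable_bounded_borel_mult \<phi>) simp
   show "integrable lborel (\<lambda>t. M * norm (e (p n) (q n) t - density_of u w t))" using ie ig by simp
   show "norm (\<phi> t * (e (p n) (q n) t - density_of u w t)) <= M * norm (e (p n) (q n) t - density_of u w t)" for t
    unfolding norm_mult by (intro mult_right_mono M) simp
  qed
  also have "... <= M * (c2 * (norm (x n - u) * norm (y n) + norm u * norm (y n - w)))"
  proof -
   have "(LBINT t. norm (e (p n) (q n) t - density_of u w t)) <= c2 * (norm (x n - u) * norm (y n) + norm u * norm (y n - w))"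
    using D x(1) y(1) unfolding is_density_def by blast
   then show ?thesis using M by (simp add: mult_left_mono)
  qed
  finally show "norm ((LBINT t. \<phi> t * e (p n) (q n) t) - B \<phi> u w) <= M * (c2 * (norm (x n - u) * norm (y n) + norm u * norm (y n - w)))" .
 qed
 have "(\<lambda>n. M * (c2 * (norm (x n - u) * norm (y n) + norm u * norm (y n - w)))) \<longlonglongrightarrow> M * (c2 * (norm (u - u) * norm w + norm u * norm (w - w)))"
  by (intro tendsto_intros x y)
 then show "(\<lambda>n. M * (c2 * (norm (x n - u) * norm (y n) + norm u * norm (y n - w)))) \<longlonglongrightarrow> 0" by simp
 qed
qed

lemma e_mult_integrable: "bounded_borel \<phi> ==> horner A K u p ==> horner A K w q ==> integrable lborel (\<lambda>t. \<phi> t * e p q t)"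
 by (intro integrable_bounded_borel_mult e_integrable(1))

lemma B_add_right:
 assumes "bounded_borel \<phi>" "u \<in> H" "v \<in> H" "w \<in> H"
 shows "B \<phi> u (v + w) = B \<phi> u v + B \<phi> u w"
proof -
 obtain x p where x: "!!n. horner A K (x n) (p n)" "x \<longlonglongrightarrow> u" by (rule H_approx[OF assms(2)]) blast
 obtain y q where y: "!!n. horner A K (y n) (q n)" "y \<longlonglongrightarrow> v" by (rule H_approx[OF assms(3)]) blast
 obtain z r where z: "!!n. horner A K (z n) (r n)" "z \<longlonglongrightarrow> w" by (rule H_approx[OF assms(4)]) blast
 have "(\<lambda>n. LBINT t. \<phi> t * e (p n) (\<lambda>s. q n s + r n s) t) \<longlonglongrightarrow> B \<phi> u (v + w)"
  by (rule B_limit[OF assms(1) x horner_add[OF A K y(1) z(1)] tendsto_add[OF y(2) z(2)]])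
 moreover have "(LBINT t. \<phi> t * e (p n) (\<lambda>s. q n s + r n s) t) = (LBINT t. \<phi> t * e (p n) (q n) t) + (LBINT t. \<phi> t * e (p n) (r n) t)" for n
  unfolding e_add_right distrib_left
  by (intro Bochner_Integration.integral_add e_mult_integrable[OF assms(1) x(1)] y(1) z(1)) (rule y(1), rule z(1))
 ultimately have "(\<lambda>n. (LBINT t. \<phi> t * e (p n) (q n) t) + (LBINT t. \<phi> t * e (p n) (r n) t)) \<longlonglongrightarrow> B \<phi> u (v + w)" by simp
 moreover have "(\<lambda>n. (LBINT t. \<phi> t * e (p n) (q n) t) + (LBINT t. \<phi> t * e (p n) (r n) t)) \<longlonglongrightarrow> B \<phi> u v + B \<phi> u w"
  by (intro tendsto_add B_limit[OF assms(1) x y] B_limit[OF assms(1) x z])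
 ultimately show ?thesis by (rule LIMSEQ_unique)
qed

lemma B_scale_right:
 assumes "bounded_borel \<phi>" "u \<in> H" "w \<in> H"
 shows "B \<phi> u (k *\<^sub>C w) = k * B \<phi> u w"
proof -
 obtain x p where x: "!!n. horner A K (x n) (p n)" "x \<longlonglongrightarrow> u" by (rule H_approx[OF assms(2)]) blast
 obtain y q where y: "!!n. horner A K (y n) (q n)" "y \<longlonglongrightarrow> w" by (rule H_approx[OF assms(3)]) blast
 have "(\<lambda>n. LBINT t. \<phi> t * e (p n) (\<lambda>s. k *\<^sub>C q n s) t) \<longlonglongrightarrow> B \<phi> u (k *\<^sub>C w)"
  by (rule B_limit[OF assms(1) x horner_scale[OF A K y(1)] tendsto_scaleC[OF tendsto_const y(2)]])
 moreover have "(LBINT t. \<phi> t * e (p n) (\<lambda>s. k *\<^sub>C q n s) t) = k * (LBINT t. \<phi> t * e (p n) (q n) t)" for n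
  unfolding e_scale_right mult.left_commute[of _ k] by (rule integral_mult_right_zero)
 ultimately have "(\<lambda>n. k * (LBINT t. \<phi> t * e (p n) (q n) t)) \<longlonglongrightarrow> B \<phi> u (k *\<^sub>C w)" by simp
 moreover have "(\<lambda>n. k * (LBINT t. \<phi> t * e (p n) (q n) t)) \<longlonglongrightarrow> k * B \<phi> u w"
  by (intro tendsto_mult tendsto_const B_limit[OF assms(1) x y])
 ultimately show ?thesis by (rule LIMSEQ_unique)
qed

lemma B_zero_right: "bounded_borel \<phi> ==> u \<in> H ==> B \<phi> u 0 = 0"
 using B_scale_right[of \<phi> u 0 0] closed_csubspaceD(2)[OF H_subspace] by simp

lemma B_diff_right:
 assumes "bounded_borel \<phi>" "u \<in> H" "v \<in> H" "w \<in> H"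
 shows "B \<phi> u (v - w) = B \<phi> u v - B \<phi> u w"
 using B_add_right[OF assms(1-3), of "(-1) *\<^sub>C w"] B_scale_right[OF assms(1,2,4), of "-1"]
  closed_csubspaceD(4)[OF H_subspace assms(4), of "-1"] by simp

lemma B_cnj:
 assumes "bounded_borel \<phi>" "u \<in> H" "w \<in> H"
 shows "B \<phi> u w = cnj (B (\<lambda>t. cnj (\<phi> t)) w u)"
proof -
 obtain x p where x: "!!n. horner A K (x n) (p n)" "x \<longlonglongrightarrow> u" by (rule H_approx[OF assms(2)]) blast
 obtain y q where y: "!!n. horner A K (y n) (q n)" "y \<longlonglongrightarrow> w" by (rule H_approx[OF assms(3)]) blast
 have "(\<lambda>n. LBINT t. \<phi> t * e (p n) (q n) t) \<longlonglongrightarrow> B \<phi> u w" by (rule B_limit[OF assms(1) x y])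
 moreover have "(LBINT t. \<phi> t * e (p n) (q n) t) = cnj (LBINT t. cnj (\<phi> t) * e (q n) (p n) t)" for n
  unfolding Bochner_Integration.integral_cnj[symmetric] complex_cnj_mult complex_cnj_cnj e_cnj[symmetric] ..
 ultimately have "(\<lambda>n. cnj (LBINT t. cnj (\<phi> t) * e (q n) (p n) t)) \<longlonglongrightarrow> B \<phi> u w" by simp
 moreover have "(\<lambda>n. cnj (LBINT t. cnj (\<phi> t) * e (q n) (p n) t)) \<longlonglongrightarrow> cnj (B (\<lambda>t. cnj (\<phi> t)) w u)"
  by (intro tendsto_cnj B_limit[OF bounded_borel_cnj[OF assms(1)] y x])
 ultimately show ?thesis by (rule LIMSEQ_unique)
qed

lemma B_support:
 assumes "bounded_borel \<phi>" "u \<in> H" "w \<in> H"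
 shows "B \<phi> u w = B (\<lambda>t. \<phi> t * indicator {a..b} t) u w"
proof -
 obtain x p where x: "!!n. horner A K (x n) (p n)" "x \<longlonglongrightarrow> u" by (rule H_approx[OF assms(2)]) blast
 obtain y q where y: "!!n. horner A K (y n) (q n)" "y \<longlonglongrightarrow> w" by (rule H_approx[OF assms(3)]) blast
 have b: "bounded_borel (\<lambda>t. \<phi> t * indicator {a..b} t)"
  by (intro bounded_borel_mult assms bounded_borel_indicator) simp
 have eq: "\<phi> t * indicator {a..b} t * e (p n) (q n) t = \<phi> t * e (p n) (q n) t" for t n
  using e_support[of t "p n" "q n"] by (auto simp: indicator_def)
 have "(\<lambda>n. LBINT t. \<phi> t * e (p n) (q n) t) \<longlonglongrightarrow> B \<phi> u w" by (rule B_limit[OF assms(1) x y])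
 moreover from B_limit[OF b x y] have "(\<lambda>n. LBINT t. \<phi> t * e (p n) (q n) t) \<longlonglongrightarrow> B (\<lambda>t. \<phi> t * indicator {a..b} t) u w" unfolding eq .
 ultimately show ?thesis by (intro LIMSEQ_unique)
qed

text \<open>In the model \<open>A\<close> is multiplication by the variable. The cutoff to
  \<open>[a,b]\<close> makes this multiplier bounded and changes no integral, since the weight
  vanishes elsewhere.\<close>

lemma B_apply:
 assumes "bounded_borel \<phi>" "u \<in> H" "w \<in> H"
 shows "B \<phi> u (A w) = B (\<lambda>t. \<phi> t * (of_real t * indicator {a..b} t)) u w"
proof -
 obtain x p where x: "!!n. horner A K (x n) (p n)" "x \<longlonglongrightarrow> u" by (rule H_approx[OF assms(2)]) blast
 obtain y q where y: "!!n. horner A K (y n) (q n)" "y \<longlonglongrightarrow> w" by (rule H_approx[OF assms(3)]) blast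
 have b: "bounded_borel (\<lambda>t. \<phi> t * (of_real t * indicator {a..b} t))"
  by (intro bounded_borel_mult assms bounded_borel_continuous[of "\<lambda>z. z"] continuous_intros)
 have eq: "\<phi> t * e (p n) (\<lambda>z. z *\<^sub>C q n z) t = \<phi> t * (of_real t * indicator {a..b} t) * e (p n) (q n) t" for t n
  using e_support[of t "p n" "q n"]
  by (cases "t \<in> {a..b}") (auto simp: e_def P_support matrix_vector_mult_scaleC cinner_scaleC_right)
 have "(\<lambda>n. LBINT t. \<phi> t * e (p n) (\<lambda>z. z *\<^sub>C q n z) t) \<longlonglongrightarrow> B \<phi> u (A w)"
  by (rule B_limit[OF assms(1) x horner_apply[OF K y(1)] A_tendsto[OF y(2)]])
 moreover from B_limit[OF b x y] have "(\<lambda>n. LBINT t. \<phi> t * e (p n) (\<lambda>z. z *\<^sub>C q n z) t) \<longlonglongrightarrow> B (\<lambda>t. \<phi> t * (of_real t * indicator {a..b} t)) u w" unfolding eq .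
 ultimately show ?thesis by (intro LIMSEQ_unique)
qed

lemma B_nonneg:
 assumes "bounded_borel (\<lambda>t. of_real (f t))" "!!t. 0 <= f t" "u \<in> H"
 shows "0 <= Re (B (\<lambda>t. of_real (f t)) u u)"
proof -
 obtain x p where x: "!!n. horner A K (x n) (p n)" "x \<longlonglongrightarrow> u" by (rule H_approx[OF assms(3)]) blast
 have "(\<lambda>n. Re (LBINT t. of_real (f t) * e (p n) (p n) t)) \<longlonglongrightarrow> Re (B (\<lambda>t. of_real (f t)) u u)"
  by (intro tendsto_Re B_limit[OF assms(1) x x])
 moreover have "0 <= Re (LBINT t. of_real (f t) * e (p n) (p n) t)" for n
 proof -
  have "Re (LBINT t. of_real (f t) * e (p n) (p n) t) = (LBINT t. Re (of_real (f t) * e (p n) (p n) t))"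
   by (rule integral_Re[OF e_mult_integrable[OF assms(1) x(1) x(1)], symmetric])
  also have "0 <= ..."
   by (rule integral_nonneg_AE, use P_nonneg in eventually_elim) (use assms(2) in \<open>simp add: e_def\<close>)
  finally show ?thesis .
 qed
 ultimately show ?thesis by (intro LIMSEQ_le_const) auto
qed

lemma B_norm:
 assumes "u \<in> H"
 shows "c1 * (norm u)\<^sup>2 <= Re (B (\<lambda>_. 1) u u)" "Re (B (\<lambda>_. 1) u u) <= c2 * (norm u)\<^sup>2"
proof -
 obtain x p where x: "!!n. horner A K (x n) (p n)" "x \<longlonglongrightarrow> u" by (rule H_approx[OF assms]) blast
 have l: "(\<lambda>n. Re (LBINT t. 1 * e (p n) (p n) t)) \<longlonglongrightarrow> Re (B (\<lambda>_. 1) u u)"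
  by (intro tendsto_Re B_limit[OF bounded_borel_const x x])
 have eq: "Re (LBINT t. 1 * e (p n) (p n) t) = (LBINT t. Re (cinner (p n (of_real t)) (P t *v p n (of_real t))))" for n
  by (simp only: mult_1_left e_def[symmetric] integral_Re[OF e_integrable(1)[OF x(1) x(1)]])
 have n: "(\<lambda>n. k * (norm (x n))\<^sup>2) \<longlonglongrightarrow> k * (norm u)\<^sup>2" for k by (intro tendsto_intros x)
 show "c1 * (norm u)\<^sup>2 <= Re (B (\<lambda>_. 1) u u)"
  by (rule LIMSEQ_le[OF n l]) (use lower[OF x(1)] eq in auto)
 show "Re (B (\<lambda>_. 1) u u) <= c2 * (norm u)\<^sup>2"
  by (rule LIMSEQ_le[OF l n]) (use upper[OF x(1)] eq in auto)
qed

lemma B_bound: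
 assumes "\<phi> \<in> borel_measurable borel" "!!t. cmod (\<phi> t) <= M" "u \<in> H" "w \<in> H"
 shows "cmod (B \<phi> u w) <= M * (c2 * norm u * norm w)"
proof -
 have b: "bounded_borel \<phi>" by (rule bounded_borelI[OF assms(1,2)])
 have M0: "0 <= M" using assms(2)[of 0] norm_ge_zero order_trans by blast
 obtain x p where x: "!!n. horner A K (x n) (p n)" "x \<longlonglongrightarrow> u" by (rule H_approx[OF assms(3)]) blast
 obtain y q where y: "!!n. horner A K (y n) (q n)" "y \<longlonglongrightarrow> w" by (rule H_approx[OF assms(4)]) blast
 have "(\<lambda>n. cmod (LBINT t. \<phi> t * e (p n) (q n) t)) \<longlonglongrightarrow> cmod (B \<phi> u w)" by (intro tendsto_norm B_limit[OF b x y])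
 moreover have "(\<lambda>n. M * (c2 * norm (x n) * norm (y n))) \<longlonglongrightarrow> M * (c2 * norm u * norm w)" by (intro tendsto_intros x y)
 moreover have "cmod (LBINT t. \<phi> t * e (p n) (q n) t) <= M * (c2 * norm (x n) * norm (y n))" for n
 proof -
  have "cmod (LBINT t. \<phi> t * e (p n) (q n) t) <= (LBINT t. M * norm (e (p n) (q n) t))"
  proof (rule norm_lebesgue_integral_le[OF e_mult_integrable[OF b x(1) y(1)]])
   show "integrable lborel (\<lambda>t. M * norm (e (p n) (q n) t))" using e_integrable(1)[OF x(1) y(1)] by simp
   show "norm (\<phi> t * e (p n) (q n) t) <= M * norm (e (p n) (q n) t)" for t
    unfolding norm_mult by (intro mult_right_mono assms) simp
  qed
  also have "... <= M * (c2 * norm (x n) * norm (y n))"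
   using e_integrable(2)[OF x(1) y(1), of n n] M0 by (simp add: mult_left_mono)
  finally show ?thesis .
 qed
 ultimately show ?thesis by (intro LIMSEQ_le) auto
qed

lemma B_fun_add:
 assumes "bounded_borel \<phi>" "bounded_borel \<psi>" "u \<in> H" "w \<in> H"
 shows "B (\<lambda>t. \<phi> t + \<psi> t) u w = B \<phi> u w + B \<psi> u w"
 unfolding B_def distrib_right
 by (intro Bochner_Integration.integral_add integrable_bounded_borel_mult assms density_integrable)

lemma B_fun_cmult: "B (\<lambda>t. k * \<phi> t) u w = k * B \<phi> u w"
 unfolding B_def mult.assoc by (rule integral_mult_right_zero)

lemma B_fun_diff:
 assumes "bounded_borel \<phi>" "bounded_borel \<psi>" "u \<in> H" "w \<in> H"
 shows "B (\<lambda>t. \<phi> t - \<psi> t) u w = B \<phi> u w - B \<psi> u w"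
 unfolding B_def left_diff_distrib
 by (intro Bochner_Integration.integral_diff integrable_bounded_borel_mult assms density_integrable)

text \<open>Because the form has a density, an exceptional set of Lebesgue measure zero is harmless.
  This makes polynomial approximation almost everywhere sufficient for a Borel multiplier.\<close>

lemma B_dominated:
 assumes \<phi>: "!!n. \<phi> n \<in> borel_measurable borel" "!!n t. cmod (\<phi> n t) <= M" and [measurable]: "\<psi> \<in> borel_measurable borel"
  and lim: "AE t in lborel. (\<lambda>n. \<phi> n t) \<longlonglongrightarrow> \<psi> t" and u: "u \<in> H" and w: "w \<in> H"
 shows "(\<lambda>n. B (\<phi> n) u w) \<longlonglongrightarrow> B \<psi> u w"
 unfolding B_def
proof (rule integral_dominated_convergence[where w="\<lambda>t. M * norm (density_of u w t)"])
 note \<phi>(1)[measurable]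
 have i: "integrable lborel (density_of u w)" by (rule density_integrable[OF u w])
 then have [measurable]: "density_of u w \<in> borel_measurable borel" by auto
 show "(\<lambda>t. \<psi> t * density_of u w t) \<in> borel_measurable lborel" "(\<lambda>t. \<phi> n t * density_of u w t) \<in> borel_measurable lborel" for n
  by measurable
 show "integrable lborel (\<lambda>t. M * norm (density_of u w t))" using i by simp
 show "AE t in lborel. (\<lambda>n. \<phi> n t * density_of u w t) \<longlonglongrightarrow> \<psi> t * density_of u w t"
  using lim by eventually_elim (intro tendsto_mult tendsto_const)
 show "AE t in lborel. norm (\<phi> n t * density_of u w t) <= M * norm (density_of u w t)" for n
  unfolding norm_mult by (intro AE_I2 mult_right_mono \<phi>) simp
qed

end

text \<open>The similarity has to act on the simple part itself, so the functional calculus is built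
  inside a closed invariant subspace \<open>V\<close> of \<open>H\<close>, while test vectors may
  range over all of \<open>H\<close>.\<close>

locale spectral_submodel = spectral_model A K P a b c1 c2
 for A :: "'h::complex_hilbert => 'h" and K :: "complex^'m => 'h" and P a b c1 c2 +
 fixes V :: "'h set"
 assumes V: "closed_csubspace V" and VH: "V \<subseteq> H" and AV: "!!x. x \<in> V ==> A x \<in> V"
begin

lemmas Vs = closed_csubspaceD[OF V]

lemma VD: "u \<in> V ==> u \<in> H" using VH by blast

text \<open>With the map \<open>c \<mapsto> c u\<close> in place of \<open>K\<close>, the relation
  \<open>horner\<close> describes \<open>w = p(A) u\<close> for scalar polynomials. The lemma is
  thus the polynomial functional calculus, obtained from \<open>B_apply\<close> by
  recursion.\<close>

lemma B_horner:
 assumes "horner A (\<lambda>c. c *\<^sub>C u) w p" "u \<in> V"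
 shows "w \<in> V \<and> (\<forall>\<phi> v. bounded_borel \<phi> \<longrightarrow> v \<in> H \<longrightarrow> B \<phi> v w = B (\<lambda>t. \<phi> t * (p (of_real t) * indicator {a..b} t)) v u)"
 using assms(1)
proof (induction rule: horner.induct)
 case horner_zero
 show ?case using Vs(2) by (auto simp: B_zero_right) (simp add: B_def)
next
 case (horner_step w p c)
 have w: "w \<in> V" using horner_step.IH by blast
 have Aw: "A w \<in> V" and cu: "c *\<^sub>C u \<in> V" using AV[OF w] Vs(4)[OF assms(2)] by auto
 have p: "continuous_on UNIV p" using horner_step.hyps by (rule horner_continuous)
 show ?case
 proof (intro conjI allI impI)
  show "A w + c *\<^sub>C u \<in> V" by (rule Vs(3)[OF Aw cu])
  fix \<phi> v assume \<phi>: "bounded_borel \<phi>" and v: "v \<in> H"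
  have b1: "bounded_borel (\<lambda>t. \<phi> t * (of_real t * indicator {a..b} t))"
   by (intro bounded_borel_mult \<phi> bounded_borel_continuous[of "\<lambda>z. z"] continuous_intros)
  have b2: "bounded_borel (\<lambda>t. \<phi> t * (of_real t * indicator {a..b} t) * (p (of_real t) * indicator {a..b} t))"
   by (intro bounded_borel_mult[OF b1] bounded_borel_continuous p)
  have b3: "bounded_borel (\<lambda>t. c * \<phi> t * indicator {a..b} t)"
   by (intro bounded_borel_mult bounded_borel_cmult \<phi> bounded_borel_indicator) simp
  have "B \<phi> v (A w + c *\<^sub>C u) = B \<phi> v (A w) + c * B \<phi> v u"
   by (simp add: B_add_right[OF \<phi> v VD[OF Aw] VD[OF cu]] B_scale_right[OF \<phi> v VD[OF assms(2)]])
  also have "B \<phi> v (A w) = B (\<lambda>t. \<phi> t * (of_real t * indicator {a..b} t) * (p (of_real t) * indicator {a..b} t)) v u"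
   using horner_step.IH b1 v unfolding B_apply[OF \<phi> v VD[OF w]] by blast
  also have "c * B \<phi> v u = B (\<lambda>t. c * \<phi> t * indicator {a..b} t) v u"
   unfolding B_fun_cmult[symmetric] by (rule B_support[OF bounded_borel_cmult[OF \<phi>] v VD[OF assms(2)]])
  also have "B (\<lambda>t. \<phi> t * (of_real t * indicator {a..b} t) * (p (of_real t) * indicator {a..b} t)) v u + B (\<lambda>t. c * \<phi> t * indicator {a..b} t) v u
   = B (\<lambda>t. \<phi> t * (of_real t * indicator {a..b} t) * (p (of_real t) * indicator {a..b} t) + c * \<phi> t * indicator {a..b} t) v u"
   by (rule B_fun_add[OF b2 b3 v VD[OF assms(2)], symmetric])
  also have "(\<lambda>t. \<phi> t * (of_real t * indicator {a..b} t) * (p (of_real t) * indicator {a..b} t) + c * \<phi> t * indicator {a..b} t)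
    = (\<lambda>t. \<phi> t * ((of_real t *\<^sub>C p (of_real t) + c) * indicator {a..b} t))"
   by (auto simp: fun_eq_iff indicator_def scaleC_complex_def algebra_simps)
  finally show "B \<phi> v (A w + c *\<^sub>C u) = B (\<lambda>t. \<phi> t * ((of_real t *\<^sub>C p (of_real t) + c) * indicator {a..b} t)) v u" .
 qed
qed

lemma bounded_borel_square: "bounded_borel \<phi> ==> bounded_borel (\<lambda>t. of_real ((cmod (\<phi> t))\<^sup>2))"
 using bounded_borel_mult[OF _ bounded_borel_cnj, of \<phi> \<phi>] by (simp only: complex_norm_square)

text \<open>\<open>d\<close> stands for \<open>\<phi>(A) u\<close>, and the claim is that the new
  scalar product turns it into the square mean of \<open>\<phi>\<close>. The multiplier property is
  used in the right argument and, after Hermitian symmetry, in the left one.\<close>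

lemma B_square_of_multiplier:
 assumes \<phi>: "bounded_borel \<phi>" and u: "u \<in> H" and d: "d \<in> H"
  and mult: "!!\<psi> v. bounded_borel \<psi> ==> v \<in> H ==> B \<psi> v d = B (\<lambda>t. \<psi> t * \<phi> t) v u"
 shows "B (\<lambda>_. 1) d d = B (\<lambda>t. of_real ((cmod (\<phi> t))\<^sup>2)) u u"
proof -
 have "B (\<lambda>_. 1) d d = B (\<lambda>t. 1 * \<phi> t) d u" by (rule mult[OF bounded_borel_const d])
 also have "... = cnj (B (\<lambda>t. cnj (\<phi> t)) u d)" using B_cnj[OF \<phi> d u] by simp
 also have "... = cnj (B (\<lambda>t. cnj (\<phi> t) * \<phi> t) u u)" by (simp only: mult[OF bounded_borel_cnj[OF \<phi>] u])
 also have "... = cnj (B (\<lambda>t. of_real ((cmod (\<phi> t))\<^sup>2)) u u)" unfolding complex_norm_square mult.commute[of "cnj _"] ..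
 also have "... = B (\<lambda>t. of_real ((cmod (\<phi> t))\<^sup>2)) u u"
  by (subst B_cnj[OF bounded_borel_square[OF \<phi>] u u]) simp
 finally show ?thesis .
qed

lemma B_tendsto:
 assumes \<phi>: "bounded_borel \<phi>" and v: "v \<in> H" and w: "!!n. w n \<in> H" "w' \<in> H" "w \<longlonglongrightarrow> w'"
 shows "(\<lambda>n. B \<phi> v (w n)) \<longlonglongrightarrow> B \<phi> v w'"
proof -
 obtain M where M: "\<phi> \<in> borel_measurable borel" "0 <= M" "!!x. cmod (\<phi> x) <= M" using \<phi> by (rule bounded_borelE) blast
 show ?thesis
 proof (rule LIM_zero_cancel, rule Lim_null_comparison)
 have "norm (B \<phi> v (w n) - B \<phi> v w') <= M * (c2 * norm v * norm (w n - w'))" for n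
  using B_bound[OF M(1,3) v closed_csubspaceD(6)[OF H_subspace w(1,2)], of n] by (simp add: B_diff_right[OF \<phi> v w(1,2)])
 then show "\<forall>\<^sub>F n in sequentially. norm (B \<phi> v (w n) - B \<phi> v w') <= M * (c2 * norm v * norm (w n - w'))"
  by (intro always_eventually allI)
 have "(\<lambda>n. M * (c2 * norm v * norm (w n - w'))) \<longlonglongrightarrow> M * (c2 * norm v * norm (w' - w'))"
  by (intro tendsto_intros w)
 then show "(\<lambda>n. M * (c2 * norm v * norm (w n - w'))) \<longlonglongrightarrow> 0" by simp
 qed
qed

text \<open>The Borel functional calculus, with \<open>w\<close> in the role of
  \<open>\<psi>(A) u\<close>. Polynomials approximate \<open>\<psi>\<close> boundedly almost
  everywhere on \<open>[a,b]\<close>; by \<open>B_square_of_multiplier\<close> the distances of the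
  vectors \<open>p n (A) u\<close> are square-mean distances of the polynomials, so these vectors
  converge in the closed set \<open>V\<close>.\<close>

lemma multiplier_exists:
 assumes \<psi>: "bounded_borel \<psi>" and u: "u \<in> V"
 shows "\<exists>w\<in>V. \<forall>\<phi> v. bounded_borel \<phi> \<longrightarrow> v \<in> H \<longrightarrow> B \<phi> v w = B (\<lambda>t. \<phi> t * \<psi> t) v u"
proof -
 obtain M where M: "\<psi> \<in> borel_measurable borel" "0 <= M" "!!x. cmod (\<psi> x) <= M" using \<psi> by (rule bounded_borelE) blast
 obtain p :: "nat => complex poly" where p: "!!n t. t \<in> {a..b} ==> cmod (poly (p n) (of_real t)) <= 2 * M + 2"
  and pl: "AE t in lborel. t \<in> {a..b} \<longrightarrow> (\<lambda>n. poly (p n) (of_real t)) \<longlonglongrightarrow> \<psi> t"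
  using bounded_measurable_poly_limit[OF M(1,3)] by blast
 define \<theta> where "\<theta> = (\<lambda>n t. poly (p n) (complex_of_real t) * indicator {a..b} t)"
 define \<psi>' where "\<psi>' = (\<lambda>t. \<psi> t * indicator {a..b} t)"
 have b\<theta>: "bounded_borel (\<theta> n)" for n
  unfolding \<theta>_def by (intro bounded_borel_continuous continuous_intros)
 have b\<psi>: "bounded_borel \<psi>'" unfolding \<psi>'_def by (intro bounded_borel_mult \<psi> bounded_borel_indicator) simp
 have m\<theta>: "\<theta> n \<in> borel_measurable borel" for n using b\<theta>[of n] by (simp add: bounded_borel_def)
 have m\<psi>: "\<psi>' \<in> borel_measurable borel" using b\<psi> by (simp add: bounded_borel_def)
 have \<theta>M: "cmod (\<theta> n t) <= 2 * M + 2" for n t using p[of t n] M(2) by (auto simp: \<theta>_def indicator_def)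
 have \<psi>M: "cmod (\<psi>' t) <= M" for t using M(2,3) by (auto simp: \<psi>'_def indicator_def)
 have lim: "AE t in lborel. (\<lambda>n. \<theta> n t) \<longlonglongrightarrow> \<psi>' t"
  using pl by eventually_elim (auto simp: \<theta>_def \<psi>'_def indicator_def)
 have "bounded_clinear (\<lambda>c. c *\<^sub>C u)"
  by (rule bounded_clinear_onI[where C="norm u"])
   (simp_all add: scaleC_add_left scaleC_scaleC scaleC_complex_def norm_scaleC mult.commute)
 then have "\<forall>n. \<exists>w. horner A (\<lambda>c. c *\<^sub>C u) w (\<lambda>z. poly (p n) z *\<^sub>C 1)" using horner_poly[OF A] by blast
 from choice[OF this] obtain w where w: "!!n. horner A (\<lambda>c. c *\<^sub>C u) (w n) (\<lambda>z. poly (p n) z *\<^sub>C 1)" by blast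
 have wV: "w n \<in> V" for n using B_horner[OF w u] by blast
 have Bw: "B \<phi> v (w n) = B (\<lambda>t. \<phi> t * \<theta> n t) v u" if "bounded_borel \<phi>" "v \<in> H" for \<phi> v n
  using B_horner[OF w u] that by (simp add: \<theta>_def scaleC_complex_def)
 \<comment> \<open>The squared distance of \<open>\<theta> n\<close> from \<open>\<psi>'\<close> in
   the square mean determined by \<open>u\<close>.\<close>
 define \<delta> where "\<delta> = (\<lambda>n. Re (B (\<lambda>t. of_real ((cmod (\<theta> n t - \<psi>' t))\<^sup>2)) u u))"
 have \<delta>: "\<delta> \<longlonglongrightarrow> 0"
 proof -
  have "(\<lambda>n. B (\<lambda>t. of_real ((cmod (\<theta> n t - \<psi>' t))\<^sup>2)) u u) \<longlonglongrightarrow> B (\<lambda>t. 0) u u"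
  proof (rule B_dominated[where M="(3 * M + 2)\<^sup>2", OF _ _ _ _ VD[OF u] VD[OF u]])
   show "(\<lambda>t. complex_of_real ((cmod (\<theta> n t - \<psi>' t))\<^sup>2)) \<in> borel_measurable borel" for n
    using m\<theta>[of n] m\<psi> by measurable
   show "cmod (complex_of_real ((cmod (\<theta> n t - \<psi>' t))\<^sup>2)) <= (3 * M + 2)\<^sup>2" for n t
   proof -
    have "cmod (\<theta> n t - \<psi>' t) <= 3 * M + 2"
     using norm_triangle_ineq4[of "\<theta> n t" "\<psi>' t"] \<theta>M[of n t] \<psi>M[of t] by linarith
    then show ?thesis by (simp add: power_mono norm_power)
   qed
   show "AE t in lborel. (\<lambda>n. complex_of_real ((cmod (\<theta> n t - \<psi>' t))\<^sup>2)) \<longlonglongrightarrow> 0"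
    using lim
   proof eventually_elim
    case (elim t)
    have "(\<lambda>n. complex_of_real ((cmod (\<theta> n t - \<psi>' t))\<^sup>2)) \<longlonglongrightarrow> complex_of_real ((cmod (\<psi>' t - \<psi>' t))\<^sup>2)"
     by (intro tendsto_intros elim)
    then show ?case by simp
   qed
  qed simp
  then show ?thesis using tendsto_Re unfolding \<delta>_def by (fastforce simp: B_def)
 qed
 have step: "c1 * (norm (w n - w m))\<^sup>2 <= 2 * \<delta> n + 2 * \<delta> m" for n m
 proof -
  have d: "w n - w m \<in> V" by (rule Vs(6)[OF wV wV])
  have bd: "bounded_borel (\<lambda>t. \<theta> n t - \<theta> m t)" by (intro bounded_borel_diff b\<theta>)
  have mult: "B \<phi> v (w n - w m) = B (\<lambda>t. \<phi> t * (\<theta> n t - \<theta> m t)) v u" if "bounded_borel \<phi>" "v \<in> H" for \<phi> v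
   unfolding B_diff_right[OF that VD[OF wV] VD[OF wV]] Bw[OF that] right_diff_distrib
   by (intro B_fun_diff[symmetric] bounded_borel_mult that b\<theta> VD u)
  let ?f = "\<lambda>k t. (cmod (\<theta> k t - \<psi>' t))\<^sup>2" and ?g = "\<lambda>t. (cmod (\<theta> n t - \<theta> m t))\<^sup>2"
  have bf: "bounded_borel (\<lambda>t. of_real (?f k t))" for k
   by (intro bounded_borel_square bounded_borel_diff b\<theta> b\<psi>)
  have bg: "bounded_borel (\<lambda>t. of_real (?g t))" by (intro bounded_borel_square bd)
  have "bounded_borel (\<lambda>t. 2 * of_real (?f n t) + 2 * of_real (?f m t) - of_real (?g t))"
   by (intro bounded_borel_diff bounded_borel_add bounded_borel_cmult bf bg)
  moreover have "(\<lambda>t. 2 * of_real (?f n t) + 2 * of_real (?f m t) - of_real (?g t)) = (\<lambda>t. complex_of_real (2 * ?f n t + 2 * ?f m t - ?g t))"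
   by simp
  ultimately have b: "bounded_borel (\<lambda>t. complex_of_real (2 * ?f n t + 2 * ?f m t - ?g t))" by simp
  have "0 <= Re (B (\<lambda>t. complex_of_real (2 * ?f n t + 2 * ?f m t - ?g t)) u u)"
  proof (rule B_nonneg[OF b _ VD[OF u]])
   fix t
   have "?g t <= 2 * ?f n t + 2 * ?f m t"
    using norm_sum_sq_le[of "\<theta> n t - \<psi>' t" "\<psi>' t - \<theta> m t"] by (simp add: norm_minus_commute)
   then show "0 <= 2 * ?f n t + 2 * ?f m t - ?g t" by linarith
  qed
  also have "B (\<lambda>t. complex_of_real (2 * ?f n t + 2 * ?f m t - ?g t)) u u
    = 2 * B (\<lambda>t. of_real (?f n t)) u u + 2 * B (\<lambda>t. of_real (?f m t)) u u - B (\<lambda>t. of_real (?g t)) u u"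
  proof -
   note U = VD[OF u] VD[OF u]
   have "B (\<lambda>t. complex_of_real (2 * ?f n t + 2 * ?f m t - ?g t)) u u = B (\<lambda>t. (2 * of_real (?f n t) + 2 * of_real (?f m t)) - of_real (?g t)) u u"
    by simp
   also have "... = B (\<lambda>t. 2 * of_real (?f n t) + 2 * of_real (?f m t)) u u - B (\<lambda>t. of_real (?g t)) u u"
    by (rule B_fun_diff[OF bounded_borel_add[OF bounded_borel_cmult[OF bf] bounded_borel_cmult[OF bf]] bg U])
   also have "B (\<lambda>t. 2 * of_real (?f n t) + 2 * of_real (?f m t)) u u = B (\<lambda>t. 2 * of_real (?f n t)) u u + B (\<lambda>t. 2 * of_real (?f m t)) u u"
    by (rule B_fun_add[OF bounded_borel_cmult[OF bf] bounded_borel_cmult[OF bf] U])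
   finally show ?thesis unfolding B_fun_cmult .
  qed
  finally have "Re (B (\<lambda>t. of_real (?g t)) u u) <= 2 * \<delta> n + 2 * \<delta> m" by (simp add: \<delta>_def)
  moreover have "B (\<lambda>_. 1) (w n - w m) (w n - w m) = B (\<lambda>t. of_real (?g t)) u u"
   by (rule B_square_of_multiplier[OF bd VD[OF u] VD[OF d] mult])
  ultimately show ?thesis using B_norm(1)[OF VD[OF d]] by simp
 qed
 have "Cauchy w"
  unfolding Cauchy_iff
 proof (intro allI impI)
  fix \<epsilon> :: real assume \<epsilon>: "\<epsilon> > 0"
  have "\<forall>\<^sub>F n in sequentially. \<delta> n < c1 * \<epsilon>\<^sup>2 / 4"
   using order_tendstoD(2)[OF \<delta>, of "c1 * \<epsilon>\<^sup>2 / 4"] \<epsilon> c by simp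
  then obtain N where N: "!!n. n \<ge> N ==> \<delta> n < c1 * \<epsilon>\<^sup>2 / 4" by (auto simp: eventually_sequentially)
  show "\<exists>N. \<forall>m\<ge>N. \<forall>n\<ge>N. norm (w m - w n) < \<epsilon>"
  proof (intro exI[of _ N] allI impI)
   fix m n assume "m \<ge> N" "n \<ge> N"
   then have "c1 * (norm (w m - w n))\<^sup>2 < c1 * \<epsilon>\<^sup>2" using step[of m n] N[of m] N[of n] by linarith
   then have "(norm (w m - w n))\<^sup>2 < \<epsilon>\<^sup>2" using c by simp
   then show "norm (w m - w n) < \<epsilon>" using \<epsilon> by (simp add: power2_less_imp_less)
  qed
 qed
 then obtain w' where w': "w \<longlonglongrightarrow> w'" using Cauchy_convergent_iff convergent_def by blast
 have w'V: "w' \<in> V" by (rule closed_sequentially[OF Vs(1) wV w'])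
 have "B \<phi> v w' = B (\<lambda>t. \<phi> t * \<psi> t) v u" if \<phi>: "bounded_borel \<phi>" and v: "v \<in> H" for \<phi> v
 proof -
  obtain N where N: "\<phi> \<in> borel_measurable borel" "0 <= N" "!!x. cmod (\<phi> x) <= N" using \<phi> by (rule bounded_borelE) blast
  have "(\<lambda>n. B (\<lambda>t. \<phi> t * \<theta> n t) v u) \<longlonglongrightarrow> B (\<lambda>t. \<phi> t * \<psi>' t) v u"
  proof (rule B_dominated[where M="N * (2 * M + 2)", OF _ _ _ _ v VD[OF u]])
   show "(\<lambda>t. \<phi> t * \<theta> n t) \<in> borel_measurable borel" for n using N(1) m\<theta>[of n] by measurable
   show "(\<lambda>t. \<phi> t * \<psi>' t) \<in> borel_measurable borel" using N(1) m\<psi> by measurable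
   show "cmod (\<phi> t * \<theta> n t) <= N * (2 * M + 2)" for n t
    unfolding norm_mult using N \<theta>M by (intro mult_mono) auto
   show "AE t in lborel. (\<lambda>n. \<phi> t * \<theta> n t) \<longlonglongrightarrow> \<phi> t * \<psi>' t"
    using lim by eventually_elim (intro tendsto_intros)
  qed
  moreover have "(\<lambda>n. B (\<lambda>t. \<phi> t * \<theta> n t) v u) \<longlonglongrightarrow> B \<phi> v w'"
   unfolding Bw[OF \<phi> v, symmetric] by (rule B_tendsto[OF \<phi> v VD[OF wV] VD[OF w'V] w'])
  ultimately have "B \<phi> v w' = B (\<lambda>t. \<phi> t * \<psi>' t) v u" by (rule LIMSEQ_unique[symmetric])
  also have "... = B (\<lambda>t. \<phi> t * \<psi> t) v u"
   using B_support[OF bounded_borel_mult[OF \<phi> \<psi>] v VD[OF u]] by (simp add: \<psi>'_def mult.assoc)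
  finally show ?thesis .
 qed
 then show ?thesis using w'V by blast
qed

definition mult_by :: "(real => complex) => 'h => 'h" where
 "mult_by \<psi> u = (SOME w. w \<in> V \<and> (\<forall>\<phi> v. bounded_borel \<phi> \<longrightarrow> v \<in> H \<longrightarrow> B \<phi> v w = B (\<lambda>t. \<phi> t * \<psi> t) v u))"

lemma mult_by:
 assumes "bounded_borel \<psi>" "u \<in> V"
 shows "mult_by \<psi> u \<in> V" "!!\<phi> v. bounded_borel \<phi> ==> v \<in> H ==> B \<phi> v (mult_by \<psi> u) = B (\<lambda>t. \<phi> t * \<psi> t) v u"
proof -
 have "\<exists>w. w \<in> V \<and> (\<forall>\<phi> v. bounded_borel \<phi> \<longrightarrow> v \<in> H \<longrightarrow> B \<phi> v w = B (\<lambda>t. \<phi> t * \<psi> t) v u)"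
  using multiplier_exists[OF assms] by blast
 from someI_ex[OF this] show "mult_by \<psi> u \<in> V" "!!\<phi> v. bounded_borel \<phi> ==> v \<in> H ==> B \<phi> v (mult_by \<psi> u) = B (\<lambda>t. \<phi> t * \<psi> t) v u"
  unfolding mult_by_def by blast+
qed

text \<open>Tested with the indicator of the set where the real part is negative: nonnegativity of
  the form there forces the integral over that set to vanish.\<close>

lemma density_of_nonneg:
 assumes u: "u \<in> H"
 shows "AE t in lborel. 0 <= Re (density_of u u t)"
proof -
 let ?g = "density_of u u"
 have ig: "integrable lborel ?g" by (rule density_integrable[OF u u])
 then have [measurable]: "?g \<in> borel_measurable borel" by auto
 define N where "N = {t. Re (?g t) < 0}"
 have N: "N \<in> sets borel" unfolding N_def by measurable
 have bN: "bounded_borel (\<lambda>t. of_real (indicator N t))"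
  using bounded_borel_indicator[OF N] by (simp add: indicator_def of_bool_def if_distrib cong: if_cong)
 have iN: "integrable lborel (\<lambda>t. of_real (indicator N t) * ?g t)" by (rule integrable_bounded_borel_mult[OF bN ig])
 have "0 <= Re (B (\<lambda>t. of_real (indicator N t)) u u)" by (rule B_nonneg[OF bN _ u]) simp
 also have "... = (LBINT t. Re (of_real (indicator N t) * ?g t))" unfolding B_def by (rule integral_Re[OF iN, symmetric])
 finally have "0 <= (LBINT t. Re (of_real (indicator N t) * ?g t))" .
 moreover have "(LBINT t. - Re (of_real (indicator N t) * ?g t)) \<ge> 0"
  by (rule Bochner_Integration.integral_nonneg) (simp add: N_def indicator_def)
 ultimately have z: "(LBINT t. - Re (of_real (indicator N t) * ?g t)) = 0" by simp
 have "AE t in lborel. - Re (of_real (indicator N t) * ?g t) = 0"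
 proof (subst integral_nonneg_eq_0_iff_AE[symmetric])
  show "integrable lborel (\<lambda>t. - Re (of_real (indicator N t) * ?g t))" using integrable_Re[OF iN] by simp
  show "AE t in lborel. 0 <= - Re (of_real (indicator N t) * ?g t)" by (intro AE_I2) (simp add: N_def indicator_def)
 qed (rule z)
 then show ?thesis by eventually_elim (auto simp: N_def indicator_def split: if_splits)
qed

text \<open>
 The spectral form of the constant \<open>1\<close> is equivalent to the scalar product on \<open>V\<close>, hence is the scalar
 product transported by some \<open>S\<close>. In this form \<open>A\<close> is symmetric, and so is multiplication by any
 real function of the spectral parameter.
\<close>

theorem similar_to_absolutely_continuous:
 "\<exists>T. selfadjoint_on V T \<and> abs_cont_spectrum_on V T \<and> linearly_similar_on V A T"
proof -
 \<comment> \<open>\<open>form_similarity\<close> requires the lower constant not to exceed the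
   upper one, and \<open>c1 <= c2\<close> is not an assumption of the model.\<close>
 define C where "C = max c1 c2"
 have C: "0 < C" "c1 <= C" "c2 <= C" using c by (auto simp: C_def)
 note b1 = bounded_borel_const[of 1]
 have "\<exists>S. bounded_clinear_on V S \<and> bij_betw S V V \<and> bounded_clinear_on V (inv_into V S) \<and>
  (\<forall>x\<in>V. \<forall>y\<in>V. B (\<lambda>_. 1) x y = of_real C * cinner (S x) (S y))"
 proof (rule form_similarity[OF V])
  show "B (\<lambda>_. 1) x y = cnj (B (\<lambda>_. 1) y x)" if "x \<in> V" "y \<in> V" for x y
   using B_cnj[OF b1 VD[OF that(1)] VD[OF that(2)]] by simp
  show "B (\<lambda>_. 1) x (y + z) = B (\<lambda>_. 1) x y + B (\<lambda>_. 1) x z" if "x \<in> V" "y \<in> V" "z \<in> V" for x y z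
   by (rule B_add_right[OF b1 VD[OF that(1)] VD[OF that(2)] VD[OF that(3)]])
  show "B (\<lambda>_. 1) x (k *\<^sub>C y) = k * B (\<lambda>_. 1) x y" if "x \<in> V" "y \<in> V" for k x y
   by (rule B_scale_right[OF b1 VD[OF that(1)] VD[OF that(2)]])
  show "c1 * (norm x)\<^sup>2 <= Re (B (\<lambda>_. 1) x x)" if "x \<in> V" for x by (rule B_norm(1)[OF VD[OF that]])
  show "Re (B (\<lambda>_. 1) x x) <= C * (norm x)\<^sup>2" if "x \<in> V" for x
   by (rule order_trans[OF B_norm(2)[OF VD[OF that]]]) (intro mult_right_mono C zero_le_power2)
 qed (use c C in auto)
 then obtain S where S: "bounded_clinear_on V S" "bij_betw S V V" "bounded_clinear_on V (inv_into V S)"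
  and BS: "!!x y. x \<in> V ==> y \<in> V ==> B (\<lambda>_. 1) x y = of_real C * cinner (S x) (S y)" by blast
 define T where "T = inv_into V S"
 have SV: "S x \<in> V" and TV: "T x \<in> V" and ST: "S (T x) = x" and TS: "T (S x) = x" if "x \<in> V" for x
  using S(2) that unfolding T_def
  by (auto simp: bij_betw_def inv_into_into f_inv_into_f)
 obtain CT where CT: "!!x. x \<in> V ==> norm (T x) <= CT * norm x"
  using S(3) unfolding bounded_clinear_on_def T_def by blast
 have Tadd: "T (x + y) = T x + T y" if "x \<in> V" "y \<in> V" for x y
  using S(3) that by (auto simp: bounded_clinear_on_def T_def)
 have Tscale: "T (k *\<^sub>C x) = k *\<^sub>C T x" if "x \<in> V" for x k
  using S(3) that by (auto simp: bounded_clinear_on_def T_def)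
 \<comment> \<open>As \<open>T\<close> inverts \<open>S\<close>, this is the functional calculus of
   \<open>A\<close> conjugated by \<open>S\<close>, hence symmetric in the original scalar product
   when \<open>\<psi>\<close> is real.\<close>
 define X where "X = (\<lambda>\<psi> y. S (mult_by \<psi> (T y)))"
 have XV: "X \<psi> y \<in> V" if "bounded_borel \<psi>" "y \<in> V" for \<psi> y
  unfolding X_def by (intro SV mult_by TV that)
 have X: "cinner v (X \<psi> y) = B \<psi> (T v) (T y) / of_real C" if "bounded_borel \<psi>" "y \<in> V" "v \<in> V" for \<psi> y v
 proof -
  have "of_real C * cinner v (X \<psi> y) = of_real C * cinner (S (T v)) (S (mult_by \<psi> (T y)))" by (simp add: ST[OF that(3)] X_def)
  also have "... = B (\<lambda>_. 1) (T v) (mult_by \<psi> (T y))" by (rule BS[symmetric, OF TV[OF that(3)] mult_by(1)[OF that(1) TV[OF that(2)]]])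
  also have "... = B \<psi> (T v) (T y)" using mult_by(2)[OF that(1) TV[OF that(2)] b1 VD[OF TV[OF that(3)]]] by simp
  finally show ?thesis using C by (simp add: field_simps)
 qed
 \<comment> \<open>Vectors of \<open>V\<close> are determined by their scalar products with
   \<open>V\<close>, so every identity for \<open>X\<close> reduces to one for the form
   \<open>B\<close>.\<close>
 have Xeq: "z = X \<psi> y" if "bounded_borel \<psi>" "y \<in> V" "z \<in> V" "!!v. v \<in> V ==> cinner v z = B \<psi> (T v) (T y) / of_real C" for \<psi> y z
  by (rule cinner_eqI[where V=V]) (use that X in \<open>auto intro!: Vs(6) XV\<close>)
 have Xself: "selfadjoint_on V (X \<psi>)" if \<psi>: "bounded_borel \<psi>" and real: "!!t. cnj (\<psi> t) = \<psi> t" for \<psi>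
  unfolding selfadjoint_on_def
 proof (intro conjI ballI)
  obtain M where M: "\<psi> \<in> borel_measurable borel" "0 <= M" "!!x. cmod (\<psi> x) <= M" using \<psi> by (rule bounded_borelE) blast
  show "X \<psi> ` V \<subseteq> V" using XV[OF \<psi>] by blast
  show "cinner (X \<psi> x) y = cinner x (X \<psi> y)" if x: "x \<in> V" and y: "y \<in> V" for x y
  proof -
   have "cinner (X \<psi> x) y = cnj (cinner y (X \<psi> x))" by (rule cinner_commute)
   also have "... = cnj (B \<psi> (T y) (T x)) / of_real C" by (simp add: X[OF \<psi> x y])
   also have "cnj (B \<psi> (T y) (T x)) = B \<psi> (T x) (T y)"
    using B_cnj[OF \<psi> VD[OF TV[OF x]] VD[OF TV[OF y]]] by (simp add: real)
   finally show ?thesis by (simp add: X[OF \<psi> y x])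
  qed
  show "bounded_clinear_on V (X \<psi>)"
  proof (rule bounded_clinear_onI[where C="M * c2 * CT\<^sup>2 / C"])
   fix x y assume x: "x \<in> V" and y: "y \<in> V"
   show "X \<psi> (x + y) = X \<psi> x + X \<psi> y"
    by (rule Xeq[symmetric, OF \<psi>])
     (simp_all add: x y Vs XV \<psi> cinner_add_right X Tadd B_add_right[OF \<psi>] VD TV add_divide_distrib)
  next
   fix k x assume x: "x \<in> V"
   show "X \<psi> (k *\<^sub>C x) = k *\<^sub>C X \<psi> x"
    by (rule Xeq[symmetric, OF \<psi>])
     (simp_all add: x Vs XV \<psi> cinner_scaleC_right X Tscale B_scale_right[OF \<psi>] VD TV)
  next
   fix x assume x: "x \<in> V"
   have "of_real ((norm (X \<psi> x))\<^sup>2) = B \<psi> (T (X \<psi> x)) (T x) / of_real C"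
    using X[OF \<psi> x XV[OF \<psi> x]] by (simp add: cinner_self)
   then have "(norm (X \<psi> x))\<^sup>2 = cmod (B \<psi> (T (X \<psi> x)) (T x) / of_real C)"
    by (metis abs_of_nonneg norm_of_real zero_le_power2)
   also have "... = cmod (B \<psi> (T (X \<psi> x)) (T x)) / C"
    using C by (simp add: norm_divide)
   also have "... <= M * (c2 * norm (T (X \<psi> x)) * norm (T x)) / C"
    using C by (intro divide_right_mono B_bound[OF M(1,3)] VD TV XV \<psi> x) simp
   also have "... <= M * (c2 * (CT * norm (X \<psi> x)) * (CT * norm x)) / C"
    using C c M(2) CT[OF XV[OF \<psi> x]] CT[OF x] order_trans[OF norm_ge_zero CT[OF XV[OF \<psi> x]]]
    by (intro divide_right_mono mult_left_mono mult_mono) auto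
   also have "... = norm (X \<psi> x) * (M * c2 * CT\<^sup>2 / C * norm x)" by (simp add: power2_eq_square)
   finally have le: "norm (X \<psi> x) * norm (X \<psi> x) <= norm (X \<psi> x) * (M * c2 * CT\<^sup>2 / C * norm x)" by (simp only: power2_eq_square)
   show "norm (X \<psi> x) <= M * c2 * CT\<^sup>2 / C * norm x"
   proof (cases "norm (X \<psi> x) = 0")
    case True
    then show ?thesis using C c M(2) by simp
   next
    case False
    then show ?thesis using le by (metis mult_le_cancel_left_pos norm_ge_zero order_le_less)
   qed
  qed
 qed
 have Xmult: "X \<phi> (X \<psi> x) = X (\<lambda>t. \<phi> t * \<psi> t) x" if \<phi>: "bounded_borel \<phi>" and \<psi>: "bounded_borel \<psi>" and x: "x \<in> V" for \<phi> \<psi> x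
 proof (rule Xeq[OF bounded_borel_mult[OF \<phi> \<psi>] x XV[OF \<phi> XV[OF \<psi> x]]])
  fix v assume v: "v \<in> V"
  have "T (X \<psi> x) = mult_by \<psi> (T x)" unfolding X_def by (intro TS mult_by \<psi> TV x)
  then show "cinner v (X \<phi> (X \<psi> x)) = B (\<lambda>t. \<phi> t * \<psi> t) (T v) (T x) / of_real C"
   by (simp add: X[OF \<phi> XV[OF \<psi> x] v] mult_by(2)[OF \<psi> TV[OF x] \<phi> VD[OF TV[OF v]]])
 qed
 have Xone: "X (\<lambda>_. 1) x = x" if x: "x \<in> V" for x
 proof (rule Xeq[symmetric, OF b1 x x])
  fix v assume v: "v \<in> V"
  show "cinner v x = B (\<lambda>_. 1) (T v) (T x) / of_real C"
   using BS[OF TV[OF v] TV[OF x]] C by (simp add: ST x v)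
 qed
 have Xadd: "X (\<lambda>t. \<phi> t + \<psi> t) x = X \<phi> x + X \<psi> x" if \<phi>: "bounded_borel \<phi>" and \<psi>: "bounded_borel \<psi>" and x: "x \<in> V" for \<phi> \<psi> x
  by (rule Xeq[symmetric, OF bounded_borel_add[OF \<phi> \<psi>] x Vs(3)[OF XV[OF \<phi> x] XV[OF \<psi> x]]])
   (simp add: cinner_add_right X \<phi> \<psi> x B_fun_add VD TV add_divide_distrib)
 have Xdiff: "X (\<lambda>t. \<phi> t - \<psi> t) x = X \<phi> x - X \<psi> x" if \<phi>: "bounded_borel \<phi>" and \<psi>: "bounded_borel \<psi>" and x: "x \<in> V" for \<phi> \<psi> x
  by (rule Xeq[symmetric, OF bounded_borel_diff[OF \<phi> \<psi>] x Vs(6)[OF XV[OF \<phi> x] XV[OF \<psi> x]]])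
   (simp add: cinner_diff_right X \<phi> \<psi> x B_fun_diff VD TV diff_divide_distrib)
 have Xnorm: "(norm (X \<psi> x))\<^sup>2 = Re (B (\<lambda>t. of_real ((cmod (\<psi> t))\<^sup>2)) (T x) (T x)) / C" if \<psi>: "bounded_borel \<psi>" and x: "x \<in> V" for \<psi> x
 proof -
  note m = mult_by[OF \<psi> TV[OF x]]
  have "of_real C * of_real ((norm (X \<psi> x))\<^sup>2) = B (\<lambda>_. 1) (mult_by \<psi> (T x)) (mult_by \<psi> (T x))"
   unfolding BS[OF m(1) m(1)] X_def cinner_self ..
  also have "... = B (\<lambda>t. of_real ((cmod (\<psi> t))\<^sup>2)) (T x) (T x)"
   by (rule B_square_of_multiplier[OF \<psi> VD[OF TV[OF x]] VD[OF m(1)] m(2)])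
  finally have "Re (of_real (C * (norm (X \<psi> x))\<^sup>2)) = Re (B (\<lambda>t. of_real ((cmod (\<psi> t))\<^sup>2)) (T x) (T x))" by simp
  then show ?thesis using C by (simp add: field_simps)
 qed
 have Xlim: "(\<lambda>n. X (\<psi> n) x) \<longlonglongrightarrow> X \<psi>' x"
  if \<psi>: "!!n. \<psi> n \<in> borel_measurable borel" "!!n t. cmod (\<psi> n t) <= 1" "\<psi>' \<in> borel_measurable borel" "!!t. cmod (\<psi>' t) <= 1"
   and lim: "!!t. (\<lambda>n. \<psi> n t) \<longlonglongrightarrow> \<psi>' t" and x: "x \<in> V" for \<psi> :: "nat => real => complex" and \<psi>' x
 proof -
  note b = bounded_borelI[OF \<psi>(1,2)] bounded_borelI[OF \<psi>(3,4)]
  have "(\<lambda>n. B (\<lambda>t. of_real ((cmod (\<psi> n t - \<psi>' t))\<^sup>2)) (T x) (T x)) \<longlonglongrightarrow> B (\<lambda>t. 0) (T x) (T x)"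
  proof (rule B_dominated[where M=4, OF _ _ _ AE_I2 VD[OF TV[OF x]] VD[OF TV[OF x]]])
   show "(\<lambda>t. complex_of_real ((cmod (\<psi> n t - \<psi>' t))\<^sup>2)) \<in> borel_measurable borel" for n
    using \<psi>(1)[of n] \<psi>(3) by measurable
   show "cmod (complex_of_real ((cmod (\<psi> n t - \<psi>' t))\<^sup>2)) <= 4" for n t
   proof -
    have "cmod (\<psi> n t - \<psi>' t) <= 2" using norm_triangle_ineq4[of "\<psi> n t" "\<psi>' t"] \<psi>(2)[of n t] \<psi>(4)[of t] by linarith
    from power_mono[OF this norm_ge_zero, of 2] show ?thesis by (simp add: norm_power)
   qed
   show "(\<lambda>n. complex_of_real ((cmod (\<psi> n t - \<psi>' t))\<^sup>2)) \<longlonglongrightarrow> 0" for t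
   proof -
    have "(\<lambda>n. complex_of_real ((cmod (\<psi> n t - \<psi>' t))\<^sup>2)) \<longlonglongrightarrow> complex_of_real ((cmod (\<psi>' t - \<psi>' t))\<^sup>2)"
     by (intro tendsto_intros lim)
    then show ?thesis by simp
   qed
  qed simp
  then have "(\<lambda>n. Re (B (\<lambda>t. of_real ((cmod (\<psi> n t - \<psi>' t))\<^sup>2)) (T x) (T x)) / C) \<longlonglongrightarrow> Re 0 / C"
   by (intro tendsto_divide tendsto_Re tendsto_const) (use C in \<open>simp_all add: B_def\<close>)
  then have "(\<lambda>n. (norm (X (\<psi> n) x - X \<psi>' x))\<^sup>2) \<longlonglongrightarrow> 0"
   unfolding Xdiff[OF b x, symmetric] Xnorm[OF bounded_borel_diff[OF b] x] by simp
  then have "(\<lambda>n. sqrt ((norm (X (\<psi> n) x - X \<psi>' x))\<^sup>2)) \<longlonglongrightarrow> sqrt 0" by (rule tendsto_real_sqrt)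
  then have "(\<lambda>n. norm (X (\<psi> n) x - X \<psi>' x)) \<longlonglongrightarrow> 0" by simp
  then show ?thesis by (rule LIM_zero_cancel[OF tendsto_norm_zero_cancel])
 qed
 define E where "E = (\<lambda>\<Delta>. X (indicator \<Delta>))"
 note bi = bounded_borel_indicator
 have bi': "bounded_borel (indicator \<Delta>)" if "\<Delta> \<in> sets borel" for \<Delta> using bi[OF that] .
 have E: "spectral_measure_on V E"
  unfolding spectral_measure_on_def
 proof (intro conjI ballI allI impI)
  fix \<Delta> :: "real set" assume \<Delta>: "\<Delta> \<in> sets borel"
  show "selfadjoint_on V (E \<Delta>)" unfolding E_def by (rule Xself[OF bi'[OF \<Delta>]]) (simp add: indicator_def)
  fix x assume x: "x \<in> V"
  have "(\<lambda>t. indicator \<Delta> t * indicator \<Delta> t :: complex) = indicator \<Delta>" by (auto simp: indicator_def)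
  then show "E \<Delta> (E \<Delta> x) = E \<Delta> x" unfolding E_def Xmult[OF bi'[OF \<Delta>] bi'[OF \<Delta>] x] by simp
 next
  fix x assume "x \<in> V"
  moreover have "indicator UNIV = (\<lambda>_::real. 1::complex)" by (auto simp: indicator_def)
  ultimately show "E UNIV x = x" unfolding E_def using Xone by simp
 next
  fix \<Delta> :: "nat => real set" and x assume "range \<Delta> \<subseteq> sets borel \<and> disjoint_family \<Delta>" and x: "x \<in> V"
  then have \<Delta>: "!!n. \<Delta> n \<in> sets borel" and dis: "disjoint_family \<Delta>" by auto
  have U: "(\<Union>i<n. \<Delta> i) \<in> sets borel" "(\<Union>n. \<Delta> n) \<in> sets borel" for n using \<Delta> by auto
  have part: "(\<Sum>i<n. E (\<Delta> i) x) = E (\<Union>i<n. \<Delta> i) x" for n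
  proof (induction n)
   case 0
   have "X (\<lambda>t. 0) x = 0" using Xdiff[OF b1 b1 x] by simp
   moreover have "indicator {} = (\<lambda>t::real. 0::complex)" by auto
   ultimately show ?case by (simp add: E_def)
  next
   case (Suc n)
   have "indicator (\<Union>i<Suc n. \<Delta> i) = (\<lambda>t. indicator (\<Union>i<n. \<Delta> i) t + indicator (\<Delta> n) t :: complex)"
   proof
    fix t
    have "\<Delta> i \<inter> \<Delta> n = {}" if "i < n" for i using disjoint_family_onD[OF dis, of i n] that by simp
    then have "(\<Union>i<n. \<Delta> i) \<inter> \<Delta> n = {}" by blast
    then show "indicator (\<Union>i<Suc n. \<Delta> i) t = (indicator (\<Union>i<n. \<Delta> i) t + indicator (\<Delta> n) t :: complex)"
     by (auto simp: indicator_def lessThan_Suc)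
   qed
   then show ?case using Xadd[OF bi'[OF U(1)] bi'[OF \<Delta>] x] Suc.IH by (simp add: E_def)
  qed
  have "(\<lambda>n. X (indicator (\<Union>i<n. \<Delta> i)) x) \<longlonglongrightarrow> X (indicator (\<Union>n. \<Delta> n)) x"
   using U by (intro Xlim x LIMSEQ_indicator_UN borel_measurable_indicator) (auto simp: indicator_def)
  then show "(\<lambda>n. E (\<Delta> n) x) sums E (\<Union>n. \<Delta> n) x"
   unfolding sums_def part by (simp only: E_def)
 qed
 define \<tau> where "\<tau> = (\<lambda>t. complex_of_real t * indicator {a..b} t)"
 have b\<tau>: "bounded_borel \<tau>" unfolding \<tau>_def by (intro bounded_borel_continuous[of "\<lambda>z. z"] continuous_intros)
 \<comment> \<open>The operator similar to \<open>A\<close>. It is identified next with the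
   multiplier by the variable, from which symmetry and the spectral formula follow.\<close>
 define Op where "Op = (\<lambda>y. S (A (T y)))"
 have Op: "Op y = X \<tau> y" if y: "y \<in> V" for y
 proof (rule Xeq[OF b\<tau> y])
  have AT: "A (T y) \<in> V" by (intro AV TV y)
  then show "Op y \<in> V" unfolding Op_def by (rule SV)
  fix v assume v: "v \<in> V"
  have "of_real C * cinner v (Op y) = B (\<lambda>_. 1) (T v) (A (T y))"
   using BS[OF TV[OF v] AT] by (simp add: Op_def ST v)
  also have "... = B \<tau> (T v) (T y)" using B_apply[OF b1 VD[OF TV[OF v]] VD[OF TV[OF y]]] by (simp add: \<tau>_def)
  finally show "cinner v (Op y) = B \<tau> (T v) (T y) / of_real C" using C by (simp add: field_simps)
 qed
 have sX: "selfadjoint_on V (X \<tau>)" by (rule Xself[OF b\<tau>]) (simp add: \<tau>_def indicator_def)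
 have sOp: "selfadjoint_on V Op"
  using sX Op unfolding selfadjoint_on_def bounded_clinear_on_def
  by (simp add: Vs(3,4) image_subset_iff)
 have density: "\<exists>f. f \<in> borel_measurable lborel \<and> scalar_spectral_measure E x = density lborel f
   \<and> integrable (scalar_spectral_measure E x) (\<lambda>t. t)
   \<and> cinner x (Op x) = of_real (LINT t|scalar_spectral_measure E x. t)" if x: "x \<in> V" for x
 proof -
  define g where "g = density_of (T x) (T x)"
  note H2 = VD[OF TV[OF x]] VD[OF TV[OF x]]
  have ig: "integrable lborel g" unfolding g_def by (rule density_integrable[OF H2])
  then have [measurable]: "g \<in> borel_measurable borel" by auto
  \<comment> \<open>The density is nonnegative only almost everywhere and the maximum makes it so at
    every point, as a measure density requires. The indicator gives bounded support and so makes the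
    identity function integrable.\<close>
  define f where "f = (\<lambda>t. max 0 (Re (g t)) * indicator {a..b} t / C)"
  have f0: "0 <= f t" for t using C by (simp add: f_def)
  have [measurable]: "f \<in> borel_measurable borel" unfolding f_def by measurable
  have eqf: "AE t in lborel. f t = Re (g t) * indicator {a..b} t / C"
   using density_of_nonneg[OF VD[OF TV[OF x]]] by eventually_elim (simp add: f_def g_def)
  have ifn: "integrable lborel f"
  proof (rule Bochner_Integration.integrable_bound[where f="\<lambda>t. norm (g t) / C"])
   have "f t <= norm (g t) / C" for t
   proof -
    have "max 0 (Re (g t)) * indicator {a..b} t <= cmod (g t)" using complex_Re_le_cmod[of "g t"] by (simp add: indicator_def)
    then show ?thesis unfolding f_def using C by (intro divide_right_mono) auto
   qed
   then show "AE t in lborel. norm (f t) <= norm (norm (g t) / C)" using C f0 by simp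
  qed (use ig in auto)
  have real: "cinner x (X \<psi> x) = of_real (LBINT t. h t * f t)"
   if \<psi>: "bounded_borel \<psi>" and h: "!!t. \<psi> t = of_real (h t)" and i: "integrable lborel (\<lambda>t. h t * f t)" for \<psi> h
  proof (rule complex_eqI)
   have b: "bounded_borel (\<lambda>t. \<psi> t * indicator {a..b} t)" by (intro bounded_borel_mult \<psi> bi) simp
   have "cinner x (X \<psi> x) = B (\<lambda>t. \<psi> t * indicator {a..b} t) (T x) (T x) / of_real C"
    by (simp add: X[OF \<psi> x x] flip: B_support[OF \<psi> H2])
   then have "Re (cinner x (X \<psi> x)) = Re (LBINT t. \<psi> t * indicator {a..b} t * g t) / C" by (simp add: B_def g_def)
   also have "Re (LBINT t. \<psi> t * indicator {a..b} t * g t) = (LBINT t. Re (\<psi> t * indicator {a..b} t * g t))"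
    by (rule integral_Re[symmetric, OF integrable_bounded_borel_mult[OF b ig]])
   also have "... / C = (LBINT t. Re (\<psi> t * indicator {a..b} t * g t) / C)" by simp
   also have "... = (LBINT t. h t * f t)"
   proof (rule integral_cong_AE)
    have "\<psi> \<in> borel_measurable borel" using \<psi> by (simp add: bounded_borel_def)
    then show "(\<lambda>t. Re (\<psi> t * indicator {a..b} t * g t) / C) \<in> borel_measurable lborel" by measurable
    show "(\<lambda>t. h t * f t) \<in> borel_measurable lborel" using i by auto
    show "AE t in lborel. Re (\<psi> t * indicator {a..b} t * g t) / C = h t * f t"
     using eqf by eventually_elim (simp add: h indicator_def)
   qed
   finally show "Re (cinner x (X \<psi> x)) = Re (of_real (LBINT t. h t * f t))" by simp
   have "cinner x (X \<psi> x) = cnj (cinner x (X \<psi> x))"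
    using Xself[OF \<psi>] x h by (metis cinner_commute complex_cnj_complex_of_real selfadjoint_on_def)
   then show "Im (cinner x (X \<psi> x)) = Im (of_real (LBINT t. h t * f t))" by (simp add: complex_eq_iff)
  qed
  have m: "scalar_spectral_measure E x = density lborel (\<lambda>t. ennreal (f t))"
  proof -
   have "scalar_spectral_measure E x = measure_of UNIV (sets borel) (emeasure (density lborel (\<lambda>t. ennreal (f t))))"
    unfolding scalar_spectral_measure_def
   proof (rule measure_of_eq)
    fix \<Delta> :: "real set" assume "\<Delta> \<in> sigma_sets UNIV (sets borel)"
    then have \<Delta> [measurable]: "\<Delta> \<in> sets borel" using sets.sigma_sets_eq[of "borel::real measure"] by simp
    have i: "integrable lborel (\<lambda>t. indicator \<Delta> t * f t)"
     using integrable_mult_indicator[OF _ ifn, of \<Delta>] by simp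
    have "Re (cinner x (E \<Delta> x)) = (LBINT t. indicator \<Delta> t * f t)"
     unfolding E_def by (subst real[OF bi'[OF \<Delta>] _ i]) (simp_all add: indicator_def)
    then have "ennreal (Re (cinner x (E \<Delta> x))) = ennreal (LBINT t. indicator \<Delta> t * f t)" by simp
    also have "... = (\<integral>\<^sup>+t. ennreal (indicator \<Delta> t * f t) \<partial>lborel)"
     by (rule nn_integral_eq_integral[symmetric, OF i]) (simp add: f0)
    also have "... = (\<integral>\<^sup>+t. ennreal (f t) * indicator \<Delta> t \<partial>lborel)"
     by (intro nn_integral_cong) (simp add: indicator_def)
    also have "... = emeasure (density lborel (\<lambda>t. ennreal (f t))) \<Delta>" by (rule emeasure_density[symmetric]) simp_all
    finally show "ennreal (Re (cinner x (E \<Delta> x))) = emeasure (density lborel (\<lambda>t. ennreal (f t))) \<Delta>" .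
   qed simp
   also have "... = density lborel (\<lambda>t. ennreal (f t))"
    using measure_of_of_measure[of "density lborel (\<lambda>t. ennreal (f t))"] by simp
   finally show ?thesis .
  qed
  obtain N where N: "0 <= N" "!!t. t \<in> {a..b} ==> norm t <= N"
   by (rule continuous_bounded_Icc[of a b "\<lambda>t. t"]) (auto intro!: continuous_intros)
  have it: "integrable lborel (\<lambda>t. f t * t)"
  proof (rule Bochner_Integration.integrable_bound[where f="\<lambda>t. N * f t"])
   have "norm (f t * t) <= norm (N * f t)" for t
   proof (cases "t \<in> {a..b}")
    case True
    then have "\<bar>t\<bar> * f t <= N * f t" using N f0 by (intro mult_right_mono) auto
    then show ?thesis using N f0 by (simp add: abs_mult mult.commute)
   qed (simp add: f_def)
   then show "AE t in lborel. norm (f t * t) <= norm (N * f t)" by (intro AE_I2)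
  qed (use ifn in auto)
  have it': "integrable lborel (\<lambda>t. (t * indicator {a..b} t) * f t)"
   by (rule Bochner_Integration.integrable_cong[THEN iffD1, OF refl _ it]) (simp add: f_def indicator_def)
  have "integrable (scalar_spectral_measure E x) (\<lambda>t. t)"
   unfolding m by (subst integrable_real_density) (use it f0 in auto)
  moreover have "cinner x (Op x) = of_real (LINT t|scalar_spectral_measure E x. t)"
  proof -
   have "cinner x (Op x) = of_real (LBINT t. (t * indicator {a..b} t) * f t)"
    unfolding Op[OF x] by (rule real[OF b\<tau> _ it']) (simp add: \<tau>_def indicator_def)
   also have "(LBINT t. (t * indicator {a..b} t) * f t) = (LBINT t. f t * t)"
    by (rule Bochner_Integration.integral_cong) (simp_all add: f_def indicator_def)
   also have "... = (LINT t|scalar_spectral_measure E x. t)"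
    unfolding m by (rule integral_real_density[symmetric]) (use f0 in auto)
   finally show ?thesis .
  qed
  moreover have "(\<lambda>t. ennreal (f t)) \<in> borel_measurable lborel" by measurable
  ultimately show ?thesis by (intro exI[of _ "\<lambda>t. ennreal (f t)"] conjI m)
 qed
 have "spectral_measure_of_on V Op E" unfolding spectral_measure_of_on_def using E density by blast
 moreover have "absolutely_continuous lborel (scalar_spectral_measure E x)" if "x \<in> V" for x
  using density[OF that] by (metis absolutely_continuousI_density)
 ultimately have "abs_cont_spectrum_on V Op" unfolding abs_cont_spectrum_on_def by blast
 moreover have "linearly_similar_on V A Op"
  unfolding linearly_similar_on_def by (rule exI[of _ S]) (simp add: S Op_def TS)
 ultimately show ?thesis using sOp by blast
qed

end

section \<open>Resolvent moments and the simple part\<close>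

lemma cadjoint_eqI:
 assumes "!!x y. cinner (S y) x = cinner y (T x)"
 shows "cadjoint T = S"
 unfolding cadjoint_def
proof (rule the_equality)
 show "\<forall>x y. cinner (S y) x = cinner y (T x)" using assms by blast
 fix S' assume S': "\<forall>x y. cinner (S' y) x = cinner y (T x)"
 show "S' = S"
 proof
  fix y
  have e: "cinner (S' y) x = cinner (S y) x" for x using S' assms by simp
  have e': "cinner x (S' y) = cinner x (S y)" for x unfolding cinner_commute[of x] e ..
  show "S' y = S y" by (rule cinner_eqI[where V=UNIV]) (simp_all add: e')
 qed
qed

text \<open>\<open>cadjoint\<close> is a definite description, so an adjoint must be exhibited
  before it can be used. For a finite-dimensional domain it is written down in coordinates.\<close>

lemma finite_dimensional_adjoint:
 fixes K :: "complex^'m => 'h::complex_hilbert"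
 assumes K: "bounded_clinear K"
 obtains Ks where "bounded_clinear Ks" "!!x v. cinner (Ks x) v = cinner x (K v)"
proof -
 obtain CK where CK: "!!v. norm (K v) <= CK * norm v" using K by (auto simp: bounded_clinear_on_def)
 define Ks where "Ks = (\<lambda>y. \<chi> i. cinner (K (axis i 1)) y)"
 have adj: "cinner (Ks y) v = cinner y (K v)" for y v
 proof -
  have "K v = K (\<Sum>i\<in>UNIV. v $ i *\<^sub>C axis i 1)" using vec_as_sum[of v] by simp
  also have "... = (\<Sum>i\<in>UNIV. v $ i *\<^sub>C K (axis i 1))"
   by (simp only: linear_sum[OF bounded_linear.linear[OF bounded_clinear_imp_bounded_linear[OF K]]] bounded_clinearD(2)[OF K])
  finally have "cinner y (K v) = (\<Sum>i\<in>UNIV. v $ i * cinner y (K (axis i 1)))"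
   by (simp only: linear_sum[OF bounded_linear.linear[OF bounded_linear_cinner_right]] cinner_scaleC_right)
  also have "... = cinner (Ks y) v"
   unfolding cinner_vec_def cinner_complex_def Ks_def by (simp add: cinner_commute[of y] mult.commute)
  finally show ?thesis ..
 qed
 have "bounded_clinear Ks"
 proof (rule bounded_clinear_onI[where C="\<bar>CK\<bar>"])
  show "Ks (x + y) = Ks x + Ks y" for x y by (simp add: Ks_def vec_eq_iff cinner_add_right)
  show "Ks (c *\<^sub>C x) = c *\<^sub>C Ks x" for c x by (simp add: Ks_def vec_eq_iff cinner_scaleC_right scaleC_vec_def scaleC_complex_def)
  show "norm (Ks y) <= \<bar>CK\<bar> * norm y" for y
  proof -
   have "(norm (Ks y))\<^sup>2 = cmod (cinner y (K (Ks y)))"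
    unfolding adj[symmetric] cinner_self by (simp add: norm_power)
   also have "... <= norm y * norm (K (Ks y))" by (rule cinner_Cauchy_Schwarz)
   also have "... <= norm y * (\<bar>CK\<bar> * norm (Ks y))"
    by (intro mult_left_mono order_trans[OF CK] mult_right_mono) auto
   finally have "norm (Ks y) * norm (Ks y) <= norm (Ks y) * (\<bar>CK\<bar> * norm y)" by (simp add: power2_eq_square mult_ac)
   then show ?thesis
    by (cases "norm (Ks y) = 0") (simp, metis mult_le_cancel_left_pos norm_ge_zero order_le_less)
  qed
 qed
 then show ?thesis using adj by (rule that)
qed

text \<open>Surjectivity comes from the contraction \<open>x \<mapsto> (A x - y) / z\<close>;
  injectivity and the bound on the inverse come from the triangle inequality.\<close>

lemma resolvent_set_outside:
 fixes A :: "'h::complex_hilbert => 'h"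
 assumes A: "bounded_clinear A" and N: "!!x. norm (A x) <= N * norm x" "0 < N" "N < cmod z"
 shows "z \<in> resolvent_set A"
proof -
 let ?T = "\<lambda>x. A x - z *\<^sub>C x"
 have z0: "z \<noteq> 0" using N by auto
 have Tdiff: "?T (x - y) = ?T x - ?T y" for x y
  by (simp add: bounded_clinearD[OF A] scaleC_diff_right)
 have low: "(cmod z - N) * norm x <= norm (?T x)" for x
 proof -
  have "cmod z * norm x - N * norm x <= norm (z *\<^sub>C x) - norm (A x)" using N(1)[of x] by (simp add: norm_scaleC)
  also have "... <= norm (?T x)" using norm_triangle_ineq2[of "z *\<^sub>C x" "A x"] by (simp add: norm_minus_commute)
  finally show ?thesis by (simp add: algebra_simps)
 qed
 have inj: "inj ?T"
 proof (rule injI)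
  fix x y assume "?T x = ?T y"
  then have "(cmod z - N) * norm (x - y) <= 0" using low[of "x - y"] Tdiff[of x y] by simp
  then show "x = y" using N(3) by (simp add: mult_le_0_iff)
 qed
 have surj: "\<exists>x. ?T x = y" for y
 proof -
  have "\<exists>!x. (\<lambda>x. (1 / z) *\<^sub>C (A x - y)) x = x"
  proof (rule banach_fix_type)
   show "0 <= N / cmod z" "N / cmod z < 1" using N(2,3) by (simp_all add: divide_less_eq)
   show "\<forall>u v. dist ((1 / z) *\<^sub>C (A u - y)) ((1 / z) *\<^sub>C (A v - y)) <= N / cmod z * dist u v"
   proof (intro allI)
    fix u v
    have "dist ((1 / z) *\<^sub>C (A u - y)) ((1 / z) *\<^sub>C (A v - y)) = norm (A (u - v)) / cmod z"
     by (simp add: dist_norm bounded_clinearD[OF A] norm_scaleC norm_divide flip: scaleC_diff_right)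
    also have "... <= (N * norm (u - v)) / cmod z" by (intro divide_right_mono N) simp
    finally show "dist ((1 / z) *\<^sub>C (A u - y)) ((1 / z) *\<^sub>C (A v - y)) <= N / cmod z * dist u v" by (simp add: dist_norm)
   qed
  qed
  then obtain x where x: "(1 / z) *\<^sub>C (A x - y) = x" by blast
  have "z *\<^sub>C x = z *\<^sub>C ((1 / z) *\<^sub>C (A x - y))" using x by simp
  also have "... = A x - y" using z0 by (simp add: scaleC_scaleC)
  finally have "?T x = y" by simp
  then show ?thesis ..
 qed
 then have "surj ?T" unfolding surj_def by metis
 with inj have bij: "bij ?T" by (simp add: bij_def)
 have Tinv: "?T (inv ?T x) = x" for x by (rule surj_f_inv_f[OF \<open>surj ?T\<close>])
 have invT: "inv ?T x = y" if "?T y = x" for x y using inv_f_f[OF inj, of y] that by simp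
 have "bounded_clinear (inv ?T)"
 proof (rule bounded_clinear_onI[where C="1 / (cmod z - N)"])
  show "inv ?T (x + y) = inv ?T x + inv ?T y" for x y
  proof (rule invT)
   have "?T (u + v) = ?T u + ?T v" for u v by (simp add: bounded_clinearD[OF A] scaleC_add_right)
   then show "?T (inv ?T x + inv ?T y) = x + y" by (simp only: Tinv)
  qed
  show "inv ?T (c *\<^sub>C x) = c *\<^sub>C inv ?T x" for c x
  proof (rule invT)
   have "?T (c *\<^sub>C u) = c *\<^sub>C ?T u" for u by (simp add: bounded_clinearD[OF A] scaleC_diff_right scaleC_scaleC mult.commute)
   then show "?T (c *\<^sub>C inv ?T x) = c *\<^sub>C x" by (simp only: Tinv)
  qed
  show "norm (inv ?T x) <= 1 / (cmod z - N) * norm x" for x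
   using low[of "inv ?T x"] N(3) unfolding Tinv by (simp add: field_simps)
 qed
 with bij show ?thesis by (simp add: resolvent_set_def)
qed

text \<open>Compares coefficients at infinity without expanding in a series. Both \<open>r t\<close>
  and the Cauchy integrals satisfy the same recursion in \<open>n\<close>, up to the difference of
  the \<open>n\<close>-th moments, and all terms are evaluated at \<open>z = i t\<close> with
  \<open>t\<close> tending to infinity. The induction therefore carries the resolvent identities
  together with the moments already found.\<close>

lemma resolvent_moments:
 fixes A :: "'h::complex_hilbert => 'h" and g :: "real => complex^'m"
 assumes A: "bounded_clinear A" and Ks: "bounded_clinear Ks"
  and N: "!!x. norm (A x) <= N * norm x" "0 < N"
  and g: "g \<in> borel_measurable borel" "!!x. norm (g x) <= M" "!!x. x \<notin> {a..b} ==> g x = 0"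
  and res: "!!t. N < t ==> \<exists>r. A r - (\<i> * of_real t) *\<^sub>C r = y \<and>
   Ks r = (1 / (4 * pi)) *\<^sub>R (LBINT x. (1 / (complex_of_real x - \<i> * of_real t)) *\<^sub>C g x)"
 shows "Ks ((A ^^ n) y) = (1 / (4 * pi)) *\<^sub>R (LBINT x. x ^ n *\<^sub>R g x)"
proof -
 note g(1)[measurable]
 define z where "z = (\<lambda>t. \<i> * complex_of_real t)"
 have "\<forall>t. \<exists>r. N < t \<longrightarrow> A r - z t *\<^sub>C r = y \<and> Ks r = (1 / (4 * pi)) *\<^sub>R (LBINT x. (1 / (complex_of_real x - z t)) *\<^sub>C g x)"
  using res unfolding z_def by blast
 from choice[OF this] obtain r where r: "!!t. N < t ==> A (r t) - z t *\<^sub>C r t = y"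
  and Kr: "!!t. N < t ==> Ks (r t) = (1 / (4 * pi)) *\<^sub>R (LBINT x. (1 / (complex_of_real x - z t)) *\<^sub>C g x)" by blast
 obtain CK where CK: "!!x. norm (Ks x) <= CK * norm x" using Ks by (auto simp: bounded_clinear_on_def)
 have zn: "cmod (1 / (complex_of_real x - z t)) <= 1 / t" if "N < t" for x t
  using norm_inverse_nonreal[of "z t" x] N(2) that by (simp add: z_def)
 have nz: "complex_of_real x - z t \<noteq> 0" if "N < t" for x t
  using of_real_minus_nonreal[of "z t" x] N(2) that by (simp add: z_def)
 have rn: "norm (r t) <= norm y / (t - N)" if t: "N < t" for t
 proof -
  have "t * norm (r t) = norm (z t *\<^sub>C r t)" using N(2) t by (simp add: norm_scaleC z_def norm_mult)
  also have "z t *\<^sub>C r t = A (r t) - y" using r[OF t] by (simp add: algebra_simps)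
  also have "norm (A (r t) - y) <= N * norm (r t) + norm y" using norm_triangle_ineq4[of "A (r t)" y] N(1)[of "r t"] by linarith
  finally show ?thesis using t by (simp add: field_simps)
 qed
 define m where "m = (\<lambda>n. LBINT x. x ^ n *\<^sub>R g x)"
 define I where "I = (\<lambda>n t. LBINT x. (1 / (complex_of_real x - z t)) *\<^sub>C (x ^ n *\<^sub>R g x))"
 have bound: "\<exists>E\<ge>0. \<forall>x. norm (x ^ n *\<^sub>R g x) <= E" for n
 proof -
  obtain E where E: "E \<ge> 0" "!!x. x \<in> {a..b} ==> norm (x ^ n) <= E"
   by (rule continuous_bounded_Icc[of a b "\<lambda>x. x ^ n"]) (auto intro!: continuous_intros)
  have M0: "0 <= M" using g(2)[of 0] norm_ge_zero order_trans by blast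
  have "norm (x ^ n *\<^sub>R g x) <= E * M" for x
  proof (cases "x \<in> {a..b}")
   case True
   then show ?thesis unfolding norm_scaleR using E g(2)[of x] by (intro mult_mono) auto
  qed (use E M0 g(3) in simp)
  then show ?thesis using E M0 by (intro exI[of _ "E * M"]) simp
 qed
 have im: "integrable lborel (\<lambda>x. x ^ n *\<^sub>R g x)" for n
 proof -
  obtain E where "E \<ge> 0" "\<forall>x. norm (x ^ n *\<^sub>R g x) <= E" using bound by blast
  then show ?thesis by (intro integrable_bounded_support[where a=a and b=b and B=E]) (auto simp: g(3))
 qed
 have iI: "integrable lborel (\<lambda>x. (1 / (complex_of_real x - z t)) *\<^sub>C (x ^ n *\<^sub>R g x))" if t: "N < t" for n t
 proof -
  obtain E where E: "E \<ge> 0" "\<forall>x. norm (x ^ n *\<^sub>R g x) <= E" using bound by blast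
  have "norm ((1 / (complex_of_real x - z t)) *\<^sub>C (x ^ n *\<^sub>R g x)) <= 1 / t * E" for x
   unfolding norm_scaleC using zn[OF t, of x] E N(2) t by (intro mult_mono) auto
  then show ?thesis by (intro integrable_bounded_support[where a=a and b=b and B="1 / t * E"]) (auto simp: g(3))
 qed
 have Istep: "I (Suc n) t = m n + z t *\<^sub>C I n t" if t: "N < t" for n t
 proof -
  have "(1 / (complex_of_real x - z t)) *\<^sub>C (x ^ Suc n *\<^sub>R g x) = x ^ n *\<^sub>R g x + z t *\<^sub>C ((1 / (complex_of_real x - z t)) *\<^sub>C (x ^ n *\<^sub>R g x))" for x
  proof -
   let ?w = "1 / (complex_of_real x - z t)"
   have "?w * of_real x = 1 + z t * ?w" using nz[OF t, of x] by (simp add: field_simps)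
   moreover have "?w *\<^sub>C (x ^ Suc n *\<^sub>R g x) = (?w * of_real x) *\<^sub>C (x ^ n *\<^sub>R g x)"
    by (simp add: scaleC_scaleC flip: scaleC_of_real)
   ultimately show ?thesis by (simp add: scaleC_add_left scaleC_scaleC)
  qed
  then show ?thesis
   unfolding I_def m_def by (simp add: Bochner_Integration.integral_add[OF im integral_scaleC(1)[OF iI[OF t]]] integral_scaleC(2)[OF iI[OF t]])
 qed
 have Aadd: "(A ^^ n) (x + y) = (A ^^ n) x + (A ^^ n) y" for n x y
  by (induction n) (simp_all add: bounded_clinearD[OF A])
 have Ascale: "(A ^^ n) (c *\<^sub>C x) = c *\<^sub>C (A ^^ n) x" for n c x
  by (induction n) (simp_all add: bounded_clinearD[OF A])
 have An: "norm ((A ^^ n) x) <= N ^ n * norm x" for n x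
 proof (induction n)
  case (Suc n)
  have "norm ((A ^^ Suc n) x) <= N * norm ((A ^^ n) x)" using N(1) by simp
  also have "... <= N * (N ^ n * norm x)" using Suc N(2) by (intro mult_left_mono) auto
  finally show ?case by simp
 qed simp
 have "(\<forall>t>N. Ks ((A ^^ n) (r t)) = (1 / (4 * pi)) *\<^sub>R I n t) \<and> (\<forall>i<n. Ks ((A ^^ i) y) = (1 / (4 * pi)) *\<^sub>R m i)" for n
 proof (induction n)
  case 0
  then show ?case using Kr by (simp add: I_def)
 next
  case (Suc n)
  \<comment> \<open>This defect does not depend on \<open>t\<close>; the recursion exhibits it as a
    difference of two quantities that tend to \<open>0\<close> as \<open>t\<close> grows, so it
    vanishes.\<close>
  define d where "d = Ks ((A ^^ n) y) - (1 / (4 * pi)) *\<^sub>R m n"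
  have d: "d = Ks ((A ^^ Suc n) (r t)) - (1 / (4 * pi)) *\<^sub>R I (Suc n) t" if t: "N < t" for t
  proof -
   have "A (r t) = y + z t *\<^sub>C r t" using r[OF t] by (simp add: algebra_simps)
   then have "(A ^^ Suc n) (r t) = (A ^^ n) y + z t *\<^sub>C (A ^^ n) (r t)" by (simp only: funpow_Suc_right o_apply Aadd Ascale)
   then have "Ks ((A ^^ Suc n) (r t)) = Ks ((A ^^ n) y) + z t *\<^sub>C Ks ((A ^^ n) (r t))"
    by (simp only: bounded_clinearD[OF Ks])
   also have "Ks ((A ^^ n) (r t)) = (1 / (4 * pi)) *\<^sub>R I n t" using Suc.IH t by blast
   finally have "Ks ((A ^^ Suc n) (r t)) = Ks ((A ^^ n) y) + z t *\<^sub>C ((1 / (4 * pi)) *\<^sub>R I n t)" .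
   moreover have "z t *\<^sub>C ((1 / (4 * pi)) *\<^sub>R I n t) = (1 / (4 * pi)) *\<^sub>R (z t *\<^sub>C I n t)"
    by (simp add: scaleC_scaleC mult.commute flip: scaleC_of_real)
   ultimately show ?thesis by (simp add: d_def Istep[OF t] scaleR_add_right)
  qed
  obtain E where E: "E \<ge> 0" "\<forall>x. norm (x ^ Suc n *\<^sub>R g x) <= E" using bound by blast
  have In: "norm (I (Suc n) t) <= (1 / t) * (E * measure lborel {a..b})" if t: "N < t" for t
  proof -
   have "norm (I (Suc n) t) <= (LBINT x. (1 / t) * (E * indicator {a..b} x))"
    unfolding I_def
   proof (rule norm_lebesgue_integral_le[OF iI[OF t]])
    show "integrable lborel (\<lambda>x. 1 / t * (E * indicator {a..b} x))"
     by (intro integrable_mult_right integrable_real_indicator) (auto simp: emeasure_lborel_Icc_eq)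
    show "norm ((1 / (complex_of_real x - z t)) *\<^sub>C x ^ Suc n *\<^sub>R g x) <= 1 / t * (E * indicator {a..b} x)" for x
    proof (cases "x \<in> {a..b}")
     case True
     have "norm ((1 / (complex_of_real x - z t)) *\<^sub>C x ^ Suc n *\<^sub>R g x) <= 1 / t * E"
      unfolding norm_scaleC using zn[OF t, of x] E N(2) t by (intro mult_mono) auto
     then show ?thesis using True by simp
    qed (simp add: g(3))
   qed
   then show ?thesis by simp
  qed
  have nd: "norm d <= \<bar>CK\<bar> * (N ^ Suc n * (norm y / (t - N))) + (1 / t) * (E * measure lborel {a..b})" if t: "N < t" for t
  proof -
   have "norm d <= norm (Ks ((A ^^ Suc n) (r t))) + norm ((1 / (4 * pi)) *\<^sub>R I (Suc n) t)"
    unfolding d[OF t] by (rule norm_triangle_ineq4)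
   moreover have "norm (Ks ((A ^^ Suc n) (r t))) <= \<bar>CK\<bar> * (N ^ Suc n * (norm y / (t - N)))"
   proof -
    have "norm ((A ^^ Suc n) (r t)) <= N ^ Suc n * (norm y / (t - N))"
     using N(2) by (intro order_trans[OF An] mult_left_mono rn t) simp
    then have "\<bar>CK\<bar> * norm ((A ^^ Suc n) (r t)) <= \<bar>CK\<bar> * (N ^ Suc n * (norm y / (t - N)))" by (rule mult_left_mono) simp
    moreover have "norm (Ks ((A ^^ Suc n) (r t))) <= \<bar>CK\<bar> * norm ((A ^^ Suc n) (r t))"
     by (intro order_trans[OF CK] mult_right_mono) auto
    ultimately show ?thesis by linarith
   qed
   moreover have "norm ((1 / (4 * pi)) *\<^sub>R I (Suc n) t) <= 1 * ((1 / t) * (E * measure lborel {a..b}))"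
   proof -
    have "1 <= 4 * pi" using pi_gt3 by simp
    then have "\<bar>1 / (4 * pi)\<bar> <= 1" by (simp add: divide_le_eq)
    then show ?thesis unfolding norm_scaleR using In[OF t] by (intro mult_mono) auto
   qed
   ultimately show ?thesis by linarith
  qed
  have "((\<lambda>t. \<bar>CK\<bar> * (N ^ Suc n * (norm y / (t - N))) + (1 / t) * (E * measure lborel {a..b})) \<longlongrightarrow> 0) at_top"
   by real_asymp
  then have "norm d <= 0"
   by (rule tendsto_lowerbound) (use nd in \<open>auto intro: eventually_mono[OF eventually_gt_at_top[of N]]\<close>)
  then have d0: "d = 0" by simp
  show ?case
  proof (intro conjI allI impI)
   show "Ks ((A ^^ Suc n) (r t)) = (1 / (4 * pi)) *\<^sub>R I (Suc n) t" if "N < t" for t using d[OF that] d0 by simp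
   show "Ks ((A ^^ i) y) = (1 / (4 * pi)) *\<^sub>R m i" if "i < Suc n" for i
    using Suc.IH d0 that by (cases "i = n") (auto simp: d_def)
  qed
 qed
 from this[of "Suc n"] show ?thesis by (simp add: m_def)
qed

text \<open>The given density is only Lebesgue measurable on \<open>[a,b]\<close>, while the product
  measurability behind the Fubini arguments is available for Borel functions on the line.\<close>

lemma borel_version:
 fixes F :: "real => 'b::euclidean_space"
 assumes F: "F \<in> borel_measurable (lebesgue_on {a..b})" and bd: "bounded (F ` {a..b})"
 obtains F' where "F' \<in> borel_measurable borel" "bounded (range F')" "!!x. x \<notin> {a..b} ==> F' x = 0"
  "AE x in lborel. x \<in> {a..b} \<longrightarrow> F' x = F x"
proof -
 obtain B where B: "!!x. x \<in> {a..b} ==> norm (F x) <= B" using bd unfolding bounded_iff by blast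
 define G where "G = (\<lambda>x. if x \<in> {a..b} then F x else 0)"
 have G: "G \<in> borel_measurable lebesgue" unfolding G_def using F by (subst borel_measurable_if) auto
 have "\<forall>u. \<exists>h. h \<in> borel_measurable lborel \<and> (AE x in lborel. G x \<bullet> u = h x)"
 proof
  fix u
  have "(\<lambda>x. G x \<bullet> u) \<in> borel_measurable lebesgue" using G by measurable
  from completion_ex_borel_measurable_real[OF this] show "\<exists>h. h \<in> borel_measurable lborel \<and> (AE x in lborel. G x \<bullet> u = h x)" by blast
 qed
 from choice[OF this] obtain h where h: "!!u. h u \<in> borel_measurable lborel" "!!u. AE x in lborel. G x \<bullet> u = h u x" by blast
 define H where "H = (\<lambda>x. \<Sum>u\<in>Basis. h u x *\<^sub>R u)"
 have Hm [measurable]: "H \<in> borel_measurable borel" unfolding H_def using h(1) by simp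
 have "AE x in lborel. \<forall>u\<in>Basis. G x \<bullet> u = h u x" using h(2) by (intro AE_finite_allI) auto
 then have GH: "AE x in lborel. H x = G x"
 proof eventually_elim
  case (elim x)
  have "H x = (\<Sum>u\<in>Basis. (G x \<bullet> u) *\<^sub>R u)" unfolding H_def using elim by (intro sum.cong) auto
  then show ?case by (simp add: euclidean_representation)
 qed
 \<comment> \<open>\<open>H\<close> agrees with \<open>G\<close> only almost everywhere; cutting it
   off at \<open>B\<close> restores boundedness and the support at every point.\<close>
 define F' where "F' = (\<lambda>x. if x \<in> {a..b} \<and> norm (H x) <= B then H x else 0)"
 show ?thesis
 proof (rule that[of F'])
  show "F' \<in> borel_measurable borel" unfolding F'_def by measurable
  show "bounded (range F')" unfolding bounded_iff by (rule exI[of _ "\<bar>B\<bar>"]) (auto simp: F'_def)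
  show "F' x = 0" if "x \<notin> {a..b}" for x using that by (auto simp: F'_def)
  show "AE x in lborel. x \<in> {a..b} \<longrightarrow> F' x = F x" using GH by eventually_elim (use B in \<open>auto simp: F'_def G_def\<close>)
 qed
qed

lemma bounded_bilinear_mscale: "bounded_bilinear (mscale :: complex => complex^'n^'m => _)"
proof -
 have "bilinear (mscale :: complex => complex^'n^'m => _)"
  unfolding bilinear_def by (auto intro!: linearI simp: vec_eq_iff algebra_simps)
 then show ?thesis by (simp add: bilinear_conv_bounded_bilinear)
qed

lemma borel_measurable_mscale [measurable (raw)]:
 fixes F :: "'a => complex^'n^'m"
 assumes "c \<in> borel_measurable M" "F \<in> borel_measurable M"
 shows "(\<lambda>x. mscale (c x) (F x)) \<in> borel_measurable M"
 by (rule borel_measurable_continuous_Pair[OF assms])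
  (intro bounded_bilinear.continuous_on[OF bounded_bilinear_mscale] continuous_intros)

lemma lebesgue_on_integral_borel_version:
 fixes f g :: "real => 'b::{banach, second_countable_topology}"
 assumes f: "f \<in> borel_measurable (lebesgue_on {a..b})" and g: "g \<in> borel_measurable borel" "!!x. x \<notin> {a..b} ==> g x = 0"
  and eq: "AE x in lborel. x \<in> {a..b} \<longrightarrow> g x = f x"
 shows "(LINT x|lebesgue_on {a..b}. f x) = (LBINT x. g x)"
proof -
 have "(LINT x|lebesgue_on {a..b}. f x) = (LINT x|lebesgue_on {a..b}. g x)"
 proof (rule integral_cong_AE[OF f])
  have gl: "g \<in> borel_measurable lebesgue" using g(1) by (simp add: measurable_completion)
  then show "g \<in> borel_measurable (lebesgue_on {a..b})" by (rule measurable_restrict_space1)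
  have "AE x in lebesgue. x \<in> {a..b} \<longrightarrow> f x = g x" using AE_completion[OF eq] by eventually_elim auto
  then show "AE x in lebesgue_on {a..b}. f x = g x" by (subst AE_restrict_space_iff) auto
 qed
 also have "... = (LINT x|lebesgue. indicator {a..b} x *\<^sub>R g x)" by (rule integral_restrict_space) simp
 also have "(\<lambda>x. indicator {a..b} x *\<^sub>R g x) = g" using g(2) by (auto simp: fun_eq_iff indicator_def)
 also have "(LINT x|lebesgue. g x) = (LBINT x. g x)" using g(1) by (intro integral_completion) simp
 finally show ?thesis .
qed

lemma borel_measurable_vecI:
 fixes f :: "'a => 'b::euclidean_space^'n"
 assumes "!!i. (\<lambda>x. f x $ i) \<in> borel_measurable M"
 shows "f \<in> borel_measurable M"
proof (subst borel_measurable_euclidean_space, rule ballI)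
 fix u :: "'b^'n" assume "u \<in> Basis"
 then obtain i v where u: "u = axis i v" by (auto simp: Basis_vec_def)
 show "(\<lambda>x. f x \<bullet> u) \<in> borel_measurable M" unfolding u inner_axis using assms[of i] by measurable
qed

lemma psd_matrix_limit:
 assumes lim: "(f \<longlongrightarrow> M) (at_right 0)" and psd: "!!y. y > 0 ==> psd_matrix (f (y::real))"
 shows "psd_matrix M"
 unfolding psd_matrix_def
proof (intro allI conjI)
 fix v
 have l: "((\<lambda>y. cinner v (f y *v v)) \<longlongrightarrow> cinner v (M *v v)) (at_right 0)"
  by (intro tendsto_cinner tendsto_const bounded_linear.tendsto[OF bounded_bilinear.bounded_linear_left[OF bounded_bilinear_matrix_vector_mult] lim])
 have ev: "\<forall>\<^sub>F y in at_right 0. Im (cinner v (f y *v v)) = 0 \<and> 0 <= Re (cinner v (f y *v v))"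
  using eventually_at_right_less[of "0::real"] by eventually_elim (use psd in \<open>auto simp: psd_matrix_def\<close>)
 have "((\<lambda>y. Im (cinner v (f y *v v))) \<longlongrightarrow> 0) (at_right 0)"
  by (rule tendsto_eventually) (use ev in eventually_elim, simp)
 then show "Im (cinner v (M *v v)) = 0"
  by (rule tendsto_unique[OF trivial_limit_at_right_real tendsto_Im[OF l]])
 show "0 <= Re (cinner v (M *v v))"
  by (rule tendsto_lowerbound[OF tendsto_Re[OF l]]) (use ev in \<open>eventually_elim, simp\<close>, simp)
qed

lemma psd_matrix_mscale_cancel:
 assumes "psd_matrix (mscale (of_real r) M)" "r > 0"
 shows "psd_matrix M"
 using assms unfolding psd_matrix_def by (simp add: mscale_mult_vector cinner_scaleC_right zero_le_mult_iff)

lemma tendsto_matrix_mult: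
 fixes f :: "'a => complex^'n^'m" and g :: "'a => complex^'k^'n"
 assumes "(f \<longlongrightarrow> M) G" "(g \<longlongrightarrow> N) G"
 shows "((\<lambda>x. f x ** g x) \<longlongrightarrow> M ** N) G"
 unfolding matrix_matrix_mult_def
 by (intro vec_tendstoI) (simp, intro tendsto_sum tendsto_mult tendsto_vec_nth assms)

lemma tendsto_ctranspose: "(f \<longlongrightarrow> M) G ==> ((\<lambda>x. ctranspose (f x)) \<longlongrightarrow> ctranspose (M::complex^'n^'m)) G"
 by (intro vec_tendstoI) (simp, intro tendsto_cnj tendsto_vec_nth)

lemma closed_csubspace_closure:
 assumes "0 \<in> S" "!!x y. x \<in> S ==> y \<in> S ==> x + y \<in> S" "!!c x. x \<in> S ==> c *\<^sub>C x \<in> S"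
 shows "closed_csubspace (closure (S :: 'h::complex_inner set))"
 unfolding closed_csubspace_def
proof (intro conjI ballI allI)
 show "closed (closure S)" by simp
 show "0 \<in> closure S" using assms(1) closure_subset by blast
 fix u assume u: "u \<in> closure S"
 then obtain x where x: "\<forall>n. x n \<in> S" "x \<longlonglongrightarrow> u" unfolding closure_sequential by blast
 show "k *\<^sub>C u \<in> closure S" for k
  unfolding closure_sequential by (rule exI[of _ "\<lambda>n. k *\<^sub>C x n"]) (use x assms in \<open>auto intro!: tendsto_scaleC\<close>)
 fix w assume "w \<in> closure S"
 then obtain y where y: "\<forall>n. y n \<in> S" "y \<longlonglongrightarrow> w" unfolding closure_sequential by blast
 show "u + w \<in> closure S"
  unfolding closure_sequential by (rule exI[of _ "\<lambda>n. x n + y n"]) (use x y assms in \<open>auto intro!: tendsto_add\<close>)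
qed

lemma simple_space_properties:
 fixes A :: "'h::complex_hilbert => 'h"
 assumes A: "bounded_clinear A" and As: "bounded_clinear (cadjoint A)"
 shows "closed_csubspace (simple_space A)" "x \<in> simple_space A ==> A x \<in> simple_space A"
  "closed_csubspace H ==> (!!x. x \<in> H ==> A x \<in> H) ==> (!!x. A x - cadjoint A x \<in> H) ==> simple_space A \<subseteq> H"
proof -
 have D: "closed_csubspace (defect_space A)"
  unfolding defect_space_def
 proof (rule closed_csubspace_closure)
  let ?T = "\<lambda>x. A x - cadjoint A x"
  have add: "?T (x + y) = ?T x + ?T y" and scale: "?T (c *\<^sub>C x) = c *\<^sub>C ?T x" and zero: "?T 0 = 0" for x y c
   by (simp_all add: bounded_clinearD[OF A] bounded_clinearD[OF As] scaleC_diff_right)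
  show "0 \<in> range ?T" by (rule range_eqI[of _ _ 0]) (rule zero[symmetric])
  show "x + y \<in> range ?T" if x: "x \<in> range ?T" and y: "y \<in> range ?T" for x y
  proof -
   obtain u v where "x = ?T u" "y = ?T v" using x y by blast
   then show ?thesis by (intro range_eqI[of _ _ "u + v"]) (simp only: add)
  qed
  show "c *\<^sub>C x \<in> range ?T" if x: "x \<in> range ?T" for c x
  proof -
   obtain u where "x = ?T u" using x by blast
   then show ?thesis by (intro range_eqI[of _ _ "c *\<^sub>C u"]) (simp only: scale)
  qed
 qed
 note Ds = closed_csubspaceD[OF D]
 define S where "S = {(\<Sum>k<n. (A ^^ k) (d k)) | n d. \<forall>k<n. d k \<in> defect_space A}"
 have sS: "simple_space A = closure S" by (simp add: simple_space_def S_def)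
 have A0: "(A ^^ n) 0 = 0" and Aadd: "(A ^^ n) (x + y) = (A ^^ n) x + (A ^^ n) y" and Ascale: "(A ^^ n) (c *\<^sub>C x) = c *\<^sub>C (A ^^ n) x" for n x y c
  by (induction n) (simp_all add: bounded_clinearD[OF A])
 have Asum: "A (\<Sum>k<n. f k) = (\<Sum>k<n. A (f k))" for f :: "nat => 'h" and n
  by (rule linear_sum[OF bounded_linear.linear[OF bounded_clinear_imp_bounded_linear[OF A]]])
 have SI: "(\<Sum>k<n. (A ^^ k) (d k)) \<in> S" if "!!k. d k \<in> defect_space A" for n d using that unfolding S_def by blast
 have SE: "\<exists>n d. x = (\<Sum>k<n. (A ^^ k) (d k)) \<and> (\<forall>k. d k \<in> defect_space A) \<and> (\<forall>k\<ge>n. d k = 0)" if xS: "x \<in> S" for x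
 proof -
  obtain n d where x: "x = (\<Sum>k<n. (A ^^ k) (d k))" "\<forall>k<n. d k \<in> defect_space A" using xS unfolding S_def by blast
  then show ?thesis using Ds(2) by (intro exI[of _ n] exI[of _ "\<lambda>k. if k < n then d k else 0"]) auto
 qed
 \<comment> \<open>Coefficients beyond \<open>n\<close> are taken to be \<open>0\<close>, so that
   sums of different lengths can be added termwise.\<close>
 have pad: "(\<Sum>k<n. (A ^^ k) (d k)) = (\<Sum>k<n + m. (A ^^ k) (d k))" if "\<forall>k\<ge>n. d k = 0" for n m d
  using that by (intro sum.mono_neutral_left) (auto simp: A0)
 show cS: "closed_csubspace (simple_space A)"
  unfolding sS
 proof (rule closed_csubspace_closure)
  show "0 \<in> S" using SI[of "\<lambda>_. 0" 0] Ds(2) by simp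
  fix x assume "x \<in> S"
  then obtain n d where x: "x = (\<Sum>k<n. (A ^^ k) (d k))" "\<forall>k. d k \<in> defect_space A" "\<forall>k\<ge>n. d k = 0" using SE by blast
  have "c *\<^sub>C x = (\<Sum>k<n. (A ^^ k) (c *\<^sub>C d k))" for c
   unfolding x Ascale using linear_sum[OF bounded_linear.linear[OF bounded_linear_scaleC]] by blast
  then show "c *\<^sub>C x \<in> S" for c using SI[of "\<lambda>k. c *\<^sub>C d k" n] x(2) Ds(4) by auto
  fix y assume "y \<in> S"
  then obtain m d' where y: "y = (\<Sum>k<m. (A ^^ k) (d' k))" "\<forall>k. d' k \<in> defect_space A" "\<forall>k\<ge>m. d' k = 0" using SE by blast
  have "x + y = (\<Sum>k<n + m. (A ^^ k) (d k + d' k))"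
   unfolding x(1) y(1) pad[OF x(3), of m] pad[OF y(3), of n] add.commute[of m n] by (simp add: Aadd sum.distrib)
  then show "x + y \<in> S" using SI[of "\<lambda>k. d k + d' k" "n + m"] x(2) y(2) Ds(3) by auto
 qed
 have AS: "A x \<in> S" if xS: "x \<in> S" for x
 proof -
  obtain n d where x: "x = (\<Sum>k<n. (A ^^ k) (d k))" "\<forall>k. d k \<in> defect_space A" using SE[OF xS] by blast
  \<comment> \<open>Applying \<open>A\<close> shifts the index by one; the vacant coefficient at
    \<open>0\<close> is filled with the zero vector.\<close>
  have "A x = (\<Sum>k<Suc n. (A ^^ k) (case k of 0 => 0 | Suc j => d j))"
   unfolding x Asum sum.lessThan_Suc_shift by simp
  moreover have "!!k. (case k of 0 => 0 | Suc j => d j) \<in> defect_space A" using x(2) Ds(2) by (simp split: nat.split)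
  ultimately show ?thesis using SI[of "\<lambda>k. case k of 0 => 0 | Suc j => d j" "Suc n"] by simp
 qed
 show "A x \<in> simple_space A" if xS: "x \<in> simple_space A"
 proof -
  obtain y where y: "\<forall>n. y n \<in> S" "y \<longlonglongrightarrow> x" using xS unfolding sS closure_sequential by blast
  have "(\<lambda>n. A (y n)) \<longlonglongrightarrow> A x" by (rule bounded_linear.tendsto[OF bounded_clinear_imp_bounded_linear[OF A] y(2)])
  moreover have "\<forall>n. A (y n) \<in> S" using y(1) by (simp add: AS)
  ultimately show ?thesis unfolding sS closure_sequential by (intro exI[of _ "\<lambda>n. A (y n)"] conjI)
 qed
 assume H: "closed_csubspace H" "!!x. x \<in> H ==> A x \<in> H" "!!x. A x - cadjoint A x \<in> H"
 note Hs = closed_csubspaceD[OF H(1)]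
 have DH: "defect_space A \<subseteq> H" unfolding defect_space_def by (rule closure_minimal[OF _ Hs(1)]) (use H(3) in blast)
 have AnH: "(A ^^ k) d \<in> H" if "d \<in> H" for k d by (induction k) (simp_all add: that H(2))
 have sumH: "(\<Sum>k<n. f k) \<in> H" if "!!k. k < n ==> f k \<in> H" for f :: "nat => 'h" and n
  using that by (induction n) (auto intro: Hs)
 show "simple_space A \<subseteq> H"
  unfolding sS
 proof (rule closure_minimal[OF _ Hs(1)])
  show "S \<subseteq> H" using DH by (auto simp: S_def intro!: sumH AnH)
 qed
qed

lemma matrix_bounded_clinear:
 fixes L :: "complex^'m => complex^'n"
 assumes L: "bounded_clinear L"
 shows "matrix L *v v = L v"
proof -
 have "L v = L (\<Sum>i\<in>UNIV. v $ i *\<^sub>C axis i 1)" using vec_as_sum[of v] by simp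
 also have "... = (\<Sum>i\<in>UNIV. v $ i *\<^sub>C L (axis i 1))"
  by (simp only: linear_sum[OF bounded_linear.linear[OF bounded_clinear_imp_bounded_linear[OF L]]] bounded_clinearD(2)[OF L])
 also have "... = matrix L *v v"
  by (simp add: vec_eq_iff matrix_vector_mult_def matrix_def scaleC_vec_def scaleC_complex_def mult.commute)
 finally show ?thesis ..
qed

lemma bounded_clinear_compose:
 assumes "bounded_clinear f" "bounded_clinear g"
 shows "bounded_clinear (\<lambda>x. f (g x))"
proof -
 obtain C where C: "!!x. norm (f x) <= C * norm x" using assms(1) by (auto simp: bounded_clinear_on_def)
 obtain D where D: "!!x. norm (g x) <= D * norm x" using assms(2) by (auto simp: bounded_clinear_on_def)
 show ?thesis
 proof (rule bounded_clinear_onI[where C="\<bar>C\<bar> * D"])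
  show "norm (f (g x)) <= \<bar>C\<bar> * D * norm x" for x
  proof -
   have "norm (f (g x)) <= \<bar>C\<bar> * norm (g x)" by (intro order_trans[OF C] mult_right_mono) auto
   also have "... <= \<bar>C\<bar> * (D * norm x)" by (intro mult_left_mono D) simp
   finally show ?thesis by (simp add: mult.assoc)
  qed
 qed (simp_all add: bounded_clinearD[OF assms(1)] bounded_clinearD[OF assms(2)])
qed

text \<open>Evaluated at \<open>J *v v\<close>, so that \<open>J ** J = mat 1\<close> removes the
  trailing \<open>J\<close> and the resolvent acts on \<open>K v\<close> directly.\<close>

lemma char_function_resolvent:
 fixes A :: "'h::complex_hilbert => 'h" and J :: "complex^'m^'m"
 assumes K: "bounded_clinear K" and Ks: "bounded_clinear (cadjoint K)" and J: "J ** J = mat 1" and z: "z \<in> resolvent_set A"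
 obtains r where "A r - z *\<^sub>C r = K v"
  "char_function A K J z *v (J *v v) = J *v v - (2 * \<i>) *\<^sub>C cadjoint K r"
proof -
 let ?T = "\<lambda>x. A x - z *\<^sub>C x"
 have T: "bij ?T" "bounded_clinear (inv ?T)" using z by (auto simp: resolvent_set_def)
 have 1: "A (inv ?T (K v)) - z *\<^sub>C inv ?T (K v) = K v" by (rule surj_f_inv_f[OF bij_is_surj[OF T(1)]])
 have L: "bounded_clinear (\<lambda>v. cadjoint K (inv ?T (K v)))"
  by (intro bounded_clinear_compose[OF Ks] bounded_clinear_compose[OF T(2)] K)
 have "char_function A K J z *v (J *v v) = J *v v - (2 * \<i>) *\<^sub>C (matrix (\<lambda>v. cadjoint K (inv ?T (K v))) *v ((J ** J) *v v))"
  unfolding char_function_def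
  by (simp only: matrix_vector_mult_diff_rdistrib mscale_mult_vector matrix_vector_mul_lid matrix_vector_mul_assoc[symmetric])
 then have "char_function A K J z *v (J *v v) = J *v v - (2 * \<i>) *\<^sub>C cadjoint K (inv ?T (K v))"
  unfolding J matrix_vector_mul_lid matrix_bounded_clinear[OF L] .
 with 1 show ?thesis by (rule that)
qed

lemma Cauchy_integral_action:
 fixes F :: "real => complex^'m^'m"
 assumes F: "F \<in> borel_measurable (lebesgue_on {a..b})"
  and F': "F' \<in> borel_measurable borel" "bounded (range F')" "!!x. x \<notin> {a..b} ==> F' x = 0"
   "AE x in lborel. x \<in> {a..b} \<longrightarrow> F' x = F x"
  and z: "Im z \<noteq> 0"
 shows "(LINT x|lebesgue_on {a..b}. mscale (1 / (complex_of_real x - z)) (F x)) *v w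
  = (LBINT x. (1 / (complex_of_real x - z)) *\<^sub>C (F' x *v w))"
proof -
 note F'(1)[measurable]
 obtain B where B: "!!x. norm (F' x) <= B" using F'(2) unfolding bounded_iff by blast
 have B0: "0 <= B" using B[of 0] norm_ge_zero order_trans by blast
 obtain k where k: "0 <= k" "!!c (M::complex^'m^'m). norm (mscale c M) <= norm c * norm M * k"
  using bounded_bilinear.nonneg_bounded[OF bounded_bilinear_mscale] by blast
 have zero: "mscale c 0 = (0::complex^'m^'m)" for c by (simp add: vec_eq_iff)
 have "(LINT x|lebesgue_on {a..b}. mscale (1 / (complex_of_real x - z)) (F x)) = (LBINT x. mscale (1 / (complex_of_real x - z)) (F' x))"
 proof (rule lebesgue_on_integral_borel_version)
  have "(\<lambda>x. 1 / (complex_of_real x - z)) \<in> borel_measurable lborel" by measurable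
  then have "(\<lambda>x. 1 / (complex_of_real x - z)) \<in> borel_measurable lebesgue" by (rule measurable_completion)
  then have "(\<lambda>x. 1 / (complex_of_real x - z)) \<in> borel_measurable (lebesgue_on {a..b})" by (rule measurable_restrict_space1)
  then show "(\<lambda>x. mscale (1 / (complex_of_real x - z)) (F x)) \<in> borel_measurable (lebesgue_on {a..b})"
   using F by (rule borel_measurable_mscale)
  show "(\<lambda>x. mscale (1 / (complex_of_real x - z)) (F' x)) \<in> borel_measurable borel" by measurable
  show "mscale (1 / (complex_of_real x - z)) (F' x) = 0" if "x \<notin> {a..b}" for x unfolding F'(3)[OF that] by (rule zero)
  show "AE x in lborel. x \<in> {a..b} \<longrightarrow> mscale (1 / (complex_of_real x - z)) (F' x) = mscale (1 / (complex_of_real x - z)) (F x)"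
   using F'(4) by eventually_elim simp
 qed
 also have "... *v w = (LBINT x. mscale (1 / (complex_of_real x - z)) (F' x) *v w)"
 proof (rule integral_bounded_linear[symmetric])
  show "bounded_linear (\<lambda>M. M *v w)"
   by (rule bounded_bilinear.bounded_linear_left[OF bounded_bilinear_matrix_vector_mult])
  show "integrable lborel (\<lambda>x. mscale (1 / (complex_of_real x - z)) (F' x))"
  proof (rule integrable_bounded_support[where a=a and b=b and B="1 / \<bar>Im z\<bar> * B * k"])
   show "norm (mscale (1 / (complex_of_real x - z)) (F' x)) <= 1 / \<bar>Im z\<bar> * B * k" for x
    by (rule order_trans[OF k(2)]) (intro mult_right_mono mult_mono norm_inverse_nonreal z B k norm_ge_zero, simp)
   show "mscale (1 / (complex_of_real x - z)) (F' x) = 0" if "x \<notin> {a..b}" for x unfolding F'(3)[OF that] by (rule zero)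
  qed measurable
 qed
 finally show ?thesis by (simp add: mscale_mult_vector)
qed

lemma norm_row_product_le: "cmod (\<Sum>p\<in>UNIV. f $ p * q $ p) <= norm f * norm (q :: complex^'m)"
proof -
 have "(\<Sum>p\<in>UNIV. f $ p * q $ p) = cinner (\<chi> p. cnj (f $ p)) q" by (simp add: cinner_vec_def cinner_complex_def)
 moreover have "norm (\<chi> p. cnj (f $ p)) = norm f" by (simp add: norm_vec_def)
 ultimately show ?thesis using cinner_Cauchy_Schwarz[of "\<chi> p. cnj (f $ p)" q] by simp
qed

lemma gram_quadratic_form:
 fixes D :: "complex^'m^'m" and f :: "nat => complex^'m"
 assumes "!!p r. (\<Sum>i<k. cnj (f i $ p) * f i $ r) = D $ p $ r"
 shows "cinner q (D *v q) = of_real (\<Sum>i<k. (cmod (\<Sum>p\<in>UNIV. f i $ p * q $ p))\<^sup>2)"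
proof -
 have "of_real (\<Sum>i<k. (cmod (\<Sum>p\<in>UNIV. f i $ p * q $ p))\<^sup>2) = (\<Sum>i<k. (\<Sum>p\<in>UNIV. cnj (f i $ p * q $ p)) * (\<Sum>r\<in>UNIV. f i $ r * q $ r))"
  unfolding of_real_sum complex_norm_square cnj_sum by (simp only: mult.commute)
 also have "... = (\<Sum>i<k. \<Sum>p\<in>UNIV. \<Sum>r\<in>UNIV. cnj (f i $ p * q $ p) * (f i $ r * q $ r))"
  by (simp only: sum_product)
 also have "... = (\<Sum>p\<in>UNIV. \<Sum>i<k. \<Sum>r\<in>UNIV. cnj (f i $ p * q $ p) * (f i $ r * q $ r))" by (rule sum.swap)
 also have "... = (\<Sum>p\<in>UNIV. \<Sum>r\<in>UNIV. \<Sum>i<k. cnj (f i $ p * q $ p) * (f i $ r * q $ r))"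
  by (intro sum.cong refl) (rule sum.swap)
 also have "... = (\<Sum>p\<in>UNIV. \<Sum>r\<in>UNIV. cnj (q $ p) * (D $ p $ r * q $ r))"
  by (intro sum.cong refl) (simp add: assms[symmetric] sum_distrib_left sum_distrib_right mult_ac)
 also have "... = cinner q (D *v q)"
  by (simp add: cinner_vec_def cinner_complex_def matrix_vector_mult_def sum_distrib_left)
 finally show ?thesis ..
qed

text \<open>The norm estimates involve \<open>J *v p\<close>, the model involves \<open>p\<close>;
  conjugating the weight by \<open>J\<close> accounts for the difference. The upper bound for the
  norm becomes the lower constant \<open>1 / d\<close> of the form.\<close>

lemma (in node_pair) spectral_model_exists: "\<exists>c1 c2. spectral_model A K (\<lambda>x. J ** Q1 x ** J) a b c1 c2"
proof -
 obtain c where c: "c > 0" "!!u p. horner A K u p ==> (LBINT x. Re (cinner (J *v p (of_real x)) (Q1 x *v (J *v p (of_real x))))) <= c * (norm u)\<^sup>2"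
  using horner_norm_lower_bound by blast
 define d where "d = (1 / (4 * pi)) * (1 / 2 + C)"
 have d: "d > 0" using C0 by (simp add: d_def)
 have form: "cinner v ((J ** Q1 x ** J) *v w) = cinner (J *v v) (Q1 x *v (J *v w))" for v w x
 proof -
  have "(J ** Q1 x ** J) *v w = J *v (Q1 x *v (J *v w))" by (simp add: matrix_vector_mult_assoc' matrix_mul_assoc)
  then show ?thesis by (simp only: cinner_J)
 qed
 have "spectral_model A K (\<lambda>x. J ** Q1 x ** J) a b (1 / d) c"
 proof
  show "bounded_clinear A" "bounded_clinear K" by (fact A, fact K)
  show "(\<lambda>x. J ** Q1 x ** J) \<in> borel_measurable borel" by measurable
  have "ctranspose (Q1 x) = Q1 x" for x
  proof (cases "x \<in> {a..b}")
   case True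
   then show ?thesis by (simp only: Q1_def if_True ctranspose_diff ctranspose_mult ctranspose_ctranspose J matrix_mul_assoc)
  next
   case False
   then have "Q1 x = 0" by (simp only: Q1_def if_False)
   then show ?thesis by (simp add: vec_eq_iff)
  qed
  then show "ctranspose (J ** Q1 x ** J) = J ** Q1 x ** J" for x by (simp only: ctranspose_mult J matrix_mul_assoc)
  show "J ** Q1 x ** J = 0" if "x \<notin> {a..b}" for x
  proof -
   have "Q1 x = 0" using that by (simp only: Q1_def if_False)
   then show ?thesis by (simp add: vec_eq_iff matrix_matrix_mult_def)
  qed
  show "AE x in lborel. \<forall>v. 0 <= Re (cinner v ((J ** Q1 x ** J) *v v))"
   using forward.Q_nonneg by eventually_elim (simp only: form, blast)
  show "0 < 1 / d" "0 < c" using d c(1) by simp_all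
  fix u p assume u: "horner A K u p"
  show "integrable lborel (\<lambda>x. Re (cinner (p (of_real x)) ((J ** Q1 x ** J) *v p (of_real x))))"
  proof -
   have p: "continuous_on UNIV p" using u by (rule horner_continuous)
   have "continuous_on {a..b} (\<lambda>x. p (complex_of_real x))"
    by (rule continuous_on_compose2[OF p]) (auto intro!: continuous_intros)
   then obtain E where E: "E \<ge> 0" "!!x. x \<in> {a..b} ==> norm (p (complex_of_real x)) <= E"
    by (rule continuous_bounded_Icc) blast
   have "(\<lambda>x. J *v p (complex_of_real x)) \<in> borel_measurable borel" using p by measurable
   then show ?thesis unfolding form by (rule forward.integrable_Q[where D=E]) (simp add: E)
  qed
  show "(LBINT x. Re (cinner (p (of_real x)) ((J ** Q1 x ** J) *v p (of_real x)))) <= c * (norm u)\<^sup>2"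
   unfolding form by (rule c(2)[OF u])
  have "(norm u)\<^sup>2 <= d * (LBINT x. Re (cinner (p (of_real x)) ((J ** Q1 x ** J) *v p (of_real x))))"
   unfolding form d_def by (rule forward.horner_norm_bound[OF u])
  then show "1 / d * (norm u)\<^sup>2 <= (LBINT x. Re (cinner (p (of_real x)) ((J ** Q1 x ** J) *v p (of_real x))))"
   using d by (simp add: field_simps)
 qed
 then show ?thesis by blast
qed

section \<open>From the hypotheses on the characteristic function to the spectral model\<close>

theorem theorem3:
  fixes A A_R A_I :: "'h::complex_hilbert \<Rightarrow> 'h"
    and K :: "complex ^ 'm \<Rightarrow> 'h"
    and J :: "complex ^ 'm ^ 'm"
    and W :: "complex \<Rightarrow> complex ^ 'm ^ 'm"
    and F U R :: "real \<Rightarrow> complex ^ 'm ^ 'm"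
    and F1 F2 :: "real \<Rightarrow> nat \<Rightarrow> complex ^ 'm"
    and a b :: real
    and k :: nat
  assumes "bounded_clinear A"
    and "selfadjoint_on UNIV A_R" and "selfadjoint_on UNIV A_I"
    and "\<And>x. A x = A_R x + \<i> *\<^sub>C A_I x"
    and "bounded_clinear K"
    and "ctranspose J = J" and "J ** J = mat 1"
    and "\<And>x. A_I x = K (J *v cadjoint K x)"
    and "\<And>z. z \<in> resolvent_set A \<Longrightarrow> W z = char_function A K J z"
    and "a < b"
    and "\<And>i j. (\<lambda>z. W z $ i $ j) analytic_on (- complex_of_real ` {a..b})"
    and "F \<in> borel_measurable (lebesgue_on {a..b})" and "bounded (F ` {a..b})"
    and "\<And>z. z \<notin> complex_of_real ` {a..b} \<Longrightarrow>
           W z = mat 1 + mscale (1 / (2 * of_real pi * \<i>))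
             (LINT x|lebesgue_on {a..b}. mscale (1 / (complex_of_real x - z)) (F x))"
    and "\<And>z. z \<notin> complex_of_real ` {a..b} \<Longrightarrow> ctranspose (W z) ** J ** W (cnj z) = J"
    and "\<And>z. z \<noteq> cnj z \<Longrightarrow>
           psd_matrix (mscale (\<i> / (z - cnj z)) (ctranspose (W z) ** J ** W z - J))"
    and "associated_factors J W a b U R k F1 F2"
    and "bounded_rows_on {a..b} k F1" and "bounded_rows_on {a..b} k F2"
  shows "\<exists>B. selfadjoint_on (simple_space A) B \<and>
             abs_cont_spectrum_on (simple_space A) B \<and>
             linearly_similar_on (simple_space A) A B"
proof -
 note A = assms(1) and K = assms(5) and J = assms(6,7)
 obtain Ks where Ks: "bounded_clinear Ks" "!!x v. cinner (Ks x) v = cinner x (K v)"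
  by (rule finite_dimensional_adjoint[OF K]) blast
 have cK: "cadjoint K = Ks" by (rule cadjoint_eqI) (rule Ks(2))
 \<comment> \<open>The candidate for the adjoint: since \<open>A_I = K J K*\<close>, this is
   \<open>A_R - i A_I\<close>.\<close>
 define As where "As = (\<lambda>x. A x - (2 * \<i>) *\<^sub>C K (J *v Ks x))"
 have As_eq: "As x = A x - (2 * \<i>) *\<^sub>C K (J *v Ks x)" for x by (simp add: As_def)
 have As: "cinner (As x) y = cinner x (A y)" for x y
 proof -
  have "(2 * \<i>) *\<^sub>C A_I x = \<i> *\<^sub>C A_I x + \<i> *\<^sub>C A_I x" by (simp flip: scaleC_add_left)
  then have "As x = A_R x - \<i> *\<^sub>C A_I x" unfolding As_def assms(4) assms(8)[of x, unfolded cK, symmetric] by simp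
  moreover have "cinner (A_R x) y = cinner x (A_R y)" "cinner (A_I x) y = cinner x (A_I y)"
   using assms(2,3) by (auto simp: selfadjoint_on_def)
  ultimately show ?thesis by (simp add: assms(4) cinner_simps)
 qed
 have cA: "cadjoint A = As" by (rule cadjoint_eqI) (rule As)

 obtain F' where F': "F' \<in> borel_measurable borel" "bounded (range F')" "!!x. x \<notin> {a..b} ==> F' x = 0"
  "AE x in lborel. x \<in> {a..b} \<longrightarrow> F' x = F x"
  by (rule borel_version[OF assms(12,13)]) blast
 define \<kappa> where "\<kappa> = 1 / (2 * complex_of_real pi * \<i>)"
 have nonreal: "z \<notin> complex_of_real ` {a..b}" if "Im z \<noteq> 0" for z using that by auto
 have Wact: "W z *v w = w + \<kappa> *\<^sub>C (LBINT x. (1 / (complex_of_real x - z)) *\<^sub>C (F' x *v w))" if z: "Im z \<noteq> 0" for z w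
  unfolding assms(14)[OF nonreal[OF z]] matrix_vector_mult_add_rdistrib mscale_mult_vector matrix_vector_mul_lid \<kappa>_def
  by (intro arg_cong2[where f="(+)"] refl arg_cong[where f="scaleC _"] Cauchy_integral_action[OF assms(12) F' z])
 have moments: "Ks ((A ^^ n) (K v)) = (1 / (4 * pi)) *\<^sub>R (LBINT x. x ^ n *\<^sub>R (F' x *v (J *v v)))" for n v
 proof -
  obtain N0 where N0: "!!x. norm (A x) <= N0 * norm x" using A by (auto simp: bounded_clinear_on_def)
  define N where "N = \<bar>N0\<bar> + 1"
  have N: "norm (A x) <= N * norm x" "0 < N" for x
   by (rule order_trans[OF N0]) (auto simp: N_def intro: mult_right_mono)
  obtain B where B: "!!x. norm (F' x) <= B" using F'(2) unfolding bounded_iff by blast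
  obtain C where C: "0 <= C" "!!(M::complex^'m^'m) v. norm (M *v v) <= norm M * norm v * C"
   using bounded_bilinear.nonneg_bounded[OF bounded_bilinear_matrix_vector_mult] by blast
  show ?thesis
  proof (rule resolvent_moments[OF A Ks(1) N, where M="B * norm (J *v v) * C" and a=a and b=b])
   show "(\<lambda>x. F' x *v (J *v v)) \<in> borel_measurable borel" using F'(1) by measurable
   show "norm (F' x *v (J *v v)) <= B * norm (J *v v) * C" for x
    by (rule order_trans[OF C(2)]) (intro mult_right_mono B C norm_ge_zero)
   show "F' x *v (J *v v) = 0" if "x \<notin> {a..b}" for x using F'(3)[OF that] by simp
   fix t assume t: "N < t"
   \<comment> \<open>On the imaginary axis beyond \<open>N\<close> both descriptions of
     \<open>W\<close> hold, the one by the resolvent and the one by the Cauchy integral. Comparing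
     them gives \<open>Ks r\<close> with the factor \<open>1 / (4 \<pi>)\<close>.\<close>
   define z where "z = \<i> * complex_of_real t"
   have t0: "0 < t" using N(2) t by linarith
   have z: "Im z \<noteq> 0" "N < cmod z" using t0 t by (simp_all add: z_def norm_mult)
   have zr: "z \<in> resolvent_set A" by (rule resolvent_set_outside[OF A N z(2)])
   obtain r where r: "A r - z *\<^sub>C r = K v" "char_function A K J z *v (J *v v) = J *v v - (2 * \<i>) *\<^sub>C Ks r"
    by (rule char_function_resolvent[OF K _ J(2) zr, of v]) (auto simp: cK Ks(1))
   define I where "I = (LBINT x. (1 / (complex_of_real x - z)) *\<^sub>C (F' x *v (J *v v)))"
   have "J *v v - (2 * \<i>) *\<^sub>C Ks r = J *v v + \<kappa> *\<^sub>C I"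
    unfolding r(2)[symmetric] assms(9)[OF zr, symmetric] I_def by (rule Wact[OF z(1)])
   then have "(2 * \<i>) *\<^sub>C Ks r = (- \<kappa>) *\<^sub>C I" by (simp add: algebra_simps add_eq_0_iff)
   then have "(1 / (2 * \<i>)) *\<^sub>C (2 * \<i>) *\<^sub>C Ks r = (1 / (2 * \<i>)) *\<^sub>C (- \<kappa>) *\<^sub>C I" by (rule arg_cong)
   then have "Ks r = (1 / (2 * \<i>) * (- \<kappa>)) *\<^sub>C I" by (simp add: scaleC_scaleC)
   also have "1 / (2 * \<i>) * (- \<kappa>) = complex_of_real (1 / (4 * pi))" by (simp add: \<kappa>_def field_simps)
   finally have "Ks r = (1 / (4 * pi)) *\<^sub>R I" by (simp only: scaleC_of_real)
   then show "\<exists>r. A r - (\<i> * complex_of_real t) *\<^sub>C r = K v \<and>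
    Ks r = (1 / (4 * pi)) *\<^sub>R (LBINT x. (1 / (complex_of_real x - \<i> * complex_of_real t)) *\<^sub>C (F' x *v (J *v v)))"
    using r(1) unfolding I_def z_def by blast
  qed
 qed
 interpret node A As K Ks J F' a b
  by unfold_locales (fact A K Ks As As_eq J F' moments)+
 have W_char: "W z *v w = char_action z w" if "Im z \<noteq> 0" for z w
  unfolding Wact[OF that] char_action_def ctrans_def \<kappa>_def ..

 have "\<forall>i. \<exists>Gp Gm :: real => complex^'m. Gp \<in> borel_measurable borel \<and> Gm \<in> borel_measurable borel \<and>
  (AE x in lborel. ((\<lambda>y. ctrans (\<lambda>_. axis i 1) (Complex x y)) \<longlongrightarrow> Gp x) (at_right 0) \<and>
    ((\<lambda>y. ctrans (\<lambda>_. axis i 1) (Complex x (- y))) \<longlongrightarrow> Gm x) (at_right 0) \<and>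
    Gp x - Gm x = (2 * of_real pi * \<i>) *\<^sub>C (F' x *v axis i 1))"
 proof
  fix i :: 'm
  have "(\<lambda>_. axis i 1 :: complex^'m) \<in> borel_measurable borel" by simp
  from ctrans_boundary[OF this order_refl] show "\<exists>Gp Gm :: real => complex^'m. Gp \<in> borel_measurable borel \<and> Gm \<in> borel_measurable borel \<and>
   (AE x in lborel. ((\<lambda>y. ctrans (\<lambda>_. axis i 1) (Complex x y)) \<longlongrightarrow> Gp x) (at_right 0) \<and>
    ((\<lambda>y. ctrans (\<lambda>_. axis i 1) (Complex x (- y))) \<longlongrightarrow> Gm x) (at_right 0) \<and>
    Gp x - Gm x = (2 * of_real pi * \<i>) *\<^sub>C (F' x *v axis i 1))" by blast
 qed
 from choice[OF this] obtain Gp where "\<forall>i. \<exists>Gm :: real => complex^'m. Gp i \<in> borel_measurable borel \<and> Gm \<in> borel_measurable borel \<and>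
  (AE x in lborel. ((\<lambda>y. ctrans (\<lambda>_. axis i 1) (Complex x y)) \<longlongrightarrow> Gp i x) (at_right 0) \<and>
    ((\<lambda>y. ctrans (\<lambda>_. axis i 1) (Complex x (- y))) \<longlongrightarrow> Gm x) (at_right 0) \<and>
    Gp i x - Gm x = (2 * of_real pi * \<i>) *\<^sub>C (F' x *v axis i 1))" by blast
 from choice[OF this] obtain Gm where Gpm: "!!i. Gp i \<in> borel_measurable borel" "!!i. Gm i \<in> borel_measurable borel"
  and G: "!!i. AE x in lborel. ((\<lambda>y. ctrans (\<lambda>_. axis i 1) (Complex x y)) \<longlongrightarrow> Gp i x) (at_right 0) \<and>
    ((\<lambda>y. ctrans (\<lambda>_. axis i 1) (Complex x (- y))) \<longlongrightarrow> Gm i x) (at_right 0) \<and>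
    Gp i x - Gm i x = (2 * of_real pi * \<i>) *\<^sub>C (F' x *v axis i 1)" by blast
 \<comment> \<open>Matrix boundary values are assembled from columns, the limits of \<open>W\<close>
   on the basis vectors. This also makes them measurable functions defined at every real
   point.\<close>
 define M where "M = (\<lambda>(G :: 'm => real => complex^'m) x. (\<chi> p i. (axis i 1 + \<kappa> *\<^sub>C G i x) $ p) :: complex^'m^'m)"
 define Wp where "Wp = M Gp"
 define Wm where "Wm = M Gm"
 have M_measurable: "M G \<in> borel_measurable borel" if "!!i. G i \<in> borel_measurable borel" for G
 proof (intro borel_measurable_vecI)
  fix p i
  have "(\<lambda>x. G i x $ p) \<in> borel_measurable borel" by (rule borel_measurable_vec_component[OF that])
  then show "(\<lambda>x. M G x $ p $ i) \<in> borel_measurable borel" by (simp add: M_def scaleC_vec_def scaleC_complex_def)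
 qed
 have entry: "N $ p $ i = (N *v axis i 1) $ p" for N :: "complex^'m^'m" and p i
  by (simp add: matrix_vector_mult_def axis_def if_distrib[of "\<lambda>x. _ * x"] cong: if_cong)
 have M_limit: "((\<lambda>y. W (Complex x (s * y))) \<longlongrightarrow> M G x) (at_right 0)"
  if s: "s = 1 \<or> s = -1" and lim: "!!i. ((\<lambda>y. ctrans (\<lambda>_. axis i 1) (Complex x (s * y))) \<longlongrightarrow> G i x) (at_right 0)" for s x G
 proof (intro vec_tendstoI)
  fix p i
  have "((\<lambda>y. (axis i 1 + \<kappa> *\<^sub>C ctrans (\<lambda>_. axis i 1) (Complex x (s * y))) $ p) \<longlongrightarrow> (axis i 1 + \<kappa> *\<^sub>C G i x) $ p) (at_right 0)"
   by (intro tendsto_vec_nth tendsto_add tendsto_const tendsto_scaleC lim)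
  then have "((\<lambda>y. W (Complex x (s * y)) $ p $ i) \<longlongrightarrow> (axis i 1 + \<kappa> *\<^sub>C G i x) $ p) (at_right 0)"
  proof (rule Lim_transform_eventually)
   show "\<forall>\<^sub>F y in at_right 0. (axis i 1 + \<kappa> *\<^sub>C ctrans (\<lambda>_. axis i 1) (Complex x (s * y))) $ p = W (Complex x (s * y)) $ p $ i"
    using eventually_at_right_less[of "0::real"]
   proof eventually_elim
    case (elim y)
    have "Im (Complex x (s * y)) \<noteq> 0" using elim s by auto
    from W_char[OF this] show ?case unfolding entry by (simp only: char_action_def \<kappa>_def)
   qed
  qed
  then show "((\<lambda>y. W (Complex x (s * y)) $ p $ i) \<longlongrightarrow> M G x $ p $ i) (at_right 0)" by (simp add: M_def)
 qed
 have limits: "AE x in lborel. ((\<lambda>y. W (Complex x y)) \<longlongrightarrow> Wp x) (at_right 0) \<and> ((\<lambda>y. W (Complex x (- y))) \<longlongrightarrow> Wm x) (at_right 0) \<and> F' x = Wp x - Wm x"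
 proof -
  have "AE x in lborel. \<forall>i. ((\<lambda>y. ctrans (\<lambda>_. axis i 1) (Complex x y)) \<longlongrightarrow> Gp i x) (at_right 0) \<and>
    ((\<lambda>y. ctrans (\<lambda>_. axis i 1) (Complex x (- y))) \<longlongrightarrow> Gm i x) (at_right 0) \<and>
    Gp i x - Gm i x = (2 * of_real pi * \<i>) *\<^sub>C (F' x *v axis i 1)"
   using G by (intro AE_all_countable[THEN iffD2] allI)
  then show ?thesis
  proof eventually_elim
   case (elim x)
   have "F' x $ p $ i = (Wp x - Wm x) $ p $ i" for p i
   proof -
    have "(Wp x - Wm x) $ p $ i = (\<kappa> *\<^sub>C (Gp i x - Gm i x)) $ p" by (simp add: Wp_def Wm_def M_def scaleC_diff_right)
    also have "Gp i x - Gm i x = (2 * of_real pi * \<i>) *\<^sub>C (F' x *v axis i 1)" using elim by blast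
    also have "\<kappa> *\<^sub>C ... = F' x *v axis i 1" by (simp add: scaleC_scaleC \<kappa>_def)
    finally show ?thesis by (simp add: entry)
   qed
   then have "F' x = Wp x - Wm x" by (simp add: vec_eq_iff)
   then show ?case using M_limit[of 1 x Gp] M_limit[of "-1" x Gm] elim by (simp add: Wp_def Wm_def)
  qed
 qed
 have at_left: "(f \<longlongrightarrow> L) (at_left 0)" if "((\<lambda>y. f (- y)) \<longlongrightarrow> L) (at_right (0::real))" for f and L :: "complex^'m^'m"
  using that by (simp add: filterlim_at_left_to_right)
 have boundary: "AE x in lborel. boundary_values W x (Wp x) (Wm x) \<and> ctranspose (Wp x) ** J ** Wm x = J \<and>
   psd_matrix (ctranspose (Wp x) ** J ** Wp x - J) \<and> psd_matrix (J - ctranspose (Wm x) ** J ** Wm x)"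
  using limits
 proof eventually_elim
  case (elim x)
  then have l: "((\<lambda>y. W (Complex x y)) \<longlongrightarrow> Wp x) (at_right 0)" "((\<lambda>y. W (Complex x (- y))) \<longlongrightarrow> Wm x) (at_right 0)" by auto
  have bv: "boundary_values W x (Wp x) (Wm x)" unfolding boundary_values_def using l(1) at_left[OF l(2)] by blast
  have "((\<lambda>y. ctranspose (W (Complex x y)) ** J ** W (Complex x (- y))) \<longlongrightarrow> ctranspose (Wp x) ** J ** Wm x) (at_right 0)"
   by (intro tendsto_matrix_mult tendsto_ctranspose tendsto_const l)
  moreover have "((\<lambda>y. ctranspose (W (Complex x y)) ** J ** W (Complex x (- y))) \<longlongrightarrow> J) (at_right 0)"
  proof (rule tendsto_eventually)
   show "\<forall>\<^sub>F y in at_right 0. ctranspose (W (Complex x y)) ** J ** W (Complex x (- y)) = J"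
    using eventually_at_right_less[of "0::real"]
   proof eventually_elim
    case (elim y)
    then show ?case using assms(15)[OF nonreal, of "Complex x y"] by (simp add: complex_cnj)
   qed
  qed
  ultimately have WJ: "ctranspose (Wp x) ** J ** Wm x = J" by (intro tendsto_unique[OF trivial_limit_at_right_real])
  have psd1: "psd_matrix (ctranspose (W (Complex x y)) ** J ** W (Complex x y) - J)" if "y > 0" for y
  proof (rule psd_matrix_mscale_cancel)
   have e: "\<i> / (Complex x y - cnj (Complex x y)) = of_real (1 / (2 * y))" using that by (simp add: complex_eq_iff Complex_eq field_simps)
   have "Complex x y \<noteq> cnj (Complex x y)" using that by (simp add: complex_eq_iff)
   from assms(16)[OF this] show "psd_matrix (mscale (of_real (1 / (2 * y))) (ctranspose (W (Complex x y)) ** J ** W (Complex x y) - J))"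
    unfolding e .
   show "0 < 1 / (2 * y)" using that by simp
  qed
  \<comment> \<open>In the lower half-plane the factor \<open>\<i> / (z - cnj z)\<close> is
    negative, so the hypothesis yields the reversed inequality there.\<close>
  have psd2: "psd_matrix (J - ctranspose (W (Complex x (- y))) ** J ** W (Complex x (- y)))" if "y > 0" for y
  proof (rule psd_matrix_mscale_cancel)
   let ?z = "Complex x (- y)"
   have e: "\<i> / (?z - cnj ?z) = of_real (- (1 / (2 * y)))" using that by (simp add: complex_eq_iff Complex_eq field_simps)
   have "?z \<noteq> cnj ?z" using that by (simp add: complex_eq_iff)
   from assms(16)[OF this] have "psd_matrix (mscale (of_real (- (1 / (2 * y)))) (ctranspose (W ?z) ** J ** W ?z - J))"
    unfolding e .
   moreover have "mscale (of_real (- (1 / (2 * y)))) (ctranspose (W ?z) ** J ** W ?z - J) = mscale (of_real (1 / (2 * y))) (J - ctranspose (W ?z) ** J ** W ?z)"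
    by (simp add: vec_eq_iff algebra_simps)
   ultimately show "psd_matrix (mscale (of_real (1 / (2 * y))) (J - ctranspose (W ?z) ** J ** W ?z))" by (simp only:)
   show "0 < 1 / (2 * y)" using that by simp
  qed
  have "psd_matrix (ctranspose (Wp x) ** J ** Wp x - J)"
   by (rule psd_matrix_limit[OF tendsto_diff[OF tendsto_matrix_mult[OF tendsto_matrix_mult[OF tendsto_ctranspose[OF l(1)] tendsto_const] l(1)] tendsto_const] psd1])
  moreover have "psd_matrix (J - ctranspose (Wm x) ** J ** Wm x)"
   by (rule psd_matrix_limit[OF tendsto_diff[OF tendsto_const tendsto_matrix_mult[OF tendsto_matrix_mult[OF tendsto_ctranspose[OF l(2)] tendsto_const] l(2)]] psd2])
  ultimately show ?case using bv WJ by blast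
 qed

 obtain C1 C2 where C12: "!!x i. x \<in> {a..b} ==> i < k ==> norm (F1 x i) <= C1" "!!x i. x \<in> {a..b} ==> i < k ==> norm (F2 x i) <= C2"
  using assms(18,19) unfolding bounded_rows_on_def by blast
 define C0 where "C0 = max \<bar>C1\<bar> \<bar>C2\<bar>"
 \<comment> \<open>There are \<open>k\<close> rows, each of norm at most \<open>C0\<close>, so the
   squared norm of their products with \<open>q\<close> is at most \<open>k * C0^2\<close> times
   that of \<open>q\<close>. The \<open>C\<close> below is the constant of
   \<open>J_polar_bounds\<close> for this \<open>c\<close>.\<close>
 define c where "c = real k * C0\<^sup>2"
 have c0: "0 <= c" by (simp add: c_def)
 define C where "C = (4 + c\<^sup>2)^3 * (1 + c + c\<^sup>2)"
 have CC: "0 <= C" using c0 by (simp add: C_def)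
 have rows: "(\<Sum>i<k. (cmod (\<Sum>p\<in>UNIV. f i $ p * q $ p))\<^sup>2) <= c * (norm q)\<^sup>2" if "!!i. i < k ==> norm (f i) <= C0" for f and q :: "complex^'m"
 proof -
  have "(\<Sum>i<k. (cmod (\<Sum>p\<in>UNIV. f i $ p * q $ p))\<^sup>2) <= (\<Sum>i<k. (C0 * norm q)\<^sup>2)"
  proof (intro sum_mono power_mono norm_ge_zero)
   fix i assume "i \<in> {..<k}"
   then show "cmod (\<Sum>p\<in>UNIV. f i $ p * q $ p) <= C0 * norm q"
    by (intro order_trans[OF norm_row_product_le] mult_right_mono that) auto
  qed
  then show ?thesis by (simp add: c_def power_mult_distrib)
 qed
 define n where "n = (\<lambda>x q. \<Sum>i<k. (cmod (\<Sum>p\<in>UNIV. F1 x i $ p * q $ p))\<^sup>2)"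
 have af: "!!x Wp Wm. x \<in> {a..b} ==> boundary_values W x Wp Wm ==> J_polar_decomposition J Wp Wm (U x) (R x)"
  "!!x p q. x \<in> {a..b} ==> (\<Sum>i<k. cnj (F1 x i $ p) * F1 x i $ q) = jump_density J W a b R x $ p $ q"
  "!!x i. x \<in> {a..b} ==> i < k ==> F2 x i = F1 x i v* (J ** ctranspose (U x))"
  using assms(17) unfolding associated_factors_def by blast+
 \<comment> \<open>Since the rows of \<open>F2\<close> are those of \<open>F1\<close> multiplied by
   \<open>J U*\<close>, the bound on \<open>F2\<close> becomes the bound on \<open>n\<close> at
   \<open>J U* v\<close> that \<open>J_polar_bounds\<close> requires.\<close>
 have n2: "n x ((J ** ctranspose (U x)) *v v) = (\<Sum>i<k. (cmod (\<Sum>p\<in>UNIV. F2 x i $ p * v $ p))\<^sup>2)" if x: "x \<in> {a..b}" for x v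
  unfolding n_def
 proof (intro sum.cong refl)
  fix i assume "i \<in> {..<k}"
  then have F2: "F2 x i = F1 x i v* (J ** ctranspose (U x))" using af(3)[OF x] by simp
  let ?N = "J ** ctranspose (U x)"
  have "(\<Sum>p\<in>UNIV. F1 x i $ p * (?N *v v) $ p) = (\<Sum>p\<in>UNIV. \<Sum>r\<in>UNIV. F1 x i $ p * (?N $ p $ r * v $ r))"
   by (simp add: matrix_vector_mult_def sum_distrib_left)
  also have "... = (\<Sum>r\<in>UNIV. \<Sum>p\<in>UNIV. F1 x i $ p * (?N $ p $ r * v $ r))" by (rule sum.swap)
  also have "... = (\<Sum>r\<in>UNIV. F2 x i $ r * v $ r)"
   unfolding F2 by (simp add: vector_matrix_mult_def sum_distrib_left mult_ac)
  finally show "(cmod (\<Sum>p\<in>UNIV. F1 x i $ p * (?N *v v) $ p))\<^sup>2 = (cmod (\<Sum>p\<in>UNIV. F2 x i $ p * v $ p))\<^sup>2" by simp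
 qed
 have bounds: "AE x in lborel. x \<in> {a..b} \<longrightarrow> (\<forall>q v.
   Im (cinner q ((ctranspose (Wp x) ** J ** Wp x - ctranspose (Wm x) ** J ** Wm x) *v q)) = 0 \<and>
   0 <= Re (cinner q ((ctranspose (Wp x) ** J ** Wp x - ctranspose (Wm x) ** J ** Wm x) *v q)) \<and>
   Re (cinner q ((ctranspose (Wp x) ** J ** Wp x - ctranspose (Wm x) ** J ** Wm x) *v q)) <= C * (norm q)\<^sup>2 \<and>
   0 <= Re (cinner v ((Wp x ** J ** ctranspose (Wp x) - Wm x ** J ** ctranspose (Wm x)) *v v)) \<and>
   Re (cinner v ((Wp x ** J ** ctranspose (Wp x) - Wm x ** J ** ctranspose (Wm x)) *v v)) <= C * (norm v)\<^sup>2 \<and>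
   (norm (F' x *v q))\<^sup>2 <= C * Re (cinner q ((ctranspose (Wp x) ** J ** Wp x - ctranspose (Wm x) ** J ** Wm x) *v q)) \<and>
   (norm (ctranspose (F' x) *v v))\<^sup>2 <= C * Re (cinner v ((Wp x ** J ** ctranspose (Wp x) - Wm x ** J ** ctranspose (Wm x)) *v v)) \<and>
   Re (cinner ((J ** (Wp x + Wm x)) *v q) ((Wp x ** J ** ctranspose (Wp x) - Wm x ** J ** ctranspose (Wm x)) *v ((J ** (Wp x + Wm x)) *v q)))
    <= C * Re (cinner q ((ctranspose (Wp x) ** J ** Wp x - ctranspose (Wm x) ** J ** Wm x) *v q)))"
  (is "AE x in lborel. x \<in> {a..b} \<longrightarrow> ?P x")
  using limits boundary
 proof eventually_elim
  case (elim x)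
  show ?case
  proof (intro impI)
   assume x: "x \<in> {a..b}"
   have bv: "boundary_values W x (Wp x) (Wm x)" and h: "ctranspose (Wp x) ** J ** Wm x = J"
    "psd_matrix (ctranspose (Wp x) ** J ** Wp x - J)" "psd_matrix (J - ctranspose (Wm x) ** J ** Wm x)" using elim by blast+
   have Fx: "F' x = Wp x - Wm x" using elim by blast
   have jd: "jump_density J W a b R x = J ** (R x - matrix_inv (R x))" using x bv by (auto simp: jump_density_def)
   have n1: "cinner q ((J ** (R x - matrix_inv (R x))) *v q) = of_real (n x q)" for q
    unfolding n_def jd[symmetric] by (rule gram_quadratic_form) (rule af(2)[OF x])
   have n0: "0 <= n x q" for q by (simp add: n_def sum_nonneg)
   have nc: "n x q <= c * (norm q)\<^sup>2" for q
    unfolding n_def by (intro rows) (unfold C0_def, rule order_trans[OF C12(1)[OF x] order_trans[OF abs_ge_self max.cobounded1]])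
   have nU: "n x ((J ** ctranspose (U x)) *v v) <= c * (norm v)\<^sup>2" for v
    unfolding n2[OF x] by (intro rows) (unfold C0_def, rule order_trans[OF C12(2)[OF x] order_trans[OF abs_ge_self max.cobounded2]])
   note JB = J_polar_bounds[OF J af(1)[OF x bv] h n1 n0 c0 nc nU, folded C_def, folded Fx]
   show "?P x" by (intro allI conjI JB)
  qed
 qed
 interpret np: node_pair A As K Ks J F' a b Wp Wm C
 proof
  fix w
  show "AE x in lborel. x \<in> {a..b} \<longrightarrow>
   ((\<lambda>y. char_action (Complex x y) w) \<longlongrightarrow> Wp x *v w) (at_right 0) \<and>
   ((\<lambda>y. char_action (Complex x (- y)) w) \<longlongrightarrow> Wm x *v w) (at_right 0)"
   using limits
  proof eventually_elim
   case (elim x)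
   have "((\<lambda>y. char_action (Complex x (s * y)) w) \<longlongrightarrow> L *v w) (at_right 0)"
    if s: "s = 1 \<or> s = -1" and l: "((\<lambda>y. W (Complex x (s * y))) \<longlongrightarrow> L) (at_right 0)" for s L
   proof (rule Lim_transform_eventually)
    show "((\<lambda>y. W (Complex x (s * y)) *v w) \<longlongrightarrow> L *v w) (at_right 0)"
     by (rule bounded_linear.tendsto[OF bounded_bilinear.bounded_linear_left[OF bounded_bilinear_matrix_vector_mult] l])
    show "\<forall>\<^sub>F y in at_right 0. W (Complex x (s * y)) *v w = char_action (Complex x (s * y)) w"
     using eventually_at_right_less[of "0::real"] by eventually_elim (rule W_char, use s in auto)
   qed
   from this[of 1 "Wp x"] this[of "-1" "Wm x"] elim show ?case by simp
  qed
 next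
  show "Wp \<in> borel_measurable borel" "Wm \<in> borel_measurable borel"
   unfolding Wp_def Wm_def by (intro M_measurable Gpm)+
  show "0 <= C" by (rule CC)
  show "AE x in lborel. x \<in> {a..b} \<longrightarrow> F' x = Wp x - Wm x" using limits by eventually_elim blast
  show "AE x in lborel. x \<in> {a..b} \<longrightarrow> ctranspose (Wp x) ** J ** Wm x = J" using boundary by eventually_elim blast
 qed (unfold Let_def, (rule eventually_mono[OF bounds], blast)+)
 obtain c1 c2 where sm: "spectral_model A K (\<lambda>x. J ** np.Q1 x ** J) a b c1 c2" using np.spectral_model_exists by blast
 interpret sm: spectral_model A K "\<lambda>x. J ** np.Q1 x ** J" a b c1 c2 by (rule sm)
 note simple = simple_space_properties[OF A np.As_linear[folded cA]]
 \<comment> \<open>\<open>A - A*\<close> equals \<open>2 i K J K*\<close>, so its range consists of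
   multiples of constant polynomial vectors, and \<open>H\<close> is closed and invariant under
   \<open>A\<close>.\<close>
 have "simple_space A \<subseteq> sm.H"
 proof (rule simple(3)[OF sm.H_subspace sm.H_apply])
  fix x
  have "K (J *v Ks x) \<in> sm.H" by (rule sm.horner_H[OF horner_const[OF A]])
  then show "A x - cadjoint A x \<in> sm.H" unfolding cA As_def by (simp add: closed_csubspaceD(4)[OF sm.H_subspace])
 qed
 then interpret sub: spectral_submodel A K "\<lambda>x. J ** np.Q1 x ** J" a b c1 c2 "simple_space A"
  by unfold_locales (simp_all add: simple(1,2))
 show ?thesis by (rule sub.similar_to_absolutely_continuous)
qed

end
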